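(* Let $\mathcal F$ be the graded spin FH-algebra with $\mathbb Z$-basis $d_\lambda$ ($\lambda\in\mathcal{EP}$), $G$ the graded Farahat–Higman ring with $\mathbb Z$-basis $c_\lambda$ ($\lambda\in\mathcal P$), and $g_\lambda$ Macdonald's basis of the ring of symmetric functions, all as defined in the context. (1) There exists an injective algebra homomorphism $\iota:\mathcal F\to G$ which sends $d_\lambda\mapsto(-1)^{\ell(\lambda)}c_\lambda$ for each $\lambda\in\mathcal{EP}$. (2) There exists an isomorphism of algebras $\psi:\mathbb Q\otimes_{\mathbb Z}\mathcal F\to\Lambda^e_{\mathbb Q}:=\mathbb Q[p_2,p_4,\ldots]$ which sends $d_\lambda$ to $(-1)^{\ell(\lambda)}g_\lambda$ for each $\lambda\in\mathcal{EP}$, where $p_k$ denotes the $k$th power sum symmetric function.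
   Context: Partitions: $\mathcal P$ is the set of all partitions, $\mathcal{EP}\subset\mathcal P$ the set of partitions all of whose parts are even (including $\emptyset$). $|\lambda|$ is the sum of the parts of $\lambda$, $\ell(\lambda)$ the number of parts. Permutations are multiplied right to left. The ring $G$: a permutation whose nontrivial cycles have lengths $\rho_1,\dots,\rho_t$ has modified cycle type $(\rho_1-1,\dots,\rho_t-1)$. For $\lambda\in\mathcal P$, $c_\lambda(n)\in\mathbb ZS_n$ is the sum of all elements of $S_n$ of modified cycle type $\lambda$ (it is $0$ if $|\lambda|+\ell(\lambda)>n$). For $|\nu|=|\lambda|+|\mu|$ the coefficient $k_{\lambda\mu}^\nu$ of $c_\nu(n)$ in $c_\lambda(n)c_\mu(n)$ is independent of $n\ge|\nu|+\ell(\nu)$ (Farahat–Higman). $G$ is the commutative ring with $\mathbb Z$-basis $\{c_\lambda:\lambda\in\mathcal P\}$ and multiplication $c_\lambda*c_\mu=\sum_{|\nu|=|\lambda|+|\mu|}k_{\lambda\mu}^\nu c_\nu$. Double cover: $\widetilde S_n$ is the group generated by $t_1,\dots,t_{n-1},z$ with relations: $z$ central, $z^2=1$, $t_i^2=z$, $t_it_{i+1}t_i=t_{i+1}t_it_{i+1}$, $t_jt_i=zt_it_j$ for $|i-j|>1$. There are natural embeddings $\widetilde S_n\subset\widetilde S_{n+1}$. In $\widetilde S_{n+1}$ put $x_i=t_it_{i+1}\cdots t_{n-1}t_nt_{n-1}\cdots t_{i+1}t_i$ for $1\le i\le n$ (so $x_n=t_n$). For distinct $i_1,\dots,i_m\in\{1,\dots,n\}$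 with $m\ge2$ put $[i_1,\dots,i_m]=x_{i_1}x_{i_m}x_{i_{m-1}}\cdots x_{i_2}x_{i_1}$. This element lies in $\widetilde S_n$, does not depend on $n$, and maps to the cycle $(i_1,\dots,i_m)$ under $\widetilde S_n\to S_n$, $t_i\mapsto(i,i+1)$, $z\mapsto 1$. The ring $\mathcal F$: for $\lambda=(\lambda_1,\dots,\lambda_\ell)\in\mathcal{EP}$, $D_\lambda(n)$ is the set of all products of disjoint cycles $[i_1,\dots,i_{\lambda_1+1}][j_1,\dots,j_{\lambda_2+1}]\cdots[k_1,\dots,k_{\lambda_\ell+1}]$ in $\widetilde S_n$; it is empty if $|\lambda|+\ell(\lambda)>n$, and a conjugacy class of $\widetilde S_n$ otherwise. $\mathbb ZS_n^-=\mathbb Z\widetilde S_n/\langle z+1\rangle$ is a superalgebra with every $t_i$ odd, and $d_\lambda(n)\in\mathbb ZS_n^-$ is the image of the class sum of $D_\lambda(n)$. The $d_\lambda(n)$ with $\lambda\in\mathcal{EP}$, $|\lambda|+\ell(\lambda)\le n$, form a basis of the ring of even central elements of $\mathbb ZS_n^-$. For $\lambda,\mu,\nu\in\mathcal{EP}$ with $|\nu|=|\lambda|+|\mu|$, the coefficient $f_{\lambda\mu}^\nu\in\mathbb Z$ of $d_\nu(n)$ in $d_\lambda(n)d_\mu(n)$ is independent of $n\ge|\nu|+\ell(\nu)$. $\mathcal F$ is the (commutative, associative) ring with $\mathbb Z$-basis $\{d_\lambda:\lambda\in\mathcal{EP}\}$ and multiplication $d_\lambda*d_\mu=\sum_{\nu\in\mathcal{EP},\,|\nu|=|\lambda|+|\mu|}f_{\lambda\mu}^\nu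 d_\nu$. Symmetric functions: $\Lambda$ is the ring of symmetric functions over $\mathbb Z$ with complete symmetric functions $h_r$, power sums $p_r$ and the standard Hall inner product $\langle\cdot,\cdot\rangle$. Define $h_r^*\in\Lambda$ ($r\ge1$) by compositional inversion: if $u=t+h_1t^2+h_2t^3+\cdots$, then $t=u+h_1^*u^2+h_2^*u^3+\cdots$. Put $h_\mu^*=\prod_ih_{\mu_i}^*$; these form a $\mathbb Z$-basis of $\Lambda$, and $\{g_\lambda\}_{\lambda\in\mathcal P}$ is the dual basis: $\langle g_\lambda,h_\mu^*\rangle=\delta_{\lambda\mu}$. Macdonald showed that $c_\lambda\mapsto g_\lambda$ defines a ring isomorphism $G\to\Lambda$; moreover $g_{(r)}=-p_r$ for $r\ge1$. *)

theory Defs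
  imports
    "HOL-Algebra.Sym_Groups"
    "HOL-Algebra.QuotRing"
    "HOL-Library.Poly_Mapping"
    "HOL-Library.Multiset"
    "HOL-Combinatorics.Orbits"
    "HOL-Computational_Algebra.Formal_Power_Series"
begin

section \<open>Partitions\<close>

text \<open>
  A partition is the multiset of its (positive) parts, so that \<open>|\<kappa>|\<close> is \<^term>\<open>\<Sum>\<^sub># \<kappa>\<close> and
  \<open>\<ell>(\<kappa>)\<close> is \<^term>\<open>size \<kappa>\<close>.
\<close>

type_synonym partition = "nat multiset"

definition Par :: "partition set" where
  "Par = {\<kappa>. 0 \<notin># \<kappa>}"

definition EPar :: "partition set" where
  "EPar = {\<kappa> \<in> Par. \<forall>r \<in># \<kappa>. even r}"

definition fits :: "nat \<Rightarrow> partition set" where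
  "fits n = {\<kappa>. \<Sum>\<^sub># \<kappa> + size \<kappa> \<le> n}"


section \<open>Integral group rings and coefficients\<close>

definition group_ring :: "('g, 'm) monoid_scheme \<Rightarrow> ('g \<Rightarrow>\<^sub>0 int) ring" where
  "group_ring G =
    \<lparr> carrier = {f. Poly_Mapping.keys f \<subseteq> carrier G},
      mult = (\<lambda>f g. \<Sum>x \<in> Poly_Mapping.keys f. \<Sum>y \<in> Poly_Mapping.keys g.
        Poly_Mapping.single (x \<otimes>\<^bsub>G\<^esub> y) (Poly_Mapping.lookup f x * Poly_Mapping.lookup g y)),
      one = frag_of \<one>\<^bsub>G\<^esub>,
      zero = 0,
      add = (+) \<rparr>"

text \<open>
  The integer coefficients of \<open>x\<close> with respect to a family \<open>b\<close> that is linearly independent over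
  the integers on the index set \<open>I\<close>.
\<close>

definition coords :: "('a, 'm) ring_scheme \<Rightarrow> 'i set \<Rightarrow> ('i \<Rightarrow> 'a) \<Rightarrow> 'a \<Rightarrow> ('i \<Rightarrow>\<^sub>0 int)" where
  "coords R I b x = (THE a. Poly_Mapping.keys a \<subseteq> I \<and>
     x = (\<Oplus>\<^bsub>R\<^esub>i \<in> Poly_Mapping.keys a. add_pow R (Poly_Mapping.lookup a i) (b i)))"


section \<open>Graded algebras with a basis indexed by partitions\<close>

text \<open>
  The free module on the basis \<open>B\<close> (basis vectors \<^term>\<open>Poly_Mapping.single \<kappa> 1\<close>), with the
  bilinear multiplication that has the integer structure constants \<open>k \<kappa> \<mu> \<nu>\<close> for
  \<open>|\<nu>| = |\<kappa>| + |\<mu>|\<close>.  The coefficient ring is a parameter: over \<^typ>\<open>rat\<close> this is the extension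
  of scalars from the integers to the rationals of the same algebra over \<^typ>\<open>int\<close>, with
  \<open>Poly_Mapping.single \<kappa> 1\<close> in the role of \<open>1 \<otimes> b\<^sub>\<kappa>\<close>.
\<close>

definition graded_algebra ::
    "partition set \<Rightarrow> (partition \<Rightarrow> partition \<Rightarrow> partition \<Rightarrow> int)
      \<Rightarrow> (partition \<Rightarrow>\<^sub>0 'r::comm_ring_1) ring" where
  "graded_algebra B k =
    \<lparr> carrier = {f. Poly_Mapping.keys f \<subseteq> B},
      mult = (\<lambda>f g. \<Sum>\<kappa> \<in> Poly_Mapping.keys f. \<Sum>\<mu> \<in> Poly_Mapping.keys g.
        \<Sum>\<nu> \<in> {\<nu> \<in> B. \<Sum>\<^sub># \<nu> = \<Sum>\<^sub># \<kappa> + \<Sum>\<^sub># \<mu>}.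
          Poly_Mapping.single \<nu>
            (Poly_Mapping.lookup f \<kappa> * Poly_Mapping.lookup g \<mu> * of_int (k \<kappa> \<mu> \<nu>))),
      one = Poly_Mapping.single {#} 1,
      zero = 0,
      add = (+) \<rparr>"


section \<open>The Farahat--Higman ring\<close>

definition modified_cycle_type :: "(nat \<Rightarrow> nat) \<Rightarrow> partition" where
  "modified_cycle_type \<sigma> =
     image_mset (\<lambda>C. card C - 1) (mset_set {orbit \<sigma> i | i. \<sigma> i \<noteq> i})"

definition class_sum :: "nat \<Rightarrow> partition \<Rightarrow> (nat \<Rightarrow> nat) \<Rightarrow>\<^sub>0 int" where
  "class_sum n \<kappa> = (\<Sum>\<sigma> \<in> {\<sigma> \<in> carrier (sym_group n). modified_cycle_type \<sigma> = \<kappa>}. frag_of \<sigma>)"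

text \<open>
  The structure constant is the common value of the coefficients of \<open>c\<^sub>\<nu>(n)\<close> in
  \<open>c\<^sub>\<kappa>(n) c\<^sub>\<mu>(n)\<close> for \<open>n \<ge> |\<nu>| + \<ell>(\<nu>)\<close>; it is meaningful for \<open>|\<nu>| = |\<kappa>| + |\<mu>|\<close> only.
\<close>

definition FH_coeff :: "partition \<Rightarrow> partition \<Rightarrow> partition \<Rightarrow> int" where
  "FH_coeff \<kappa> \<mu> \<nu> = (THE k. \<forall>n \<ge> \<Sum>\<^sub># \<nu> + size \<nu>.
     Poly_Mapping.lookup
       (coords (group_ring (sym_group n)) (Par \<inter> fits n) (class_sum n)
         (class_sum n \<kappa> \<otimes>\<^bsub>group_ring (sym_group n)\<^esub> class_sum n \<mu>)) \<nu> = k)"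

definition FH :: "(partition \<Rightarrow>\<^sub>0 int) ring" where
  "FH = graded_algebra Par FH_coeff"


section \<open>The double cover of the symmetric group\<close>

text \<open>
  Since \<open>z\<^sup>2 = 1\<close> and \<open>t\<^sub>i\<^sup>2 = z\<close>, all generators are invertible in the monoid with the given
  presentation, so this monoid is the group with the same presentation.  It is constructed as the
  set of congruence classes of words in the generators \<open>z, t\<^sub>1, \<dots>, t\<^sub>n\<^sub>-\<^sub>1\<close>.
\<close>

datatype spin_gen = SpinZ | SpinT nat

definition spin_words :: "nat \<Rightarrow> spin_gen list set" where
  "spin_words n = lists (insert SpinZ (SpinT ` {1..<n}))"

inductive spin_eq :: "nat \<Rightarrow> spin_gen list \<Rightarrow> spin_gen list \<Rightarrow> bool" for n where
  refl: "w \<in> spin_words n \<Longrightarrow> spin_eq n w w"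
| sym: "spin_eq n u v \<Longrightarrow> spin_eq n v u"
| trans: "spin_eq n u v \<Longrightarrow> spin_eq n v w \<Longrightarrow> spin_eq n u w"
| cong: "spin_eq n u v \<Longrightarrow> a \<in> spin_words n \<Longrightarrow> b \<in> spin_words n \<Longrightarrow> spin_eq n (a @ u @ b) (a @ v @ b)"
| central: "1 \<le> i \<Longrightarrow> i < n \<Longrightarrow> spin_eq n [SpinZ, SpinT i] [SpinT i, SpinZ]"
| z_square: "spin_eq n [SpinZ, SpinZ] []"
| t_square: "1 \<le> i \<Longrightarrow> i < n \<Longrightarrow> spin_eq n [SpinT i, SpinT i] [SpinZ]"
| braid: "1 \<le> i \<Longrightarrow> i + 1 < n \<Longrightarrow> spin_eq n [SpinT i, SpinT (i + 1), SpinT i] [SpinT (i + 1), SpinT i, SpinT (i + 1)]"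
| far: "1 \<le> i \<Longrightarrow> i < n \<Longrightarrow> 1 \<le> j \<Longrightarrow> j < n \<Longrightarrow> i + 1 < j \<or> j + 1 < i \<Longrightarrow>
    spin_eq n [SpinT j, SpinT i] [SpinZ, SpinT i, SpinT j]"

definition spin_class :: "nat \<Rightarrow> spin_gen list \<Rightarrow> spin_gen list set" where
  "spin_class n w = {v. spin_eq n w v}"

definition spin_group :: "nat \<Rightarrow> spin_gen list set monoid" where
  "spin_group n =
    \<lparr> carrier = spin_class n ` spin_words n,
      mult = (\<lambda>A B. \<Union>a \<in> A. \<Union>b \<in> B. spin_class n (a @ b)),
      one = spin_class n [] \<rparr>"

definition spin_embed :: "nat \<Rightarrow> spin_gen list set \<Rightarrow> spin_gen list set" where
  "spin_embed n A = (\<Union>a \<in> A. spin_class (n + 1) a)"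

definition spin_x :: "nat \<Rightarrow> nat \<Rightarrow> spin_gen list set" where
  "spin_x n i = spin_class (n + 1) (map SpinT ([i..<n + 1] @ rev [i..<n]))"

definition spin_prod :: "nat \<Rightarrow> spin_gen list set list \<Rightarrow> spin_gen list set" where
  "spin_prod n As = foldr (mult (spin_group n)) As \<one>\<^bsub>spin_group n\<^esub>"

text \<open>
  For \<open>is = [i\<^sub>1, \<dots>, i\<^sub>m]\<close> the element \<open>x\<^sub>i\<^sub>1 x\<^sub>i\<^sub>m x\<^sub>i\<^sub>m\<^sub>-\<^sub>1 \<dots> x\<^sub>i\<^sub>2 x\<^sub>i\<^sub>1\<close>, computed in the double cover for
  \<open>n + 1\<close>.
\<close>

definition spin_cycle :: "nat \<Rightarrow> nat list \<Rightarrow> spin_gen list set" where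
  "spin_cycle n is = spin_prod (n + 1) (map (spin_x n) (hd is # rev is))"

text \<open>
  The parts of \<open>\<kappa>\<close> are taken in weakly decreasing order.  The products of cycles live in the double
  cover for \<open>n + 1\<close> and are pulled back along the embedding.
\<close>

definition spin_D :: "nat \<Rightarrow> partition \<Rightarrow> spin_gen list set set" where
  "spin_D n \<kappa> = {A \<in> carrier (spin_group n). \<exists>cs :: nat list list.
     map length cs = map Suc (rev (sorted_list_of_multiset \<kappa>)) \<and>
     distinct (concat cs) \<and> set (concat cs) \<subseteq> {1..n} \<and>
     spin_embed n A = spin_prod (n + 1) (map (spin_cycle n) cs)}"

definition spin_ideal :: "nat \<Rightarrow> (spin_gen list set \<Rightarrow>\<^sub>0 int) set" where
  "spin_ideal n = Idl\<^bsub>group_ring (spin_group n)\<^esub>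
     {frag_of (spin_class n [SpinZ]) + frag_of \<one>\<^bsub>spin_group n\<^esub>}"

definition spin_ring :: "nat \<Rightarrow> (spin_gen list set \<Rightarrow>\<^sub>0 int) set ring" where
  "spin_ring n = group_ring (spin_group n) Quot spin_ideal n"

definition spin_class_sum :: "nat \<Rightarrow> partition \<Rightarrow> (spin_gen list set \<Rightarrow>\<^sub>0 int) set" where
  "spin_class_sum n \<kappa> =
     spin_ideal n +>\<^bsub>group_ring (spin_group n)\<^esub> (\<Sum>A \<in> spin_D n \<kappa>. frag_of A)"

definition spin_FH_coeff :: "partition \<Rightarrow> partition \<Rightarrow> partition \<Rightarrow> int" where
  "spin_FH_coeff \<kappa> \<mu> \<nu> = (THE k. \<forall>n \<ge> \<Sum>\<^sub># \<nu> + size \<nu>.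
     Poly_Mapping.lookup
       (coords (spin_ring n) (EPar \<inter> fits n) (spin_class_sum n)
         (spin_class_sum n \<kappa> \<otimes>\<^bsub>spin_ring n\<^esub> spin_class_sum n \<mu>)) \<nu> = k)"

text \<open>\<open>\<F>\<close> is this ring over \<^typ>\<open>int\<close>, and \<open>\<rat> \<otimes> \<F>\<close> is this ring over \<^typ>\<open>rat\<close>.\<close>

definition spin_FH :: "(partition \<Rightarrow>\<^sub>0 'r::comm_ring_1) ring" where
  "spin_FH = graded_algebra EPar spin_FH_coeff"


section \<open>The ring of symmetric functions\<close>

text \<open>
  A monomial in the variables \<open>x\<^sub>0, x\<^sub>1, \<dots>\<close> is encoded by the multiset of the indices of its
  variables.  A symmetric function is a formal power series in these variables that is of bounded
  degree and invariant under permutations of the variables.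
\<close>

definition symmetric_series :: "(nat multiset \<Rightarrow> 'a::zero) \<Rightarrow> bool" where
  "symmetric_series f \<longleftrightarrow> (\<forall>\<pi> m. bij \<pi> \<longrightarrow> f (image_mset \<pi> m) = f m)"

definition bounded_degree :: "(nat multiset \<Rightarrow> 'a::zero) \<Rightarrow> bool" where
  "bounded_degree f \<longleftrightarrow> (\<exists>d. \<forall>m. f m \<noteq> 0 \<longrightarrow> size m \<le> d)"

typedef (overloaded) ('a::zero) symfun =
  "{f :: nat multiset \<Rightarrow> 'a. symmetric_series f \<and> bounded_degree f}"
  morphisms mcoeff Abs_symfun
proof
  show "(\<lambda>_. 0) \<in> {f :: nat multiset \<Rightarrow> 'a. symmetric_series f \<and> bounded_degree f}"
    by (auto simp: symmetric_series_def bounded_degree_def)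
qed

setup_lifting type_definition_symfun

text \<open>The Cauchy product: monomials multiply by adding multisets.\<close>

definition series_mult ::
    "(nat multiset \<Rightarrow> 'a::comm_ring_1) \<Rightarrow> (nat multiset \<Rightarrow> 'a) \<Rightarrow> nat multiset \<Rightarrow> 'a" where
  "series_mult f g m = (\<Sum>(a, b) \<in> {(a, b). a + b = m}. f a * g b)"

lemma finite_submultisets: "finite {a. a \<subseteq># (m :: 'b multiset)}"
proof -
  have "{a. a \<subseteq># m} \<subseteq> mset ` {xs. set xs \<subseteq> set_mset m \<and> length xs \<le> size m}"
  proof
    fix a assume "a \<in> {a. a \<subseteq># m}"
    moreover obtain xs where "mset xs = a" by (metis ex_mset)
    ultimately show "a \<in> mset ` {xs. set xs \<subseteq> set_mset m \<and> length xs \<le> size m}"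
      by (intro image_eqI[of _ _ xs]) (auto dest: mset_subset_eqD size_mset_mono)
  qed
  thus ?thesis by (rule finite_subset) (simp add: finite_lists_length_le)
qed

lemma finite_multiset_splits: "finite {(a, b). a + b = (m :: 'b multiset)}"
proof -
  have "{(a, b). a + b = m} \<subseteq> {a. a \<subseteq># m} \<times> {b. b \<subseteq># m}" by auto
  thus ?thesis by (rule finite_subset) (simp add: finite_submultisets)
qed

lemma finite_multiset_splits': "finite {p. fst p + snd p = (m :: 'b multiset)}"
  using finite_multiset_splits[of m] by (simp add: split_def)

lemma series_mult_symmetric:
  assumes "symmetric_series f" "symmetric_series g"
  shows "symmetric_series (series_mult f g)"
  unfolding symmetric_series_def
proof (intro allI impI)
  fix \<pi> :: "nat \<Rightarrow> nat" and m assume \<pi>: "bij \<pi>"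
  have inv: "image_mset \<pi> (image_mset (inv' \<pi>) a) = a" "image_mset (inv' \<pi>) (image_mset \<pi> a) = a" for a
    using \<pi> by (simp_all add: multiset.map_comp o_def bij_is_surj surj_f_inv_f bij_is_inj)
  have eq: "f (image_mset (inv' \<pi>) a) = f a" "g (image_mset (inv' \<pi>) a) = g a" for a
    using assms \<pi> by (simp_all add: symmetric_series_def bij_imp_bij_inv)
  show "series_mult f g (image_mset \<pi> m) = series_mult f g m"
    unfolding series_mult_def
    by (rule sum.reindex_bij_witness
        [of _ "map_prod (image_mset \<pi>) (image_mset \<pi>)" "map_prod (image_mset (inv' \<pi>)) (image_mset (inv' \<pi>))"])
       (auto simp: inv eq simp flip: image_mset_union)
qed

lemma series_mult_bounded:
  assumes "bounded_degree f" "bounded_degree g"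
  shows "bounded_degree (series_mult f g)"
proof -
  from assms obtain d e where d: "\<And>m. f m \<noteq> 0 \<Longrightarrow> size m \<le> d" and e: "\<And>m. g m \<noteq> 0 \<Longrightarrow> size m \<le> e"
    unfolding bounded_degree_def by blast
  have "size m \<le> d + e" if "series_mult f g m \<noteq> 0" for m
  proof -
    from that obtain a b where "a + b = m" "f a * g b \<noteq> 0"
      unfolding series_mult_def by (smt (verit) case_prodE mem_Collect_eq prod.simps(2) sum.neutral)
    moreover from this have "f a \<noteq> 0" "g b \<noteq> 0" by auto
    ultimately show ?thesis using d[of a] e[of b] by auto
  qed
  thus ?thesis unfolding bounded_degree_def by blast
qed

lemma series_mult_commute: "series_mult f g m = series_mult g f m"
  unfolding series_mult_def
  by (rule sum.reindex_bij_witness[of _ prod.swap prod.swap]) (auto simp: ac_simps)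

lemma series_mult_assoc: "series_mult (series_mult f g) h m = series_mult f (series_mult g h) m"
proof -
  have "series_mult (series_mult f g) h m =
      (\<Sum>((p, c), (a, b)) \<in> (SIGMA (p, c) : {(p, c). p + c = m}. {(a, b). a + b = p}). f a * g b * h c)"
    unfolding series_mult_def
    by (subst sum.Sigma[symmetric])
       (auto simp: finite_multiset_splits' sum_distrib_right split_def intro!: sum.cong)
  also have "\<dots> =
      (\<Sum>((a, q), (b, c)) \<in> (SIGMA (a, q) : {(a, q). a + q = m}. {(b, c). b + c = q}). f a * (g b * h c))"
    by (rule sum.reindex_bij_witness[of _
          "\<lambda>((a, q), (b, c)). ((a + b, c), (a, b))" "\<lambda>((p, c), (a, b)). ((a, b + c), (b, c))"])
       (auto simp: ac_simps)
  also have "\<dots> = series_mult f (series_mult g h) m"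
    unfolding series_mult_def
    by (subst sum.Sigma[symmetric])
       (auto simp: finite_multiset_splits' sum_distrib_left split_def intro!: sum.cong)
  finally show ?thesis .
qed

lemma series_mult_one: "series_mult (\<lambda>m. if m = {#} then 1 else 0) f m = f m"
proof -
  have "series_mult (\<lambda>m. if m = {#} then 1 else 0) f m =
      (\<Sum>(a, b) \<in> {({#} :: nat multiset, m)}. (if a = {#} then 1 else 0) * f b)"
    unfolding series_mult_def
    by (rule sum.mono_neutral_cong_right[OF finite_multiset_splits]) (auto split: if_splits)
  thus ?thesis by simp
qed

instantiation symfun :: (comm_ring_1) comm_ring_1
begin

lift_definition zero_symfun :: "'a symfun" is "\<lambda>_. 0"
  by (auto simp: symmetric_series_def bounded_degree_def)

lift_definition one_symfun :: "'a symfun" is "\<lambda>m. if m = {#} then 1 else 0"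
  by (auto simp: symmetric_series_def bounded_degree_def)

lift_definition plus_symfun :: "'a symfun \<Rightarrow> 'a symfun \<Rightarrow> 'a symfun" is "\<lambda>f g m. f m + g m"
proof -
  fix f g :: "nat multiset \<Rightarrow> 'a"
  assume *: "symmetric_series f \<and> bounded_degree f" "symmetric_series g \<and> bounded_degree g"
  then obtain d e where "\<And>m. f m \<noteq> 0 \<Longrightarrow> size m \<le> d" "\<And>m. g m \<noteq> 0 \<Longrightarrow> size m \<le> e"
    unfolding bounded_degree_def by blast
  hence "\<forall>m. f m + g m \<noteq> 0 \<longrightarrow> size m \<le> max d e" by (metis add.left_neutral max.coboundedI1 max.coboundedI2)
  with * show "symmetric_series (\<lambda>m. f m + g m) \<and> bounded_degree (\<lambda>m. f m + g m)"
    unfolding symmetric_series_def bounded_degree_def by (intro conjI exI) auto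
qed

lift_definition uminus_symfun :: "'a symfun \<Rightarrow> 'a symfun" is "\<lambda>f m. - f m"
  by (auto simp: symmetric_series_def bounded_degree_def)

definition minus_symfun :: "'a symfun \<Rightarrow> 'a symfun \<Rightarrow> 'a symfun" where
  "minus_symfun f g = f + (- g)"

lift_definition times_symfun :: "'a symfun \<Rightarrow> 'a symfun \<Rightarrow> 'a symfun" is series_mult
  by (simp add: series_mult_symmetric series_mult_bounded)

instance
proof
  fix a b c :: "'a symfun"
  show "a * b * c = a * (b * c)" by transfer (simp add: fun_eq_iff series_mult_assoc)
  show "a * b = b * a" by transfer (simp add: fun_eq_iff series_mult_commute)
  show "1 * a = a" by transfer (simp add: fun_eq_iff series_mult_one)
  show "(a + b) * c = a * c + b * c"
    by transfer (simp add: fun_eq_iff series_mult_def distrib_right sum.distrib split_def)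
  show "a + b + c = a + (b + c)" by transfer (simp add: add.assoc)
  show "a + b = b + a" by transfer (simp add: add.commute)
  show "0 + a = a" by transfer simp
  show "- a + a = 0" by transfer simp
  show "a - b = a + - b" by (simp add: minus_symfun_def)
  show "(0 :: 'a symfun) \<noteq> 1" by transfer (auto simp: fun_eq_iff)
qed

end

lift_definition symfun_const :: "'a::comm_ring_1 \<Rightarrow> 'a symfun" is "\<lambda>c m. if m = {#} then c else 0"
  by (auto simp: symmetric_series_def bounded_degree_def)

lift_definition symfun_of_int :: "int symfun \<Rightarrow> 'a::comm_ring_1 symfun" is "\<lambda>f m. of_int (f m)"
  by (auto simp: symmetric_series_def bounded_degree_def) (metis of_int_0)

lift_definition complete_symfun :: "nat \<Rightarrow> 'a::comm_ring_1 symfun" is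
  "\<lambda>r m. if size m = r then 1 else 0"
  by (auto simp: symmetric_series_def bounded_degree_def)

text \<open>For \<open>r = 0\<close> this is the constant \<open>1\<close>; only \<open>r \<ge> 1\<close> is a power sum.\<close>

lift_definition power_sum :: "nat \<Rightarrow> 'a::comm_ring_1 symfun" is
  "\<lambda>r m. if \<exists>i. m = replicate_mset r i then 1 else 0"
proof -
  fix r :: nat
  have "(\<exists>i. image_mset \<pi> m = replicate_mset r i) \<longleftrightarrow> (\<exists>i. m = replicate_mset r i)"
    if "bij \<pi>" for \<pi> :: "nat \<Rightarrow> nat" and m
  proof
    assume "\<exists>i. image_mset \<pi> m = replicate_mset r i"
    then obtain i where "image_mset \<pi> m = replicate_mset r i" by blast
    hence "image_mset (inv' \<pi>) (image_mset \<pi> m) = replicate_mset r (inv' \<pi> i)" by simp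
    thus "\<exists>i. m = replicate_mset r i"
      using that by (auto simp: multiset.map_comp o_def bij_is_inj)
  qed auto
  thus "symmetric_series (\<lambda>m. if \<exists>i. m = replicate_mset r i then 1 else 0 :: 'a) \<and>
      bounded_degree (\<lambda>m. if \<exists>i. m = replicate_mset r i then 1 else 0 :: 'a)"
    by (auto simp: symmetric_series_def bounded_degree_def)
qed

definition exponents :: "nat multiset \<Rightarrow> partition" where
  "exponents m = image_mset (count m) (mset_set (set_mset m))"

lemma exponents_image:
  assumes "bij \<pi>" shows "exponents (image_mset \<pi> m) = exponents m"
proof -
  have inj: "inj \<pi>" using assms by (rule bij_is_inj)
  have "mset_set (\<pi> ` set_mset m) = image_mset \<pi> (mset_set (set_mset m))"
    using inj by (simp add: image_mset_mset_set inj_on_subset)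
  moreover have "count (image_mset \<pi> m) (\<pi> i) = count m i" for i
    using inj by (induction m) (auto simp: inj_eq)
  ultimately show ?thesis by (simp add: exponents_def multiset.map_comp o_def)
qed

lift_definition monomial_symfun :: "partition \<Rightarrow> 'a::comm_ring_1 symfun" is
  "\<lambda>\<mu> m. if exponents m = \<mu> then 1 else 0"
proof -
  fix \<mu> :: partition
  have "size m = \<Sum>\<^sub># (exponents m)" for m
    by (simp add: exponents_def size_multiset_overloaded_eq flip: sum_unfold_sum_mset)
  thus "symmetric_series (\<lambda>m. if exponents m = \<mu> then 1 else 0 :: 'a) \<and>
      bounded_degree (\<lambda>m. if exponents m = \<mu> then 1 else 0 :: 'a)"
    by (auto simp: symmetric_series_def bounded_degree_def exponents_image)
qed

text \<open>
  The Hall inner product is the bilinear form for which the bases \<open>h\<^sub>\<kappa> = \<Prod>\<^sub>i h\<^bsub>\<kappa>\<^sub>i\<^esub>\<close> and \<open>m\<^sub>\<mu>\<close> are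
  dual to each other.
\<close>

definition hall_inner :: "int symfun \<Rightarrow> int symfun \<Rightarrow> int" where
  "hall_inner f g = (THE k. \<exists>a b :: partition \<Rightarrow>\<^sub>0 int.
     Poly_Mapping.keys a \<subseteq> Par \<and> Poly_Mapping.keys b \<subseteq> Par \<and>
     f = (\<Sum>\<kappa> \<in> Poly_Mapping.keys a.
           of_int (Poly_Mapping.lookup a \<kappa>) * (\<Prod>r \<in># \<kappa>. complete_symfun r)) \<and>
     g = (\<Sum>\<mu> \<in> Poly_Mapping.keys b. of_int (Poly_Mapping.lookup b \<mu>) * monomial_symfun \<mu>) \<and>
     k = (\<Sum>\<kappa> \<in> Poly_Mapping.keys a. Poly_Mapping.lookup a \<kappa> * Poly_Mapping.lookup b \<kappa>))"


section \<open>Macdonald's basis\<close>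

text \<open>
  \<open>t + a\<^sub>1 t\<^sup>2 + a\<^sub>2 t\<^sup>3 + \<dots>\<close>, where \<open>a\<^sub>0 = 1\<close>.  Note that \<^term>\<open>complete_symfun 0 = 1\<close>, and
  that \<open>F oo G\<close> is the series \<open>F(G(t))\<close>.
\<close>

definition shifted_series :: "(nat \<Rightarrow> int symfun) \<Rightarrow> int symfun fps" where
  "shifted_series a = fps_X * Abs_fps a"

definition hstar :: "nat \<Rightarrow> int symfun" where
  "hstar = (THE a. a 0 = 1 \<and> shifted_series a oo shifted_series complete_symfun = fps_X)"

definition macdonald_g :: "partition \<Rightarrow> int symfun" where
  "macdonald_g \<kappa> =
     (THE g. \<forall>\<mu> \<in> Par. hall_inner g (\<Prod>r \<in># \<mu>. hstar r) = (if \<kappa> = \<mu> then 1 else 0))"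

inductive_set even_symfuns :: "rat symfun set" where
  const: "symfun_const q \<in> even_symfuns"
| power_sum: "k \<ge> 1 \<Longrightarrow> power_sum (2 * k) \<in> even_symfuns"
| add: "f \<in> even_symfuns \<Longrightarrow> g \<in> even_symfuns \<Longrightarrow> f + g \<in> even_symfuns"
| mult: "f \<in> even_symfuns \<Longrightarrow> g \<in> even_symfuns \<Longrightarrow> f * g \<in> even_symfuns"

definition even_symfun_ring :: "rat symfun ring" where
  "even_symfun_ring = \<lparr> carrier = even_symfuns, mult = (*), one = 1, zero = 0, add = (+) \<rparr>"

end

theory Submission
  imports Defs "HOL-Library.Multiset_Order"
begin

text \<open>
  For \<open>|\<nu>| = |\<kappa>| + |\<mu>|\<close> the structure constant of the Farahat--Higman ring is the number
  \<open>k(\<kappa>, \<mu>, \<nu>)\<close> of factorizations \<open>w = u v\<close> of a fixed \<open>w\<close> of type \<open>\<nu>\<close> into factors of types \<open>\<kappa>\<close>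
  and \<open>\<mu>\<close>.  Such factorizations are minimal: the cycles of \<open>w\<close> arise by gluing cycles of \<open>v\<close> along the
  cycles of \<open>u\<close>.  In particular even parts produce only even parts.

  The double cover acts faithfully through a Clifford algebra, with \<open>t\<^sub>i\<close> acting as
  \<open>(E\<^sub>i - E\<^bsub>i+1\<^esub>) / \<surd>2\<close>.  There a permutation with cycles of odd length has a canonical lift, the
  product of the elements \<open>-[i\<^sub>1, \<dots>, i\<^sub>m]\<close> over its nontrivial cycles, and canonical lifts are
  multiplicative on minimal factorizations.
  Hence the spin structure constant is \<open>(-1)\<close> to the power \<open>\<ell>(\<kappa>) + \<ell>(\<mu>) + \<ell>(\<nu>)\<close> times
  \<open>k(\<kappa>, \<mu>, \<nu>)\<close>, which gives the embedding into the Farahat--Higman ring.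

  Counting the ways in which an \<open>(r+1)\<close>-cycle can be the first factor shows that, with
  \<open>\<tau> = u + h\<^sub>1\<^sup>* u\<^sup>2 + \<dots>\<close>, the sum \<open>\<Sum>\<^sub>\<mu> k((r), \<mu>, \<nu>) h\<^sub>\<mu>\<^sup>*\<close> is the value at \<open>h\<^sub>\<nu>\<^sup>*\<close> of the derivation with
  \<open>\<tau> \<mapsto> u \<tau>' \<tau>\<^sup>r\<close>.  The adjoint of multiplication by \<open>p\<^sub>r\<close> is the derivation \<open>h\<^sub>n \<mapsto> h\<^bsub>n-r\<^esub>\<close>, and differentiating the
  equation for the inverse series identifies the two up to sign.  Dually,
  \<open>- p\<^sub>r g\<^sub>\<mu> = \<Sum>\<^sub>\<nu> k((r), \<mu>, \<nu>) g\<^sub>\<nu>\<close>.  Here \<open>\<nu> = \<mu> \<union> (r)\<close> occurs and all other \<open>\<nu>\<close> have fewer parts, so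
  induction on the number of parts yields both the multiplicativity of \<open>c\<^sub>\<kappa> \<mapsto> g\<^sub>\<kappa>\<close> and
  \<open>g\<^sub>\<kappa> \<in> \<rat>[p\<^sub>2, p\<^sub>4, \<dots>]\<close> for even \<open>\<kappa>\<close>.
\<close>

text \<open>The structure constants are definite descriptions, and products of class sums also have
  terms of lower degree, so a product must be expanded completely before one coefficient can be read
  off. Coefficients at class representatives serve as dual functionals. In the spin ring the
  functional at A is the coefficient of A minus that of zA; on products of the classes it vanishes
  over types with an odd part, because a lift with a cycle of even length is conjugate to its
  negative or has the wrong parity. A presentation could collapse: normal forms bound the spin group
  from above, and the Clifford operators, where z acts as -1, bound it from below. The formula for a
  cycle, applied to one entry, gives x_i^2 = z instead of 1. The minus sign in the canonical lift
  repairs this and makes gluing free of signs; the sign (-1)^\<ell> of the theorem is what separates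
  the classes D from the canonical lifts. In (2) rational scalars enter because p_r g_\<mu> contains
  g at \<mu> \<union> (r) up to sign with the multiplicity of r in \<mu> \<union> (r), by which one
  has to divide.\<close>

abbreviation (input) "lookup \<equiv> Poly_Mapping.lookup"
abbreviation (input) "keys \<equiv> Poly_Mapping.keys"
abbreviation (input) "single \<equiv> Poly_Mapping.single"

section \<open>Permutations given by disjoint cycles, and their minimal factorizations\<close>

section \<open>Disjoint cycle decompositions\<close>

abbreviation mct :: "(nat \<Rightarrow> nat) \<Rightarrow> partition" where
  "mct \<equiv> modified_cycle_type"

text \<open>One-element cycles are allowed, so that a fixed point can be listed when it takes part
  in a merge. The equation with \<open>rotate1\<close> says that \<open>p\<close> moves each entry
  of \<open>c\<close> to the next one, cyclically.\<close>

definition disjoint_cycles :: "('a \<Rightarrow> 'a) \<Rightarrow> 'a list list \<Rightarrow> bool" where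
  "disjoint_cycles p cs \<longleftrightarrow> distinct (concat cs) \<and> [] \<notin> set cs \<and>
     (\<forall>c \<in> set cs. map p c = rotate1 c) \<and> (\<forall>x. x \<notin> set (concat cs) \<longrightarrow> p x = x)"

text \<open>Serves to choose orders: of cycles with prescribed lengths, and of variables with
  prescribed exponents.\<close>

lemma map_eq_rearrange:
  assumes "image_mset f (mset xs) = mset ys"
  shows "\<exists>zs. mset zs = mset xs \<and> map f zs = ys"
  using assms
proof (induction ys arbitrary: xs)
  case Nil
  then show ?case by auto
next
  case (Cons y ys)
  then have "y \<in># image_mset f (mset xs)" by simp
  then obtain x where x: "x \<in> set xs" "y = f x" by auto
  have "image_mset f (mset (remove1 x xs)) = mset ys"
    using Cons.prems x by (simp add: image_mset_Diff)
  then obtain zs where "mset zs = mset (remove1 x xs)" "map f zs = ys" using Cons.IH by blast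
  then show ?case using x by (intro exI[of _ "x # zs"]) auto
qed

lemma mset_concat_cong: "mset cs = mset ds \<Longrightarrow> mset (concat cs) = mset (concat ds)"
  by (metis mset_concat mset_map sum_mset_sum_list)

lemma disjoint_cycles_mset:
  assumes "mset cs = mset ds"
  shows "disjoint_cycles p cs \<longleftrightarrow> disjoint_cycles p ds"
proof -
  have "set cs = set ds" using assms by (rule mset_eq_setD)
  moreover have "distinct (concat cs) = distinct (concat ds)"
    using mset_concat_cong[OF assms] by (rule mset_eq_imp_distinct_iff)
  ultimately show ?thesis unfolding disjoint_cycles_def by simp
qed

lemma disjoint_cycles_move_front:
  "disjoint_cycles w cs \<Longrightarrow> c \<in> set cs \<Longrightarrow> disjoint_cycles w (c # remove1 c cs)"
  using disjoint_cycles_mset[of "c # remove1 c cs" cs w] by simp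

lemma disjoint_cycles_rotate:
  assumes "disjoint_cycles p (c # cs)"
  shows "disjoint_cycles p (rotate k c # cs)"
proof -
  have "map p c = rotate1 c" using assms by (simp add: disjoint_cycles_def)
  then have "map p (rotate k c) = rotate1 (rotate k c)"
    by (simp add: rotate_map[symmetric] rotate1_rotate_swap[symmetric])
  then show ?thesis using assms by (auto simp: disjoint_cycles_def eq_commute[of "[]"])
qed

lemma rotate_to_front:
  assumes "x \<in> set c" obtains k A where "rotate k c = x # A"
proof -
  obtain l r where "c = l @ x # r" using assms by (auto simp: in_set_conv_decomp)
  then have "rotate (length l) c = x # r @ l" by (simp add: rotate_append)
  then show ?thesis using that by blast
qed

lemma disjoint_cycles_to_front:
  assumes "disjoint_cycles p cs" "x \<in> set (concat cs)"
  obtains as c bs k A where "cs = as @ c # bs" "rotate k c = x # A"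
    "disjoint_cycles p ((x # A) # as @ bs)" "set (x # A) = set c"
proof -
  obtain c where "c \<in> set cs" "x \<in> set c" using assms by auto
  then obtain as bs where cs: "cs = as @ c # bs" by (auto simp: in_set_conv_decomp)
  obtain k A where k: "rotate k c = x # A" using rotate_to_front \<open>x \<in> set c\<close> by metis
  have "disjoint_cycles p (c # as @ bs)"
    using assms(1) disjoint_cycles_mset[of cs "c # as @ bs"] cs by simp
  then show ?thesis using that[of as c bs k A] cs k disjoint_cycles_rotate[of p c "as @ bs" k]
    by (metis set_rotate)
qed

lemma disjoint_cycles_unique:
  assumes "disjoint_cycles p cs" "disjoint_cycles q cs" shows "p = q"
proof
  fix x
  show "p x = q x"
  proof (cases "x \<in> set (concat cs)")
    case True
    then obtain c where "c \<in> set cs" "x \<in> set c" by auto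
    then have "map p c = map q c" using assms by (simp add: disjoint_cycles_def)
    then show ?thesis using \<open>x \<in> set c\<close> by simp
  next
    case False
    then show ?thesis using assms by (simp add: disjoint_cycles_def)
  qed
qed

lemma map_cycle_of_list: "distinct c \<Longrightarrow> map (cycle_of_list c) c = rotate1 c"
  using cyclic_rotation[of c 1] by simp

lemma disjoint_cycles_Nil_iff: "disjoint_cycles p [] \<longleftrightarrow> p = id"
  by (auto simp: disjoint_cycles_def)

lemma disjoint_cycles_ConsI:
  assumes "disjoint_cycles q cs" "distinct c" "c \<noteq> []" "set c \<inter> set (concat cs) = {}"
  shows "disjoint_cycles (cycle_of_list c \<circ> q) (c # cs)"
proof -
  have "map (cycle_of_list c \<circ> q) d = rotate1 d" if "d \<in> set cs" for d
  proof -
    have "map q d = rotate1 d" using assms(1) that by (simp add: disjoint_cycles_def)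
    then have "map (cycle_of_list c \<circ> q) d = map (cycle_of_list c) (rotate1 d)" by (simp flip: map_map)
    also have "\<dots> = rotate1 d"
      using assms(4) that by (intro map_idI id_outside_supp) auto
    finally show ?thesis .
  qed
  moreover have "map (cycle_of_list c \<circ> q) c = rotate1 c"
  proof -
    have "q x = x" if "x \<in> set c" for x
      using assms(1,4) that unfolding disjoint_cycles_def by blast
    then have "map q c = c" by (intro map_idI)
    then show ?thesis using map_cycle_of_list[OF assms(2)] by (simp flip: map_map)
  qed
  ultimately show ?thesis
    using assms by (auto simp: disjoint_cycles_def id_outside_supp)
qed

lemma disjoint_cycles_exists:
  assumes "distinct (concat cs)" "[] \<notin> set cs"
  shows "\<exists>p. disjoint_cycles p cs \<and> p permutes set (concat cs)"
  using assms
proof (induction cs)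
  case Nil
  then show ?case by (intro exI[of _ id] conjI) (auto simp: disjoint_cycles_def permutes_def)
next
  case (Cons c cs)
  then obtain q where q: "disjoint_cycles q cs" "q permutes set (concat cs)" by auto
  have "(cycle_of_list c \<circ> q) permutes set (concat (c # cs))"
    by (rule permutes_compose)
       (use q(2) cycle_permutes[of c] in \<open>auto intro: permutes_subset\<close>)
  moreover have "disjoint_cycles (cycle_of_list c \<circ> q) (c # cs)"
    using disjoint_cycles_ConsI[OF q(1)] Cons.prems by auto
  ultimately show ?case by blast
qed

lemma disjoint_cycles_permutes: "disjoint_cycles p cs \<Longrightarrow> p permutes set (concat cs)"
  using disjoint_cycles_exists disjoint_cycles_unique unfolding disjoint_cycles_def by metis

lemma disjoint_cycles_permutation: "disjoint_cycles p cs \<Longrightarrow> permutation p"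
  using disjoint_cycles_permutes permutation_permutes by blast

lemma disjoint_cycles_ConsE:
  assumes "disjoint_cycles p (c # cs)"
  obtains q where "disjoint_cycles q cs" "p = cycle_of_list c \<circ> q" "distinct c" "c \<noteq> []"
    "set c \<inter> set (concat cs) = {}"
proof -
  have c: "distinct c" "c \<noteq> []" "set c \<inter> set (concat cs) = {}" "distinct (concat cs)" "[] \<notin> set cs"
    using assms by (auto simp: disjoint_cycles_def)
  then obtain q where "disjoint_cycles q cs" using disjoint_cycles_exists by blast
  then show ?thesis using that disjoint_cycles_ConsI disjoint_cycles_unique[OF assms] c by metis
qed

lemma disjoint_cycles_ex:
  assumes "p permutes S" "finite S"
  shows "\<exists>cs. disjoint_cycles p cs \<and> set (concat cs) = S"
proof -
  have "cycle_decomp S p" using assms by (rule cycle_decomposition)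
  then show ?thesis
  proof induction
    case empty
    show ?case by (intro exI[of _ "[]"] conjI) (auto simp: disjoint_cycles_def)
  next
    case (comp I p c)
    then obtain cs where cs: "disjoint_cycles p cs" "set (concat cs) = I" by blast
    show ?case
    proof (cases "c = []")
      case True
      then show ?thesis using cs by (auto simp: comp_def)
    next
      case False
      then show ?thesis
        using disjoint_cycles_ConsI[OF cs(1), of c] comp(2,3) cs(2)
        by (intro exI[of _ "c # cs"] conjI) (simp_all add: comp_def)
    qed
  qed
qed

lemma disjoint_cycles_ex':
  assumes "permutation p" obtains cs where "disjoint_cycles p cs"
  using assms disjoint_cycles_ex unfolding permutation_permutes by metis

lemma permutes_support: "permutation p \<Longrightarrow> p permutes {x. p x \<noteq> x}"
  unfolding permutation_permutes by (auto intro: permutes_superset)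

lemma finite_support: "permutation p \<Longrightarrow> finite {x. p x \<noteq> x}"
  by (simp add: permutation)

text \<open>Unlisted points are fixed, and \<open>cycle_of_list [x]\<close> is the identity, so they
  may be prepended as one-element cycles. The covered set is tracked exactly, because later it must
  be known that no foreign point, such as the auxiliary index \<open>b\<close>, has entered.\<close>

lemma disjoint_cycles_cover:
  assumes "disjoint_cycles p cs"
  shows "\<exists>ds. disjoint_cycles p (ds @ cs) \<and> set (concat (ds @ cs)) = set (concat cs) \<union> set xs"
proof (induction xs)
  case Nil
  then show ?case using assms by (intro exI[of _ "[]"]) simp
next
  case (Cons x xs)
  then obtain ds where ds: "disjoint_cycles p (ds @ cs)" "set (concat (ds @ cs)) = set (concat cs) \<union> set xs"
    by blast
  show ?case
  proof (cases "x \<in> set (concat (ds @ cs))")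
    case True
    then show ?thesis using ds by (intro exI[of _ ds]) auto
  next
    case False
    then have "disjoint_cycles (cycle_of_list [x] \<circ> p) ([x] # ds @ cs)"
      using disjoint_cycles_ConsI[OF ds(1), of "[x]"] by auto
    then have "disjoint_cycles p (([x] # ds) @ cs)" by simp
    then show ?thesis using ds(2) by (intro exI[of _ "[x] # ds"]) auto
  qed
qed

lemma disjoint_cycles_orbit:
  assumes "map p c = rotate1 c" "x \<in> set c"
  shows "orbit p x = set c"
proof
  have closed: "p y \<in> set c" if "y \<in> set c" for y
  proof -
    have "p y \<in> set (map p c)" using that by simp
    then show ?thesis using assms(1) by simp
  qed
  show "orbit p x \<subseteq> set c"
  proof
    fix y assume "y \<in> orbit p x"
    then show "y \<in> set c" by induction (use closed assms(2) in auto)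
  qed
  obtain k A where k: "rotate k c = x # A" using rotate_to_front assms(2) by metis
  have "map p (x # A) = A @ [x]"
    using assms(1) k by (metis rotate1.simps(2) rotate1_rotate_swap rotate_map)
  then have step: "p ((x # A) ! i) = (A @ [x]) ! i" if "i \<le> length A" for i
    using that nth_map[of i "x # A" p] by simp
  have "(A @ [x]) ! i \<in> orbit p x" if "i \<le> length A" for i
    using that
  proof (induction i)
    case 0
    then show ?case using step[of 0] orbit.base[of p x] by simp
  next
    case (Suc i)
    then have "p ((A @ [x]) ! i) \<in> orbit p x" by (simp add: orbit.step)
    moreover have "p ((A @ [x]) ! i) = (A @ [x]) ! Suc i"
      using step[of "Suc i"] Suc.prems by (simp add: nth_append)
    ultimately show ?case by simp
  qed
  then have "set (A @ [x]) \<subseteq> orbit p x" by (auto simp: in_set_conv_nth simp del: set_append)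
  moreover have "set c = set (A @ [x])" using k by (metis rotate1.simps(2) set_rotate set_rotate1)
  ultimately show "set c \<subseteq> orbit p x" by simp
qed

lemma disjoint_cycles_fixed:
  assumes "disjoint_cycles p cs" "c \<in> set cs" "x \<in> set c" "p x = x"
  shows "c = [x]"
proof -
  have c: "map p c = rotate1 c" "distinct c" using assms by (auto simp: disjoint_cycles_def distinct_concat_iff)
  have "orbit p x = {x}" using assms(4) by (simp add: orbit_eq_singleton_iff)
  then have "set c = {x}" using disjoint_cycles_orbit[OF c(1) assms(3)] by simp
  moreover from this have "length c = 1" using distinct_card[OF c(2)] by simp
  ultimately show ?thesis by (cases c) auto
qed

lemma disjoint_cycles_distinct:
  assumes "disjoint_cycles p cs" shows "distinct cs" "inj_on set (set cs)"
proof -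
  have d: "distinct (concat cs)" "[] \<notin> set cs" using assms by (auto simp: disjoint_cycles_def)
  then show "distinct cs"
  proof (induction cs)
    case (Cons c cs)
    then have "c \<noteq> []" "set c \<inter> set (concat cs) = {}" by auto
    then have "c \<notin> set cs" by (cases c) auto
    then show ?case using Cons by auto
  qed simp
  show "inj_on set (set cs)"
  proof (rule inj_onI)
    fix c c' assume cc: "c \<in> set cs" "c' \<in> set cs" "set c = set c'"
    then have "c \<noteq> []" using d by auto
    then show "c = c'" using d cc unfolding distinct_concat_iff by (metis Int_absorb set_empty)
  qed
qed

text \<open>Disjoint nonempty cycles have different sets of entries, so the orbits of moved points
  correspond to the cycles with at least two entries; the filter removes the one-element
  cycles.\<close>

lemma modified_cycle_type_eq:
  assumes "disjoint_cycles p cs"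
  shows "mct p = filter_mset (\<lambda>k. k \<noteq> 0) (mset (map (\<lambda>c. length c - 1) cs))"
proof -
  let ?N = "{c \<in> set cs. length c - 1 \<noteq> 0}"
  have cyc: "\<And>c. c \<in> set cs \<Longrightarrow> map p c = rotate1 c"
    and dist: "\<And>c. c \<in> set cs \<Longrightarrow> distinct c" and ne: "[] \<notin> set cs"
    using assms by (auto simp: disjoint_cycles_def distinct_concat_iff)
  have "{orbit p i | i. p i \<noteq> i} = set ` ?N"
  proof (intro Set.set_eqI iffI)
    fix X assume "X \<in> {orbit p i | i. p i \<noteq> i}"
    then obtain i where i: "X = orbit p i" "p i \<noteq> i" by blast
    then have "i \<in> set (concat cs)" using assms unfolding disjoint_cycles_def by blast
    then obtain c where c: "c \<in> set cs" "i \<in> set c" by auto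
    have "length c - 1 \<noteq> 0"
    proof
      assume "length c - 1 = 0"
      then have "length c \<le> 1" by simp
      then have "c = [i]" using c(2) by (cases c) auto
      then show False using cyc[OF c(1)] i(2) by simp
    qed
    moreover have "X = set c" using i(1) disjoint_cycles_orbit[OF cyc[OF c(1)] c(2)] by simp
    ultimately show "X \<in> set ` ?N" using c(1) by blast
  next
    fix X assume "X \<in> set ` ?N"
    then obtain c where c: "c \<in> set cs" "length c - 1 \<noteq> 0" "X = set c" by blast
    then have "c \<noteq> []" by auto
    then obtain i where i: "i \<in> set c" using list.set_intros(1) neq_Nil_conv by metis
    have "p i \<noteq> i" using disjoint_cycles_fixed[OF assms c(1) i] c(2) by auto
    moreover have "X = orbit p i" using disjoint_cycles_orbit[OF cyc[OF c(1)] i] c(3) by simp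
    ultimately show "X \<in> {orbit p i | i. p i \<noteq> i}" by blast
  qed
  moreover have "mset_set (set ` ?N) = image_mset set (mset_set ?N)"
    using disjoint_cycles_distinct(2)[OF assms] by (subst image_mset_mset_set) (auto intro: inj_on_subset)
  ultimately have "mct p = image_mset (\<lambda>c. card (set c) - 1) (mset_set ?N)"
    unfolding modified_cycle_type_def by (simp only: multiset.map_comp comp_def)
  also have "\<dots> = image_mset (\<lambda>c. length c - 1) (mset_set ?N)"
    by (rule image_mset_cong) (auto simp: dist distinct_card)
  also have "mset_set ?N = filter_mset (\<lambda>c. length c - 1 \<noteq> 0) (mset cs)"
    using disjoint_cycles_distinct(1)[OF assms]
    by (simp add: mset_set_set[symmetric] filter_mset_mset_set del: mset_set_set)
  finally show ?thesis by (simp add: filter_mset_image_mset comp_def not_le)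
qed

lemma modified_cycle_type_Par: "permutation p \<Longrightarrow> mct p \<in> Par"
  by (erule disjoint_cycles_ex') (simp add: Par_def modified_cycle_type_eq)

lemma EPar_iff_odd:
  assumes "disjoint_cycles p cs"
  shows "mct p \<in> EPar \<longleftrightarrow> (\<forall>c \<in> set cs. odd (length c))"
proof -
  have "[] \<notin> set cs" using assms by (simp add: disjoint_cycles_def)
  then have *: "c \<in> set cs \<Longrightarrow> length c > 0" for c by auto
  have "mct p \<in> Par" using assms disjoint_cycles_permutation modified_cycle_type_Par by blast
  then have "mct p \<in> EPar \<longleftrightarrow> (\<forall>c \<in> set cs. length c - 1 \<noteq> 0 \<longrightarrow> even (length c - 1))"
    by (auto simp: EPar_def modified_cycle_type_eq[OF assms])
  also have "\<dots> \<longleftrightarrow> (\<forall>c \<in> set cs. odd (length c))"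
  proof (rule ball_cong[OF HOL.refl])
    fix c assume "c \<in> set cs"
    then obtain k where "length c = Suc k" using *[of c] by (cases "length c") auto
    then show "(length c - 1 \<noteq> 0 \<longrightarrow> even (length c - 1)) \<longleftrightarrow> odd (length c)" by auto
  qed
  finally show ?thesis .
qed

text \<open>For a permutation, the least number of transpositions with product \<open>p\<close>. A
  product is minimal when this length is additive.\<close>

definition nrm :: "(nat \<Rightarrow> nat) \<Rightarrow> nat" where
  "nrm p = \<Sum>\<^sub># (mct p)"

lemma nrm_eq:
  assumes "disjoint_cycles p cs"
  shows "nrm p = (\<Sum>c\<leftarrow>cs. length c - 1)"
proof -
  have "\<Sum>\<^sub># (filter_mset (\<lambda>k. k \<noteq> 0) M) = \<Sum>\<^sub># M" for M :: "nat multiset"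
    by (induction M) auto
  then show ?thesis unfolding nrm_def modified_cycle_type_eq[OF assms]
    by (simp add: sum_mset_sum_list[symmetric])
qed

lemma nrm_add_length:
  assumes "disjoint_cycles p cs"
  shows "nrm p + length cs = length (concat cs)"
proof -
  have "[] \<notin> set cs" using assms by (simp add: disjoint_cycles_def)
  then show ?thesis unfolding nrm_eq[OF assms]
  proof (induction cs)
    case (Cons c cs)
    then obtain x A where "c = x # A" by (cases c) auto
    then show ?case using Cons by auto
  qed simp
qed

lemma mct_id [simp]: "mct id = {#}"
  using modified_cycle_type_eq[of id "[]"] by (simp add: disjoint_cycles_Nil_iff)

lemma mct_empty_iff:
  assumes "permutation p" shows "mct p = {#} \<longleftrightarrow> p = id"
proof
  assume e: "mct p = {#}"
  obtain cs where cs: "disjoint_cycles p cs" using assms by (rule disjoint_cycles_ex')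
  have ne: "[] \<notin> set cs" using cs by (simp add: disjoint_cycles_def)
  have "length c - 1 = 0" if "c \<in> set cs" for c
    using e that unfolding modified_cycle_type_eq[OF cs] by (auto simp: filter_mset_eq_conv)
  then have sing: "length c = 1" if "c \<in> set cs" for c
    using ne that by (cases c) force+
  show "p = id"
  proof
    fix x
    show "p x = id x"
    proof (cases "x \<in> set (concat cs)")
      case True
      then obtain c where c: "c \<in> set cs" "x \<in> set c" by auto
      then have "length c = 1" using sing by blast
      then have "c = [x]" using c(2) unfolding length_Suc_conv One_nat_def by auto
      moreover have "map p c = rotate1 c" using cs c by (simp add: disjoint_cycles_def)
      ultimately show ?thesis by simp
    next
      case False
      then show ?thesis using cs by (simp add: disjoint_cycles_def)
    qed
  qed
qed simp

section \<open>Merging cycles\<close>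

text \<open>Both sides spell the same word, in which heads and tails alternate; only the brackets
  move by one place. With \<open>z = x\<close> this shows that a merged cycle is mapped to its
  rotation by one.\<close>

lemma concat_map2_Cons_shift:
  assumes "length As = length xs"
  shows "x # concat (map2 (\<lambda>y A. A @ [y]) (xs @ [z]) (A # As)) =
    concat (map2 (#) (x # xs) (A # As)) @ [z]"
  using assms
proof (induction xs arbitrary: x A As)
  case (Cons x1 xs)
  then obtain A1 As1 where "As = A1 # As1" by (cases As) auto
  then show ?case using Cons.IH[of As1 x1 A1] Cons.prems by simp
qed simp

lemma set_concat_map2_Cons:
  assumes "length As = length xs"
  shows "set (concat (map2 (#) xs As)) = set xs \<union> \<Union> (set ` set As)"
  using assms by (induction xs As rule: list_induct2') auto

text \<open>After the last entry of \<open>A\<close> the map \<open>v\<close> would return to the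
  head \<open>x\<close>; the left factor sends it on to the next head instead. So the cycles are run
  through one after another.\<close>

lemma disjoint_cycles_merge:
  assumes dc: "disjoint_cycles v (map2 (#) xs As @ rest)"
    and len: "length As = length xs" and ne: "xs \<noteq> []"
  shows "disjoint_cycles (cycle_of_list xs \<circ> v) (concat (map2 (#) xs As) # rest)"
proof -
  let ?L = "concat (map2 (#) xs As)"
  have hd_in: "\<And>x. x \<in> set xs \<Longrightarrow> x \<in> set ?L"
    using len by (simp add: set_concat_map2_Cons del: set_concat)
  have dist: "distinct ?L" "set ?L \<inter> set (concat rest) = {}" "distinct (concat rest)"
    "[] \<notin> set rest" and cyc: "\<And>c. c \<in> set (map2 (#) xs As) \<union> set rest \<Longrightarrow> map v c = rotate1 c"
    and fixv: "\<And>x. x \<notin> set ?L \<Longrightarrow> x \<notin> set (concat rest) \<Longrightarrow> v x = x"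
    subgoal using dc by (simp add: disjoint_cycles_def)
    subgoal using dc unfolding disjoint_cycles_def concat_append distinct_append by blast
    subgoal using dc unfolding disjoint_cycles_def concat_append distinct_append by blast
    subgoal using dc unfolding disjoint_cycles_def by (simp del: set_concat)
    subgoal for c using dc unfolding disjoint_cycles_def set_append by blast
    subgoal using dc unfolding disjoint_cycles_def concat_append set_append by blast
    done
  \<comment> \<open>The heads avoid the tails, so the left factor fixes every entry of a
    tail.\<close>
  have dxs: "distinct xs \<and> (\<forall>A \<in> set As. set xs \<inter> set A = {})"
    using len dist(1) 
  proof (induction xs As rule: list_induct2')
    case (4 x xs A As)
    have sub: "set xs \<subseteq> set (concat (map2 (#) xs As))" "\<forall>A\<in>set As. set A \<subseteq> set (concat (map2 (#) xs As))"
      using 4(2) by (auto simp: set_concat_map2_Cons simp del: set_concat)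
    have d: "x \<notin> set A" "distinct (concat (map2 (#) xs As))" "x \<notin> set (concat (map2 (#) xs As))"
      "set A \<inter> set (concat (map2 (#) xs As)) = {}"
      using 4(3) by auto
    have IH: "distinct xs \<and> (\<forall>A \<in> set As. set xs \<inter> set A = {})" using 4(1) 4(2) d(2) by simp
    have "x \<notin> set xs" using sub(1) d(3) by blast
    moreover have "\<forall>B \<in> set As. x \<notin> set B" using sub(2) d(3) by blast
    moreover have "set xs \<inter> set A = {}" using sub(1) d(4) by blast
    ultimately show ?case using IH d(1) by auto
  qed auto
  let ?c = "cycle_of_list xs"
  have cA: "map ?c A = A" if "A \<in> set As" for A
    using dxs that by (intro map_idI id_outside_supp) auto
  obtain x0 xs0 A0 As0 where xs: "xs = x0 # xs0" "As = A0 # As0" "length As0 = length xs0"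
    using len ne by (cases xs; cases As) auto
  have "map (?c \<circ> v) (concat (map2 (#) ys Bs)) = concat (map2 (\<lambda>y A. A @ [y]) (map ?c ys) Bs)"
    if "length Bs = length ys" "set (zip ys Bs) \<subseteq> set (zip xs As)" for ys Bs
    using that
  proof (induction ys Bs rule: list_induct2')
    case (4 y ys B Bs)
    have "(y, B) \<in> set (zip xs As)" using 4(3) by auto
    then have "y # B \<in> set (map2 (#) xs As)" "B \<in> set As" by (force dest: set_zip_rightD)+
    then have "map v (y # B) = B @ [y]" using cyc[of "y # B"] by simp
    then have "map (?c \<circ> v) (y # B) = B @ [?c y]"
      using cA[OF \<open>B \<in> set As\<close>] by (metis list.map(1,2) map_append map_map)
    moreover have "map (?c \<circ> v) (concat (map2 (#) ys Bs)) = concat (map2 (\<lambda>y A. A @ [y]) (map ?c ys) Bs)"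
      using 4(1) 4(2,3) by (metis Suc_inject insert_subset length_Cons list.set(2) zip_Cons_Cons)
    ultimately show ?case
      by (simp only: zip_Cons_Cons list.map concat.simps map_append case_prod_conv append_assoc)
  qed auto
  from this[of As xs] have "map (?c \<circ> v) ?L = concat (map2 (\<lambda>y A. A @ [y]) (rotate1 xs) As)"
    using len dxs map_cycle_of_list[of xs] by simp
  moreover have "x0 # concat (map2 (\<lambda>y A. A @ [y]) (rotate1 xs) As) = ?L @ [x0]"
    using concat_map2_Cons_shift[OF xs(3), of x0 x0 A0] xs by simp
  then have "concat (map2 (\<lambda>y A. A @ [y]) (rotate1 xs) As) = rotate1 ?L"
    using xs by simp
  ultimately have "map (?c \<circ> v) ?L = rotate1 ?L" by simp
  moreover have "map (?c \<circ> v) d = rotate1 d" if "d \<in> set rest" for d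
  proof -
    have "map (?c \<circ> v) d = map ?c (rotate1 d)" using cyc[of d] that by (simp flip: map_map)
    also have "\<dots> = rotate1 d"
    proof (intro map_idI id_outside_supp notI)
      fix x assume "x \<in> set (rotate1 d)" "x \<in> set xs"
      then have "x \<in> set (concat rest)" "x \<in> set ?L" using that hd_in by auto
      then show False using dist(2) by blast
    qed
    finally show ?thesis .
  qed
  moreover have "(?c \<circ> v) x = x" if "x \<notin> set ?L" "x \<notin> set (concat rest)" for x
    using fixv[OF that] id_outside_supp[of x xs] hd_in[of x] that(1) by auto
  moreover have "?L \<noteq> []" using xs by simp
  ultimately show ?thesis
    unfolding disjoint_cycles_def
  proof (intro conjI ballI allI impI)
    show "distinct (concat (?L # rest))" using dist by (simp only: concat.simps distinct_append simp_thms)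
    show "[] \<notin> set (?L # rest)"
    proof
      assume "[] \<in> set (?L # rest)"
      then have "[] = ?L \<or> [] \<in> set rest" unfolding list.set by blast
      then show False using \<open>?L \<noteq> []\<close> dist(4) by metis
    qed
  qed (auto simp only: list.set concat.simps set_append insert_iff Un_iff)
qed

text \<open>The opposite of a merge with two heads; it is what makes the norm drop in
  \<open>nrm_transpose\<close>.\<close>

lemma disjoint_cycles_split:
  assumes dc: "disjoint_cycles q ((a # A @ b # B) # rest)"
  shows "disjoint_cycles (transpose a b \<circ> q) ((a # A) # (b # B) # rest)"
proof -
  have "map q (a # A @ b # B) = A @ b # B @ [a]" using dc by (simp add: disjoint_cycles_def)
  then have "map q (a # A) @ map q (b # B) = (A @ [b]) @ (B @ [a])" by simp
  then have q: "map q (a # A) = A @ [b]" "map q (b # B) = B @ [a]"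
    by (subst (asm) append_eq_append_conv; simp)+
  have d: "a \<notin> set A" "b \<notin> set A" "a \<notin> set B" "b \<notin> set B" "a \<noteq> b"
    "a \<notin> set (concat rest)" "b \<notin> set (concat rest)"
    using dc by (auto simp: disjoint_cycles_def)
  have t: "map (transpose a b) X = X" if "a \<notin> set X" "b \<notin> set X" for X
    using that by (intro map_idI) (auto simp: transpose_def)
  have 1: "map (transpose a b \<circ> q) (a # A) = A @ [a]"
    unfolding map_map[symmetric] q using t[of A] d by simp
  have 2: "map (transpose a b \<circ> q) (b # B) = B @ [b]"
    unfolding map_map[symmetric] q using t[of B] d by simp
  have 3: "map (transpose a b \<circ> q) c = rotate1 c" if "c \<in> set rest" for c
  proof -
    have "map q c = rotate1 c" using dc that by (simp add: disjoint_cycles_def)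
    then have "map (transpose a b \<circ> q) c = map (transpose a b) (rotate1 c)" by (simp flip: map_map)
    also have "\<dots> = rotate1 c" using t[of "rotate1 c"] d that by auto
    finally show ?thesis .
  qed
  have 4: "transpose a b (q x) = x" if "x \<notin> set ((a # A @ b # B) @ concat rest)" for x
  proof -
    have "q x = x" using dc that by (auto simp: disjoint_cycles_def)
    then show ?thesis using that by (simp add: transpose_def)
  qed
  have 5: "distinct (concat ((a # A) # (b # B) # rest))" "[] \<notin> set ((a # A) # (b # B) # rest)"
    using dc unfolding disjoint_cycles_def by auto
  show ?thesis
    unfolding disjoint_cycles_def
  proof (intro conjI ballI allI impI 5)
    fix c assume "c \<in> set ((a # A) # (b # B) # rest)"
    then consider "c = a # A" | "c = b # B" | "c \<in> set rest" by auto
    then show "map (transpose a b \<circ> q) c = rotate1 c"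
      using 1 2 3 by cases (auto simp only: rotate1.simps)
  next
    fix x assume "x \<notin> set (concat ((a # A) # (b # B) # rest))"
    then show "(transpose a b \<circ> q) x = x" using 4[of x] by simp
  qed
qed

section \<open>Minimal products\<close>

lemma nrm_transpose:
  assumes "permutation q" "a \<noteq> b"
  obtains (merge) A B rest where "disjoint_cycles q ((a # A) # (b # B) # rest)"
      "nrm (transpose a b \<circ> q) = nrm q + 1"
    | (split) "nrm (transpose a b \<circ> q) < nrm q"
proof -
  obtain cs where "disjoint_cycles q cs" using assms(1) by (rule disjoint_cycles_ex')
  then obtain ds where ds: "disjoint_cycles q ds" "a \<in> set (concat ds)" "b \<in> set (concat ds)"
    using disjoint_cycles_cover[of q cs "[a, b]"] by (metis UnCI list.set_intros)
  obtain as c bs k C where C: "ds = as @ c # bs" "rotate k c = a # C"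
    "disjoint_cycles q ((a # C) # as @ bs)" "set (a # C) = set c"
    using disjoint_cycles_to_front[OF ds(1,2)] by metis
  show ?thesis
  proof (cases "b \<in> set C")
    case True
    then obtain A B where "C = A @ b # B" by (auto simp: in_set_conv_decomp)
    then have d: "disjoint_cycles q ((a # A @ b # B) # as @ bs)" using C(3) by simp
    have "nrm (transpose a b \<circ> q) < nrm q"
      unfolding nrm_eq[OF d] nrm_eq[OF disjoint_cycles_split[OF d]] by simp
    then show ?thesis by (rule split)
  next
    case False
    then have "b \<in> set (concat (as @ bs))" using ds(3) assms(2) C(1,4) by auto
    then obtain d where "d \<in> set (as @ bs)" "b \<in> set d" by auto
    then obtain as' bs' where d: "as @ bs = as' @ d # bs'" "b \<in> set d" by (metis in_set_conv_decomp)
    obtain j B where j: "rotate j d = b # B" using rotate_to_front[OF d(2)] by metis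
    have "disjoint_cycles q (d # (a # C) # as' @ bs')"
      using C(3) disjoint_cycles_mset[of "(a # C) # as @ bs" "d # (a # C) # as' @ bs'" q] d(1) by simp
    then have "disjoint_cycles q ((b # B) # (a # C) # as' @ bs')"
      using disjoint_cycles_rotate[of q d _ j] j by metis
    then have 1: "disjoint_cycles q ((a # C) # (b # B) # as' @ bs')"
      using disjoint_cycles_mset[of "(a # C) # (b # B) # as' @ bs'" "(b # B) # (a # C) # as' @ bs'" q] by simp
    then have "disjoint_cycles (cycle_of_list [a, b] \<circ> q) ((a # C @ b # B) # as' @ bs')"
      using disjoint_cycles_merge[of q "[a, b]" "[C, B]" "as' @ bs'"] by simp
    then have 2: "disjoint_cycles (transpose a b \<circ> q) ((a # C @ b # B) # as' @ bs')" by simp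
    have "nrm (transpose a b \<circ> q) = nrm q + 1"
      unfolding nrm_eq[OF 1] nrm_eq[OF 2] by simp
    then show ?thesis using 1 merge by blast
  qed
qed

lemma cycle_of_list_snoc:
  assumes "distinct (x # xs @ [y])"
  shows "cycle_of_list (x # xs @ [y]) = transpose x y \<circ> cycle_of_list (x # xs)"
proof -
  have 1: "disjoint_cycles (cycle_of_list (x # xs) \<circ> (cycle_of_list [y] \<circ> id)) ((x # xs) # [y] # [])"
    using assms by (intro disjoint_cycles_ConsI) (auto simp: disjoint_cycles_Nil_iff)
  have "disjoint_cycles (cycle_of_list [x, y] \<circ> (cycle_of_list (x # xs) \<circ> (cycle_of_list [y] \<circ> id)))
      [x # xs @ [y]]"
    using disjoint_cycles_merge[of _ "[x, y]" "[xs, []]" "[]"] 1 by simp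
  moreover have "disjoint_cycles (cycle_of_list (x # xs @ [y]) \<circ> id) [x # xs @ [y]]"
    using assms by (intro disjoint_cycles_ConsI) (auto simp: disjoint_cycles_Nil_iff)
  ultimately have "cycle_of_list [x, y] \<circ> (cycle_of_list (x # xs) \<circ> (cycle_of_list [y] \<circ> id)) =
      cycle_of_list (x # xs @ [y]) \<circ> id"
    by (rule disjoint_cycles_unique)
  then show ?thesis by simp
qed

text \<open>The cycle is a product of transpositions that share its first entry
  (\<open>cycle_of_list_snoc\<close>), and each of them raises the norm by at most 1. Equality
  forces every one to merge two cycles, so the entries of \<open>xs\<close> lie in different cycles
  of \<open>v\<close>.\<close>

lemma nrm_cycle_comp:
  assumes dc: "disjoint_cycles v cs" and "distinct xs" "xs \<noteq> []"
  shows "nrm (cycle_of_list xs \<circ> v) \<le> nrm v + (length xs - 1) \<and>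
    (nrm (cycle_of_list xs \<circ> v) = nrm v + (length xs - 1) \<longrightarrow>
      (\<exists>As rest. length As = length xs \<and> disjoint_cycles v (map2 (#) xs As @ rest) \<and>
        set (concat (map2 (#) xs As @ rest)) = set (concat cs) \<union> set xs))"
  using assms(3,2)
proof (induction xs rule: rev_nonempty_induct)
  case (single x)
  obtain ds where ds: "disjoint_cycles v (ds @ cs)" "set (concat (ds @ cs)) = set (concat cs) \<union> {x}"
    using disjoint_cycles_cover[OF dc, of "[x]"] by auto
  then obtain as c bs k A where c: "ds @ cs = as @ c # bs" "rotate k c = x # A"
    "disjoint_cycles v ((x # A) # as @ bs)" "set (x # A) = set c"
    using disjoint_cycles_to_front[OF ds(1), of x] by blast
  have "set (concat ((x # A) # as @ bs)) = set (concat (ds @ cs))" using c(1,4) by auto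
  then have "set (concat (map2 (#) [x] [A] @ as @ bs)) = set (concat cs) \<union> set [x]"
    using ds(2) by simp
  moreover have "disjoint_cycles v (map2 (#) [x] [A] @ as @ bs)" "length [A] = length [x]"
    using c(3) by simp_all
  ultimately have "\<exists>As rest. length As = length [x] \<and> disjoint_cycles v (map2 (#) [x] As @ rest) \<and>
        set (concat (map2 (#) [x] As @ rest)) = set (concat cs) \<union> set [x]"
    by blast
  then show ?case by simp
next
  case (snoc y xs)
  obtain x xs' where xs: "xs = x # xs'" using snoc by (cases xs) auto
  let ?q = "cycle_of_list xs \<circ> v"
  have eq: "cycle_of_list (xs @ [y]) \<circ> v = transpose x y \<circ> ?q"
    using cycle_of_list_snoc[of x xs' y] snoc.prems xs by (simp add: comp_assoc)
  have perm: "permutation ?q"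
    using disjoint_cycles_permutation[OF dc] permutation_of_cycle permutation_compose by blast
  have ne: "x \<noteq> y" using snoc.prems xs by auto
  have IH: "nrm ?q \<le> nrm v + (length xs - 1)"
    and IH': "nrm ?q = nrm v + (length xs - 1) \<Longrightarrow>
      (\<exists>As rest. length As = length xs \<and> disjoint_cycles v (map2 (#) xs As @ rest) \<and>
        set (concat (map2 (#) xs As @ rest)) = set (concat cs) \<union> set xs)"
    using snoc.IH snoc.prems by (simp_all add: comp_def)
  show ?case
    using perm ne
  proof (cases rule: nrm_transpose)
    case split
    then have "nrm (cycle_of_list (xs @ [y]) \<circ> v) < nrm v + length xs" using IH eq xs by simp
    then show ?thesis by (auto simp: comp_def)
  next
    case (merge A B rest0)
    have le: "nrm (cycle_of_list (xs @ [y]) \<circ> v) \<le> nrm v + (length (xs @ [y]) - 1)"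
      using merge(2) IH eq xs by simp
    have "\<exists>As rest. length As = length (xs @ [y]) \<and> disjoint_cycles v (map2 (#) (xs @ [y]) As @ rest) \<and>
        set (concat (map2 (#) (xs @ [y]) As @ rest)) = set (concat cs) \<union> set (xs @ [y])"
      if "nrm (cycle_of_list (xs @ [y]) \<circ> v) = nrm v + (length (xs @ [y]) - 1)"
    proof -
      have "nrm ?q = nrm v + (length xs - 1)" using that merge(2) IH eq xs by simp
      then obtain As rest1 where As: "length As = length xs" "disjoint_cycles v (map2 (#) xs As @ rest1)"
        "set (concat (map2 (#) xs As @ rest1)) = set (concat cs) \<union> set xs" using IH' by blast
      obtain ds where ds: "disjoint_cycles v (ds @ map2 (#) xs As @ rest1)"
        "set (concat (ds @ map2 (#) xs As @ rest1)) = set (concat (map2 (#) xs As @ rest1)) \<union> {y}"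
        using disjoint_cycles_cover[OF As(2), of "[y]"] by auto
      define rest where "rest = ds @ rest1"
      have rest: "disjoint_cycles v (map2 (#) xs As @ rest)"
        using ds(1) disjoint_cycles_mset[of "ds @ map2 (#) xs As @ rest1" "map2 (#) xs As @ rest" v]
        by (simp add: rest_def)
      have cover: "set (concat (map2 (#) xs As @ rest)) = set (concat cs) \<union> set xs \<union> {y}"
        using ds(2) unfolding rest_def As(3) concat_append set_append
        using As(3) unfolding concat_append set_append by (metis Un_assoc Un_commute)
      have q: "disjoint_cycles ?q (concat (map2 (#) xs As) # rest)"
        using disjoint_cycles_merge[OF rest As(1)] xs by simp
      \<comment> \<open>The entries of \<open>xs\<close> are already merged into one cycle of
        \<open>?q\<close>, and the transposition of \<open>x\<close> and \<open>y\<close> is a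
        merge; hence \<open>y\<close> lies in a cycle of \<open>v\<close> that has not been touched
        yet.\<close>
      have "y \<notin> set (concat (map2 (#) xs As))"
      proof
        assume "y \<in> set (concat (map2 (#) xs As))"
        moreover have "x \<in> set (concat (map2 (#) xs As))"
          using xs set_concat_map2_Cons[OF As(1)] by simp
        ultimately have "orbit ?q x = orbit ?q y"
          using q disjoint_cycles_orbit[of ?q "concat (map2 (#) xs As)"] unfolding disjoint_cycles_def
          by (metis list.set_intros(1))
        moreover have "orbit ?q x = set (x # A)" "orbit ?q y = set (y # B)"
          using merge(1) disjoint_cycles_orbit[of ?q "x # A" x] disjoint_cycles_orbit[of ?q "y # B" y]
          unfolding disjoint_cycles_def by (meson list.set_intros)+
        ultimately show False using merge(1) by (auto simp: disjoint_cycles_def)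
      qed
      then have "y \<in> set (concat rest)" using cover unfolding concat_append set_append by blast
      then obtain d where "d \<in> set rest" "y \<in> set d" by auto
      then obtain r1 r2 where d: "rest = r1 @ d # r2" "y \<in> set d"
        by (auto simp: in_set_conv_decomp[of d])
      obtain j D where j: "rotate j d = y # D" using rotate_to_front[OF d(2)] by metis
      have "disjoint_cycles v (d # map2 (#) xs As @ r1 @ r2)"
        using rest disjoint_cycles_mset[of "map2 (#) xs As @ rest" "d # map2 (#) xs As @ r1 @ r2" v] d(1)
        by simp
      then have "disjoint_cycles v ((y # D) # map2 (#) xs As @ r1 @ r2)"
        using disjoint_cycles_rotate[of v d _ j] j by metis
      moreover have m: "map2 (#) (xs @ [y]) (As @ [D]) = map2 (#) xs As @ [y # D]"
        using As(1) by simp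
      ultimately have "disjoint_cycles v (map2 (#) (xs @ [y]) (As @ [D]) @ r1 @ r2)"
        using disjoint_cycles_mset[of "(y # D) # map2 (#) xs As @ r1 @ r2"
            "map2 (#) (xs @ [y]) (As @ [D]) @ r1 @ r2" v] by simp
      moreover have "set d = set (y # D)" using j by (metis set_rotate)
      then have "set (concat (map2 (#) (xs @ [y]) (As @ [D]) @ r1 @ r2)) = set (concat cs) \<union> set (xs @ [y])"
        using cover d(1) unfolding m by (simp del: set_concat add: concat.simps(2)) blast
      moreover have "length (As @ [D]) = length (xs @ [y])" using As(1) by simp
      ultimately show ?thesis by blast
    qed
    with le show ?thesis by blast
  qed
qed

lemma nrm_comp_le:
  assumes "permutation u" "permutation v" shows "nrm (u \<circ> v) \<le> nrm u + nrm v"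
proof -
  obtain cs where "disjoint_cycles u cs" using assms(1) by (rule disjoint_cycles_ex')
  then show ?thesis
  proof (induction cs arbitrary: u)
    case Nil
    then show ?case by (simp add: disjoint_cycles_Nil_iff)
  next
    case (Cons c cs)
    obtain q where q: "disjoint_cycles q cs" "u = cycle_of_list c \<circ> q" "distinct c" "c \<noteq> []"
      using disjoint_cycles_ConsE[OF Cons.prems] by metis
    have "permutation (q \<circ> v)" using q(1) assms(2) disjoint_cycles_permutation permutation_compose by blast
    then obtain ds where "disjoint_cycles (q \<circ> v) ds" by (rule disjoint_cycles_ex')
    then have "nrm (u \<circ> v) \<le> nrm (q \<circ> v) + (length c - 1)"
      using nrm_cycle_comp[of "q \<circ> v" ds c] q by (simp add: comp_assoc)
    also have "\<dots> \<le> nrm q + nrm v + (length c - 1)" using Cons.IH[OF q(1)] by (simp add: comp_def)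
    also have "\<dots> = nrm u + nrm v" using nrm_eq[OF Cons.prems] nrm_eq[OF q(1)] by simp
    finally show ?case .
  qed
qed

text \<open>The cycles of a minimal product arise from those of \<open>v\<close> by successively gluing, along each cycle
  of \<open>u\<close>, distinct cycles into one.\<close>

lemma minimal_product_induct:
  assumes "disjoint_cycles u cs" "permutation v" "nrm (u \<circ> v) = nrm u + nrm v" "Q [] v"
    and step: "\<And>q xs As rest cs. Q cs q \<Longrightarrow> distinct (concat (xs # cs)) \<Longrightarrow> xs \<noteq> [] \<Longrightarrow> length As = length xs \<Longrightarrow>
      disjoint_cycles q (map2 (#) xs As @ rest) \<Longrightarrow> set (concat rest) \<subseteq> {x. q x \<noteq> x} \<union> set xs \<Longrightarrow>
      Q (xs # cs) (cycle_of_list xs \<circ> q)"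
  shows "Q cs (u \<circ> v)"
  using assms(1,3)
proof (induction cs arbitrary: u)
  case Nil
  then show ?case using assms(4) by (simp add: disjoint_cycles_Nil_iff)
next
  case (Cons c cs)
  obtain q where q: "disjoint_cycles q cs" "u = cycle_of_list c \<circ> q" "distinct c" "c \<noteq> []"
    using disjoint_cycles_ConsE[OF Cons.prems(1)] by metis
  have "permutation (q \<circ> v)" using q(1) assms(2) disjoint_cycles_permutation permutation_compose by blast
  then obtain ds where ds: "disjoint_cycles (q \<circ> v) ds" "set (concat ds) = {x. (q \<circ> v) x \<noteq> x}"
    using disjoint_cycles_ex[OF permutes_support finite_support] by blast
  have le: "nrm (u \<circ> v) \<le> nrm (q \<circ> v) + (length c - 1)"
    using nrm_cycle_comp[OF ds(1) q(3,4)] q(2) by (simp add: comp_assoc)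
  have u: "nrm u = nrm q + (length c - 1)" using nrm_eq[OF Cons.prems(1)] nrm_eq[OF q(1)] by simp
  have "nrm (q \<circ> v) \<le> nrm q + nrm v"
    using nrm_comp_le disjoint_cycles_permutation q(1) assms(2) by blast
  \<comment> \<open>The two bounds add up to the norm of the whole product, so both are
    equalities.\<close>
  then have eq: "nrm (q \<circ> v) = nrm q + nrm v" "nrm (u \<circ> v) = nrm (q \<circ> v) + (length c - 1)"
    using le u Cons.prems(2) by (auto simp: comp_def)
  then obtain As rest where As: "length As = length c" "disjoint_cycles (q \<circ> v) (map2 (#) c As @ rest)"
    "set (concat (map2 (#) c As @ rest)) = set (concat ds) \<union> set c"
    using nrm_cycle_comp[OF ds(1) q(3,4)] q(2) by (auto simp: comp_assoc)
  have "Q (c # cs) (cycle_of_list c \<circ> (q \<circ> v))"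
  proof (rule step)
    show "Q cs (q \<circ> v)" using Cons.IH[OF q(1) eq(1)] .
    show "distinct (concat (c # cs))" using Cons.prems(1) by (simp add: disjoint_cycles_def)
    show "set (concat rest) \<subseteq> {x. (q \<circ> v) x \<noteq> x} \<union> set c"
      using As(3) ds(2) by auto
  qed (use As q in auto)
  then show ?case using q(2) by (simp add: comp_def)
qed

text \<open>A merged cycle has at least as many entries as \<open>xs\<close>. If it contains a fixed
  point, then \<open>xs\<close> has one entry and the left factor is the identity.\<close>

lemma disjoint_cycles_fixed_merge:
  assumes dc: "disjoint_cycles q (map2 (#) xs As @ rest)" "length As = length xs" "xs \<noteq> []"
    and fixed: "(cycle_of_list xs \<circ> q) x = x"
  shows "q x = x"
proof (cases "x \<in> set xs \<union> \<Union> (set ` set As)")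
  case True
  have "disjoint_cycles (cycle_of_list xs \<circ> q) (concat (map2 (#) xs As) # rest)"
    using disjoint_cycles_merge dc by blast
  moreover have "x \<in> set (concat (map2 (#) xs As))" using True set_concat_map2_Cons[OF dc(2)] by blast
  ultimately have single: "concat (map2 (#) xs As) = [x]" using disjoint_cycles_fixed fixed by (meson list.set_intros(1))
  have "length xs \<le> length (concat (map2 (#) xs As))"
    using dc(2) by (induction xs As rule: list_induct2') auto
  then have "length xs \<le> 1" using single by simp
  then obtain y where "xs = [y]" using dc(3) by (cases xs) auto
  then show ?thesis using fixed by simp
next
  case False
  then have x: "cycle_of_list xs x = x" by (simp add: id_outside_supp)
  have "inj (cycle_of_list xs)" using permutation_bijective[OF permutation_of_cycle] bij_is_inj by blast
  then show ?thesis using fixed x by (metis comp_apply injD)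
qed

text \<open>Merging never cancels a moved point. This is what makes the structure constants
  independent of \<open>n\<close>: the factors of a minimal product move only points that the
  product moves.\<close>

lemma minimal_product_fixed:
  assumes "permutation u" "permutation v" "nrm (u \<circ> v) = nrm u + nrm v" "(u \<circ> v) x = x"
  shows "u x = x" "v x = x"
proof -
  obtain cs where "disjoint_cycles u cs" using assms(1) by (rule disjoint_cycles_ex')
  then have "(u \<circ> v) x = x \<longrightarrow> v x = x" using assms(2,3)
    by (rule minimal_product_induct[where Q = "\<lambda>_ q. q x = x \<longrightarrow> v x = x"])
       (metis disjoint_cycles_fixed_merge | simp)+
  then show "v x = x" using assms(4) by blast
  then show "u x = x" using assms(4) by simp
qed

lemma odd_length_concat: "\<forall>c \<in> set cs. odd (length c) \<Longrightarrow> odd (length (concat cs)) \<longleftrightarrow> odd (length cs)"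
  by (induction cs) auto

text \<open>Each step glues an odd number of cycles of odd length, which gives a cycle of odd
  length.\<close>

lemma minimal_product_EPar:
  assumes "permutation u" "permutation v" "nrm (u \<circ> v) = nrm u + nrm v"
    and "mct u \<in> EPar" "mct v \<in> EPar"
  shows "mct (u \<circ> v) \<in> EPar"
proof -
  obtain cs where cs: "disjoint_cycles u cs" using assms(1) by (rule disjoint_cycles_ex')
  then have "(\<forall>c \<in> set cs. odd (length c)) \<longrightarrow> mct (u \<circ> v) \<in> EPar"
    using assms(2,3)
  proof (rule minimal_product_induct[where Q = "\<lambda>cs q. (\<forall>c \<in> set cs. odd (length c)) \<longrightarrow> mct q \<in> EPar"])
    fix q :: "nat \<Rightarrow> nat" and xs As rest and cs :: "nat list list"
    assume q: "(\<forall>c \<in> set cs. odd (length c)) \<longrightarrow> mct q \<in> EPar" and len: "length As = length xs" and ne: "xs \<noteq> []"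
      and dc: "disjoint_cycles q (map2 (#) xs As @ rest)"
    show "(\<forall>c \<in> set (xs # cs). odd (length c)) \<longrightarrow> mct (cycle_of_list xs \<circ> q) \<in> EPar"
    proof
      assume odd: "\<forall>c \<in> set (xs # cs). odd (length c)"
      then have *: "\<forall>c \<in> set (map2 (#) xs As @ rest). odd (length c)" using q EPar_iff_odd[OF dc] by auto
      then have "odd (length (concat (map2 (#) xs As)))"
        using odd len odd_length_concat[of "map2 (#) xs As"] by (simp only: set_append) auto
      then show "mct (cycle_of_list xs \<circ> q) \<in> EPar"
        using * EPar_iff_odd[OF disjoint_cycles_merge[OF dc len ne]] by simp
    qed
  qed (use assms in auto)
  then show ?thesis using EPar_iff_odd[OF cs] assms(4) by blast
qed

section \<open>Conjugacy and cycle type\<close>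

lemma disjoint_cycles_conj:
  fixes \<pi> :: "'a \<Rightarrow> 'a"
  assumes "disjoint_cycles p cs" "bij \<pi>"
  shows "disjoint_cycles (\<pi> \<circ> p \<circ> inv' \<pi>) (map (map \<pi>) cs)"
proof -
  have inv: "inv' \<pi> (\<pi> x) = x" "\<pi> (inv' \<pi> x) = x" for x
    using assms(2) by (simp_all add: bij_is_inj bij_is_surj surj_f_inv_f)
  have "map (\<pi> \<circ> p \<circ> inv' \<pi>) (map \<pi> c) = rotate1 (map \<pi> c)" if "c \<in> set cs" for c
  proof -
    have "map (\<pi> \<circ> p \<circ> inv' \<pi>) (map \<pi> c) = map \<pi> (map p c)" by (simp add: inv)
    moreover have "map p c = rotate1 c" using assms(1) that by (simp add: disjoint_cycles_def)
    ultimately show ?thesis by (simp only: rotate1_map)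
  qed
  moreover have "distinct (concat (map (map \<pi>) cs))"
    using assms unfolding map_concat[symmetric] distinct_map disjoint_cycles_def
    by (auto intro: inj_on_subset dest: bij_is_inj)
  moreover have "(\<pi> \<circ> p \<circ> inv' \<pi>) x = x" if "x \<notin> set (concat (map (map \<pi>) cs))" for x
  proof -
    have "inv' \<pi> x \<notin> set (concat cs)"
    proof
      assume "inv' \<pi> x \<in> set (concat cs)"
      then have "\<pi> (inv' \<pi> x) \<in> set (map \<pi> (concat cs))" unfolding set_map by (rule imageI)
      then have "x \<in> set (map \<pi> (concat cs))" by (simp only: inv)
      then show False using that by (simp only: map_concat not_True_eq_False)
    qed
    then have "p (inv' \<pi> x) = inv' \<pi> x" using assms(1) unfolding disjoint_cycles_def by blast
    then show ?thesis by (simp add: inv)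
  qed
  ultimately show ?thesis using assms(1) by (auto simp: disjoint_cycles_def)
qed

lemma mct_conj:
  assumes "permutation p" "bij \<pi>" shows "mct (\<pi> \<circ> p \<circ> inv' \<pi>) = mct p"
proof -
  obtain cs where cs: "disjoint_cycles p cs" using assms(1) by (rule disjoint_cycles_ex')
  have "map (\<lambda>c. length c - 1) (map (map \<pi>) cs) = map (\<lambda>c. length c - 1) cs" by simp
  then show ?thesis
    using modified_cycle_type_eq[OF cs] modified_cycle_type_eq[OF disjoint_cycles_conj[OF cs assms(2)]]
    by metis
qed

lemma permutes_extend:
  assumes "distinct xs" "distinct ys" "length xs = length ys" "set xs \<subseteq> S" "set ys \<subseteq> S" "finite S"
  shows "\<exists>\<pi>. \<pi> permutes S \<and> map \<pi> xs = ys"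
proof -
  have "card (S - set xs) = card (S - set ys)"
    using assms by (simp add: card_Diff_subset distinct_card)
  then obtain g where g: "bij_betw g (S - set xs) (S - set ys)"
    using assms(6) finite_same_card_bij by (metis finite_Diff)
  define f where "f x = (case map_of (zip xs ys) x of Some y \<Rightarrow> y | None \<Rightarrow> g x)" for x
  have fx: "f (xs ! i) = ys ! i" if "i < length xs" for i
    using assms(1,3) that by (simp add: f_def map_of_zip_nth)
  have map: "map f xs = ys" using fx assms(3) by (intro nth_equalityI) auto
  have "bij_betw f (set xs) (set ys)"
    using map assms(1,2) by (metis bij_betw_def distinct_map set_map)
  moreover have fg: "f x = g x" if "x \<notin> set xs" for x
    using that assms(3) by (simp add: f_def map_of_zip_is_None split: option.split) (metis map_of_zip_is_None option.distinct(1))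
  then have "bij_betw f (S - set xs) (S - set ys)"
    using g by (subst bij_betw_cong[of _ f g]) auto
  ultimately have bij: "bij_betw f (set xs \<union> (S - set xs)) (set ys \<union> (S - set ys))"
    by (rule bij_betw_combine) auto
  have un: "set xs \<union> (S - set xs) = S" "set ys \<union> (S - set ys) = S" using assms by auto
  define \<pi> where "\<pi> x = (if x \<in> S then f x else x)" for x
  have "bij_betw \<pi> S S" using bij unfolding un by (subst bij_betw_cong[of _ \<pi> f]) (auto simp: \<pi>_def)
  then have "\<pi> permutes S" by (rule bij_imp_permutes) (simp add: \<pi>_def)
  moreover have "map \<pi> xs = ys" using map assms(4) by (auto simp: \<pi>_def)
  ultimately show ?thesis by blast
qed

text \<open>The order of the lengths that \<open>spin_D\<close> prescribes.\<close>

definition cycle_lengths :: "partition \<Rightarrow> nat list" where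
  "cycle_lengths \<kappa> = map Suc (rev (sorted_list_of_multiset \<kappa>))"

lemma disjoint_cycles_sorted:
  assumes "permutation p"
  shows "\<exists>cs. disjoint_cycles p cs \<and> map length cs = cycle_lengths (mct p) \<and> set (concat cs) = {x. p x \<noteq> x}"
proof -
  obtain ds where ds: "disjoint_cycles p ds" using assms by (rule disjoint_cycles_ex')
  define es where "es = filter (\<lambda>c. length c - 1 \<noteq> 0) ds"
  have cyc: "\<And>c. c \<in> set ds \<Longrightarrow> map p c = rotate1 c" and ne: "[] \<notin> set ds"
    using ds by (auto simp: disjoint_cycles_def)
  have supp: "set (concat es) = {x. p x \<noteq> x}"
  proof (intro Set.set_eqI iffI)
    fix x assume "x \<in> set (concat es)"
    then obtain c where c: "c \<in> set ds" "x \<in> set c" "length c - 1 \<noteq> 0" by (auto simp: es_def)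
    then show "x \<in> {x. p x \<noteq> x}" using disjoint_cycles_fixed[OF ds c(1,2)] by auto
  next
    fix x assume "x \<in> {x. p x \<noteq> x}"
    then have "x \<in> set (concat ds)" using ds unfolding disjoint_cycles_def by blast
    then obtain c where c: "c \<in> set ds" "x \<in> set c" by auto
    have "\<not> length c \<le> 1"
    proof
      assume "length c \<le> 1"
      then have "c = [x]" using c(2) by (cases c) auto
      then show False using cyc[OF c(1)] \<open>x \<in> {x. p x \<noteq> x}\<close> by simp
    qed
    then show "x \<in> set (concat es)" using c by (auto simp: es_def)
  qed
  have "distinct (concat es)"
    using ds unfolding es_def disjoint_cycles_def by (auto simp: distinct_concat_iff distinct_filter)
       (metis filter_True filter_filter removeAll_filter_not_eq)?
  then have es: "disjoint_cycles p es"
    using cyc ne supp unfolding disjoint_cycles_def es_def by (auto simp del: set_concat)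
  have "image_mset (\<lambda>c. length c - 1) (mset es) = mct p"
    unfolding modified_cycle_type_eq[OF ds] es_def by (simp add: filter_mset_image_mset comp_def not_le)
  then have "image_mset (\<lambda>c. length c - 1) (mset es) = mset (rev (sorted_list_of_multiset (mct p)))" by simp
  then obtain cs where cs: "mset cs = mset es" "map (\<lambda>c. length c - 1) cs = rev (sorted_list_of_multiset (mct p))"
    using map_eq_rearrange by blast
  have "map length cs = map Suc (map (\<lambda>c. length c - 1) cs)"
    using mset_eq_setD[OF cs(1)] by (auto simp: es_def)
  moreover have "disjoint_cycles p cs" using es disjoint_cycles_mset[OF cs(1)] by blast
  moreover have "set (concat cs) = {x. p x \<noteq> x}" using supp mset_eq_setD[OF cs(1)] by simp
  ultimately show ?thesis using cs(2) unfolding cycle_lengths_def by metis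
qed

lemma mct_of_cycle_lengths:
  assumes "disjoint_cycles p cs" "map length cs = cycle_lengths \<kappa>" "\<kappa> \<in> Par"
  shows "mct p = \<kappa>"
proof -
  have "map (\<lambda>c. length c - 1) cs = map (\<lambda>k. k - 1) (map length cs)" by simp
  also have "\<dots> = rev (sorted_list_of_multiset \<kappa>)" by (simp add: assms(2) cycle_lengths_def comp_def)
  finally have "mset (map (\<lambda>c. length c - 1) cs) = \<kappa>" by simp
  moreover have "filter_mset (\<lambda>k. k \<noteq> 0) \<kappa> = \<kappa>" using assms(3) by (auto simp: Par_def filter_mset_eq_conv intro: gr0I)
  ultimately show ?thesis using modified_cycle_type_eq[OF assms(1)] by simp
qed

lemma length_concat_cycle_lengths:
  "map length cs = cycle_lengths \<kappa> \<Longrightarrow> length (concat cs) = \<Sum>\<^sub># \<kappa> + size \<kappa>"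
proof -
  assume a: "map length cs = cycle_lengths \<kappa>"
  have "length (concat cs) = sum_list (cycle_lengths \<kappa>)" by (simp add: length_concat a)
  also have "\<dots> = \<Sum>\<^sub># (mset (cycle_lengths \<kappa>))" by (simp add: sum_mset_sum_list)
  also have "mset (cycle_lengths \<kappa>) = image_mset Suc \<kappa>" by (simp add: cycle_lengths_def)
  also have "\<Sum>\<^sub># (image_mset Suc \<kappa>) = \<Sum>\<^sub># \<kappa> + size \<kappa>" by (induction \<kappa>) auto
  finally show ?thesis .
qed

lemma map_map_concat_eq:
  assumes "map length cs = map length ds" "map f (concat cs) = concat ds"
  shows "map (map f) cs = ds"
  using assms
proof (induction cs arbitrary: ds)
  case (Cons c cs)
  then obtain d ds' where "ds = d # ds'" by (cases ds) auto
  then show ?case using Cons by auto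
qed simp

lemma conjugate_cycles:
  assumes "disjoint_cycles p cs" "disjoint_cycles q ds" "map length cs = map length ds"
    "set (concat cs) \<subseteq> S" "set (concat ds) \<subseteq> S" "finite S"
  shows "\<exists>\<pi>. \<pi> permutes S \<and> map (map \<pi>) cs = ds \<and> q = \<pi> \<circ> p \<circ> inv' \<pi>"
proof -
  have "length (concat cs) = length (concat ds)" using assms(3) by (simp add: length_concat)
  then obtain \<pi> where \<pi>: "\<pi> permutes S" "map \<pi> (concat cs) = concat ds"
    using permutes_extend[of "concat cs" "concat ds" S] assms unfolding disjoint_cycles_def by blast
  then have m: "map (map \<pi>) cs = ds" using map_map_concat_eq assms(3) by blast
  moreover have "q = \<pi> \<circ> p \<circ> inv' \<pi>"
    using disjoint_cycles_conj[OF assms(1) permutes_bij[OF \<pi>(1)]] disjoint_cycles_unique assms(2) m by metis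
  ultimately show ?thesis using \<pi>(1) by blast
qed

lemma conjugate_if_same_type:
  assumes "p permutes S" "q permutes S" "finite S" "mct p = mct q"
  shows "\<exists>\<pi>. \<pi> permutes S \<and> q = \<pi> \<circ> p \<circ> inv' \<pi>"
proof -
  have "permutation p" "permutation q" using assms permutation_permutes by blast+
  then obtain cs ds where cs: "disjoint_cycles p cs" "map length cs = cycle_lengths (mct p)" "set (concat cs) = {x. p x \<noteq> x}"
     and ds: "disjoint_cycles q ds" "map length ds = cycle_lengths (mct q)" "set (concat ds) = {x. q x \<noteq> x}"
    using disjoint_cycles_sorted[of p] disjoint_cycles_sorted[of q] by blast
  have "map length cs = map length ds" "set (concat cs) \<subseteq> S" "set (concat ds) \<subseteq> S"
    using cs ds assms by (auto simp: permutes_def simp del: set_concat)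
  then show ?thesis using conjugate_cycles[OF cs(1) ds(1), of S] assms(3) by blast
qed

lemma exists_cycle_lengths:
  assumes "0 \<notin> set ls"
  shows "\<exists>cs. map length cs = ls \<and> concat cs = [a..<a + sum_list ls]"
  using assms
proof (induction ls arbitrary: a)
  case (Cons l ls)
  then obtain cs where "map length cs = ls" "concat cs = [a + l..<a + l + sum_list ls]" by auto
  moreover have "[a..<a + (l + sum_list ls)] = [a..<a + l] @ [a + l..<a + l + sum_list ls]"
    using upt_add_eq_append[of a "a + l" "sum_list ls"] by (simp add: add.assoc)
  ultimately show ?case by (intro exI[of _ "[a..<a + l] # cs"]) (simp del: upt_Suc)
qed simp

lemma exists_permutes_of_type:
  assumes "\<kappa> \<in> Par" "\<Sum>\<^sub># \<kappa> + size \<kappa> \<le> n"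
  shows "\<exists>p cs. p permutes {1..n} \<and> mct p = \<kappa> \<and> disjoint_cycles p cs \<and> map length cs = cycle_lengths \<kappa> \<and>
    set (concat cs) \<subseteq> {1..n}"
proof -
  have "0 \<notin> set (cycle_lengths \<kappa>)" by (auto simp: cycle_lengths_def)
  then obtain cs where cs: "map length cs = cycle_lengths \<kappa>" "concat cs = [1..<1 + sum_list (cycle_lengths \<kappa>)]"
    using exists_cycle_lengths by blast
  have "sum_list (cycle_lengths \<kappa>) \<le> n"
    using length_concat_cycle_lengths[OF cs(1)] assms(2) cs(2) by (metis add_diff_cancel_left' length_upt)
  then have sub: "set (concat cs) \<subseteq> {1..n}" unfolding cs(2) by auto
  have "[] \<notin> set cs"
  proof
    assume "[] \<in> set cs"
    then have "0 \<in> set (map length cs)" by force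
    then show False using cs(1) by (auto simp: cycle_lengths_def)
  qed
  moreover have "distinct (concat cs)" unfolding cs(2) by simp
  ultimately obtain p where p: "disjoint_cycles p cs" "p permutes set (concat cs)"
    using disjoint_cycles_exists by blast
  then show ?thesis using mct_of_cycle_lengths[OF p(1) cs(1) assms(1)] cs(1) sub permutes_subset by blast
qed

lemma mct_fits:
  assumes "p permutes {1..n}" shows "\<Sum>\<^sub># (mct p) + size (mct p) \<le> n"
proof -
  have "permutation p" using assms permutation_permutes by blast
  then obtain cs where cs: "disjoint_cycles p cs" "map length cs = cycle_lengths (mct p)" "set (concat cs) = {x. p x \<noteq> x}"
    using disjoint_cycles_sorted by blast
  have "set (concat cs) \<subseteq> {1..n}" using cs(3) assms by (auto simp: permutes_def)
  then have "card (set (concat cs)) \<le> n" using card_mono[of "{1..n}"] by fastforce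
  moreover have "distinct (concat cs)" using cs(1) by (simp add: disjoint_cycles_def)
  ultimately show ?thesis using length_concat_cycle_lengths[OF cs(2)] distinct_card by metis
qed

section \<open>Structure constants as numbers of minimal factorizations\<close>

text \<open>No \<open>n\<close> occurs: the factors are finitely supported permutations of all
  naturals. When the degrees add up, minimality confines them to the support of
  \<open>w\<close>.\<close>

definition factorizations :: "partition \<Rightarrow> partition \<Rightarrow> (nat \<Rightarrow> nat) \<Rightarrow> ((nat \<Rightarrow> nat) \<times> (nat \<Rightarrow> nat)) set" where
  "factorizations \<kappa> \<mu> w =
    {(u, v). permutation u \<and> permutation v \<and> mct u = \<kappa> \<and> mct v = \<mu> \<and> u \<circ> v = w}"

text \<open>The choice of a representative is harmless, because conjugation carries factorizations
  to factorizations; see \<open>card_factorizations\<close>.\<close>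

definition factor_count :: "partition \<Rightarrow> partition \<Rightarrow> partition \<Rightarrow> nat" where
  "factor_count \<kappa> \<mu> \<nu> = card (factorizations \<kappa> \<mu> (SOME w. permutation w \<and> mct w = \<nu>))"

lemma inv_conj_conj: "bij \<pi> \<Longrightarrow> inv' \<pi> \<circ> (\<pi> \<circ> p \<circ> inv' \<pi>) \<circ> \<pi> = p"
  by (auto simp: fun_eq_iff bij_is_inj)

lemma permutation_conj: "permutation p \<Longrightarrow> permutation \<pi> \<Longrightarrow> permutation (\<pi> \<circ> p \<circ> inv' \<pi>)"
  by (intro permutation_compose permutation_inverse)

lemma card_factorizations_conj_le:
  assumes "permutation \<pi>" "finite (factorizations \<kappa> \<mu> (\<pi> \<circ> w \<circ> inv' \<pi>))"
  shows "finite (factorizations \<kappa> \<mu> w) \<and>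
    card (factorizations \<kappa> \<mu> w) \<le> card (factorizations \<kappa> \<mu> (\<pi> \<circ> w \<circ> inv' \<pi>))"
proof -
  have b: "bij \<pi>" using assms(1) by (rule permutation_bijective)
  let ?f = "\<lambda>(u, v). (\<pi> \<circ> u \<circ> inv' \<pi>, \<pi> \<circ> v \<circ> inv' \<pi>)"
  have "inj_on ?f (factorizations \<kappa> \<mu> w)"
    by (rule inj_on_inverseI[where g = "\<lambda>(u, v). (inv' \<pi> \<circ> u \<circ> \<pi>, inv' \<pi> \<circ> v \<circ> \<pi>)"])
       (auto simp: inv_conj_conj[OF b])
  moreover have "?f ` factorizations \<kappa> \<mu> w \<subseteq> factorizations \<kappa> \<mu> (\<pi> \<circ> w \<circ> inv' \<pi>)"
  proof (rule image_subsetI)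
    fix x assume "x \<in> factorizations \<kappa> \<mu> w"
    then obtain u v where x: "x = (u, v)" "permutation u" "permutation v" "mct u = \<kappa>" "mct v = \<mu>" "u \<circ> v = w"
      by (auto simp: factorizations_def)
    have "(\<pi> \<circ> u \<circ> inv' \<pi>) \<circ> (\<pi> \<circ> v \<circ> inv' \<pi>) = \<pi> \<circ> w \<circ> inv' \<pi>"
      unfolding x(6)[symmetric] using b by (auto simp: fun_eq_iff bij_is_inj)
    then show "?f x \<in> factorizations \<kappa> \<mu> (\<pi> \<circ> w \<circ> inv' \<pi>)"
      using x assms(1) b by (simp add: factorizations_def permutation_conj mct_conj)
  qed
  ultimately show ?thesis using assms(2) by (metis card_inj_on_le inj_on_finite)
qed

lemma finite_factorizations:
  assumes "permutation w" "nrm w = \<Sum>\<^sub># \<kappa> + \<Sum>\<^sub># \<mu>"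
  shows "finite (factorizations \<kappa> \<mu> w)"
    "(u, v) \<in> factorizations \<kappa> \<mu> w \<Longrightarrow> u permutes {x. w x \<noteq> x} \<and> v permutes {x. w x \<noteq> x}"
proof -
  show *: "u permutes {x. w x \<noteq> x} \<and> v permutes {x. w x \<noteq> x}" if "(u, v) \<in> factorizations \<kappa> \<mu> w" for u v
  proof -
    have uv: "permutation u" "permutation v" "nrm (u \<circ> v) = nrm u + nrm v" "u \<circ> v = w"
      using that assms(2) by (auto simp: factorizations_def nrm_def)
    then have "u x = x" "v x = x" if "w x = x" for x
      using minimal_product_fixed[OF uv(1,2,3), of x] that by auto
    then have "{x. u x \<noteq> x} \<subseteq> {x. w x \<noteq> x}" "{x. v x \<noteq> x} \<subseteq> {x. w x \<noteq> x}" by blast+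
    then show ?thesis
      using permutes_subset[OF permutes_support[OF uv(1)]] permutes_subset[OF permutes_support[OF uv(2)]] by blast
  qed
  have "factorizations \<kappa> \<mu> w \<subseteq> {p. p permutes {x. w x \<noteq> x}} \<times> {p. p permutes {x. w x \<noteq> x}}"
    using * by auto
  then show "finite (factorizations \<kappa> \<mu> w)"
    using finite_permutations[OF finite_support[OF assms(1)]] by (meson finite_SigmaI finite_subset)
qed

lemma conjugate_permutations:
  assumes "permutation p" "permutation q" "mct p = mct q"
  shows "\<exists>\<pi>. permutation \<pi> \<and> q = \<pi> \<circ> p \<circ> inv' \<pi>"
proof -
  let ?S = "{x. p x \<noteq> x} \<union> {x. q x \<noteq> x}"
  have p: "p permutes ?S" "q permutes ?S"
    using permutes_subset[OF permutes_support[OF assms(1)]] permutes_subset[OF permutes_support[OF assms(2)]]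
    by blast+
  have fin: "finite ?S" using finite_support assms(1,2) by blast
  obtain \<pi> where \<pi>: "\<pi> permutes ?S" "q = \<pi> \<circ> p \<circ> inv' \<pi>"
    using conjugate_if_same_type[OF p fin assms(3)] by (elim exE conjE)
  have "permutation \<pi>" using \<pi>(1) fin permutation_permutes by metis
  then show ?thesis using \<pi>(2) by (intro exI conjI)
qed

lemma card_factorizations:
  assumes "permutation w" "mct w = \<nu>" "\<Sum>\<^sub># \<nu> = \<Sum>\<^sub># \<kappa> + \<Sum>\<^sub># \<mu>"
  shows "card (factorizations \<kappa> \<mu> w) = factor_count \<kappa> \<mu> \<nu>"
proof -
  let ?w = "SOME w. permutation w \<and> mct w = \<nu>"
  have w: "permutation ?w \<and> mct ?w = \<nu>" by (rule someI[of _ w]) (simp add: assms)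
  have fin: "finite (factorizations \<kappa> \<mu> w)" "finite (factorizations \<kappa> \<mu> ?w)"
    using finite_factorizations(1) assms w by (simp_all add: nrm_def)
  obtain \<pi> \<pi>' where "permutation \<pi>" "?w = \<pi> \<circ> w \<circ> inv' \<pi>" "permutation \<pi>'" "w = \<pi>' \<circ> ?w \<circ> inv' \<pi>'"
    using conjugate_permutations[of w ?w] conjugate_permutations[of ?w w] assms w by metis
  then show ?thesis
    using card_factorizations_conj_le[of \<pi> \<kappa> \<mu> w] card_factorizations_conj_le[of \<pi>' \<kappa> \<mu> ?w] fin
    unfolding factor_count_def by (metis le_antisym)
qed

lemma exists_permutation_of_type: "\<kappa> \<in> Par \<Longrightarrow> \<exists>w. permutation w \<and> mct w = \<kappa>"
  using exists_permutes_of_type[of \<kappa> "\<Sum>\<^sub># \<kappa> + size \<kappa>"] permutation_permutes by blast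

lemma factor_count_EPar:
  assumes "\<kappa> \<in> EPar" "\<mu> \<in> EPar" "\<nu> \<in> Par" "\<Sum>\<^sub># \<nu> = \<Sum>\<^sub># \<kappa> + \<Sum>\<^sub># \<mu>" "factor_count \<kappa> \<mu> \<nu> \<noteq> 0"
  shows "\<nu> \<in> EPar"
proof -
  obtain w where w: "permutation w" "mct w = \<nu>" using exists_permutation_of_type assms(3) by blast
  then have "factorizations \<kappa> \<mu> w \<noteq> {}" using card_factorizations[OF w assms(4)] assms(5) by auto
  then obtain u v where "permutation u" "permutation v" "mct u = \<kappa>" "mct v = \<mu>" "u \<circ> v = w"
    by (auto simp: factorizations_def)
  then show ?thesis using minimal_product_EPar[of u v] w assms by (simp add: nrm_def)
qed

lemma finite_partitions: "finite {\<kappa> \<in> Par. \<Sum>\<^sub># \<kappa> = n}"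
proof -
  have "\<kappa> \<in> mset ` {xs. set xs \<subseteq> {..n} \<and> length xs \<le> n}" if "\<kappa> \<in> Par" "\<Sum>\<^sub># \<kappa> = n" for \<kappa>
  proof -
    obtain xs where xs: "mset xs = \<kappa>" by (metis ex_mset)
    have s: "sum_list xs = n" using that(2) xs by (metis sum_mset_sum_list)
    have "0 \<notin> set xs" using that(1) xs by (auto simp: Par_def)
    then have "length xs \<le> sum_list xs" by (induction xs) auto
    moreover have "set xs \<subseteq> {..n}" unfolding s[symmetric] by (auto intro: member_le_sum_list)
    ultimately show ?thesis using xs s by blast
  qed
  then have "{\<kappa> \<in> Par. \<Sum>\<^sub># \<kappa> = n} \<subseteq> mset ` {xs. set xs \<subseteq> {..n} \<and> length xs \<le> n}" by blast
  then show ?thesis by (rule finite_subset) (simp add: finite_lists_length_le)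
qed

definition partitions_of :: "nat \<Rightarrow> partition set" where
  "partitions_of n = {\<kappa> \<in> Par. \<Sum>\<^sub># \<kappa> = n}"

lemma finite_partitions_of [simp]: "finite (partitions_of n)"
  by (simp add: partitions_of_def finite_partitions)

lemma card_fibred:
  assumes "bij_betw f S (SIGMA x : A. B x)" "finite A" "\<And>x. x \<in> A \<Longrightarrow> finite (B x) \<and> card (B x) = k"
  shows "finite S \<and> card S = card A * k"
  using assms bij_betw_finite[OF assms(1)] bij_betw_same_card[OF assms(1)] by simp

text \<open>Both sides count triples \<open>(a, b, c)\<close> with \<open>abc = w\<close>; for \<open>abc\<close> minimal, so are \<open>ab\<close> and \<open>bc\<close>.\<close>

lemma factor_count_assoc:
  assumes "\<nu> \<in> Par" "\<Sum>\<^sub># \<nu> = \<Sum>\<^sub># \<kappa> + \<Sum>\<^sub># \<mu> + \<Sum>\<^sub># \<rho>"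
  shows "(\<Sum>\<sigma> \<in> partitions_of (\<Sum>\<^sub># \<kappa> + \<Sum>\<^sub># \<mu>). factor_count \<kappa> \<mu> \<sigma> * factor_count \<sigma> \<rho> \<nu>) =
    (\<Sum>\<sigma> \<in> partitions_of (\<Sum>\<^sub># \<mu> + \<Sum>\<^sub># \<rho>). factor_count \<mu> \<rho> \<sigma> * factor_count \<kappa> \<sigma> \<nu>)"
proof -
  obtain w where w: "permutation w" "mct w = \<nu>" using exists_permutation_of_type assms(1) by blast
  have nw: "nrm w = \<Sum>\<^sub># \<kappa> + \<Sum>\<^sub># \<mu> + \<Sum>\<^sub># \<rho>" using w assms by (simp add: nrm_def)
  define T where "T = {(a, b, c). permutation a \<and> permutation b \<and> permutation c \<and>
    mct a = \<kappa> \<and> mct b = \<mu> \<and> mct c = \<rho> \<and> a \<circ> b \<circ> c = w}"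
  have tri: "mct (a \<circ> b) \<in> partitions_of (\<Sum>\<^sub># \<kappa> + \<Sum>\<^sub># \<mu>) \<and> mct (b \<circ> c) \<in> partitions_of (\<Sum>\<^sub># \<mu> + \<Sum>\<^sub># \<rho>)"
    if "(a, b, c) \<in> T" for a b c
  proof -
    have p: "permutation a" "permutation b" "permutation c" "nrm a = \<Sum>\<^sub># \<kappa>" "nrm b = \<Sum>\<^sub># \<mu>" "nrm c = \<Sum>\<^sub># \<rho>"
      "(a \<circ> b) \<circ> c = w" "a \<circ> (b \<circ> c) = w"
      using that by (auto simp: T_def nrm_def comp_assoc)
    have pp: "permutation (a \<circ> b)" "permutation (b \<circ> c)" using p permutation_compose by blast+
    \<comment> \<open>Subadditivity for both bracketings leaves no slack, since the three norms add
      up to \<open>nrm w\<close>.\<close>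
    show ?thesis
      using nrm_comp_le[OF p(1,2)] nrm_comp_le[OF p(2,3)] nrm_comp_le[OF pp(1) p(3)] nrm_comp_le[OF p(1) pp(2)]
        p nw modified_cycle_type_Par[OF pp(1)] modified_cycle_type_Par[OF pp(2)]
      by (simp add: partitions_of_def nrm_def[symmetric])
  qed
  have fact: "finite (factorizations \<alpha> \<beta> q) \<and> card (factorizations \<alpha> \<beta> q) = factor_count \<alpha> \<beta> \<sigma>"
    if "permutation q" "mct q = \<sigma>" "\<Sum>\<^sub># \<sigma> = \<Sum>\<^sub># \<alpha> + \<Sum>\<^sub># \<beta>" for \<alpha> \<beta> \<sigma> q
    using that finite_factorizations(1)[of q \<alpha> \<beta>] card_factorizations[OF that] by (simp add: nrm_def)
  have L: "finite {(a, b, c) \<in> T. mct (a \<circ> b) = \<sigma>} \<and>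
      card {(a, b, c) \<in> T. mct (a \<circ> b) = \<sigma>} = factor_count \<kappa> \<mu> \<sigma> * factor_count \<sigma> \<rho> \<nu>"
    if "\<sigma> \<in> partitions_of (\<Sum>\<^sub># \<kappa> + \<Sum>\<^sub># \<mu>)" for \<sigma>
  proof -
    have \<sigma>: "\<Sum>\<^sub># \<sigma> = \<Sum>\<^sub># \<kappa> + \<Sum>\<^sub># \<mu>" using that by (simp add: partitions_of_def)
    have b: "bij_betw (\<lambda>(a, b, c). ((a \<circ> b, c), (a, b))) {(a, b, c) \<in> T. mct (a \<circ> b) = \<sigma>}
      (SIGMA x : factorizations \<sigma> \<rho> w. factorizations \<kappa> \<mu> (fst x))"
      by (rule bij_betw_byWitness[where f' = "\<lambda>((q, c), (a, b)). (a, b, c)"])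
         (auto simp: T_def factorizations_def permutation_compose)
    have k: "finite (factorizations \<kappa> \<mu> (fst x)) \<and> card (factorizations \<kappa> \<mu> (fst x)) = factor_count \<kappa> \<mu> \<sigma>"
      if "x \<in> factorizations \<sigma> \<rho> w" for x
      using that \<sigma> by (intro fact) (auto simp: factorizations_def)
    show ?thesis using card_fibred[OF b _ k] fact[OF w, of \<sigma> \<rho>] assms(2) \<sigma> by simp
  qed
  have R: "card {(a, b, c) \<in> T. mct (b \<circ> c) = \<sigma>} = factor_count \<mu> \<rho> \<sigma> * factor_count \<kappa> \<sigma> \<nu>"
    if "\<sigma> \<in> partitions_of (\<Sum>\<^sub># \<mu> + \<Sum>\<^sub># \<rho>)" for \<sigma>
  proof -
    have \<sigma>: "\<Sum>\<^sub># \<sigma> = \<Sum>\<^sub># \<mu> + \<Sum>\<^sub># \<rho>" using that by (simp add: partitions_of_def)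
    have b: "bij_betw (\<lambda>(a, b, c). ((a, b \<circ> c), (b, c))) {(a, b, c) \<in> T. mct (b \<circ> c) = \<sigma>}
      (SIGMA x : factorizations \<kappa> \<sigma> w. factorizations \<mu> \<rho> (snd x))"
      by (rule bij_betw_byWitness[where f' = "\<lambda>((a, q), (b, c)). (a, b, c)"])
         (auto simp: T_def factorizations_def permutation_compose comp_assoc)
    have k: "finite (factorizations \<mu> \<rho> (snd x)) \<and> card (factorizations \<mu> \<rho> (snd x)) = factor_count \<mu> \<rho> \<sigma>"
      if "x \<in> factorizations \<kappa> \<sigma> w" for x
      using that \<sigma> by (intro fact) (auto simp: factorizations_def)
    have deg: "\<Sum>\<^sub># \<nu> = \<Sum>\<^sub># \<kappa> + \<Sum>\<^sub># \<sigma>" using assms(2) \<sigma> by simp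
    show ?thesis using card_fibred[OF b _ k] fact[OF w, of \<kappa> \<sigma>] deg by simp
  qed
  have "T = (\<Union>\<sigma> \<in> partitions_of (\<Sum>\<^sub># \<kappa> + \<Sum>\<^sub># \<mu>). {(a, b, c) \<in> T. mct (a \<circ> b) = \<sigma>})"
    using tri by auto
  then have fin: "finite T" using L by (metis (no_types, lifting) finite_UN finite_partitions_of)
  have "card T = (\<Sum>\<sigma> \<in> partitions_of (\<Sum>\<^sub># \<kappa> + \<Sum>\<^sub># \<mu>). card {(a, b, c) \<in> T. mct (a \<circ> b) = \<sigma>})"
    using fin tri by (subst card_UN_disjoint[symmetric]) (auto intro!: arg_cong[of _ _ card] elim: finite_subset[rotated])
  moreover have "card T = (\<Sum>\<sigma> \<in> partitions_of (\<Sum>\<^sub># \<mu> + \<Sum>\<^sub># \<rho>). card {(a, b, c) \<in> T. mct (b \<circ> c) = \<sigma>})"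
    using fin tri by (subst card_UN_disjoint[symmetric]) (auto intro!: arg_cong[of _ _ card] elim: finite_subset[rotated])
  ultimately show ?thesis using L R by simp
qed

section \<open>The spin group as a group of invertible Clifford elements\<close>

section \<open>A Clifford algebra acting on functions of finite sets\<close>

text \<open>Linear operators on real functions of sets, with composition as product. In this
  concrete algebra 1 and -1 visibly differ, which is what separates the two lifts of a
  permutation.\<close>

typedef clifford = "{f :: (nat set \<Rightarrow> real) \<Rightarrow> nat set \<Rightarrow> real.
    (\<forall>x y. f (\<lambda>a. x a + y a) = (\<lambda>a. f x a + f y a)) \<and> (\<forall>c x. f (\<lambda>a. c * x a) = (\<lambda>a. c * f x a))}"
  morphisms act Abs_clifford
  by (intro exI[of _ "\<lambda>f. f"]) simp

setup_lifting type_definition_clifford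

instantiation clifford :: real_algebra_1
begin

lift_definition zero_clifford :: clifford is "\<lambda>x a. 0" by simp
lift_definition one_clifford :: clifford is "\<lambda>x. x" by simp
lift_definition plus_clifford :: "clifford \<Rightarrow> clifford \<Rightarrow> clifford" is "\<lambda>f g x a. f x a + g x a"
  by (auto simp: fun_eq_iff algebra_simps)
lift_definition uminus_clifford :: "clifford \<Rightarrow> clifford" is "\<lambda>f x a. - f x a"
  by (auto simp: fun_eq_iff algebra_simps)
lift_definition minus_clifford :: "clifford \<Rightarrow> clifford \<Rightarrow> clifford" is "\<lambda>f g x a. f x a - g x a"
  by (auto simp: fun_eq_iff algebra_simps)
lift_definition scaleR_clifford :: "real \<Rightarrow> clifford \<Rightarrow> clifford" is "\<lambda>r f x a. r * f x a"
  by (auto simp: fun_eq_iff algebra_simps)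
lift_definition times_clifford :: "clifford \<Rightarrow> clifford \<Rightarrow> clifford" is "\<lambda>f g x. f (g x)"
  by auto

instance
proof
  fix a b c :: clifford and r s :: real
  show "a + b + c = a + (b + c)" by transfer (simp add: add.assoc)
  show "a + b = b + a" by transfer (simp add: add.commute)
  show "0 + a = a" by transfer simp
  show "- a + a = 0" by transfer simp
  show "a - b = a + - b" by transfer simp
  show "r *\<^sub>R (a + b) = r *\<^sub>R a + r *\<^sub>R b" by transfer (simp add: algebra_simps)
  show "(r + s) *\<^sub>R a = r *\<^sub>R a + s *\<^sub>R a" by transfer (simp add: algebra_simps)
  show "r *\<^sub>R s *\<^sub>R a = (r * s) *\<^sub>R a" by transfer (simp add: algebra_simps)
  show "1 *\<^sub>R a = a" by transfer simp
  show "a * b * c = a * (b * c)" by transfer simp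
  show "(a + b) * c = a * c + b * c" by transfer simp
  show "a * (b + c) = a * b + a * c" by transfer simp
  show "r *\<^sub>R a * b = r *\<^sub>R (a * b)" by transfer simp
  show "a * r *\<^sub>R b = r *\<^sub>R (a * b)" by transfer simp
  show "1 * a = a" by transfer simp
  show "a * 1 = a" by transfer simp
  show "(0 :: clifford) \<noteq> 1"
  proof transfer
    show "(\<lambda>(x :: nat set \<Rightarrow> real) (a :: nat set). 0 :: real) \<noteq> (\<lambda>x. x)"
    proof
      assume "(\<lambda>(x :: nat set \<Rightarrow> real) (a :: nat set). 0 :: real) = (\<lambda>x. x)"
      then have "(\<lambda>(x :: nat set \<Rightarrow> real) (a :: nat set). 0 :: real) (\<lambda>_. 1) {} = (\<lambda>x. x) (\<lambda>_. 1) {}" by metis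
      then show False by simp
    qed
  qed
qed

end

lemma clifford_eq_uminus_iff: "(a :: clifford) = - a \<longleftrightarrow> a = 0"
proof
  assume "a = - a"
  then have "2 *\<^sub>R a = 0" by (metis add.right_inverse scaleR_2)
  then show "a = 0" by simp
qed simp

definition toggle :: "nat \<Rightarrow> nat set \<Rightarrow> nat set" where
  "toggle i A = (if i \<in> A then A - {i} else insert i A)"

text \<open>The Jordan-Wigner sign: toggling a smaller index flips it, so that different generators
  anticommute.\<close>

definition below_sign :: "nat \<Rightarrow> nat set \<Rightarrow> real" where
  "below_sign i A = (-1) ^ card {j \<in> A. j < i}"

text \<open>Toggling \<open>i\<close> twice meets both values of the membership sign, hence the
  square is -1.\<close>

lift_definition E :: "nat \<Rightarrow> clifford" is
  "\<lambda>i x A. below_sign i A * (if i \<in> A then 1 else -1) * x (toggle i A)"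
  by (auto simp: fun_eq_iff algebra_simps)

lemma below_sign_square [simp]: "below_sign i A * below_sign i A = 1"
  by (simp add: below_sign_def flip: power_add mult_2)

lemma below_sign_toggle: "i \<le> j \<Longrightarrow> below_sign i (toggle j A) = below_sign i A"
proof -
  assume "i \<le> j"
  then have "{k \<in> toggle j A. k < i} = {k \<in> A. k < i}" by (auto simp: toggle_def)
  then show ?thesis by (simp add: below_sign_def)
qed

lemma below_sign_toggle_less: "i < j \<Longrightarrow> below_sign j (toggle i A) = - below_sign j A"
proof -
  assume ij: "i < j"
  have fin: "finite {k \<in> A. k < j}" by simp
  show ?thesis
  proof (cases "i \<in> A")
    case True
    then have "{k \<in> A. k < j} = insert i {k \<in> toggle i A. k < j}" "i \<notin> {k \<in> toggle i A. k < j}"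
      using ij by (auto simp: toggle_def)
    then have "card {k \<in> A. k < j} = Suc (card {k \<in> toggle i A. k < j})"
      by (metis (no_types, lifting) card_insert_disjoint fin finite_insert)
    then show ?thesis by (simp add: below_sign_def)
  next
    case False
    then have "{k \<in> toggle i A. k < j} = insert i {k \<in> A. k < j}" "i \<notin> {k \<in> A. k < j}"
      using ij by (auto simp: toggle_def)
    then have "card {k \<in> toggle i A. k < j} = Suc (card {k \<in> A. k < j})" using fin by simp
    then show ?thesis by (simp add: below_sign_def)
  qed
qed

lemma E_square [simp]: "E i * E i = -1"
proof transfer
  fix i :: nat
  have t: "toggle i (toggle i A) = A" "i \<in> toggle i A \<longleftrightarrow> i \<notin> A" for A by (auto simp: toggle_def)
  have s: "below_sign i A * (below_sign i A * z) = z" for A z by (simp flip: mult.assoc)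
  show "(\<lambda>x A. below_sign i A * (if i \<in> A then 1 else - 1) *
        (below_sign i (toggle i A) * (if i \<in> toggle i A then 1 else - 1) * x (toggle i (toggle i A)))) =
        (\<lambda>x a. - x a)"
    by (auto simp: fun_eq_iff t s below_sign_toggle)
qed

lemma E_anticommute_less: "i < j \<Longrightarrow> E i * E j = - (E j * E i)"
proof (transfer)
  fix i j :: nat assume ij: "i < j"
  have t: "toggle i (toggle j A) = toggle j (toggle i A)" "i \<in> toggle j A \<longleftrightarrow> i \<in> A" "j \<in> toggle i A \<longleftrightarrow> j \<in> A" for A
    using ij by (auto simp: toggle_def)
  show "(\<lambda>x A. below_sign i A * (if i \<in> A then 1 else - 1) *
           (below_sign j (toggle i A) * (if j \<in> toggle i A then 1 else - 1) * x (toggle j (toggle i A)))) =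
        (\<lambda>x a. - (below_sign j a * (if j \<in> a then 1 else - 1) *
              (below_sign i (toggle j a) * (if i \<in> toggle j a then 1 else - 1) * x (toggle i (toggle j a)))))"
    using ij by (auto simp: fun_eq_iff t below_sign_toggle below_sign_toggle_less)
qed

lemma E_anticommute: "i \<noteq> j \<Longrightarrow> E i * E j = - (E j * E i)"
  using E_anticommute_less[of i j] E_anticommute_less[of j i] by (cases "i < j") auto

lemma E_eq_signed:
  assumes "E i = e *\<^sub>R E j" "e = 1 \<or> e = -1" shows "i = j"
proof (rule ccontr)
  assume "i \<noteq> j"
  then have "E i * E j = - (E j * E i)" by (rule E_anticommute)
  then have "e *\<^sub>R (1 :: clifford) = - (e *\<^sub>R 1)" unfolding assms(1) by simp
  then show False using assms(2) clifford_eq_uminus_iff[of 1] by auto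
qed

section \<open>Lifts of permutations\<close>

text \<open>A vector along the root e_i - e_b, whose reflection is the transposition of
  \<open>i\<close> and \<open>b\<close>. The factor normalizes its square to -1, the image of
  z.\<close>

definition root_vec :: "nat \<Rightarrow> nat \<Rightarrow> clifford" where
  "root_vec b i = sqrt (1/2) *\<^sub>R (E i - E b)"

text \<open>Conjugation by \<open>g\<close> permutes the generators by \<sigma> with one common sign
  \<open>e\<close>, which records the parity of \<open>g\<close>: it is -1 for a root vector and
  multiplicative.\<close>

definition lifts :: "clifford \<Rightarrow> (nat \<Rightarrow> nat) \<Rightarrow> real \<Rightarrow> bool" where
  "lifts g \<sigma> e \<longleftrightarrow> (\<exists>h. g * h = 1 \<and> h * g = 1) \<and> bij \<sigma> \<and> (e = 1 \<or> e = -1) \<and>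
     (\<forall>i. g * E i = e *\<^sub>R (E (\<sigma> i) * g))"

lemma root_vec_square: "i \<noteq> b \<Longrightarrow> root_vec b i * root_vec b i = -1"
proof -
  assume "i \<noteq> b"
  then have "(E i - E b) * (E i - E b) = - 2 *\<^sub>R (1 :: clifford)"
    using E_anticommute[of i b] by (simp add: algebra_simps scaleR_2)
  moreover have "sqrt (1/2) * (sqrt (1/2) * 2) = (1::real)" by (simp flip: mult.assoc)
  ultimately show ?thesis by (simp add: root_vec_def)
qed

lemma root_vec_E:
  assumes "i \<noteq> b"
  shows "root_vec b i * E k = - (E (transpose i b k) * root_vec b i)"
proof -
  consider "k = i" | "k = b" | "k \<noteq> i" "k \<noteq> b" by blast
  then have "(E i - E b) * E k = - (E (transpose i b k) * (E i - E b))"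
    using assms E_anticommute[of k i] E_anticommute[of k b]
    by cases (simp_all add: algebra_simps)
  then show ?thesis by (simp add: root_vec_def)
qed

lemma lifts_root_vec: "i \<noteq> b \<Longrightarrow> lifts (root_vec b i) (transpose i b) (-1)"
  unfolding lifts_def using root_vec_square[of i b] root_vec_E[of i b]
  by (auto intro!: exI[of _ "- root_vec b i"])

lemma lifts_one: "lifts 1 id 1"
  by (auto simp: lifts_def)

lemma lifts_uminus: "lifts g \<sigma> e \<Longrightarrow> lifts (- g) \<sigma> e"
  unfolding lifts_def by (auto intro: exI[of _ "- h" for h])

lemma lifts_mult:
  assumes "lifts g \<sigma> e" "lifts h \<tau> d" shows "lifts (g * h) (\<sigma> \<circ> \<tau>) (e * d)"
proof -
  obtain g' h' where "g * g' = 1" "g' * g = 1" "h * h' = 1" "h' * h = 1" using assms by (auto simp: lifts_def)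
  then have "g * h * (h' * g') = 1 \<and> h' * g' * (g * h) = 1"
    by (metis mult.assoc mult.right_neutral)
  moreover have "g * h * E i = (e * d) *\<^sub>R (E ((\<sigma> \<circ> \<tau>) i) * (g * h))" for i
  proof -
    have "g * h * E i = d *\<^sub>R (g * E (\<tau> i) * h)" using assms(2) by (simp add: lifts_def mult.assoc)
    also have "\<dots> = (e * d) *\<^sub>R (E ((\<sigma> \<circ> \<tau>) i) * (g * h))" using assms(1) by (simp add: lifts_def mult.assoc)
    finally show ?thesis .
  qed
  ultimately show ?thesis using assms unfolding lifts_def by (auto intro: bij_comp)
qed

lemma lifts_unique:
  assumes "lifts g \<sigma> e" "lifts g \<tau> d" shows "\<sigma> = \<tau>"
proof
  fix i
  obtain h where h: "g * h = 1" using assms by (auto simp: lifts_def)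
  have "g * E i = e *\<^sub>R (E (\<sigma> i) * g)" "g * E i = d *\<^sub>R (E (\<tau> i) * g)" using assms by (simp_all add: lifts_def)
  then have "e *\<^sub>R (E (\<sigma> i) * g) * h = d *\<^sub>R (E (\<tau> i) * g) * h" by simp
  then have "e *\<^sub>R E (\<sigma> i) = d *\<^sub>R E (\<tau> i)" using h by (simp add: mult.assoc)
  then have "(e * e) *\<^sub>R E (\<sigma> i) = (e * d) *\<^sub>R E (\<tau> i)" by (metis scaleR_scaleR)
  moreover have "e * e = 1" "e * d = 1 \<or> e * d = -1" using assms by (auto simp: lifts_def)
  ultimately show "\<sigma> i = \<tau> i" using E_eq_signed[of "\<sigma> i" "e * d" "\<tau> i"] by simp
qed

lemma lifts_neq_uminus: "lifts g \<sigma> e \<Longrightarrow> g \<noteq> - g"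
  unfolding clifford_eq_uminus_iff by (auto simp: lifts_def)

lemma lifts_cancel:
  assumes "lifts g \<sigma> e" shows "g * x = g * y \<longleftrightarrow> x = y" "x * g = y * g \<longleftrightarrow> x = y"
proof -
  obtain h where h: "g * h = 1" "h * g = 1" using assms by (auto simp: lifts_def)
  then show "g * x = g * y \<longleftrightarrow> x = y" by (metis mult.assoc mult_1_left)
  show "x * g = y * g \<longleftrightarrow> x = y" using h by (metis mult.assoc mult_1_right)
qed

lemma lifts_sign_unique:
  assumes "lifts g \<sigma> e" "lifts g \<tau> d" shows "e = d"
proof -
  have st: "\<sigma> = \<tau>" using assms by (rule lifts_unique)
  have "e *\<^sub>R (E (\<sigma> 0) * g) = d *\<^sub>R (E (\<sigma> 0) * g)" using assms st unfolding lifts_def by metis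
  moreover have "E (\<sigma> 0) * g \<noteq> 0"
  proof
    assume "E (\<sigma> 0) * g = 0"
    then have "E (\<sigma> 0) * (E (\<sigma> 0) * g) = 0" by simp
    then have "g = 0" by (simp flip: mult.assoc)
    then show False using assms(1) by (auto simp: lifts_def)
  qed
  ultimately show ?thesis by simp
qed

lemma lifts_exists: "permutation \<sigma> \<Longrightarrow> \<exists>g e. lifts g \<sigma> e"
proof -
  assume "permutation \<sigma>"
  then obtain n where "swapidseq n \<sigma>" by (auto simp: permutation_def)
  then show ?thesis
  proof induction
    case id
    then show ?case using lifts_one by (metis id_def)
  next
    case (comp_Suc n p a b)
    then obtain g e where "lifts g p e" by blast
    then have "lifts (root_vec b a * g) (transpose a b \<circ> p) (-1 * e)"
      using lifts_mult[OF lifts_root_vec] comp_Suc by blast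
    then show ?case by blast
  qed
qed

text \<open>The sign computations with cycles rest on this rule: a lift moves the indices of a root
  vector as its permutation does, at the cost of one \<open>e\<close> per vector.\<close>

lemma lifts_root_vec_conj:
  assumes "lifts g \<sigma> e" shows "g * root_vec b i = e *\<^sub>R (root_vec (\<sigma> b) (\<sigma> i) * g)"
proof -
  have "g * (E i - E b) = e *\<^sub>R ((E (\<sigma> i) - E (\<sigma> b)) * g)"
    using assms by (simp add: lifts_def right_diff_distrib left_diff_distrib scaleR_right_diff_distrib)
  then show ?thesis by (simp add: root_vec_def mult.assoc)
qed

lemma lifts_prod_list_conj:
  assumes "lifts g \<sigma> e"
  shows "g * prod_list (map (root_vec b) L) =
    e ^ length L *\<^sub>R (prod_list (map (root_vec (\<sigma> b)) (map \<sigma> L)) * g)"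
proof (induction L)
  case (Cons i L)
  have "g * prod_list (map (root_vec b) (i # L)) = e *\<^sub>R (root_vec (\<sigma> b) (\<sigma> i) * (g * prod_list (map (root_vec b) L)))"
    using lifts_root_vec_conj[OF assms, of b i] by (simp add: mult.assoc[symmetric])
  then show ?case by (simp add: Cons.IH mult.assoc)
qed simp

section \<open>Lifts of cycles\<close>

text \<open>Up to the sign, which makes \<^term>\<open>cycle_lift b [i] = 1\<close>, this is the paper's \<open>[i\<^sub>1, \<dots>, i\<^sub>m]\<close> with
  \<open>root_vec b i\<close> in the role of \<open>x\<^sub>i\<close>, where \<open>b = n + 1\<close>.  With this sign the canonical lifts of two factors
  of a minimal product multiply to the canonical lift of the product.\<close>

definition cycle_lift :: "nat \<Rightarrow> nat list \<Rightarrow> clifford" where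
  "cycle_lift b c = - prod_list (map (root_vec b) (hd c # rev c))"

definition cycles_lift :: "nat \<Rightarrow> nat list list \<Rightarrow> clifford" where
  "cycles_lift b cs = prod_list (map (cycle_lift b) cs)"

lemma cycle_lift_single: "i \<noteq> b \<Longrightarrow> cycle_lift b [i] = 1"
  by (simp add: cycle_lift_def root_vec_square)

text \<open>The two copies of \<open>root_vec b i\<close> that meet in the middle multiply to -1,
  which the minus sign in \<open>cycle_lift\<close> absorbs. On permutations this is the merge of
  two cycles through their common entry \<open>i\<close>.\<close>

lemma cycle_lift_splice:
  assumes "i \<noteq> b"
  shows "cycle_lift b (i # A @ B) = cycle_lift b (i # B) * cycle_lift b (i # A)"
proof -
  let ?y = "root_vec b i" and ?R = "\<lambda>A. prod_list (map (root_vec b) (rev A))"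
  have "cycle_lift b (i # B) * cycle_lift b (i # A) = ?y * ?R B * (?y * ?y) * ?R A * ?y"
    by (simp add: cycle_lift_def mult.assoc)
  also have "\<dots> = cycle_lift b (i # A @ B)"
    unfolding root_vec_square[OF assms] by (simp add: cycle_lift_def mult.assoc)
  finally show ?thesis by simp
qed

text \<open>Conjugating the transposition of \<open>j\<close> and \<open>b\<close> by that of
  \<open>i\<close> and \<open>b\<close> gives the transposition of \<open>i\<close> and
  \<open>j\<close>, so the auxiliary \<open>b\<close> disappears. The exponent is the number of root
  vectors in the product.\<close>

lemma lifts_cycle_lift:
  assumes "distinct c" "b \<notin> set c" "c \<noteq> []"
  shows "lifts (cycle_lift b c) (cycle_of_list c) ((-1) ^ (length c + 1))"
proof -
  obtain i A where c: "c = i # A" using assms by (cases c) auto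
  have "distinct (i # A) \<and> b \<notin> set (i # A) \<Longrightarrow>
      lifts (cycle_lift b (i # A)) (cycle_of_list (i # A)) ((-1) ^ (length (i # A) + 1))"
  proof (induction A rule: rev_induct)
    case Nil
    then show ?case using lifts_one by (simp add: cycle_lift_single id_def)
  next
    case (snoc j A)
    have ne: "i \<noteq> b" "j \<noteq> b" "i \<noteq> j" using snoc.prems by auto
    have "lifts (- (root_vec b i * root_vec b j * root_vec b i)) (transpose i b \<circ> transpose j b \<circ> transpose i b) (-1 * -1 * -1)"
      by (intro lifts_uminus lifts_mult lifts_root_vec ne)
    moreover have "transpose i b \<circ> transpose j b \<circ> transpose i b = transpose i j"
      using ne by (auto simp: fun_eq_iff transpose_def)
    ultimately have "lifts (cycle_lift b [i, j]) (transpose i j) (-1)"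
      by (simp add: cycle_lift_def mult.assoc)
    then have "lifts (cycle_lift b [i, j] * cycle_lift b (i # A)) (transpose i j \<circ> cycle_of_list (i # A))
        (-1 * (-1) ^ (length (i # A) + 1))"
      using snoc by (intro lifts_mult) auto
    then show ?case
      using cycle_lift_splice[OF ne(1), of A "[j]"] cycle_of_list_snoc[of i A j] snoc.prems by (simp add: comp_def)
  qed
  then show ?thesis using assms c by blast
qed

lemma cycle_lift_conj:
  assumes "lifts g \<sigma> e" "\<sigma> b = b" "c \<noteq> []"
  shows "g * cycle_lift b c = e ^ (length c + 1) *\<^sub>R (cycle_lift b (map \<sigma> c) * g)"
  using lifts_prod_list_conj[OF assms(1), of b "hd c # rev c"] assms(2,3)
  by (simp add: cycle_lift_def hd_map rev_map)

lemma cycle_of_list_fixes: "b \<notin> set c \<Longrightarrow> cycle_of_list c b = b"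
  by (rule id_outside_supp)

text \<open>Conjugating the lift of a cycle by itself changes nothing, yet it rotates the entries.
  The sign is trivial exactly for odd length, which is why canonical lifts are restricted to such
  cycles.\<close>

lemma cycle_lift_rotate1:
  assumes "distinct c" "b \<notin> set c" "c \<noteq> []"
  shows "cycle_lift b (rotate1 c) = (-1) ^ (length c + 1) *\<^sub>R cycle_lift b c"
proof -
  let ?e = "(-1 :: real) ^ (length c + 1)"
  have l: "lifts (cycle_lift b c) (cycle_of_list c) ?e" by (rule lifts_cycle_lift[OF assms])
  have "cycle_lift b c * cycle_lift b c = ?e ^ (length c + 1) *\<^sub>R (cycle_lift b (rotate1 c) * cycle_lift b c)"
    using cycle_lift_conj[OF l cycle_of_list_fixes[OF assms(2)] assms(3)] map_cycle_of_list[OF assms(1)] by simp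
  then have "cycle_lift b c = ?e ^ (length c + 1) *\<^sub>R cycle_lift b (rotate1 c)"
    using lifts_cancel(2)[OF l] by (metis mult_scaleR_left)
  moreover have "?e ^ (length c + 1) = ?e" by (cases "even (length c)") simp_all
  ultimately have "?e *\<^sub>R cycle_lift b c = (?e * ?e) *\<^sub>R cycle_lift b (rotate1 c)" by (metis scaleR_scaleR)
  moreover have "?e * ?e = 1" by (simp flip: power_mult_distrib)
  ultimately show ?thesis by simp
qed

lemma cycle_lift_rotate:
  assumes "distinct c" "b \<notin> set c" "odd (length c)"
  shows "cycle_lift b (rotate k c) = cycle_lift b c"
proof (induction k)
  case (Suc k)
  have "cycle_lift b (rotate1 (rotate k c)) = cycle_lift b (rotate k c)"
    using assms by (subst cycle_lift_rotate1) auto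
  then show ?case using Suc by simp
qed simp

text \<open>Lifts of odd cycles have parity 1, and conjugation by one of them leaves the entries of
  a disjoint cycle in place.\<close>

lemma cycles_lift_commute:
  assumes "distinct (concat (c # cs))" "b \<notin> set (concat (c # cs))" "[] \<notin> set (c # cs)"
    "\<forall>d \<in> set (c # cs). odd (length d)"
  shows "cycles_lift b cs * cycle_lift b c = cycle_lift b c * cycles_lift b cs"
  using assms
proof (induction cs)
  case (Cons d cs)
  have "lifts (cycle_lift b d) (cycle_of_list d) ((-1) ^ (length d + 1))"
    using Cons.prems by (intro lifts_cycle_lift) auto
  moreover have "map (cycle_of_list d) c = c"
    using Cons.prems by (intro map_idI id_outside_supp) auto
  ultimately have "cycle_lift b d * cycle_lift b c = ((-1) ^ (length d + 1)) ^ (length c + 1) *\<^sub>R (cycle_lift b c * cycle_lift b d)"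
    using cycle_lift_conj[of "cycle_lift b d" "cycle_of_list d" _ b c] Cons.prems cycle_of_list_fixes[of b d] by auto
  then have dc: "cycle_lift b d * cycle_lift b c = cycle_lift b c * cycle_lift b d" using Cons.prems by simp
  have "cycles_lift b (d # cs) * cycle_lift b c = cycle_lift b d * (cycle_lift b c * cycles_lift b cs)"
  proof -
    have "cycles_lift b cs * cycle_lift b c = cycle_lift b c * cycles_lift b cs"
      by (rule Cons.IH) (use Cons.prems in auto)
    then show ?thesis by (simp add: cycles_lift_def mult.assoc)
  qed
  then show ?case using dc by (simp add: cycles_lift_def mult.assoc[symmetric])
qed (simp add: cycles_lift_def)

text \<open>The list \<open>vs\<close> collects heads whose tails have already been split off.
  Rotation brings the last remaining head to the front, \<open>cycle_lift_splice\<close> cuts off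
  its tail, and rotation restores the order; both rotations are free of signs because the words have
  odd length.\<close>

lemma cycle_lift_merge:
  assumes "distinct (concat (map (\<lambda>(x, A). x # A) ps) @ vs)" "b \<notin> set (concat (map (\<lambda>(x, A). x # A) ps) @ vs)"
    "\<forall>(x, A) \<in> set ps. even (length A)" "odd (length ps + length vs)"
  shows "cycle_lift b (concat (map (\<lambda>(x, A). x # A) ps) @ vs) =
    cycle_lift b (map fst ps @ vs) * cycles_lift b (map (\<lambda>(x, A). x # A) ps)"
  using assms
proof (induction ps arbitrary: vs rule: rev_induct)
  case Nil
  then show ?case by (simp add: cycles_lift_def)
next
  case (snoc p ps)
  obtain x A where p: "p = (x, A)" by (cases p) auto
  let ?M = "concat (map (\<lambda>(x, A). x # A) ps)"
  have d: "distinct (?M @ x # A @ vs)" "b \<notin> set (?M @ x # A @ vs)" using snoc.prems p by simp_all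
  have lenM: "even (length ?M) \<longleftrightarrow> even (length ps)"
    using snoc.prems(3) by (induction ps) auto
  have odd: "odd (length (?M @ x # vs))" "odd (length (?M @ x # A @ vs))"
    using snoc.prems(3,4) lenM p by auto
  have IH: "cycle_lift b (?M @ x # vs) = cycle_lift b (map fst ps @ x # vs) * cycles_lift b (map (\<lambda>(x, A). x # A) ps)"
  proof (rule snoc.IH)
    show "distinct (?M @ x # vs)" "b \<notin> set (?M @ x # vs)"
      using d unfolding distinct_append set_append by (simp_all del: set_concat) blast+
  qed (use snoc.prems in auto)
  have "cycle_lift b (?M @ x # A @ vs) = cycle_lift b (rotate (length ?M) (?M @ x # A @ vs))"
    using cycle_lift_rotate[OF d odd(2)] by simp
  also have "\<dots> = cycle_lift b (x # A @ vs @ ?M)" by (simp add: rotate_append)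
  also have "\<dots> = cycle_lift b (x # vs @ ?M) * cycle_lift b (x # A)"
    using cycle_lift_splice[of x b A "vs @ ?M"] d by auto
  also have "cycle_lift b (x # vs @ ?M) = cycle_lift b (rotate (length ?M) (?M @ x # vs))"
    by (simp add: rotate_append)
  also have "\<dots> = cycle_lift b (?M @ x # vs)"
  proof (rule cycle_lift_rotate[OF _ _ odd(1)])
    show "distinct (?M @ x # vs)" "b \<notin> set (?M @ x # vs)"
      using d unfolding distinct_append set_append by (simp_all del: set_concat) blast+
  qed
  finally show ?case using IH p by (simp add: cycles_lift_def mult.assoc)
qed

lemma lifts_cycles_lift:
  assumes "disjoint_cycles p cs" "\<forall>c \<in> set cs. odd (length c)" "b \<notin> set (concat cs)"
  shows "lifts (cycles_lift b cs) p 1"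
  using assms
proof (induction cs arbitrary: p)
  case Nil
  then have "p = id" by (simp only: disjoint_cycles_Nil_iff)
  then show ?case using lifts_one by (simp add: cycles_lift_def id_def)
next
  case (Cons c cs)
  obtain q where q: "disjoint_cycles q cs" "p = cycle_of_list c \<circ> q" "distinct c" "c \<noteq> []"
    using disjoint_cycles_ConsE[OF Cons.prems(1)] by metis
  have "lifts (cycle_lift b c) (cycle_of_list c) ((-1) ^ (length c + 1))"
    using q Cons.prems by (intro lifts_cycle_lift) auto
  moreover have "lifts (cycles_lift b cs) q 1" using Cons q by auto
  ultimately have "lifts (cycle_lift b c * cycles_lift b cs) p ((-1) ^ (length c + 1) * 1)"
    unfolding q(2) by (rule lifts_mult)
  then show ?case using Cons.prems by (simp add: cycles_lift_def)
qed

lemma cycle_from_point_unique: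
  assumes "map p (x # A) = A @ [x]" "map p (x # B) = B @ [x]" "distinct (x # A)" "distinct (x # B)"
  shows "A = B"
proof -
  have *: "length B \<le> length A" if "map p (x # A) = A @ [x]" "map p (x # B) = B @ [x]" "distinct (x # A)" "distinct (x # B)" for A B
  proof -
    have "set (x # A) = orbit p x" "set (x # B) = orbit p x"
      using disjoint_cycles_orbit[of p "x # A" x] disjoint_cycles_orbit[of p "x # B" x] that by simp_all
    then show ?thesis using that(3,4) distinct_card by (metis Suc_le_mono length_Cons order_refl)
  qed
  have len: "length A = length B" using *[of A B] *[of B A] assms by (simp add: antisym)
  have "(A @ [x]) ! i = (B @ [x]) ! i" if "i \<le> length A" for i
    using that
  proof (induction i)
    case 0
    then show ?case using assms(1,2) by (metis length_greater_0_conv list.discI list.simps(9) nth_Cons_0)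
  next
    case (Suc i)
    have "(A @ [x]) ! Suc i = p ((x # A) ! Suc i)" using assms(1) Suc.prems nth_map[of "Suc i" "x # A" p] by simp
    moreover have "(B @ [x]) ! Suc i = p ((x # B) ! Suc i)" using assms(2) Suc.prems len nth_map[of "Suc i" "x # B" p] by simp
    moreover have "(x # A) ! Suc i = (A @ [x]) ! i" "(x # B) ! Suc i = (B @ [x]) ! i"
      using Suc.prems len by (simp_all add: nth_append)
    ultimately show ?case using Suc by simp
  qed
  then have "A @ [x] = B @ [x]" using len by (intro nth_equalityI) auto
  then show ?thesis by simp
qed

lemma disjoint_cycles_remove:
  assumes "disjoint_cycles p (c # cs)"
  shows "disjoint_cycles (\<lambda>y. if y \<in> set c then y else p y) cs"
proof -
  have *: "y \<notin> set c" if "d \<in> set cs" "y \<in> set d" for d y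
    using assms that by (auto simp: disjoint_cycles_def)
  have "map (\<lambda>y. if y \<in> set c then y else p y) d = rotate1 d" if "d \<in> set cs" for d
  proof -
    have "map (\<lambda>y. if y \<in> set c then y else p y) d = map p d" using * that by (intro map_cong) auto
    moreover have "map p d = rotate1 d" using assms that by (simp add: disjoint_cycles_def)
    ultimately show ?thesis by simp
  qed
  then show ?thesis using assms unfolding disjoint_cycles_def by auto
qed

text \<open>Order, starting points and one-element cycles do not matter: odd cycles commute and
  rotate without sign, and one-element cycles lift to 1.\<close>

lemma cycles_lift_unique:
  assumes "disjoint_cycles p cs" "disjoint_cycles p ds" "\<forall>c \<in> set cs. odd (length c)" "\<forall>c \<in> set ds. odd (length c)"
    "b \<notin> set (concat cs)" "b \<notin> set (concat ds)"
  shows "cycles_lift b cs = cycles_lift b ds"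
  using assms
proof (induction cs arbitrary: p ds)
  case Nil
  have "cycles_lift b ds = 1"
    using Nil.prems(2,6)
  proof (induction ds)
    case (Cons d ds)
    have p: "p = id" using Nil.prems(1) by (simp add: disjoint_cycles_Nil_iff)
    obtain x where "d = [x]"
      using Cons.prems(1) disjoint_cycles_fixed[OF Cons.prems(1), of d] p
      by (metis disjoint_cycles_def id_apply list.set_intros(1) neq_Nil_conv)
    moreover have "disjoint_cycles p ds"
      using disjoint_cycles_remove[OF Cons.prems(1)] p by (simp add: id_def cong: if_cong)
    ultimately show ?case using Cons by (simp add: cycles_lift_def cycle_lift_single)
  qed (simp add: cycles_lift_def)
  then show ?case by (simp add: cycles_lift_def)
next
  case (Cons c cs)
  obtain x A where c: "c = x # A" using Cons.prems(1) by (cases c) (auto simp: disjoint_cycles_def)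
  let ?q = "\<lambda>y. if y \<in> set c then y else p y"
  have q: "disjoint_cycles ?q cs" by (rule disjoint_cycles_remove[OF Cons.prems(1)])
  have mapc: "map p (x # A) = A @ [x]" "distinct (x # A)" using Cons.prems(1) c by (auto simp: disjoint_cycles_def)
  have xb: "x \<noteq> b" using Cons.prems(5) c by auto
  show ?case
  proof (cases "x \<in> set (concat ds)")
    case True
    obtain as d bs k B where d: "ds = as @ d # bs" "rotate k d = x # B" "disjoint_cycles p ((x # B) # as @ bs)" "set (x # B) = set d"
      using disjoint_cycles_to_front[OF Cons.prems(2) True] by metis
    have "A = B"
      using cycle_from_point_unique[of p x A B] mapc d(3) by (auto simp: disjoint_cycles_def)
    then have "disjoint_cycles ?q (as @ bs)" using disjoint_cycles_remove[OF d(3)] c by simp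
    then have IH: "cycles_lift b cs = cycles_lift b (as @ bs)"
      using Cons.prems(3-6) d(1) by (intro Cons.IH[OF q]) auto
    have dist: "distinct (concat ds)" "[] \<notin> set ds" using Cons.prems(2) by (auto simp: disjoint_cycles_def)
    have "cycles_lift b as * cycle_lift b d = cycle_lift b d * cycles_lift b as"
      by (rule cycles_lift_commute) (use dist Cons.prems(4,6) d(1) in auto)
    moreover have "cycle_lift b d = cycle_lift b (x # B)"
      using cycle_lift_rotate[of d b k] d dist Cons.prems(4,6) by auto
    ultimately have "cycles_lift b ds = cycle_lift b c * cycles_lift b (as @ bs)"
      using d(1) c \<open>A = B\<close> by (simp add: cycles_lift_def mult.assoc[symmetric])
    then show ?thesis using IH by (simp add: cycles_lift_def)
  next
    case False
    then have "p x = x" using Cons.prems(2) unfolding disjoint_cycles_def by blast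
    then have "c = [x]" using disjoint_cycles_fixed[OF Cons.prems(1), of c x] c by simp
    then have "?q = p" using \<open>p x = x\<close> by auto
    then show ?thesis using Cons.IH[of p ds] q Cons.prems \<open>c = [x]\<close> xb by (simp add: cycles_lift_def cycle_lift_single)
  qed
qed

text \<open>A relation, since only permutations that fix \<open>b\<close> and have all cycles odd
  possess such a lift.\<close>

definition canonical_lift :: "nat \<Rightarrow> (nat \<Rightarrow> nat) \<Rightarrow> clifford \<Rightarrow> bool" where
  "canonical_lift b p g \<longleftrightarrow> (\<exists>cs. disjoint_cycles p cs \<and> (\<forall>c \<in> set cs. odd (length c)) \<and>
     b \<notin> set (concat cs) \<and> g = cycles_lift b cs)"

lemma canonical_lift_unique: "canonical_lift b p g \<Longrightarrow> canonical_lift b p h \<Longrightarrow> g = h"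
  unfolding canonical_lift_def using cycles_lift_unique by blast

lemma canonical_lift_lifts: "canonical_lift b p g \<Longrightarrow> lifts g p 1"
  unfolding canonical_lift_def using lifts_cycles_lift by blast

lemma canonical_lift_fixes: "canonical_lift b p g \<Longrightarrow> p b = b"
  unfolding canonical_lift_def disjoint_cycles_def by blast

text \<open>Along \<open>minimal_product_induct\<close> every step glues an odd number of odd
  cycles, and there \<open>cycle_lift_merge\<close> has no sign.\<close>

lemma canonical_lift_minimal:
  assumes g: "canonical_lift b u g" and h: "canonical_lift b v h" and nrm: "nrm (u \<circ> v) = nrm u + nrm v"
  shows "canonical_lift b (u \<circ> v) (g * h)"
proof -
  obtain cs where cs: "disjoint_cycles u cs" "\<forall>c \<in> set cs. odd (length c)" "b \<notin> set (concat cs)" "g = cycles_lift b cs"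
    using g unfolding canonical_lift_def by blast
  have v: "permutation v" using h disjoint_cycles_permutation unfolding canonical_lift_def by blast
  have "(\<forall>c \<in> set cs. odd (length c)) \<longrightarrow> b \<notin> set (concat cs) \<longrightarrow> canonical_lift b (u \<circ> v) (cycles_lift b cs * h)"
  proof (rule minimal_product_induct[where Q = "\<lambda>cs q. (\<forall>c \<in> set cs. odd (length c)) \<longrightarrow> b \<notin> set (concat cs) \<longrightarrow>
      canonical_lift b q (cycles_lift b cs * h)", OF cs(1) v nrm])
    show "(\<forall>c\<in>set []. odd (length c)) \<longrightarrow> b \<notin> set (concat []) \<longrightarrow> canonical_lift b v (cycles_lift b [] * h)"
      using h by (simp add: cycles_lift_def)
  next
    fix q :: "nat \<Rightarrow> nat" and xs As rest and cs :: "nat list list"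
    assume Q: "(\<forall>c \<in> set cs. odd (length c)) \<longrightarrow> b \<notin> set (concat cs) \<longrightarrow> canonical_lift b q (cycles_lift b cs * h)"
      and len: "length As = length xs" and ne: "xs \<noteq> []"
      and dc: "disjoint_cycles q (map2 (#) xs As @ rest)"
      and rest: "set (concat rest) \<subseteq> {x. q x \<noteq> x} \<union> set xs"
    show "(\<forall>c \<in> set (xs # cs). odd (length c)) \<longrightarrow> b \<notin> set (concat (xs # cs)) \<longrightarrow>
      canonical_lift b (cycle_of_list xs \<circ> q) (cycles_lift b (xs # cs) * h)"
    proof (intro impI)
      assume odd: "\<forall>c \<in> set (xs # cs). odd (length c)" and b: "b \<notin> set (concat (xs # cs))"
      have cl: "canonical_lift b q (cycles_lift b cs * h)" using Q odd b by simp
      then have qb: "q b = b" by (rule canonical_lift_fixes)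
      obtain es where es: "disjoint_cycles q es" "\<forall>c \<in> set es. odd (length c)" using cl unfolding canonical_lift_def by blast
      then have allodd: "\<forall>c \<in> set (map2 (#) xs As @ rest). odd (length c)"
        using EPar_iff_odd[OF es(1)] EPar_iff_odd[OF dc] by blast
      \<comment> \<open>Since \<open>q\<close> fixes \<open>b\<close>, it could occur only as a
        one-element cycle and would then be an entry of \<open>xs\<close>.\<close>
      have bM: "b \<notin> set (concat (map2 (#) xs As))"
      proof
        assume "b \<in> set (concat (map2 (#) xs As))"
        then obtain x A where xA: "(x, A) \<in> set (zip xs As)" "b \<in> set (x # A)" by auto
        then have "x # A \<in> set (map2 (#) xs As @ rest)" by force
        then have "x # A = [b]" using disjoint_cycles_fixed[OF dc _ xA(2) qb] by blast
        then show False using b xA(1) by (auto dest: set_zip_leftD)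
      qed
      have bR: "b \<notin> set (concat rest)" using rest qb b by auto
      have dist: "distinct (concat (map2 (#) xs As))" using dc by (simp add: disjoint_cycles_def)
      have "canonical_lift b q (cycles_lift b (map2 (#) xs As @ rest))"
        unfolding canonical_lift_def
        using dc allodd bM bR by (intro exI[of _ "map2 (#) xs As @ rest"] conjI) (simp_all del: set_concat)
      then have eq: "cycles_lift b cs * h = cycles_lift b (map2 (#) xs As) * cycles_lift b rest"
        using canonical_lift_unique[OF cl] by (simp add: cycles_lift_def)
      have M: "cycle_lift b xs * cycles_lift b (map2 (#) xs As) = cycle_lift b (concat (map2 (#) xs As))"
      proof -
        have "\<forall>(x, A) \<in> set (zip xs As). even (length A)"
        proof clarify
          fix x A assume "(x, A) \<in> set (zip xs As)"
          then have "x # A \<in> set (map2 (#) xs As @ rest)" by force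
          then show "even (length A)" using allodd by fastforce
        qed
        moreover have "odd (length (zip xs As) + length ([] :: nat list))" using odd len by simp
        ultimately have "cycle_lift b (concat (map2 (#) xs As) @ []) =
            cycle_lift b (map fst (zip xs As) @ []) * cycles_lift b (map2 (#) xs As)"
          using cycle_lift_merge[of "zip xs As" "[]" b] dist bM by (metis append_Nil2)
        then show ?thesis using len by simp
      qed
      have "cycles_lift b (xs # cs) * h = cycle_lift b xs * (cycles_lift b cs * h)"
        by (simp add: cycles_lift_def mult.assoc)
      also have "\<dots> = cycle_lift b xs * cycles_lift b (map2 (#) xs As) * cycles_lift b rest"
        unfolding eq by (simp only: mult.assoc)
      also have "\<dots> = cycles_lift b (concat (map2 (#) xs As) # rest)"
        unfolding M by (simp add: cycles_lift_def)
      finally have "cycles_lift b (xs # cs) * h = cycles_lift b (concat (map2 (#) xs As) # rest)" .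
      moreover have "odd (length (concat (map2 (#) xs As)))"
        using odd_length_concat[of "map2 (#) xs As"] allodd odd len by (simp only: set_append) auto
      ultimately show "canonical_lift b (cycle_of_list xs \<circ> q) (cycles_lift b (xs # cs) * h)"
        unfolding canonical_lift_def
        using disjoint_cycles_merge[OF dc len ne] allodd bM bR
        by (intro exI[of _ "concat (map2 (#) xs As) # rest"]) auto
    qed
  qed
  then show ?thesis using cs by blast
qed

lemma canonical_lift_exists:
  assumes "permutation p" "mct p \<in> EPar" "p b = b"
  shows "\<exists>g. canonical_lift b p g"
proof -
  obtain cs where cs: "disjoint_cycles p cs" "set (concat cs) = {x. p x \<noteq> x}"
    using disjoint_cycles_sorted[OF assms(1)] by blast
  then have "b \<notin> set (concat cs)" using assms(3) by simp
  then show ?thesis unfolding canonical_lift_def using cs(1) EPar_iff_odd[OF cs(1)] assms(2) by blast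
qed

text \<open>Conjugation by \<open>g\<close> rotates an even cycle of \<open>p\<close> by one place,
  which costs the sign -1. So \<open>g\<close> is conjugate to \<open>- g\<close>, and the type of
  \<open>p\<close> cannot contribute once z becomes -1.\<close>

lemma even_cycle_anticommute:
  assumes "lifts g p 1" "p b = b" "permutation p" "mct p \<notin> EPar"
  shows "\<exists>h \<sigma> e. lifts h \<sigma> e \<and> \<sigma> b = b \<and> (\<forall>x. p x = x \<longrightarrow> \<sigma> x = x) \<and> g * h = - (h * g)"
proof -
  obtain cs where cs: "disjoint_cycles p cs" "set (concat cs) = {x. p x \<noteq> x}"
    using disjoint_cycles_sorted[OF assms(3)] by blast
  obtain c where c: "c \<in> set cs" "even (length c)" using EPar_iff_odd[OF cs(1)] assms(4) by blast
  have cyc: "map p c = rotate1 c" "distinct c" "c \<noteq> []" "b \<notin> set c"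
    using cs c(1) assms(2) by (auto simp: disjoint_cycles_def distinct_concat_iff) 
  have l: "lifts (cycle_lift b c) (cycle_of_list c) ((-1) ^ (length c + 1))" using lifts_cycle_lift cyc by blast
  have "g * cycle_lift b c = cycle_lift b (rotate1 c) * g"
    using cycle_lift_conj[OF assms(1,2) cyc(3)] cyc(1) by simp
  then have "g * cycle_lift b c = - (cycle_lift b c * g)"
    using cycle_lift_rotate1[OF cyc(2,4,3)] c(2) by simp
  moreover have "\<forall>x. p x = x \<longrightarrow> cycle_of_list c x = x"
    using cs c(1) by (auto intro!: id_outside_supp)
  ultimately show ?thesis using l assms(2) by blast
qed

section \<open>The double cover inside the Clifford algebra\<close>

primrec gen_op :: "spin_gen \<Rightarrow> clifford" where
  "gen_op SpinZ = -1"
| "gen_op (SpinT i) = root_vec (i + 1) i"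

primrec gen_perm :: "spin_gen \<Rightarrow> nat \<Rightarrow> nat" where
  "gen_perm SpinZ = id"
| "gen_perm (SpinT i) = transpose i (i + 1)"

definition word_op :: "spin_gen list \<Rightarrow> clifford" where
  "word_op w = prod_list (map gen_op w)"

definition word_perm :: "spin_gen list \<Rightarrow> nat \<Rightarrow> nat" where
  "word_perm w = foldr (\<lambda>g p. gen_perm g \<circ> p) w id"

lemma word_op_simps [simp]:
  "word_op [] = 1" "word_op (g # w) = gen_op g * word_op w" "word_op (u @ v) = word_op u * word_op v"
  by (simp_all add: word_op_def)

lemma word_perm_simps [simp]:
  "word_perm [] = id" "word_perm (g # w) = gen_perm g \<circ> word_perm w"
  by (simp_all add: word_perm_def)

lemma word_perm_append [simp]: "word_perm (u @ v) = word_perm u \<circ> word_perm v"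
  by (induction u) (simp_all add: comp_assoc)

lemma word_lifts: "\<exists>e. lifts (word_op w) (word_perm w) e"
proof (induction w)
  case Nil
  then show ?case using lifts_one by (auto simp: id_def)
next
  case (Cons g w)
  then obtain e where e: "lifts (word_op w) (word_perm w) e" by blast
  have "\<exists>d. lifts (gen_op g) (gen_perm g) d"
    using lifts_uminus[OF lifts_one] lifts_root_vec[of i "Suc i" for i] by (cases g) (auto simp: id_def)
  then obtain d where "lifts (gen_op g) (gen_perm g) d" by blast
  then show ?case using lifts_mult[OF _ e] by (auto simp: comp_def)
qed

lemma spin_words_simps [simp]:
  "[] \<in> spin_words n" "u @ v \<in> spin_words n \<longleftrightarrow> u \<in> spin_words n \<and> v \<in> spin_words n"
  "SpinZ # w \<in> spin_words n \<longleftrightarrow> w \<in> spin_words n"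
  "SpinT i # w \<in> spin_words n \<longleftrightarrow> 1 \<le> i \<and> i < n \<and> w \<in> spin_words n"
  by (auto simp: spin_words_def)

lemma spin_words_mono: "w \<in> spin_words n \<Longrightarrow> n \<le> m \<Longrightarrow> w \<in> spin_words m"
  by (auto simp: spin_words_def)

lemma word_perm_permutes: "w \<in> spin_words n \<Longrightarrow> word_perm w permutes {1..n}"
proof (induction w)
  case Nil
  then show ?case by (simp add: permutes_def)
next
  case (Cons g w)
  have "gen_perm g permutes {1..n}"
    using Cons.prems permutes_id[of "{1..n}"] permutes_swap_id[of _ "{1..n}"] by (cases g) (auto simp: id_def)
  moreover have "word_perm w permutes {1..n}" using Cons by (cases g) auto
  ultimately have "gen_perm g \<circ> word_perm w permutes {1..n}" by (rule permutes_compose[rotated])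
  then show ?case by (simp add: comp_def)
qed

lemma spin_eq_words: "spin_eq n u v \<Longrightarrow> u \<in> spin_words n \<and> v \<in> spin_words n"
  by (induction rule: spin_eq.induct) auto

lemma spin_eq_word_op: "spin_eq n u v \<Longrightarrow> word_op u = word_op v"
proof (induction rule: spin_eq.induct)
  case (t_square i)
  then show ?case by (simp add: root_vec_square)
next
  case (braid i)
  \<comment> \<open>Both sides of the braid relation are the root vector that joins \<open>i\<close>
    and \<open>i + 2\<close>, reached by conjugating either neighbour.\<close>
  let ?a = "root_vec (i + 1) i" and ?b = "root_vec (i + 2) (i + 1)"
  have "?a * ?b = - (root_vec (i + 2) i * ?a)"
    using lifts_root_vec_conj[OF lifts_root_vec[of i "i + 1"], of "i + 2" "i + 1"] by simp
  then have 1: "?a * ?b * ?a = root_vec (i + 2) i"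
    by (simp add: mult.assoc root_vec_square)
  have "?b * ?a = - (root_vec (i + 2) i * ?b)"
    using lifts_root_vec_conj[OF lifts_root_vec[of "i + 1" "i + 2"], of "i + 1" i] by simp
  then have 2: "?b * ?a * ?b = root_vec (i + 2) i"
    by (simp add: mult.assoc root_vec_square)
  show ?case using 1 2 by (simp add: mult.assoc)
next
  case (far i j)
  then show ?case
    using lifts_root_vec_conj[OF lifts_root_vec[of j "j + 1"], of "i + 1" i] by (auto simp: transpose_def)
qed (auto simp: mult.assoc)

subsection \<open>Normal forms of words\<close>

declare spin_eq.trans [trans]

lemma spin_eq_append: "spin_eq n u u' \<Longrightarrow> spin_eq n v v' \<Longrightarrow> spin_eq n (u @ v) (u' @ v')"
  using spin_eq.cong[of n u u' "[]" v] spin_eq.cong[of n v v' u' "[]"] spin_eq_words[of n u u']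
    spin_eq_words[of n v v'] by (auto intro: spin_eq.trans)

lemma spin_eq_refl: "w \<in> spin_words n \<Longrightarrow> spin_eq n w w"
  by (rule spin_eq.refl)

lemma spin_eq_mono: "spin_eq n u v \<Longrightarrow> n \<le> m \<Longrightarrow> spin_eq m u v"
proof (induction rule: spin_eq.induct)
  case (refl w)
  then show ?case by (auto intro: spin_eq.refl spin_words_mono)
next
  case (cong u v a b)
  then show ?case by (auto intro: spin_eq.cong spin_words_mono)
next
  case (braid i)
  then show ?case using spin_eq.braid[of i m] by simp
next
  case (far i j)
  then show ?case using spin_eq.far[of i m j] by simp
qed (auto intro: spin_eq.intros)

lemma spin_z_move: "w \<in> spin_words n \<Longrightarrow> spin_eq n (w @ [SpinZ]) (SpinZ # w)"
proof (induction w)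
  case Nil
  then show ?case by (simp add: spin_eq_refl)
next
  case (Cons g w)
  then have w: "[g] \<in> spin_words n" "w \<in> spin_words n" by (cases g; simp)+
  have "spin_eq n ([g] @ (w @ [SpinZ])) ([g] @ (SpinZ # w))"
    using Cons.IH w by (intro spin_eq_append) (simp_all add: spin_eq_refl)
  also have "spin_eq n ([g, SpinZ] @ w) ([SpinZ, g] @ w)"
    using w spin_eq.sym[OF spin_eq.central[of _ n]]
    by (intro spin_eq_append spin_eq_refl) (cases g; auto intro: spin_eq.refl)
  then have "spin_eq n ([g] @ (SpinZ # w)) (SpinZ # g # w)" by simp
  finally show ?case by simp
qed

lemma spin_inverse:
  assumes "w \<in> spin_words n"
  shows "\<exists>w' \<in> spin_words n. spin_eq n (w @ w') [] \<and> spin_eq n (w' @ w) []"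
  using assms
proof (induction w)
  case Nil
  then show ?case by (auto intro!: bexI[of _ "[]"] spin_eq_refl)
next
  case (Cons g w)
  then have w: "[g] \<in> spin_words n" "w \<in> spin_words n" by (cases g; simp)+
  then obtain w' where w': "w' \<in> spin_words n" "spin_eq n (w @ w') []" "spin_eq n (w' @ w) []"
    using Cons.IH by blast
  have "\<exists>h \<in> spin_words n. spin_eq n ([g] @ h) [] \<and> spin_eq n (h @ [g]) []"
  proof (cases g)
    case SpinZ
    then show ?thesis by (intro bexI[of _ "[SpinZ]"]) (auto intro: spin_eq.intros)
  next
    case (SpinT i)
    then have i: "1 \<le> i" "i < n" using w by auto
    have tt: "spin_eq n [SpinT i, SpinT i] [SpinZ]" using i by (rule spin_eq.t_square)
    have "spin_eq n ([SpinT i, SpinT i] @ [SpinZ]) ([SpinZ] @ [SpinZ])"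
      by (intro spin_eq_append tt spin_eq_refl) simp
    also have "spin_eq n ([SpinZ] @ [SpinZ]) []" by (simp add: spin_eq.z_square)
    finally have 1: "spin_eq n [SpinT i, SpinT i, SpinZ] []" by simp
    have "spin_eq n ([SpinT i] @ [SpinZ, SpinT i]) ([SpinT i] @ [SpinT i, SpinZ])"
      using i by (intro spin_eq_append spin_eq.central spin_eq_refl) simp_all
    also have "spin_eq n ([SpinT i] @ [SpinT i, SpinZ]) []" using 1 by simp
    finally have 2: "spin_eq n [SpinT i, SpinZ, SpinT i] []" by simp
    show ?thesis using 1 2 i SpinT by (intro bexI[of _ "[SpinT i, SpinZ]"]) auto
  qed
  then obtain h where h: "h \<in> spin_words n" "spin_eq n ([g] @ h) []" "spin_eq n (h @ [g]) []" by blast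
  have "spin_eq n ([g] @ (w @ w') @ h) ([g] @ [] @ h)"
    using w w' h by (intro spin_eq_append spin_eq_refl) auto
  also have "spin_eq n ([g] @ [] @ h) []" using h by simp
  finally have 1: "spin_eq n ((g # w) @ (w' @ h)) []" by simp
  have "spin_eq n (w' @ (h @ [g]) @ w) (w' @ [] @ w)"
    using w w' h by (intro spin_eq_append spin_eq_refl) auto
  also have "spin_eq n (w' @ [] @ w) []" using w' by simp
  finally have 2: "spin_eq n ((w' @ h) @ (g # w)) []" by simp
  show ?case using 1 2 w' h by (intro bexI[of _ "w' @ h"]) auto
qed

text \<open>The power of z is left open: the normal form only has to control the permutation, and
  the remaining ambiguity is settled by operators in \<open>spin_eq_iff\<close>.\<close>

lemma spin_far_move:
  assumes "1 \<le> i" "i < n" "\<forall>k \<in> set ks. 1 \<le> k \<and> k < n \<and> (i + 1 < k \<or> k + 1 < i)"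
  shows "\<exists>m. spin_eq n (map SpinT ks @ [SpinT i]) (replicate m SpinZ @ SpinT i # map SpinT ks)"
  using assms(3)
proof (induction ks)
  case Nil
  then show ?case using assms by (intro exI[of _ 0]) (auto intro: spin_eq_refl)
next
  case (Cons k ks)
  then obtain m where m: "spin_eq n (map SpinT ks @ [SpinT i]) (replicate m SpinZ @ SpinT i # map SpinT ks)" by auto
  have k: "1 \<le> k" "k < n" "i + 1 < k \<or> k + 1 < i" using Cons.prems by auto
  have words: "map SpinT ks \<in> spin_words n" "replicate m SpinZ \<in> spin_words n" "map SpinT (k # ks) \<in> spin_words n"
    using spin_eq_words[OF m] k by auto
  have zs: "spin_eq n ([SpinT k] @ replicate m SpinZ) (replicate m SpinZ @ [SpinT k])" for m
  proof (induction m)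
    case 0
    then show ?case using k by (simp add: spin_eq_refl)
  next
    case (Suc m)
    have r: "replicate m SpinZ \<in> spin_words n" by (induction m) auto
    have "spin_eq n ([SpinT k, SpinZ] @ replicate m SpinZ) ([SpinZ, SpinT k] @ replicate m SpinZ)"
      by (rule spin_eq_append[OF spin_eq.sym[OF spin_eq.central[OF k(1,2)]] spin_eq_refl[OF r]])
    also have "spin_eq n ([SpinZ] @ ([SpinT k] @ replicate m SpinZ)) ([SpinZ] @ (replicate m SpinZ @ [SpinT k]))"
      by (rule spin_eq_append[OF spin_eq_refl Suc]) simp
    then have "spin_eq n ([SpinZ, SpinT k] @ replicate m SpinZ) (SpinZ # replicate m SpinZ @ [SpinT k])" by simp
    finally show ?case by simp
  qed
  have "spin_eq n ([SpinT k] @ (map SpinT ks @ [SpinT i])) ([SpinT k] @ (replicate m SpinZ @ SpinT i # map SpinT ks))"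
    using k by (intro spin_eq_append[OF spin_eq_refl m]) auto
  also have "spin_eq n (([SpinT k] @ replicate m SpinZ) @ SpinT i # map SpinT ks)
      ((replicate m SpinZ @ [SpinT k]) @ SpinT i # map SpinT ks)"
    using words assms by (intro spin_eq_append[OF zs spin_eq_refl]) auto
  then have "spin_eq n ([SpinT k] @ (replicate m SpinZ @ SpinT i # map SpinT ks))
      (replicate m SpinZ @ [SpinT k, SpinT i] @ map SpinT ks)" by simp
  also have "spin_eq n (replicate m SpinZ @ [SpinT k, SpinT i] @ map SpinT ks)
      (replicate m SpinZ @ [SpinZ, SpinT i, SpinT k] @ map SpinT ks)"
    using words k assms spin_eq.far[of i n k] by (intro spin_eq.cong) auto
  finally show ?case
    by (intro exI[of _ "Suc m"]) (simp add: replicate_app_Cons_same)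
qed

text \<open>Representatives of the right cosets of the cover for \<open>n\<close> in the cover for
  \<open>n + 1\<close>; \<open>j = n + 1\<close> gives the empty word.\<close>

definition descent :: "nat \<Rightarrow> nat \<Rightarrow> spin_gen list" where
  "descent n j = map SpinT (rev [j..<n + 1])"

lemma descent_Suc: "j \<le> n \<Longrightarrow> descent n j = descent n (Suc j) @ [SpinT j]"
  by (simp add: descent_def upt_conv_Cons del: upt_Suc)

lemma descent_words: "1 \<le> j \<Longrightarrow> descent n j \<in> spin_words (n + 1)"
  by (auto simp: descent_def spin_words_def)

lemma replicate_SpinZ_words: "replicate m SpinZ \<in> spin_words n"
  by (induction m) auto

text \<open>The letter \<open>SpinT i\<close> passes the whole descent if \<open>i + 1 < j\<close>,
  prolongs it if \<open>i + 1 = j\<close>, squares its last letter to z if \<open>i = j\<close>, and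
  comes out on the left with index \<open>i - 1\<close> by one braid relation if
  \<open>j < i\<close>.\<close>

lemma spin_descent_step:
  assumes j: "1 \<le> j" "j \<le> n + 1" and i: "1 \<le> i" "i \<le> n"
  shows "\<exists>w \<in> spin_words n. \<exists>k. 1 \<le> k \<and> k \<le> n + 1 \<and> spin_eq (n + 1) (descent n j @ [SpinT i]) (w @ descent n k)"
proof -
  let ?N = "n + 1"
  have wj: "descent n j \<in> spin_words ?N" by (rule descent_words[OF j(1)])
  consider "i + 1 < j" | "i + 1 = j" | "i = j" | "j < i" by linarith
  then show ?thesis
  proof cases
    case 1
    then obtain m where "spin_eq ?N (descent n j @ [SpinT i]) (replicate m SpinZ @ SpinT i # descent n j)"
      unfolding descent_def using spin_far_move[of i ?N "rev [j..<n + 1]"] i j by force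
    then show ?thesis using 1 i j replicate_SpinZ_words
      by (intro bexI[of _ "replicate m SpinZ @ [SpinT i]"] exI[of _ j]) auto
  next
    case 2
    then have "descent n i = descent n j @ [SpinT i]" using descent_Suc[of i n] i by simp
    then show ?thesis using i descent_words[of i n] by (intro bexI[of _ "[]"] exI[of _ i]) (auto intro: spin_eq_refl)
  next
    case 3
    then have d: "descent n j = descent n (Suc j) @ [SpinT j]" using descent_Suc i by simp
    have w: "descent n (Suc j) \<in> spin_words ?N" using descent_words[of "Suc j" n] by simp
    have "spin_eq ?N (descent n (Suc j) @ [SpinT j, SpinT j]) (descent n (Suc j) @ [SpinZ])"
      by (rule spin_eq_append[OF spin_eq_refl[OF w] spin_eq.t_square]) (use 3 i in auto)
    also have "spin_eq ?N (descent n (Suc j) @ [SpinZ]) (SpinZ # descent n (Suc j))"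
      using w by (rule spin_z_move)
    finally show ?thesis using 3 i d by (intro bexI[of _ "[SpinZ]"] exI[of _ "Suc j"]) auto
  next
    case 4
    define i' where "i' = i - 1"
    have i': "i = Suc i'" "j \<le> i'" "1 \<le> i'" using 4 j by (auto simp: i'_def)
    let ?low = "map SpinT (rev [j..<i'])"
    let ?hi = "descent n (Suc i)"
    have "[j..<n + 1] = [j..<i'] @ [i'..<n + 1]"
      using upt_add_eq_append[of j i' "n + 1 - i'"] i' i by simp
    moreover have "[i'..<n + 1] = i' # i # [Suc i..<n + 1]" using i' i by (simp add: upt_conv_Cons del: upt_Suc)
    ultimately have d: "descent n j = ?hi @ [SpinT i, SpinT i'] @ ?low" by (simp add: descent_def del: upt_Suc)
    have words: "?low \<in> spin_words ?N" "?hi \<in> spin_words ?N" "[SpinT i, SpinT i'] \<in> spin_words ?N"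
      using wj unfolding d by simp_all
    obtain m1 where m1: "spin_eq ?N (?low @ [SpinT i]) (replicate m1 SpinZ @ SpinT i # ?low)"
      using spin_far_move[of i ?N "rev [j..<i']"] i i' j by force
    obtain m2 where m2: "spin_eq ?N (?hi @ [SpinT i']) (replicate m2 SpinZ @ SpinT i' # ?hi)"
      unfolding descent_def using spin_far_move[of i' ?N "rev [Suc i..<n + 1]"] i i' by force
    let ?Z1 = "replicate m1 SpinZ" and ?Z2 = "replicate m2 SpinZ"
    have z: "spin_eq ?N (w @ replicate m SpinZ) (replicate m SpinZ @ w)" if "w \<in> spin_words ?N" for w m
    proof (induction m)
      case 0
      then show ?case using that by (simp add: spin_eq_refl)
    next
      case (Suc m)
      have "spin_eq ?N ((w @ [SpinZ]) @ replicate m SpinZ) ((SpinZ # w) @ replicate m SpinZ)"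
        by (rule spin_eq_append[OF spin_z_move[OF that] spin_eq_refl[OF replicate_SpinZ_words]])
      also have "spin_eq ?N ([SpinZ] @ (w @ replicate m SpinZ)) ([SpinZ] @ (replicate m SpinZ @ w))"
        by (rule spin_eq_append[OF spin_eq_refl Suc]) simp
      then have "spin_eq ?N ((SpinZ # w) @ replicate m SpinZ) (SpinZ # replicate m SpinZ @ w)" by simp
      finally show ?case by (simp add: replicate_app_Cons_same)
    qed
    have "spin_eq ?N ((?hi @ [SpinT i, SpinT i']) @ (?low @ [SpinT i])) ((?hi @ [SpinT i, SpinT i']) @ (?Z1 @ SpinT i # ?low))"
      using words by (intro spin_eq_append[OF spin_eq_refl m1]) auto
    also have "spin_eq ?N (((?hi @ [SpinT i, SpinT i']) @ ?Z1) @ SpinT i # ?low) ((?Z1 @ ?hi @ [SpinT i, SpinT i']) @ SpinT i # ?low)"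
      using words i by (intro spin_eq_append[OF z spin_eq_refl]) auto
    then have "spin_eq ?N ((?hi @ [SpinT i, SpinT i']) @ (?Z1 @ SpinT i # ?low)) (?Z1 @ ?hi @ [SpinT i, SpinT i', SpinT i] @ ?low)" by simp
    also have "spin_eq ?N (?Z1 @ ?hi @ [SpinT i, SpinT i', SpinT i] @ ?low) (?Z1 @ ?hi @ [SpinT i', SpinT i, SpinT i'] @ ?low)"
    proof -
      have "spin_eq ?N [SpinT i, SpinT i', SpinT i] [SpinT i', SpinT i, SpinT i']"
        using i i' spin_eq.sym[OF spin_eq.braid[of i' ?N]] by simp
      then have "spin_eq ?N ((?Z1 @ ?hi) @ [SpinT i, SpinT i', SpinT i] @ ?low) ((?Z1 @ ?hi) @ [SpinT i', SpinT i, SpinT i'] @ ?low)"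
        by (rule spin_eq.cong) (use words replicate_SpinZ_words in auto)
      then show ?thesis by simp
    qed
    also have "spin_eq ?N (?Z1 @ (?hi @ [SpinT i']) @ [SpinT i, SpinT i'] @ ?low) (?Z1 @ (?Z2 @ SpinT i' # ?hi) @ [SpinT i, SpinT i'] @ ?low)"
      using words replicate_SpinZ_words by (intro spin_eq.cong[OF m2]) auto
    then have "spin_eq ?N (?Z1 @ ?hi @ [SpinT i', SpinT i, SpinT i'] @ ?low) ((?Z1 @ ?Z2 @ [SpinT i']) @ descent n j)"
      unfolding d by simp
    finally have "spin_eq ?N (descent n j @ [SpinT i]) ((?Z1 @ ?Z2 @ [SpinT i']) @ descent n j)"
      unfolding d by simp
    then show ?thesis using i i' j replicate_SpinZ_words
      by (intro bexI[of _ "?Z1 @ ?Z2 @ [SpinT i']"] exI[of _ j]) auto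
  qed
qed

lemma spin_normal_form:
  assumes "w \<in> spin_words (n + 1)"
  shows "\<exists>v \<in> spin_words n. \<exists>j. 1 \<le> j \<and> j \<le> n + 1 \<and> spin_eq (n + 1) w (v @ descent n j)"
  using assms
proof (induction w rule: rev_induct)
  case Nil
  then show ?case by (intro bexI[of _ "[]"] exI[of _ "n + 1"]) (auto simp: descent_def intro: spin_eq_refl)
next
  case (snoc g w)
  have g: "[g] \<in> spin_words (n + 1)" and "w \<in> spin_words (n + 1)" using snoc.prems by simp_all
  then obtain v j where v: "v \<in> spin_words n" "1 \<le> j" "j \<le> n + 1" "spin_eq (n + 1) w (v @ descent n j)"
    using snoc.IH by blast
  have v': "v \<in> spin_words (n + 1)" using v(1) by (rule spin_words_mono) simp
  have dj: "descent n j \<in> spin_words (n + 1)" by (rule descent_words[OF v(2)])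
  have 1: "spin_eq (n + 1) (w @ [g]) ((v @ descent n j) @ [g])"
    using v(4) g by (intro spin_eq_append spin_eq_refl)
  have "\<exists>u \<in> spin_words n. \<exists>k. 1 \<le> k \<and> k \<le> n + 1 \<and> spin_eq (n + 1) (descent n j @ [g]) (u @ descent n k)"
  proof (cases g)
    case SpinZ
    then show ?thesis using spin_z_move[OF dj] v by (intro bexI[of _ "[SpinZ]"] exI[of _ j]) auto
  next
    case (SpinT i)
    then show ?thesis using spin_descent_step[OF v(2,3), of i] g by auto
  qed
  then obtain u k where u: "u \<in> spin_words n" "1 \<le> k" "k \<le> n + 1" "spin_eq (n + 1) (descent n j @ [g]) (u @ descent n k)" by blast
  have "spin_eq (n + 1) (v @ (descent n j @ [g])) (v @ (u @ descent n k))"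
    by (rule spin_eq_append[OF spin_eq_refl[OF v'] u(4)])
  then have "spin_eq (n + 1) (w @ [g]) ((v @ u) @ descent n k)" using 1 spin_eq.trans by simp
  then show ?case using u v by (intro bexI[of _ "v @ u"] exI[of _ k]) auto
qed

lemma word_perm_descent: "j \<le> n + 1 \<Longrightarrow> word_perm (descent n j) j = n + 1"
proof (induction rule: inc_induct)
  case base
  then show ?case by (simp add: descent_def)
next
  case (step j)
  then show ?case by (simp add: descent_Suc)
qed

text \<open>The representative \<open>descent n j\<close> sends \<open>j\<close> to
  \<open>n + 1\<close>, and the factor before it fixes \<open>n + 1\<close>; a word that fixes
  \<open>n + 1\<close> therefore has the empty representative.\<close>

lemma spin_descend:
  assumes "w \<in> spin_words (n + 1)" "word_perm w (n + 1) = n + 1"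
  shows "\<exists>v \<in> spin_words n. spin_eq (n + 1) w v"
proof -
  obtain v j where v: "v \<in> spin_words n" "1 \<le> j" "j \<le> n + 1" "spin_eq (n + 1) w (v @ descent n j)"
    using spin_normal_form[OF assms(1)] by blast
  obtain e d where "lifts (word_op w) (word_perm w) e" "lifts (word_op (v @ descent n j)) (word_perm (v @ descent n j)) d"
    using word_lifts by metis
  then have "word_perm w = word_perm (v @ descent n j)" using spin_eq_word_op[OF v(4)] lifts_unique by metis
  then have "word_perm w j = word_perm v (n + 1)" using word_perm_descent[OF v(3)] by simp
  also have "\<dots> = n + 1" using word_perm_permutes[OF v(1)] by (simp add: permutes_def)
  also have "\<dots> = word_perm w (n + 1)" using assms(2) by simp
  finally have "j = n + 1" using word_perm_permutes[OF assms(1)] permutes_inj injD by metis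
  then have "descent n j = []" by (simp add: descent_def)
  then show ?thesis using v by auto
qed

text \<open>Descending one index at a time shows that the presented group has at most two elements
  over each permutation. The converse bound is the difference between 1 and -1 among the
  operators.\<close>

lemma spin_kernel:
  assumes "w \<in> spin_words n" "word_perm w = id"
  shows "spin_eq n w [] \<or> spin_eq n w [SpinZ]"
  using assms
proof (induction n arbitrary: w)
  case 0
  then have "set w \<subseteq> {SpinZ}" by (auto simp: spin_words_def)
  then show ?case
  proof (induction w)
    case Nil
    then show ?case by (simp add: spin_eq_refl)
  next
    case (Cons g w)
    then have "g = SpinZ" by auto
    have "spin_eq 0 w [] \<or> spin_eq 0 w [SpinZ]" using Cons by auto
    then have "spin_eq 0 ([SpinZ] @ w) ([SpinZ] @ []) \<or> spin_eq 0 ([SpinZ] @ w) ([SpinZ] @ [SpinZ])"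
      using spin_eq_append spin_eq_refl[of "[SpinZ]" 0] by fastforce
    then show ?case using \<open>g = SpinZ\<close> spin_eq.z_square[of 0] by (auto intro: spin_eq.trans)
  qed
next
  case (Suc n)
  have w: "w \<in> spin_words (n + 1)" using Suc.prems by simp
  obtain v where v: "v \<in> spin_words n" "spin_eq (n + 1) w v"
    using spin_descend[OF w] Suc.prems by auto
  obtain e d where "lifts (word_op w) (word_perm w) e" "lifts (word_op v) (word_perm v) d"
    using word_lifts by metis
  then have "word_perm v = id" using spin_eq_word_op[OF v(2)] lifts_unique Suc.prems(2) by metis
  then have "spin_eq n v [] \<or> spin_eq n v [SpinZ]" using Suc.IH v(1) by blast
  then have "spin_eq (n + 1) v [] \<or> spin_eq (n + 1) v [SpinZ]" using spin_eq_mono by (meson le_add1)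
  then have "spin_eq (n + 1) w [] \<or> spin_eq (n + 1) w [SpinZ]" using spin_eq.trans[OF v(2)] by blast
  then show ?case by simp
qed

lemma spin_eq_iff:
  assumes "u \<in> spin_words n" "v \<in> spin_words n"
  shows "spin_eq n u v \<longleftrightarrow> word_op u = word_op v"
proof
  assume eq: "word_op u = word_op v"
  obtain v' where v': "v' \<in> spin_words n" "spin_eq n (v @ v') []" "spin_eq n (v' @ v) []"
    using spin_inverse[OF assms(2)] by blast
  have op: "word_op (u @ v') = 1" using spin_eq_word_op[OF v'(2)] eq by simp
  then have "word_perm (u @ v') = id" using word_lifts lifts_one lifts_unique by metis
  then have "spin_eq n (u @ v') [] \<or> spin_eq n (u @ v') [SpinZ]"
    using spin_kernel[of "u @ v'" n] assms v'(1) by simp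
  moreover have "\<not> spin_eq n (u @ v') [SpinZ]"
    using spin_eq_word_op[of n "u @ v'" "[SpinZ]"] op clifford_eq_uminus_iff[of 1] by auto
  ultimately have uv: "spin_eq n (u @ v') []" by blast
  have "spin_eq n (u @ []) (u @ (v' @ v))" using assms v' by (intro spin_eq_append spin_eq_refl spin_eq.sym[OF v'(3)])
  also have "spin_eq n ((u @ v') @ v) ([] @ v)" using assms uv by (intro spin_eq_append spin_eq_refl)
  then have "spin_eq n (u @ (v' @ v)) v" by simp
  finally show "spin_eq n u v" by simp
qed (rule spin_eq_word_op)

subsection \<open>The spin group as a group of Clifford elements\<close>

definition spin_op :: "spin_gen list set \<Rightarrow> clifford" where
  "spin_op A = word_op (SOME w. w \<in> A)"

lemma spin_class_eq_iff:
  assumes "u \<in> spin_words n" "v \<in> spin_words n"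
  shows "spin_class n u = spin_class n v \<longleftrightarrow> word_op u = word_op v"
proof -
  have "spin_class n u = spin_class n v \<longleftrightarrow> spin_eq n u v"
    unfolding spin_class_def using assms spin_eq.refl spin_eq.sym spin_eq.trans by (metis (no_types, lifting) Collect_cong mem_Collect_eq)
  then show ?thesis using spin_eq_iff[OF assms] by simp
qed

lemma spin_op_class [simp]: "w \<in> spin_words n \<Longrightarrow> spin_op (spin_class n w) = word_op w"
  unfolding spin_op_def spin_class_def mem_Collect_eq
  by (metis someI spin_eq.refl spin_eq_word_op)

lemma spin_group_sel [simp]:
  "carrier (spin_group n) = spin_class n ` spin_words n" "\<one>\<^bsub>spin_group n\<^esub> = spin_class n []"
  by (simp_all add: spin_group_def)

lemma spin_class_self: "w \<in> spin_words n \<Longrightarrow> w \<in> spin_class n w"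
  by (simp add: spin_class_def spin_eq.refl)

lemma spin_mult_class:
  assumes "u \<in> spin_words n" "v \<in> spin_words n"
  shows "spin_class n u \<otimes>\<^bsub>spin_group n\<^esub> spin_class n v = spin_class n (u @ v)"
proof -
  have "spin_class n (a @ b) = spin_class n (u @ v)" if "a \<in> spin_class n u" "b \<in> spin_class n v" for a b
  proof -
    have "spin_eq n u a" "spin_eq n v b" using that by (simp_all add: spin_class_def)
    then show ?thesis using spin_eq_words[of n u a] spin_eq_words[of n v b] spin_eq_word_op assms
      by (subst spin_class_eq_iff) auto
  qed
  moreover have "u \<in> spin_class n u" "v \<in> spin_class n v" using spin_class_self assms by blast+
  ultimately show ?thesis unfolding spin_group_def monoid.simps by blast
qed

lemma spin_op_inj: "A \<in> carrier (spin_group n) \<Longrightarrow> B \<in> carrier (spin_group n) \<Longrightarrow> spin_op A = spin_op B \<longleftrightarrow> A = B"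
  using spin_class_eq_iff by fastforce

lemma spin_op_mult:
  "A \<in> carrier (spin_group n) \<Longrightarrow> B \<in> carrier (spin_group n) \<Longrightarrow>
    spin_op (A \<otimes>\<^bsub>spin_group n\<^esub> B) = spin_op A * spin_op B"
  by (auto simp: spin_mult_class)

lemma spin_mult_closed:
  "A \<in> carrier (spin_group n) \<Longrightarrow> B \<in> carrier (spin_group n) \<Longrightarrow> A \<otimes>\<^bsub>spin_group n\<^esub> B \<in> carrier (spin_group n)"
  by (auto simp: spin_mult_class)

lemma spin_group_group: "group (spin_group n)"
proof (rule groupI)
  fix A assume "A \<in> carrier (spin_group n)"
  then obtain w where w: "w \<in> spin_words n" "A = spin_class n w" by auto
  then obtain w' where w': "w' \<in> spin_words n" "spin_eq n (w' @ w) []" using spin_inverse by blast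
  then have "spin_class n w' \<otimes>\<^bsub>spin_group n\<^esub> A = \<one>\<^bsub>spin_group n\<^esub>"
    using w spin_eq_word_op[OF w'(2)] by (simp add: spin_mult_class spin_class_eq_iff)
  then show "\<exists>B \<in> carrier (spin_group n). B \<otimes>\<^bsub>spin_group n\<^esub> A = \<one>\<^bsub>spin_group n\<^esub>" using w'(1) by auto
qed (auto simp: spin_mult_class)

lemma spin_op_lifts:
  assumes "A \<in> carrier (spin_group n)"
  shows "\<exists>p e. p permutes {1..n} \<and> lifts (spin_op A) p e"
proof -
  obtain w where "w \<in> spin_words n" "A = spin_class n w" using assms by auto
  then show ?thesis using word_lifts[of w] word_perm_permutes[of w n] by auto
qed

lemma spin_op_uminus:
  assumes "A \<in> carrier (spin_group n)"
  shows "spin_class n [SpinZ] \<otimes>\<^bsub>spin_group n\<^esub> A \<in> carrier (spin_group n)"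
    "spin_op (spin_class n [SpinZ] \<otimes>\<^bsub>spin_group n\<^esub> A) = - spin_op A"
  using assms by (auto simp: spin_mult_class)

lemma spin_embed_class:
  assumes "w \<in> spin_words n" shows "spin_embed n (spin_class n w) = spin_class (n + 1) w"
proof -
  have "spin_class (n + 1) a = spin_class (n + 1) w" if "a \<in> spin_class n w" for a
  proof -
    have "spin_eq n w a" using that by (simp add: spin_class_def)
    then show ?thesis using spin_eq_words[of n w a] spin_eq_word_op
      by (subst spin_class_eq_iff) (auto intro: spin_words_mono)
  qed
  moreover have "w \<in> spin_class n w" by (rule spin_class_self[OF assms])
  ultimately show ?thesis unfolding spin_embed_def by blast
qed

lemma spin_prod_op:
  assumes "set As \<subseteq> carrier (spin_group n)"
  shows "spin_prod n As \<in> carrier (spin_group n) \<and> spin_op (spin_prod n As) = prod_list (map spin_op As)"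
  using assms
proof (induction As)
  case Nil
  then show ?case by (simp add: spin_prod_def)
next
  case (Cons A As)
  then have "spin_prod n (A # As) = A \<otimes>\<^bsub>spin_group n\<^esub> spin_prod n As" by (simp add: spin_prod_def)
  then show ?case using Cons spin_op_mult[of A n "spin_prod n As"] spin_mult_closed[of A n "spin_prod n As"]
    by (simp del: spin_group_sel)
qed

text \<open>By x_i = t_i x_{i+1} t_i the root vector moves from \<open>i + 1\<close> to
  \<open>i\<close>; the sign of the conjugation cancels the square -1 of t_i.\<close>

lemma spin_x_op:
  assumes "1 \<le> i" "i \<le> n"
  shows "spin_x n i \<in> carrier (spin_group (n + 1)) \<and> spin_op (spin_x n i) = root_vec (n + 1) i"
proof -
  have w: "map SpinT ([i..<n + 1] @ rev [i..<n]) \<in> spin_words (n + 1)" using assms by (auto simp: spin_words_def)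
  have "word_op (map SpinT ([i..<n + 1] @ rev [i..<n])) = root_vec (n + 1) i"
    using assms(2,1)
  proof (induction rule: inc_induct)
    case base
    then show ?case by simp
  next
    case (step i)
    let ?w = "map SpinT ([Suc i..<n + 1] @ rev [Suc i..<n])"
    have "[i..<n + 1] @ rev [i..<n] = i # ([Suc i..<n + 1] @ rev [Suc i..<n]) @ [i]"
      using step(2) by (simp add: upt_conv_Cons del: upt_Suc)
    then have "word_op (map SpinT ([i..<n + 1] @ rev [i..<n])) = root_vec (i + 1) i * word_op ?w * root_vec (i + 1) i"
      by (simp add: mult.assoc del: upt_Suc)
    also have "word_op ?w = root_vec (n + 1) (i + 1)" using step by simp
    also have "root_vec (i + 1) i * root_vec (n + 1) (i + 1) = - (root_vec (n + 1) i * root_vec (i + 1) i)"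
      using lifts_root_vec_conj[OF lifts_root_vec[of i "i + 1"], of "n + 1" "i + 1"] step(2) by simp
    finally show ?case by (simp add: mult.assoc root_vec_square)
  qed
  then show ?thesis using w by (simp add: spin_x_def)
qed

lemma spin_cycle_op:
  assumes "c \<noteq> []" "set c \<subseteq> {1..n}"
  shows "spin_cycle n c \<in> carrier (spin_group (n + 1)) \<and> spin_op (spin_cycle n c) = - cycle_lift (n + 1) c"
proof -
  let ?c = "hd c # rev c"
  have c: "set ?c \<subseteq> {1..n}" using assms by (cases c) auto
  have 1: "set (map (spin_x n) ?c) \<subseteq> carrier (spin_group (n + 1))"
  proof
    fix X assume "X \<in> set (map (spin_x n) ?c)"
    then obtain i where "i \<in> set ?c" "X = spin_x n i" unfolding set_map by blast
    moreover from this have "1 \<le> i" "i \<le> n" using c by (meson atLeastAtMost_iff subsetD)+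
    ultimately show "X \<in> carrier (spin_group (n + 1))" using spin_x_op by blast
  qed
  have 2: "map spin_op (map (spin_x n) ?c) = map (root_vec (n + 1)) ?c"
    using c spin_x_op unfolding map_map by (intro map_cong) auto
  show ?thesis unfolding spin_cycle_def cycle_lift_def using spin_prod_op[OF 1] unfolding 2 by simp
qed

text \<open>Each bracket in the definition of the class is the negative of a
  \<open>cycle_lift\<close>, one sign per part. This is the origin of the sign in the
  theorem.\<close>

lemma spin_D_iff:
  "A \<in> spin_D n \<kappa> \<longleftrightarrow> A \<in> carrier (spin_group n) \<and> (\<exists>cs. map length cs = cycle_lengths \<kappa> \<and>
     distinct (concat cs) \<and> set (concat cs) \<subseteq> {1..n} \<and> spin_op A = (-1) ^ size \<kappa> * cycles_lift (n + 1) cs)"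
proof -
  have "spin_embed n A = spin_prod (n + 1) (map (spin_cycle n) cs) \<longleftrightarrow> spin_op A = (-1) ^ size \<kappa> * cycles_lift (n + 1) cs"
    if A: "A \<in> carrier (spin_group n)" and cs: "map length cs = cycle_lengths \<kappa>" "set (concat cs) \<subseteq> {1..n}" for cs
  proof -
    obtain w where w: "w \<in> spin_words n" "A = spin_class n w" using A by auto
    then have w': "w \<in> spin_words (n + 1)" using spin_words_mono by auto
    have emb: "spin_embed n A = spin_class (n + 1) w" using w spin_embed_class by simp
    have e: "spin_embed n A \<in> carrier (spin_group (n + 1))" "spin_op (spin_embed n A) = spin_op A"
      using emb w' w by auto
    have "0 \<notin> set (map length cs)" unfolding cs(1) by (auto simp: cycle_lengths_def)
    then have c: "c \<noteq> [] \<and> set c \<subseteq> {1..n}" if "c \<in> set cs" for c using that cs(2) by fastforce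
    then have 1: "set (map (spin_cycle n) cs) \<subseteq> carrier (spin_group (n + 1))"
      using spin_cycle_op[of _ n] by (auto simp del: spin_group_sel)
    have 2: "map spin_op (map (spin_cycle n) cs) = map (\<lambda>c. - cycle_lift (n + 1) c) cs"
      using c spin_cycle_op unfolding map_map by (intro map_cong) auto
    have "prod_list (map (\<lambda>c. - cycle_lift (n + 1) c) ds) = (-1) ^ length ds * cycles_lift (n + 1) ds" for ds
    proof (induction ds)
      case (Cons d ds)
      have "x * (-1) ^ k = (-1) ^ k * x" for x :: clifford and k by (cases "even k") simp_all
      then have "cycle_lift (n + 1) d * ((-1) ^ length ds * y) = (-1) ^ length ds * (cycle_lift (n + 1) d * y)" for y
        by (metis mult.assoc)
      then show ?case using Cons by (simp add: cycles_lift_def)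
    qed (simp add: cycles_lift_def)
    moreover have "length cs = size \<kappa>"
    proof -
      have "length cs = length (cycle_lengths \<kappa>)" using cs(1) by (metis length_map)
      also have "\<dots> = size (mset (sorted_list_of_multiset \<kappa>))" unfolding cycle_lengths_def size_mset by simp
      finally show ?thesis by simp
    qed
    ultimately have "spin_op (spin_prod (n + 1) (map (spin_cycle n) cs)) = (-1) ^ size \<kappa> * cycles_lift (n + 1) cs"
      using spin_prod_op[OF 1] unfolding 2 by metis
    then show ?thesis using spin_op_inj[OF e(1), of "spin_prod (n + 1) (map (spin_cycle n) cs)"] spin_prod_op[OF 1] e(2) by metis
  qed
  then show ?thesis unfolding spin_D_def cycle_lengths_def[symmetric] by blast
qed

lemma cycle_lengths_odd: "\<kappa> \<in> EPar \<Longrightarrow> map length cs = cycle_lengths \<kappa> \<Longrightarrow> c \<in> set cs \<Longrightarrow> odd (length c)"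
proof -
  assume a: "\<kappa> \<in> EPar" "map length cs = cycle_lengths \<kappa>" "c \<in> set cs"
  then have "length c \<in> set (cycle_lengths \<kappa>)" by (metis image_eqI set_map)
  then show ?thesis using a(1) by (auto simp: cycle_lengths_def EPar_def)
qed

lemma spin_D_canonical:
  assumes "\<kappa> \<in> EPar"
  shows "A \<in> spin_D n \<kappa> \<longleftrightarrow> A \<in> carrier (spin_group n) \<and> (\<exists>p g. p permutes {1..n} \<and> mct p = \<kappa> \<and>
    canonical_lift (n + 1) p g \<and> spin_op A = (-1) ^ size \<kappa> * g)"
proof (intro iffI conjI)
  have par: "\<kappa> \<in> Par" using assms by (simp add: EPar_def)
  {
    assume "A \<in> spin_D n \<kappa>"
    then obtain cs where A: "A \<in> carrier (spin_group n)" and cs: "map length cs = cycle_lengths \<kappa>"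
       "distinct (concat cs)" "set (concat cs) \<subseteq> {1..n}" "spin_op A = (-1) ^ size \<kappa> * cycles_lift (n + 1) cs"
      unfolding spin_D_iff by blast
    have odd: "\<forall>c \<in> set cs. odd (length c)" using cycle_lengths_odd assms cs(1) by blast
    then have "[] \<notin> set cs" by (metis even_zero list.size(3))
    then obtain p where p: "disjoint_cycles p cs" "p permutes set (concat cs)" using disjoint_cycles_exists cs(2) by blast
    have "n + 1 \<notin> set (concat cs)" using cs(3) by (meson Suc_n_not_le_n atLeastAtMost_iff subsetD add_le_same_cancel1 not_one_le_zero)
    then have "canonical_lift (n + 1) p (cycles_lift (n + 1) cs)" unfolding canonical_lift_def using p(1) odd by blast
    moreover have "p permutes {1..n}" using p(2) cs(3) permutes_subset by blast
    ultimately show "\<exists>p g. p permutes {1..n} \<and> mct p = \<kappa> \<and> canonical_lift (n + 1) p g \<and> spin_op A = (-1) ^ size \<kappa> * g"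
      using mct_of_cycle_lengths[OF p(1) cs(1) par] cs(4) by blast
    show "A \<in> carrier (spin_group n)" by (rule A)
  next
    assume "A \<in> carrier (spin_group n) \<and> (\<exists>p g. p permutes {1..n} \<and> mct p = \<kappa> \<and>
      canonical_lift (n + 1) p g \<and> spin_op A = (-1) ^ size \<kappa> * g)"
    then obtain p g where A: "A \<in> carrier (spin_group n)" and p: "p permutes {1..n}" "mct p = \<kappa>"
      "canonical_lift (n + 1) p g" "spin_op A = (-1) ^ size \<kappa> * g" by blast
    have "permutation p" using p(1) permutation_permutes by blast
    then obtain cs where cs: "disjoint_cycles p cs" "map length cs = cycle_lengths (mct p)" "set (concat cs) = {x. p x \<noteq> x}"
      using disjoint_cycles_sorted by blast
    have sub: "set (concat cs) \<subseteq> {1..n}" using cs(3) p(1) by (auto simp: permutes_def)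
    moreover have "n + 1 \<notin> set (concat cs)" using sub by (meson Suc_n_not_le_n atLeastAtMost_iff subsetD add_le_same_cancel1 not_one_le_zero)
    ultimately have "canonical_lift (n + 1) p (cycles_lift (n + 1) cs)"
      unfolding canonical_lift_def using cs(1,2) cycle_lengths_odd[of \<kappa> cs] assms p(2) by blast
    then have "g = cycles_lift (n + 1) cs" using canonical_lift_unique p(3) by blast
    then show "A \<in> spin_D n \<kappa>"
      unfolding spin_D_iff using A cs(1,2) sub p(2,4) unfolding disjoint_cycles_def by blast
  }
qed

text \<open>The brackets are built from elements of the cover for \<open>n + 1\<close>; the
  resulting word fixes \<open>n + 1\<close>, so \<open>spin_descend\<close> brings it back to the
  cover for \<open>n\<close>.\<close>

lemma canonical_lift_in_spin_group:
  assumes "p permutes {1..n}" "canonical_lift (n + 1) p g"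
  shows "\<exists>A \<in> carrier (spin_group n). spin_op A = g"
proof -
  have "permutation p" using assms(1) permutation_permutes by blast
  then obtain cs where cs: "disjoint_cycles p cs" "set (concat cs) = {x. p x \<noteq> x}"
    using disjoint_cycles_sorted by blast
  obtain ds where ds: "disjoint_cycles p ds" "\<forall>c \<in> set ds. odd (length c)" using assms(2) unfolding canonical_lift_def by blast
  have sub: "set (concat cs) \<subseteq> {1..n}" using cs(2) assms(1) by (auto simp: permutes_def)
  moreover have "n + 1 \<notin> set (concat cs)" using sub by (meson Suc_n_not_le_n atLeastAtMost_iff subsetD add_le_same_cancel1 not_one_le_zero)
  moreover have "\<forall>c \<in> set cs. odd (length c)" using EPar_iff_odd[OF ds(1)] EPar_iff_odd[OF cs(1)] ds(2) by blast
  ultimately have "canonical_lift (n + 1) p (cycles_lift (n + 1) cs)"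
    unfolding canonical_lift_def using cs(1) by blast
  then have g: "g = cycles_lift (n + 1) cs" using canonical_lift_unique assms(2) by blast
  have "\<exists>w \<in> spin_words (n + 1). word_op w = cycles_lift (n + 1) cs"
    using cs(1) sub
  proof (induction cs arbitrary: p)
    case Nil
    then show ?case by (auto simp: cycles_lift_def intro!: bexI[of _ "[]"])
  next
    case (Cons c cs)
    obtain q where q: "disjoint_cycles q cs" "c \<noteq> []" using disjoint_cycles_ConsE[OF Cons.prems(1)] by metis
    have "set (concat cs) \<subseteq> {1..n}" using Cons.prems(2) by auto
    then obtain w where w: "w \<in> spin_words (n + 1)" "word_op w = cycles_lift (n + 1) cs"
      using Cons.IH[OF q(1)] by blast
    obtain v where v: "v \<in> spin_words (n + 1)" "spin_cycle n c = spin_class (n + 1) v" "word_op v = - cycle_lift (n + 1) c"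
      using spin_cycle_op[OF q(2), of n] Cons.prems(2) by fastforce
    \<comment> \<open>The bracket gives the negative of \<open>cycle_lift\<close>; the leading
      \<open>SpinZ\<close> restores the sign.\<close>
    then show ?case using w by (intro bexI[of _ "SpinZ # v @ w"]) (auto simp: cycles_lift_def)
  qed
  then obtain w where w: "w \<in> spin_words (n + 1)" "word_op w = g" using g by blast
  obtain e where "lifts (word_op w) (word_perm w) e" using word_lifts by blast
  then have "word_perm w = p" using lifts_unique canonical_lift_lifts[OF assms(2)] w(2) by blast
  then have "word_perm w (n + 1) = n + 1" using canonical_lift_fixes[OF assms(2)] by simp
  then obtain v where v: "v \<in> spin_words n" "spin_eq (n + 1) w v" using spin_descend w(1) by blast
  then show ?thesis using spin_eq_word_op[OF v(2)] w(2) by (auto intro!: bexI[of _ "spin_class n v"])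
qed

section \<open>Reading off the structure constants of both rings\<close>

section \<open>Group rings and coordinates\<close>


lemma group_ring_sel [simp]:
  "carrier (group_ring G) = {f. keys f \<subseteq> carrier G}"
  "one (group_ring G) = frag_of \<one>\<^bsub>G\<^esub>" "zero (group_ring G) = 0" "add (group_ring G) = (+)"
  by (simp_all add: group_ring_def)

lemma group_ring_mult_superset:
  assumes "finite A" "keys f \<subseteq> A" "finite B" "keys g \<subseteq> B"
  shows "f \<otimes>\<^bsub>group_ring G\<^esub> g = (\<Sum>x \<in> A. \<Sum>y \<in> B. single (x \<otimes>\<^bsub>G\<^esub> y) (lookup f x * lookup g y))"
proof -
  have "(\<Sum>y \<in> keys g. single (x \<otimes>\<^bsub>G\<^esub> y) (lookup f x * lookup g y)) =
      (\<Sum>y \<in> B. single (x \<otimes>\<^bsub>G\<^esub> y) (lookup f x * lookup g y))" for x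
    using assms by (intro sum.mono_neutral_left) (auto simp: in_keys_iff)
  moreover have "(\<Sum>x \<in> keys f. \<Sum>y \<in> B. single (x \<otimes>\<^bsub>G\<^esub> y) (lookup f x * lookup g y)) =
      (\<Sum>x \<in> A. \<Sum>y \<in> B. single (x \<otimes>\<^bsub>G\<^esub> y) (lookup f x * lookup g y))"
    using assms by (intro sum.mono_neutral_left) (auto simp: in_keys_iff)
  ultimately show ?thesis by (simp add: group_ring_def)
qed

lemma group_ring_mult_add_left:
  "(f + f') \<otimes>\<^bsub>group_ring G\<^esub> g = f \<otimes>\<^bsub>group_ring G\<^esub> g + f' \<otimes>\<^bsub>group_ring G\<^esub> g"
  using group_ring_mult_superset[of "keys f \<union> keys f'" "f + f'" "keys g" g G]
    group_ring_mult_superset[of "keys f \<union> keys f'" f "keys g" g G]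
    group_ring_mult_superset[of "keys f \<union> keys f'" f' "keys g" g G] Poly_Mapping.keys_add[of f f']
  by (simp add: lookup_add single_add distrib_right sum.distrib)

lemma group_ring_mult_add_right:
  "f \<otimes>\<^bsub>group_ring G\<^esub> (g + g') = f \<otimes>\<^bsub>group_ring G\<^esub> g + f \<otimes>\<^bsub>group_ring G\<^esub> g'"
  using group_ring_mult_superset[of "keys f" f "keys g \<union> keys g'" "g + g'" G]
    group_ring_mult_superset[of "keys f" f "keys g \<union> keys g'" g G]
    group_ring_mult_superset[of "keys f" f "keys g \<union> keys g'" g' G] Poly_Mapping.keys_add[of g g']
  by (simp add: lookup_add single_add distrib_left sum.distrib)

lemma group_ring_mult_zero [simp]:
  "0 \<otimes>\<^bsub>group_ring G\<^esub> g = 0" "f \<otimes>\<^bsub>group_ring G\<^esub> 0 = 0"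
  by (simp_all add: group_ring_def)

lemma group_ring_mult_single:
  "single x a \<otimes>\<^bsub>group_ring G\<^esub> single y b = single (x \<otimes>\<^bsub>G\<^esub> y) (a * b)"
  using group_ring_mult_superset[of "{x}" "single x a" "{y}" "single y b" G] by (simp add: lookup_single)

lemma group_ring_mult_sum:
  "(\<Sum>i \<in> I. a i) \<otimes>\<^bsub>group_ring G\<^esub> g = (\<Sum>i \<in> I. a i \<otimes>\<^bsub>group_ring G\<^esub> g)"
  "f \<otimes>\<^bsub>group_ring G\<^esub> (\<Sum>i \<in> I. a i) = (\<Sum>i \<in> I. f \<otimes>\<^bsub>group_ring G\<^esub> a i)"
  by (induction I rule: infinite_finite_induct)
     (simp_all add: group_ring_mult_add_left group_ring_mult_add_right)

lemma poly_mapping_sum_single: "(\<Sum>x \<in> keys f. single x (lookup f x)) = f"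
  by (rule poly_mapping_eqI) (auto simp: lookup_sum lookup_single when_def in_keys_iff)

lemma lookup_group_ring_mult:
  "lookup (f \<otimes>\<^bsub>group_ring G\<^esub> g) z =
    (\<Sum>x \<in> keys f. \<Sum>y \<in> keys g. if x \<otimes>\<^bsub>G\<^esub> y = z then lookup f x * lookup g y else 0)"
  by (simp add: group_ring_def lookup_sum lookup_single when_def)

lemma group_ring_abelian_group: "abelian_group (group_ring G)"
proof (rule abelian_groupI)
  fix x assume "x \<in> carrier (group_ring G)"
  then show "\<exists>y \<in> carrier (group_ring G). y \<oplus>\<^bsub>group_ring G\<^esub> x = \<zero>\<^bsub>group_ring G\<^esub>"
    by (intro bexI[of _ "- x"]) simp_all
next
  fix x y assume "x \<in> carrier (group_ring G)" "y \<in> carrier (group_ring G)"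
  then show "x \<oplus>\<^bsub>group_ring G\<^esub> y \<in> carrier (group_ring G)" using Poly_Mapping.keys_add[of x y] by auto
qed (simp_all add: add.assoc add.commute)

lemma group_ring_mult_closed:
  assumes "group G" "keys f \<subseteq> carrier G" "keys g \<subseteq> carrier G"
  shows "keys (f \<otimes>\<^bsub>group_ring G\<^esub> g) \<subseteq> carrier G"
proof
  fix z assume "z \<in> keys (f \<otimes>\<^bsub>group_ring G\<^esub> g)"
  then have "lookup (f \<otimes>\<^bsub>group_ring G\<^esub> g) z \<noteq> 0" by (simp add: in_keys_iff)
  then obtain x where x: "x \<in> keys f" "(\<Sum>y \<in> keys g. if x \<otimes>\<^bsub>G\<^esub> y = z then lookup f x * lookup g y else 0) \<noteq> 0"
    unfolding lookup_group_ring_mult by (rule sum.not_neutral_contains_not_neutral)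
  then obtain y where "y \<in> keys g" "x \<otimes>\<^bsub>G\<^esub> y = z"
    by (rule_tac sum.not_neutral_contains_not_neutral[OF x(2)]) (auto split: if_splits)
  then show "z \<in> carrier G"
    using assms x(1) monoid.m_closed[OF group.is_monoid[OF assms(1)], of x y] by (auto simp: subset_iff)
qed

lemma group_ring_ring:
  assumes G: "group G" shows "ring (group_ring G)"
proof -
  interpret group G by (rule G)
  have assoc: "f \<otimes>\<^bsub>group_ring G\<^esub> g \<otimes>\<^bsub>group_ring G\<^esub> h = f \<otimes>\<^bsub>group_ring G\<^esub> (g \<otimes>\<^bsub>group_ring G\<^esub> h)"
    if "keys f \<subseteq> carrier G" "keys g \<subseteq> carrier G" "keys h \<subseteq> carrier G" for f g h
  proof -
    let ?s = "\<lambda>f x. single x (lookup f x)"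
    have s: "?s f x \<otimes>\<^bsub>group_ring G\<^esub> ?s g y \<otimes>\<^bsub>group_ring G\<^esub> ?s h z =
        ?s f x \<otimes>\<^bsub>group_ring G\<^esub> (?s g y \<otimes>\<^bsub>group_ring G\<^esub> ?s h z)"
      if "x \<in> keys f" "y \<in> keys g" "z \<in> keys h" for x y z
      using that \<open>keys f \<subseteq> carrier G\<close> \<open>keys g \<subseteq> carrier G\<close> \<open>keys h \<subseteq> carrier G\<close>
      by (simp add: group_ring_mult_single m_assoc subset_iff mult.assoc)
    have "(\<Sum>x\<in>keys f. ?s f x) \<otimes>\<^bsub>group_ring G\<^esub> (\<Sum>y\<in>keys g. ?s g y) \<otimes>\<^bsub>group_ring G\<^esub> (\<Sum>z\<in>keys h. ?s h z) =
        (\<Sum>x\<in>keys f. ?s f x) \<otimes>\<^bsub>group_ring G\<^esub> ((\<Sum>y\<in>keys g. ?s g y) \<otimes>\<^bsub>group_ring G\<^esub> (\<Sum>z\<in>keys h. ?s h z))"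
      by (simp add: group_ring_mult_sum s)
    then show ?thesis unfolding poly_mapping_sum_single .
  qed
  have one: "frag_of \<one>\<^bsub>G\<^esub> \<otimes>\<^bsub>group_ring G\<^esub> f = f \<and> f \<otimes>\<^bsub>group_ring G\<^esub> frag_of \<one>\<^bsub>G\<^esub> = f"
    if "keys f \<subseteq> carrier G" for f
  proof -
    have "frag_of \<one>\<^bsub>G\<^esub> \<otimes>\<^bsub>group_ring G\<^esub> (\<Sum>x\<in>keys f. single x (lookup f x)) = (\<Sum>x\<in>keys f. single x (lookup f x))"
      unfolding group_ring_mult_sum
      using that by (intro sum.cong) (auto simp: group_ring_mult_single subset_iff)
    moreover have "(\<Sum>x\<in>keys f. single x (lookup f x)) \<otimes>\<^bsub>group_ring G\<^esub> frag_of \<one>\<^bsub>G\<^esub> = (\<Sum>x\<in>keys f. single x (lookup f x))"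
      unfolding group_ring_mult_sum
      using that by (intro sum.cong) (auto simp: group_ring_mult_single subset_iff)
    ultimately show ?thesis unfolding poly_mapping_sum_single by blast
  qed
  show ?thesis
  proof (rule ringI[OF group_ring_abelian_group])
    show "monoid (group_ring G)"
      by (rule monoidI) (use assoc one group_ring_mult_closed[OF G] in \<open>auto\<close>)
  qed (simp_all add: group_ring_mult_add_left group_ring_mult_add_right)
qed

definition additive_on :: "('a, 'm) ring_scheme \<Rightarrow> ('a \<Rightarrow> int) \<Rightarrow> bool" where
  "additive_on R e \<longleftrightarrow> (\<forall>x \<in> carrier R. \<forall>y \<in> carrier R. e (x \<oplus>\<^bsub>R\<^esub> y) = e x + e y)"

lemma additive_on_add_pow:
  assumes R: "abelian_group R" and e: "additive_on R e" and x: "x \<in> carrier R"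
  shows "e (add_pow R (k :: int) x) = k * e x"
proof -
  interpret abelian_group R by (rule R)
  have z: "e \<zero>\<^bsub>R\<^esub> = 0" using e unfolding additive_on_def by (metis add.l_cancel_one' add_cancel_left_left zero_closed l_zero)
  have nat: "e (add_pow R (n :: nat) x) = int n * e x" for n
  proof (induction n)
    case (Suc n)
    then show ?case using e x by (simp add: additive_on_def algebra_simps)
  qed (simp add: z)
  have cl: "add_pow R (n :: nat) x \<in> carrier R" for n
    using add.nat_pow_closed[OF x] by (simp add: add_pow_def)
  have m: "e (\<ominus>\<^bsub>R\<^esub> y) = - e y" if "y \<in> carrier R" for y
  proof -
    have "e y + e (\<ominus>\<^bsub>R\<^esub> y) = e (y \<oplus>\<^bsub>R\<^esub> \<ominus>\<^bsub>R\<^esub> y)" using e that by (simp add: additive_on_def)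
    then show ?thesis using z that by (simp add: r_neg)
  qed
  show ?thesis
  proof (cases "k < 0")
    case True
    then have "add_pow R k x = \<ominus>\<^bsub>R\<^esub> (add_pow R (nat (- k)) x)"
      unfolding add_pow_def a_inv_def by (simp only: int_pow_def2 if_True)
    then have "e (add_pow R k x) = - e (add_pow R (nat (- k)) x)" by (simp only: m[OF cl])
    also have "\<dots> = k * e x" unfolding nat using True by simp
    finally show ?thesis .
  next
    case False
    then have "add_pow R k x = add_pow R (nat k) x" unfolding add_pow_def by (simp only: int_pow_def2 if_False)
    then have "e (add_pow R k x) = e (add_pow R (nat k) x)" by (simp only:)
    also have "\<dots> = k * e x" unfolding nat using False by simp
    finally show ?thesis .
  qed
qed

lemma additive_on_finsum:
  assumes R: "abelian_group R" and e: "additive_on R e" and "finite I" "\<And>i. i \<in> I \<Longrightarrow> F i \<in> carrier R"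
  shows "e (\<Oplus>\<^bsub>R\<^esub>i \<in> I. F i) = (\<Sum>i \<in> I. e (F i))"
proof -
  interpret abelian_group R by (rule R)
  have z: "e \<zero>\<^bsub>R\<^esub> = 0" using e unfolding additive_on_def by (metis add_cancel_left_left zero_closed l_zero)
  show ?thesis
    using assms(3,4)
  proof (induction I rule: finite_induct)
    case (insert i I)
    then have "(\<Oplus>\<^bsub>R\<^esub>i \<in> insert i I. F i) = F i \<oplus>\<^bsub>R\<^esub> (\<Oplus>\<^bsub>R\<^esub>i \<in> I. F i)" by (intro finsum_insert) auto
    then show ?case using insert e finsum_closed[of F I] unfolding additive_on_def by (auto simp: Pi_def)
  qed (simp add: z)
qed

text \<open>Evaluates the definite description in \<open>coords\<close> by a separating family of
  additive functionals \<open>e s\<close>. Those at \<open>t i\<close> are dual to the family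
  \<open>b\<close>, which gives uniqueness; the last assumption on \<open>x\<close> says that all
  functionals see it as the expected combination, which gives existence.\<close>

lemma lookup_coords:
  fixes b :: "'i \<Rightarrow> 'a" and e :: "'t \<Rightarrow> 'a \<Rightarrow> int" and t :: "'i \<Rightarrow> 't"
  assumes R: "abelian_group R"
    and e: "\<And>s. s \<in> T \<Longrightarrow> additive_on R (e s)"
    and sep: "\<And>x y. x \<in> carrier R \<Longrightarrow> y \<in> carrier R \<Longrightarrow> (\<And>s. s \<in> T \<Longrightarrow> e s x = e s y) \<Longrightarrow> x = y"
    and I: "finite I" and b: "\<And>i. i \<in> I \<Longrightarrow> b i \<in> carrier R"
    and t: "\<And>i. i \<in> I \<Longrightarrow> t i \<in> T" "\<And>i j. i \<in> I \<Longrightarrow> j \<in> I \<Longrightarrow> e (t i) (b j) = (if i = j then 1 else 0)"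
    and x: "x \<in> carrier R" "\<And>s. s \<in> T \<Longrightarrow> e s x = (\<Sum>j \<in> I. e (t j) x * e s (b j))"
    and i: "i \<in> I"
  shows "lookup (coords R I b x) i = e (t i) x"
proof -
  interpret abelian_group R by (rule R)
  let ?rep = "\<lambda>a. \<Oplus>\<^bsub>R\<^esub>i \<in> keys a. add_pow R (lookup a i) (b i)"
  have pw: "add_pow R (k :: int) (b i) \<in> carrier R" if "i \<in> I" for i k
    using b[OF that] add.int_pow_closed by (simp add: add_pow_def)
  have closed: "?rep a \<in> carrier R" if "keys a \<subseteq> I" for a :: "'i \<Rightarrow>\<^sub>0 int"
    using that pw by (intro finsum_closed) auto
  have erep: "e s (?rep a) = (\<Sum>j \<in> I. lookup a j * e s (b j))" if "keys a \<subseteq> I" "s \<in> T" for a s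
  proof -
    have "e s (?rep a) = (\<Sum>j \<in> keys a. e s (add_pow R (lookup a j) (b j)))"
      using that pw by (intro additive_on_finsum[OF R e]) auto
    also have "\<dots> = (\<Sum>j \<in> keys a. lookup a j * e s (b j))"
      using that b by (intro sum.cong HOL.refl additive_on_add_pow[OF R e]) auto
    also have "\<dots> = (\<Sum>j \<in> I. lookup a j * e s (b j))"
      using that I by (intro sum.mono_neutral_left) (auto simp: in_keys_iff)
    finally show ?thesis .
  qed
  have lk: "lookup a j = e (t j) (?rep a)" if "keys a \<subseteq> I" "j \<in> I" for a j
  proof -
    have "e (t j) (?rep a) = (\<Sum>k \<in> I. lookup a k * (if j = k then 1 else 0))"
      unfolding erep[OF that(1) t(1)[OF that(2)]] using t(2)[OF that(2)] by (intro sum.cong) auto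
    also have "\<dots> = lookup a j" using I that(2) by (simp add: if_distrib cong: if_cong)
    finally show ?thesis by simp
  qed
  define a where "a = (\<Sum>j \<in> I. single j (e (t j) x))"
  have la: "lookup a j = (if j \<in> I then e (t j) x else 0)" for j
    using I by (simp add: a_def lookup_sum lookup_single when_def)
  have ka: "keys a \<subseteq> I" by (auto simp: in_keys_iff la split: if_splits)
  have "e s x = e s (?rep a)" if "s \<in> T" for s
    unfolding erep[OF ka that] x(2)[OF that] by (intro sum.cong) (simp_all add: la)
  then have "x = ?rep a" by (rule sep[OF x(1) closed[OF ka]])
  moreover have "a' = a" if "keys a' \<subseteq> I \<and> x = ?rep a'" for a'
  proof (rule poly_mapping_eqI)
    fix j
    show "lookup a' j = lookup a j"
    proof (cases "j \<in> I")
      case True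
      then show ?thesis using lk[of a' j] that la by simp
    next
      case False
      then show ?thesis using that la by (auto simp: in_keys_iff)
    qed
  qed
  ultimately have "coords R I b x = a" unfolding coords_def using ka by (intro the_equality) blast+
  then show ?thesis using la i by simp
qed

lemma finite_fits: "finite (Par \<inter> fits n)"
proof -
  have "Par \<inter> fits n \<subseteq> (\<Union>k \<le> n. partitions_of k)" by (auto simp: fits_def partitions_of_def)
  then show ?thesis by (rule finite_subset) simp
qed

section \<open>Structure constants of the Farahat--Higman ring\<close>

lemma finite_sym_group: "finite (carrier (sym_group n))"
  using finite_permutations[of "{1..n}"] by (simp add: sym_group_def)

lemma lookup_class_sum:
  "lookup (class_sum n \<kappa>) \<sigma> = (if \<sigma> permutes {1..n} \<and> mct \<sigma> = \<kappa> then 1 else 0)"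
proof -
  have "finite {\<sigma> \<in> carrier (sym_group n). mct \<sigma> = \<kappa>}" using finite_sym_group by simp
  then show ?thesis unfolding class_sum_def by (simp add: lookup_sum sym_group_carrier)
qed

lemma sum_of_bool_card: "finite A \<Longrightarrow> (\<Sum>x \<in> A. if P x then 1 else 0 :: int) = int (card {x \<in> A. P x})"
  by (simp flip: sum.inter_filter)

lemma lookup_class_sum_mult:
  "lookup (class_sum n \<kappa> \<otimes>\<^bsub>group_ring (sym_group n)\<^esub> class_sum n \<mu>) w =
    int (card {(u, v). u permutes {1..n} \<and> v permutes {1..n} \<and> mct u = \<kappa> \<and> mct v = \<mu> \<and> u \<circ> v = w})"
proof -
  let ?S = "{p. p permutes {1..n}}"
  have fin: "finite ?S" by (rule finite_permutations) simp
  have k: "keys (class_sum n \<kappa>) \<subseteq> ?S" for \<kappa> by (auto simp: in_keys_iff lookup_class_sum split: if_splits)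
  have "class_sum n \<kappa> \<otimes>\<^bsub>group_ring (sym_group n)\<^esub> class_sum n \<mu> =
    (\<Sum>u \<in> ?S. \<Sum>v \<in> ?S. single (u \<circ> v) (lookup (class_sum n \<kappa>) u * lookup (class_sum n \<mu>) v))"
    unfolding group_ring_mult_superset[OF fin k[of \<kappa>] fin k[of \<mu>]] sym_group_mult by (rule HOL.refl)
  then have "lookup (class_sum n \<kappa> \<otimes>\<^bsub>group_ring (sym_group n)\<^esub> class_sum n \<mu>) w =
    (\<Sum>u \<in> ?S. \<Sum>v \<in> ?S. if mct u = \<kappa> \<and> mct v = \<mu> \<and> u \<circ> v = w then 1 else 0)"
    by (simp add: lookup_sum lookup_single when_def lookup_class_sum cong: sum.cong)
       (intro sum.cong; simp)
  also have "\<dots> = (\<Sum>(u, v) \<in> ?S \<times> ?S. if mct u = \<kappa> \<and> mct v = \<mu> \<and> u \<circ> v = w then 1 else 0)"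
    by (simp add: sum.cartesian_product)
  also have "\<dots> = (\<Sum>p \<in> ?S \<times> ?S. if mct (fst p) = \<kappa> \<and> mct (snd p) = \<mu> \<and> fst p \<circ> snd p = w then 1 else 0)"
    by (simp add: split_def)
  also have "\<dots> = int (card {p \<in> ?S \<times> ?S. mct (fst p) = \<kappa> \<and> mct (snd p) = \<mu> \<and> fst p \<circ> snd p = w})"
    using fin by (intro sum_of_bool_card) simp
  also have "{p \<in> ?S \<times> ?S. mct (fst p) = \<kappa> \<and> mct (snd p) = \<mu> \<and> fst p \<circ> snd p = w} =
    {(u, v). u permutes {1..n} \<and> v permutes {1..n} \<and> mct u = \<kappa> \<and> mct v = \<mu> \<and> u \<circ> v = w}" by auto
  finally show ?thesis .
qed

text \<open>Here \<open>n\<close> drops out: the factors of a minimal product stay inside the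
  support of \<open>w\<close>.\<close>

lemma card_factorizations_permutes:
  assumes w: "w permutes {1..n}" and deg: "nrm w = \<Sum>\<^sub># \<kappa> + \<Sum>\<^sub># \<mu>"
  shows "{(u, v). u permutes {1..n} \<and> v permutes {1..n} \<and> mct u = \<kappa> \<and> mct v = \<mu> \<and> u \<circ> v = w} =
    factorizations \<kappa> \<mu> w"
proof (intro equalityI subsetI)
  fix x assume "x \<in> {(u, v). u permutes {1..n} \<and> v permutes {1..n} \<and> mct u = \<kappa> \<and> mct v = \<mu> \<and> u \<circ> v = w}"
  then show "x \<in> factorizations \<kappa> \<mu> w" using permutation_permutes by (fastforce simp: factorizations_def)
next
  fix x assume x: "x \<in> factorizations \<kappa> \<mu> w"
  obtain u v where uv: "x = (u, v)" by (cases x)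
  have "permutation w" using w permutation_permutes by blast
  then have "u permutes {x. w x \<noteq> x}" "v permutes {x. w x \<noteq> x}"
    using finite_factorizations(2)[of w \<kappa> \<mu> u v] deg x uv by blast+
  moreover have "{x. w x \<noteq> x} \<subseteq> {1..n}" using w by (auto simp: permutes_def)
  ultimately show "x \<in> {(u, v). u permutes {1..n} \<and> v permutes {1..n} \<and> mct u = \<kappa> \<and> mct v = \<mu> \<and> u \<circ> v = w}"
    using x uv permutes_subset by (fastforce simp: factorizations_def)
qed

text \<open>No condition on degrees is imposed, because the terms of lower degree must be expanded
  in class sums as well.\<close>

lemma class_product_conj:
  assumes w: "w permutes {1..n}" and w': "w' permutes {1..n}" and same: "mct w = mct w'"
  shows "card {(u, v). u permutes {1..n} \<and> v permutes {1..n} \<and> mct u = \<kappa> \<and> mct v = \<mu> \<and> u \<circ> v = w} \<le>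
    card {(u, v). u permutes {1..n} \<and> v permutes {1..n} \<and> mct u = \<kappa> \<and> mct v = \<mu> \<and> u \<circ> v = w'}"
    (is "card (?F w) \<le> card (?F w')")
proof -
  obtain \<pi> where \<pi>: "\<pi> permutes {1..n}" "w' = \<pi> \<circ> w \<circ> inv' \<pi>"
    using conjugate_if_same_type[OF w w' _ same] by auto
  have b: "bij \<pi>" using \<pi>(1) by (rule permutes_bij)
  let ?f = "\<lambda>(u, v). (\<pi> \<circ> u \<circ> inv' \<pi>, \<pi> \<circ> v \<circ> inv' \<pi>)"
  have "?F w' \<subseteq> {p. p permutes {1..n}} \<times> {p. p permutes {1..n}}" by auto
  then have fin: "finite (?F w')" by (rule finite_subset) (simp add: finite_permutations)
  have "inj_on ?f (?F w)"
    by (rule inj_on_inverseI[where g = "\<lambda>(u, v). (inv' \<pi> \<circ> u \<circ> \<pi>, inv' \<pi> \<circ> v \<circ> \<pi>)"])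
       (auto simp: inv_conj_conj[OF b])
  moreover have "?f ` ?F w \<subseteq> ?F w'"
  proof (rule image_subsetI)
    fix x assume "x \<in> ?F w"
    then obtain u v where x: "x = (u, v)" "u permutes {1..n}" "v permutes {1..n}" "mct u = \<kappa>" "mct v = \<mu>" "u \<circ> v = w"
      by blast
    have "(\<pi> \<circ> u \<circ> inv' \<pi>) \<circ> (\<pi> \<circ> v \<circ> inv' \<pi>) = w'"
      unfolding \<pi>(2) x(6)[symmetric] using b by (auto simp: fun_eq_iff bij_is_inj)
    moreover have "\<pi> \<circ> u \<circ> inv' \<pi> permutes {1..n}" "\<pi> \<circ> v \<circ> inv' \<pi> permutes {1..n}"
      using x \<pi>(1) by (auto intro!: permutes_compose permutes_inv)
    moreover have "permutation u" "permutation v" using x permutation_permutes by blast+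
    moreover have "mct (\<pi> \<circ> u \<circ> inv' \<pi>) = \<kappa>" "mct (\<pi> \<circ> v \<circ> inv' \<pi>) = \<mu>"
      using x b \<open>permutation u\<close> \<open>permutation v\<close> by (simp_all add: mct_conj)
    ultimately show "?f x \<in> ?F w'" unfolding x(1) by (simp add: comp_def)
  qed
  ultimately show ?thesis using fin by (rule card_inj_on_le)
qed

lemma FH_coeff_eq:
  assumes "\<nu> \<in> Par" "\<Sum>\<^sub># \<nu> = \<Sum>\<^sub># \<kappa> + \<Sum>\<^sub># \<mu>"
  shows "FH_coeff \<kappa> \<mu> \<nu> = int (factor_count \<kappa> \<mu> \<nu>)"
proof -
  have main: "lookup (coords (group_ring (sym_group n)) (Par \<inter> fits n) (class_sum n)
         (class_sum n \<kappa> \<otimes>\<^bsub>group_ring (sym_group n)\<^esub> class_sum n \<mu>)) \<nu> = int (factor_count \<kappa> \<mu> \<nu>)"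
    if n: "n \<ge> \<Sum>\<^sub># \<nu> + size \<nu>" for n
  proof -
    let ?x = "class_sum n \<kappa> \<otimes>\<^bsub>group_ring (sym_group n)\<^esub> class_sum n \<mu>"
    have "\<forall>\<rho> \<in> Par \<inter> fits n. \<exists>w. w permutes {1..n} \<and> mct w = \<rho>"
      using exists_permutes_of_type by (fastforce simp: fits_def)
    then obtain t where t: "\<And>\<rho>. \<rho> \<in> Par \<inter> fits n \<Longrightarrow> t \<rho> permutes {1..n} \<and> mct (t \<rho>) = \<rho>" by metis
    have kc: "keys (class_sum n \<kappa>) \<subseteq> carrier (sym_group n)" for \<kappa>
      by (auto simp: in_keys_iff lookup_class_sum sym_group_carrier split: if_splits)
    have \<nu>: "\<nu> \<in> Par \<inter> fits n" using assms n by (simp add: fits_def)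
    have "lookup (coords (group_ring (sym_group n)) (Par \<inter> fits n) (class_sum n) ?x) \<nu> = lookup ?x (t \<nu>)"
    proof (rule lookup_coords[where e = "\<lambda>s f. lookup f s" and T = "carrier (sym_group n)"])
      show "abelian_group (group_ring (sym_group n))" by (rule group_ring_abelian_group)
      show "additive_on (group_ring (sym_group n)) (\<lambda>f. lookup f s)" for s
        by (simp add: additive_on_def lookup_add)
      show "x = y" if "x \<in> carrier (group_ring (sym_group n))" "y \<in> carrier (group_ring (sym_group n))"
        "\<And>s. s \<in> carrier (sym_group n) \<Longrightarrow> lookup x s = lookup y s" for x y
      proof (rule poly_mapping_eqI)
        fix s show "lookup x s = lookup y s" using that
          by (cases "s \<in> carrier (sym_group n)") (simp_all add: in_keys_iff subset_iff, metis)
      qed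
      show "finite (Par \<inter> fits n)" by (rule finite_fits)
      show "class_sum n i \<in> carrier (group_ring (sym_group n))" for i using kc by simp
      show "t i \<in> carrier (sym_group n)" if "i \<in> Par \<inter> fits n" for i using t[OF that] by (simp add: sym_group_carrier)
      show "lookup (class_sum n j) (t i) = (if i = j then 1 else 0)" if "i \<in> Par \<inter> fits n" "j \<in> Par \<inter> fits n" for i j
        using t[OF that(1)] by (simp add: lookup_class_sum)
      show "?x \<in> carrier (group_ring (sym_group n))"
        using group_ring_mult_closed[OF sym_group_is_group kc kc] by simp
      show "lookup ?x s = (\<Sum>j \<in> Par \<inter> fits n. lookup ?x (t j) * lookup (class_sum n j) s)" if "s \<in> carrier (sym_group n)" for s
      proof -
        have s: "s permutes {1..n}" using that by (simp add: sym_group_carrier)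
        have "permutation s" using s permutation_permutes by blast
        then have m: "mct s \<in> Par \<inter> fits n" using modified_cycle_type_Par mct_fits[OF s] by (simp add: fits_def)
        have "(\<Sum>j \<in> Par \<inter> fits n. lookup ?x (t j) * lookup (class_sum n j) s) =
            (\<Sum>j \<in> Par \<inter> fits n. if mct s = j then lookup ?x (t j) else 0)"
          using s by (intro sum.cong) (auto simp: lookup_class_sum)
        also have "\<dots> = lookup ?x (t (mct s))" using m finite_fits by simp
        also have "\<dots> = lookup ?x s"
          using t[OF m] s class_product_conj[of s n "t (mct s)" \<kappa> \<mu>] class_product_conj[of "t (mct s)" n s \<kappa> \<mu>]
          by (simp add: lookup_class_sum_mult)
        finally show ?thesis by simp
      qed
      show "\<nu> \<in> Par \<inter> fits n" by (rule \<nu>)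
    qed
    also have "\<dots> = int (factor_count \<kappa> \<mu> \<nu>)"
    proof -
      have "t \<nu> permutes {1..n}" "mct (t \<nu>) = \<nu>" using t[OF \<nu>] by blast+
      moreover from this have "permutation (t \<nu>)" using permutation_permutes by blast
      ultimately show ?thesis
        using card_factorizations_permutes[of "t \<nu>" n \<kappa> \<mu>] card_factorizations[of "t \<nu>" \<nu> \<kappa> \<mu>] assms(2)
        by (simp add: lookup_class_sum_mult nrm_def)
    qed
    finally show ?thesis .
  qed
  show ?thesis
    unfolding FH_coeff_def by (rule the_equality) (use main in blast)+
qed

section \<open>Structure constants of the spin ring\<close>

abbreviation spin_z :: "nat \<Rightarrow> spin_gen list set" where
  "spin_z n \<equiv> spin_class n [SpinZ]"

abbreviation (input) spin_neg :: "nat \<Rightarrow> spin_gen list set \<Rightarrow> spin_gen list set" where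
  "spin_neg n A \<equiv> spin_z n \<otimes>\<^bsub>spin_group n\<^esub> A"

lemma spin_z_carrier: "spin_z n \<in> carrier (spin_group n)"
  by auto

lemma spin_z_mult:
  assumes "A \<in> carrier (spin_group n)"
  shows "spin_neg n A \<in> carrier (spin_group n)"
    "spin_op (spin_neg n A) = - spin_op A"
    "spin_neg n (spin_neg n A) = A"
    "spin_neg n A \<noteq> A"
proof -
  note m = spin_op_uminus
  show c: "spin_neg n A \<in> carrier (spin_group n)"
    and o: "spin_op (spin_neg n A) = - spin_op A" using m[OF assms] by blast+
  show "spin_neg n (spin_neg n A) = A"
    using spin_op_inj[OF m(1)[OF c] assms] m(2)[OF c] o by simp
  show "spin_neg n A \<noteq> A"
    using spin_op_lifts[OF assms] lifts_neq_uminus o by metis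
qed

lemma spin_z_central:
  assumes "A \<in> carrier (spin_group n)" "B \<in> carrier (spin_group n)"
  shows "A \<otimes>\<^bsub>spin_group n\<^esub> (spin_neg n B) = spin_neg n (A \<otimes>\<^bsub>spin_group n\<^esub> B)"
    "(spin_neg n A) \<otimes>\<^bsub>spin_group n\<^esub> B = spin_neg n (A \<otimes>\<^bsub>spin_group n\<^esub> B)"
proof -
  note c = spin_z_mult(1)[OF assms(1)] spin_z_mult(1)[OF assms(2)] spin_mult_closed[OF assms]
  note c2 = spin_z_mult(1)[OF c(3)]
  show "A \<otimes>\<^bsub>spin_group n\<^esub> (spin_neg n B) = spin_neg n (A \<otimes>\<^bsub>spin_group n\<^esub> B)"
    using spin_op_inj[OF spin_mult_closed[OF assms(1) c(2)] c2]
      spin_op_mult[OF assms(1) c(2)] spin_z_mult(2)[OF assms(2)] spin_z_mult(2)[OF c(3)] spin_op_mult[OF assms] by simp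
  show "(spin_neg n A) \<otimes>\<^bsub>spin_group n\<^esub> B = spin_neg n (A \<otimes>\<^bsub>spin_group n\<^esub> B)"
    using spin_op_inj[OF spin_mult_closed[OF c(1) assms(2)] c2]
      spin_op_mult[OF c(1) assms(2)] spin_z_mult(2)[OF assms(1)] spin_z_mult(2)[OF c(3)] spin_op_mult[OF assms] by simp
qed

lemma lookup_group_ring_mult_inv:
  assumes G: "group G" and f: "keys f \<subseteq> carrier G" and g: "keys g \<subseteq> carrier G" and z: "z \<in> carrier G"
  shows "lookup (f \<otimes>\<^bsub>group_ring G\<^esub> g) z = (\<Sum>x \<in> keys f. lookup f x * lookup g (inv\<^bsub>G\<^esub> x \<otimes>\<^bsub>G\<^esub> z))"
    "lookup (f \<otimes>\<^bsub>group_ring G\<^esub> g) z = (\<Sum>y \<in> keys g. lookup f (z \<otimes>\<^bsub>G\<^esub> inv\<^bsub>G\<^esub> y) * lookup g y)"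
proof -
  interpret group G by (rule G)
  have "(\<Sum>y \<in> keys g. if x \<otimes>\<^bsub>G\<^esub> y = z then lookup f x * lookup g y else 0) = lookup f x * lookup g (inv\<^bsub>G\<^esub> x \<otimes>\<^bsub>G\<^esub> z)"
    if "x \<in> keys f" for x
  proof -
    have x: "x \<in> carrier G" using that f by blast
    have "(\<Sum>y \<in> keys g. if x \<otimes>\<^bsub>G\<^esub> y = z then lookup f x * lookup g y else 0) =
        (\<Sum>y \<in> keys g. if y = inv\<^bsub>G\<^esub> x \<otimes>\<^bsub>G\<^esub> z then lookup f x * lookup g y else 0)"
      using x z g by (intro sum.cong) (auto simp: inv_solve_left subset_iff)
    then show ?thesis by (simp add: in_keys_iff)
  qed
  then show "lookup (f \<otimes>\<^bsub>group_ring G\<^esub> g) z = (\<Sum>x \<in> keys f. lookup f x * lookup g (inv\<^bsub>G\<^esub> x \<otimes>\<^bsub>G\<^esub> z))"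
    unfolding lookup_group_ring_mult by (intro sum.cong) auto
  have "(\<Sum>x \<in> keys f. if x \<otimes>\<^bsub>G\<^esub> y = z then lookup f x * lookup g y else 0) = lookup f (z \<otimes>\<^bsub>G\<^esub> inv\<^bsub>G\<^esub> y) * lookup g y"
    if "y \<in> keys g" for y
  proof -
    have y: "y \<in> carrier G" using that g by blast
    have "(\<Sum>x \<in> keys f. if x \<otimes>\<^bsub>G\<^esub> y = z then lookup f x * lookup g y else 0) =
        (\<Sum>x \<in> keys f. if x = z \<otimes>\<^bsub>G\<^esub> inv\<^bsub>G\<^esub> y then lookup f x * lookup g y else 0)"
      using y z f by (intro sum.cong) (auto simp: inv_solve_right subset_iff)
    then show ?thesis by (simp add: in_keys_iff)
  qed
  then show "lookup (f \<otimes>\<^bsub>group_ring G\<^esub> g) z = (\<Sum>y \<in> keys g. lookup f (z \<otimes>\<^bsub>G\<^esub> inv\<^bsub>G\<^esub> y) * lookup g y)"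
    unfolding lookup_group_ring_mult by (subst sum.swap) (intro sum.cong; auto)
qed

text \<open>The multiples of z + 1, described by their coefficients; see
  \<open>spin_ideal_eq\<close>.\<close>

definition z_invariant :: "nat \<Rightarrow> (spin_gen list set \<Rightarrow>\<^sub>0 int) set" where
  "z_invariant n = {f. keys f \<subseteq> carrier (spin_group n) \<and>
     (\<forall>A \<in> carrier (spin_group n). lookup f (spin_neg n A) = lookup f A)}"

lemma z_invariant_ideal: "ideal (z_invariant n) (group_ring (spin_group n))"
proof -
  let ?G = "spin_group n" and ?R = "group_ring (spin_group n)"
  interpret G: group ?G by (rule spin_group_group)
  interpret R: ring ?R by (rule group_ring_ring[OF spin_group_group])
  have inv: "\<ominus>\<^bsub>?R\<^esub> f = - f" if "keys f \<subseteq> carrier ?G" for f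
    using that R.minus_equality[of "- f" f] by simp
  show ?thesis
  proof (rule idealI)
    show "ring ?R" by (rule group_ring_ring[OF spin_group_group])
    show "subgroup (z_invariant n) (add_monoid ?R)"
    proof (rule R.add.subgroupI)
      show "z_invariant n \<subseteq> carrier ?R" by (auto simp: z_invariant_def)
      have "0 \<in> z_invariant n" by (simp add: z_invariant_def)
      then show "z_invariant n \<noteq> {}" by blast
      show "\<ominus>\<^bsub>?R\<^esub> f \<in> z_invariant n" if "f \<in> z_invariant n" for f
        using that inv[of f] by (simp add: z_invariant_def)
      show "f \<oplus>\<^bsub>?R\<^esub> g \<in> z_invariant n" if "f \<in> z_invariant n" "g \<in> z_invariant n" for f g
        using that Poly_Mapping.keys_add[of f g] by (auto simp: z_invariant_def lookup_add simp del: spin_group_sel)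
    qed
  next
    fix a x assume "a \<in> z_invariant n" "x \<in> carrier ?R"
    then have a: "keys a \<subseteq> carrier ?G" "\<And>A. A \<in> carrier ?G \<Longrightarrow> lookup a (spin_neg n A) = lookup a A"
      and x: "keys x \<subseteq> carrier ?G" by (auto simp: z_invariant_def simp del: spin_group_sel)
    have "lookup (x \<otimes>\<^bsub>?R\<^esub> a) (spin_neg n A) = lookup (x \<otimes>\<^bsub>?R\<^esub> a) A" if "A \<in> carrier ?G" for A
      unfolding lookup_group_ring_mult_inv(1)[OF spin_group_group x a(1) that]
        lookup_group_ring_mult_inv(1)[OF spin_group_group x a(1) spin_z_mult(1)[OF that]]
    proof (rule sum.cong[OF HOL.refl])
      fix y assume "y \<in> keys x"
      then have y: "inv\<^bsub>?G\<^esub> y \<in> carrier ?G" using x by (intro G.inv_closed) blast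
      show "lookup x y * lookup a (inv\<^bsub>?G\<^esub> y \<otimes>\<^bsub>?G\<^esub> (spin_neg n A)) = lookup x y * lookup a (inv\<^bsub>?G\<^esub> y \<otimes>\<^bsub>?G\<^esub> A)"
        using spin_z_central(1)[OF y that] a(2)[OF G.m_closed[OF y that]] by simp
    qed
    then show "x \<otimes>\<^bsub>?R\<^esub> a \<in> z_invariant n"
      using group_ring_mult_closed[OF spin_group_group x a(1)] by (simp add: z_invariant_def del: spin_group_sel)
    have "lookup (a \<otimes>\<^bsub>?R\<^esub> x) (spin_neg n A) = lookup (a \<otimes>\<^bsub>?R\<^esub> x) A" if "A \<in> carrier ?G" for A
      unfolding lookup_group_ring_mult_inv(2)[OF spin_group_group a(1) x that]
        lookup_group_ring_mult_inv(2)[OF spin_group_group a(1) x spin_z_mult(1)[OF that]]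
    proof (rule sum.cong[OF HOL.refl])
      fix y assume "y \<in> keys x"
      then have y: "inv\<^bsub>?G\<^esub> y \<in> carrier ?G" using x by (intro G.inv_closed) blast
      show "lookup a (spin_neg n A \<otimes>\<^bsub>?G\<^esub> inv\<^bsub>?G\<^esub> y) * lookup x y = lookup a (A \<otimes>\<^bsub>?G\<^esub> inv\<^bsub>?G\<^esub> y) * lookup x y"
        using spin_z_central(2)[OF that y] a(2)[OF G.m_closed[OF that y]] by simp
    qed
    then show "a \<otimes>\<^bsub>?R\<^esub> x \<in> z_invariant n"
      using group_ring_mult_closed[OF spin_group_group a(1) x] by (simp add: z_invariant_def del: spin_group_sel)
  qed
qed

text \<open>An invariant element is a sum of integer multiples of (1 + z) A over pairs A, zA. The
  induction removes one such pair from the support at a time.\<close>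

lemma spin_ideal_eq: "spin_ideal n = z_invariant n"
proof
  let ?G = "spin_group n" and ?R = "group_ring (spin_group n)"
  let ?g = "frag_of (spin_z n) + frag_of \<one>\<^bsub>?G\<^esub>"
  interpret G: group ?G by (rule spin_group_group)
  interpret R: ring ?R by (rule group_ring_ring[OF spin_group_group])
  have z1: "spin_neg n \<one>\<^bsub>?G\<^esub> = spin_z n" by (rule G.r_one[OF spin_z_carrier])
  have ne: "spin_z n \<noteq> \<one>\<^bsub>?G\<^esub>" using spin_z_mult(4)[OF G.one_closed] z1 by metis
  have kg: "keys ?g \<subseteq> carrier ?G"
    using Poly_Mapping.keys_add[of "frag_of (spin_z n)" "frag_of \<one>\<^bsub>?G\<^esub>"] spin_z_carrier G.one_closed
    by (auto simp del: spin_group_sel)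
  have gz: "spin_neg n A = \<one>\<^bsub>?G\<^esub> \<longleftrightarrow> A = spin_z n" "spin_neg n A = spin_z n \<longleftrightarrow> A = \<one>\<^bsub>?G\<^esub>"
    if "A \<in> carrier ?G" for A
    using spin_z_mult(3)[OF that] spin_z_mult(3)[OF G.one_closed] z1 by metis+
  have "?g \<in> z_invariant n"
    using kg gz by (auto simp: z_invariant_def lookup_add simp del: spin_group_sel)
  then show "spin_ideal n \<subseteq> z_invariant n"
    unfolding spin_ideal_def by (intro R.genideal_minimal z_invariant_ideal) simp
  have I: "ideal (spin_ideal n) ?R" unfolding spin_ideal_def using kg by (intro R.genideal_ideal) simp
  have gI: "?g \<in> spin_ideal n" unfolding spin_ideal_def using kg by (intro R.genideal_self') simp
  interpret I: ideal "spin_ideal n" ?R by (rule I)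
  have step: "single A c + single (spin_neg n A) c \<in> spin_ideal n" if "A \<in> carrier ?G" for A c
  proof -
    have "?g \<otimes>\<^bsub>?R\<^esub> single A c \<in> spin_ideal n" using that by (intro I.I_r_closed gI) simp
    moreover have "?g \<otimes>\<^bsub>?R\<^esub> single A c = single (spin_neg n A) c + single A c"
      using G.l_one[OF that] by (simp add: group_ring_mult_add_left group_ring_mult_single del: spin_group_sel)
    ultimately show ?thesis by (simp add: add.commute)
  qed
  show "z_invariant n \<subseteq> spin_ideal n"
  proof
    fix f assume "f \<in> z_invariant n"
    then show "f \<in> spin_ideal n"
    proof (induction "card (keys f)" arbitrary: f rule: less_induct)
      case less
      show ?case
      proof (cases "f = 0")
        case True
        then show ?thesis using I.zero_closed by simp
      next
        case False
        then obtain A where A: "A \<in> keys f" by (metis all_not_in_conv keys_eq_empty)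
        have f: "keys f \<subseteq> carrier ?G" "\<And>A. A \<in> carrier ?G \<Longrightarrow> lookup f (spin_neg n A) = lookup f A"
          using less.prems by (auto simp: z_invariant_def simp del: spin_group_sel)
        have Ac: "A \<in> carrier ?G" using A f by blast
        define h where "h = single A (lookup f A) + single (spin_neg n A) (lookup f A)"
        have h: "h \<in> spin_ideal n" unfolding h_def by (rule step[OF Ac])
        have lh: "lookup h B = (if B = A \<or> B = spin_neg n A then lookup f A else 0)" for B
          using spin_z_mult(4)[OF Ac] by (auto simp: h_def lookup_add lookup_single when_def)
        have lfh: "lookup (f - h) B = (if B = A \<or> B = spin_neg n A then 0 else lookup f B)" for B
          using f(2)[OF Ac] by (simp add: lookup_minus lh)
        have "keys (f - h) \<subseteq> keys f" by (auto simp: in_keys_iff lfh split: if_splits)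
        moreover have "A \<notin> keys (f - h)" by (simp add: in_keys_iff lfh)
        ultimately have "card (keys (f - h)) < card (keys f)"
          using A by (intro psubset_card_mono) auto
        moreover have "f - h \<in> z_invariant n"
        proof -
          have "f - h = f + (- h)" by simp
          moreover have "h \<in> z_invariant n" using h \<open>spin_ideal n \<subseteq> z_invariant n\<close> by blast
          ultimately show ?thesis using less.prems Poly_Mapping.keys_add[of f "- h"]
            by (auto simp: z_invariant_def lookup_minus simp del: spin_group_sel)
        qed
        ultimately have "f - h \<in> spin_ideal n" using less.hyps by blast
        then have "(f - h) \<oplus>\<^bsub>?R\<^esub> h \<in> spin_ideal n" using h by (rule I.a_closed)
        then show ?thesis by simp
      qed
    qed
  qed
qed

lemma spin_ideal_ideal: "ideal (spin_ideal n) (group_ring (spin_group n))"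
  unfolding spin_ideal_eq by (rule z_invariant_ideal)

lemma spin_ring_ring: "ring (spin_ring n)"
  unfolding spin_ring_def using spin_ideal_ideal by (rule ideal.quotient_is_ring)

abbreviation spin_coset :: "nat \<Rightarrow> (spin_gen list set \<Rightarrow>\<^sub>0 int) \<Rightarrow> (spin_gen list set \<Rightarrow>\<^sub>0 int) set" where
  "spin_coset n f \<equiv> spin_ideal n +>\<^bsub>group_ring (spin_group n)\<^esub> f"

lemma spin_ring_carrier: "carrier (spin_ring n) = spin_coset n ` {f. keys f \<subseteq> carrier (spin_group n)}"
  by (auto simp: spin_ring_def FactRing_def A_RCOSETS_def' simp del: spin_group_sel)

lemma spin_ring_ops:
  assumes "keys f \<subseteq> carrier (spin_group n)" "keys g \<subseteq> carrier (spin_group n)"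
  shows "spin_coset n f \<oplus>\<^bsub>spin_ring n\<^esub> spin_coset n g = spin_coset n (f + g)"
    "spin_coset n f \<otimes>\<^bsub>spin_ring n\<^esub> spin_coset n g = spin_coset n (f \<otimes>\<^bsub>group_ring (spin_group n)\<^esub> g)"
  using ideal.a_rcos_sum[OF spin_ideal_ideal, of f n g] ideal.rcoset_mult_add[OF spin_ideal_ideal, of f n g] assms
  by (simp_all add: spin_ring_def FactRing_def del: spin_group_sel)

text \<open>The coefficient of \<open>A\<close> after z has become -1. It vanishes on
  \<open>z_invariant\<close>, so the chosen representative does not matter.\<close>

definition spin_coeff :: "nat \<Rightarrow> spin_gen list set \<Rightarrow> (spin_gen list set \<Rightarrow>\<^sub>0 int) set \<Rightarrow> int" where
  "spin_coeff n A X = (let f = SOME f. f \<in> X in lookup f A - lookup f (spin_neg n A))"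

lemma spin_coset_mem_iff:
  assumes "keys f \<subseteq> carrier (spin_group n)"
  shows "g \<in> spin_coset n f \<longleftrightarrow> g - f \<in> spin_ideal n"
proof -
  have "g \<in> spin_coset n f \<longleftrightarrow> (\<exists>h \<in> spin_ideal n. g = h + f)" by (simp add: a_r_coset_def')
  also have "\<dots> \<longleftrightarrow> g - f \<in> spin_ideal n" by (metis add_diff_cancel_right' diff_add_cancel)
  finally show ?thesis .
qed

lemma spin_coeff_coset:
  assumes f: "keys f \<subseteq> carrier (spin_group n)" and A: "A \<in> carrier (spin_group n)"
  shows "spin_coeff n A (spin_coset n f) = lookup f A - lookup f (spin_neg n A)"
proof -
  have "f - f \<in> spin_ideal n" unfolding spin_ideal_eq by (simp add: z_invariant_def)
  then have "f \<in> spin_coset n f" using spin_coset_mem_iff[OF f] by blast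
  then have "(SOME g. g \<in> spin_coset n f) \<in> spin_coset n f" by (rule someI)
  then have "(SOME g. g \<in> spin_coset n f) - f \<in> z_invariant n"
    using spin_coset_mem_iff[OF f] unfolding spin_ideal_eq by blast
  then have "lookup (SOME g. g \<in> spin_coset n f) (spin_neg n A) - lookup f (spin_neg n A) =
      lookup (SOME g. g \<in> spin_coset n f) A - lookup f A"
    using A by (simp add: z_invariant_def lookup_minus del: spin_group_sel)
  then show ?thesis unfolding spin_coeff_def Let_def by linarith
qed

lemma spin_coset_eqI:
  assumes f: "keys f \<subseteq> carrier (spin_group n)" and g: "keys g \<subseteq> carrier (spin_group n)"
    and eq: "\<And>A. A \<in> carrier (spin_group n) \<Longrightarrow>
      lookup f A - lookup f (spin_neg n A) = lookup g A - lookup g (spin_neg n A)"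
  shows "spin_coset n f = spin_coset n g"
proof -
  interpret I: ideal "spin_ideal n" "group_ring (spin_group n)" by (rule spin_ideal_ideal)
  have "lookup (g - f) (spin_neg n A) = lookup (g - f) A" if "A \<in> carrier (spin_group n)" for A
    using eq[OF that] by (simp add: lookup_minus)
  moreover have "keys (g - f) \<subseteq> carrier (spin_group n)" using keys_diff[of g f] f g by blast
  ultimately have "g - f \<in> spin_ideal n" unfolding spin_ideal_eq by (simp add: z_invariant_def del: spin_group_sel)
  then have "g \<in> spin_coset n f" using spin_coset_mem_iff[OF f] by blast
  then show ?thesis using f by (intro I.a_repr_independence') simp_all
qed

subsection \<open>The classes in the Clifford algebra\<close>

definition lift_class :: "nat \<Rightarrow> partition \<Rightarrow> clifford set" where
  "lift_class n \<kappa> = {(-1) ^ size \<kappa> * g | p g. p permutes {1..n} \<and> mct p = \<kappa> \<and> canonical_lift (n + 1) p g}"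

lemma minus_one_power_cases: "(-1 :: clifford) ^ k = 1 \<or> (-1 :: clifford) ^ k = -1"
  by (cases "even k") simp_all

lemma spin_op_D_image:
  assumes "\<kappa> \<in> EPar" shows "spin_op ` spin_D n \<kappa> = lift_class n \<kappa>"
proof (intro equalityI subsetI)
  fix x assume "x \<in> spin_op ` spin_D n \<kappa>"
  then show "x \<in> lift_class n \<kappa>" unfolding lift_class_def using spin_D_canonical[OF assms] by blast
next
  fix x assume "x \<in> lift_class n \<kappa>"
  then obtain p g where p: "p permutes {1..n}" "mct p = \<kappa>" "canonical_lift (n + 1) p g" "x = (-1) ^ size \<kappa> * g"
    unfolding lift_class_def by blast
  obtain A where A: "A \<in> carrier (spin_group n)" "spin_op A = g" using canonical_lift_in_spin_group p(1,3) by blast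
  then have "\<exists>B \<in> carrier (spin_group n). spin_op B = x"
    using minus_one_power_cases[of "size \<kappa>"] p(4) spin_z_mult(1,2)[OF A(1)] by (metis mult_1 mult_minus1)
  then show "x \<in> spin_op ` spin_D n \<kappa>" using spin_D_canonical[OF assms] p by blast
qed

lemma lift_class_lifts: "x \<in> lift_class n \<kappa> \<Longrightarrow> \<exists>p. p permutes {1..n} \<and> mct p = \<kappa> \<and> lifts x p 1"
proof -
  assume "x \<in> lift_class n \<kappa>"
  then obtain p g where p: "p permutes {1..n}" "mct p = \<kappa>" "canonical_lift (n + 1) p g" "x = (-1) ^ size \<kappa> * g"
    unfolding lift_class_def by blast
  have "lifts g p 1" using canonical_lift_lifts[OF p(3)] .
  then show ?thesis using minus_one_power_cases[of "size \<kappa>"] p(1,2,4) lifts_uminus by (metis mult_1 mult_minus1)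
qed

text \<open>A permutation determines its type and its canonical lift, hence its element. In
  particular no class contains an element together with its negative.\<close>

lemma lift_class_unique:
  assumes "x \<in> lift_class n \<kappa>" "y \<in> lift_class n \<mu>" "lifts x p e" "lifts y p d"
  shows "\<kappa> = \<mu>" "x = y"
proof -
  obtain q g where q: "mct q = \<kappa>" "canonical_lift (n + 1) q g" "x = (-1) ^ size \<kappa> * g"
    using assms(1) unfolding lift_class_def by blast
  obtain r h where r: "mct r = \<mu>" "canonical_lift (n + 1) r h" "y = (-1) ^ size \<mu> * h"
    using assms(2) unfolding lift_class_def by blast
  have *: "lifts ((-1) ^ k * g) q 1" if "canonical_lift (n + 1) q g" for k q g
    using canonical_lift_lifts[OF that] minus_one_power_cases[of k] lifts_uminus by (metis mult_1 mult_minus1)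
  have "q = p" "r = p" using *[OF q(2)] *[OF r(2)] q(3) r(3) lifts_unique assms(3,4) by metis+
  then show "\<kappa> = \<mu>" "x = y" using q r canonical_lift_unique by auto
qed

lemma finite_lift_class: "finite (lift_class n \<kappa>)"
proof -
  have "inj_on (\<lambda>x. SOME p. lifts x p 1) (lift_class n \<kappa>)"
  proof (rule inj_onI)
    fix x y assume xy: "x \<in> lift_class n \<kappa>" "y \<in> lift_class n \<kappa>" "(SOME p. lifts x p 1) = (SOME p. lifts y p 1)"
    then have "lifts x (SOME p. lifts x p 1) 1" "lifts y (SOME p. lifts y p 1) 1"
      using lift_class_lifts by (metis (mono_tags, lifting) someI_ex)+
    then show "x = y" using lift_class_unique(2) xy by metis
  qed
  moreover have "(\<lambda>x. SOME p. lifts x p 1) ` lift_class n \<kappa> \<subseteq> {p. p permutes {1..n}}"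
  proof (rule image_subsetI)
    fix x assume "x \<in> lift_class n \<kappa>"
    then obtain p where "p permutes {1..n}" "lifts x p 1" using lift_class_lifts by blast
    moreover from this have "(SOME p. lifts x p 1) = p" using lifts_unique by (metis someI)
    ultimately show "(SOME p. lifts x p 1) \<in> {p. p permutes {1..n}}" by simp
  qed
  ultimately show ?thesis using finite_permutations[of "{1..n}"] by (meson finite_atLeastAtMost inj_on_finite)
qed

lemma canonical_lift_conj:
  assumes "canonical_lift b p g" "lifts h \<sigma> e" "\<sigma> b = b"
  shows "\<exists>g'. canonical_lift b (\<sigma> \<circ> p \<circ> inv' \<sigma>) g' \<and> h * g = g' * h"
proof -
  obtain cs where cs: "disjoint_cycles p cs" "\<forall>c \<in> set cs. odd (length c)" "b \<notin> set (concat cs)" "g = cycles_lift b cs"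
    using assms(1) unfolding canonical_lift_def by blast
  have bij: "bij \<sigma>" and e: "e = 1 \<or> e = -1" using assms(2) by (auto simp: lifts_def)
  have "h * cycles_lift b cs = cycles_lift b (map (map \<sigma>) cs) * h"
    using cs(2)
  proof (induction cs)
    case (Cons c cs)
    have "c \<noteq> []" "even (length c + 1)" using Cons.prems by auto
    then have "h * cycle_lift b c = cycle_lift b (map \<sigma> c) * h"
      using cycle_lift_conj[OF assms(2,3), of c] e by (auto simp del: power_Suc)
    then have "h * cycles_lift b (c # cs) = cycle_lift b (map \<sigma> c) * (h * cycles_lift b cs)"
      by (simp add: cycles_lift_def mult.assoc[symmetric])
    then show ?case using Cons by (simp add: cycles_lift_def mult.assoc)
  qed (simp add: cycles_lift_def)
  moreover have "b \<notin> set (concat (map (map \<sigma>) cs))"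
  proof
    assume "b \<in> set (concat (map (map \<sigma>) cs))"
    then obtain c x where "c \<in> set cs" "x \<in> set c" "b = \<sigma> x" by auto
    then have "b \<in> set (concat cs)" using assms(3) bij by (metis bij_is_inj concat.simps(2) injD in_set_conv_decomp concat_append Un_iff set_append)
    then show False using cs(3) by blast
  qed
  ultimately show ?thesis
    unfolding canonical_lift_def using disjoint_cycles_conj[OF cs(1) bij] cs(2,4)
    by (intro exI[of _ "cycles_lift b (map (map \<sigma>) cs)"]) (auto intro!: exI[of _ "map (map \<sigma>) cs"])
qed

lemma lift_class_conj:
  assumes x: "x \<in> lift_class n \<kappa>" and h: "lifts h \<sigma> e" and \<sigma>: "\<sigma> permutes {1..n}"
  shows "\<exists>y \<in> lift_class n \<kappa>. h * x = y * h"
proof -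
  obtain p g where p: "p permutes {1..n}" "mct p = \<kappa>" "canonical_lift (n + 1) p g" "x = (-1) ^ size \<kappa> * g"
    using x unfolding lift_class_def by blast
  have fixb: "\<sigma> (n + 1) = n + 1" using \<sigma> by (simp add: permutes_def)
  obtain g' where g': "canonical_lift (n + 1) (\<sigma> \<circ> p \<circ> inv' \<sigma>) g'" "h * g = g' * h"
    using canonical_lift_conj[OF p(3) h fixb] by blast
  have "\<sigma> \<circ> p \<circ> inv' \<sigma> permutes {1..n}" using p(1) \<sigma> by (auto intro!: permutes_compose permutes_inv)
  moreover have "permutation p" using p(1) permutation_permutes by blast
  then have "mct (\<sigma> \<circ> p \<circ> inv' \<sigma>) = \<kappa>" using mct_conj permutes_bij[OF \<sigma>] p(2) by simp
  ultimately have "(-1) ^ size \<kappa> * g' \<in> lift_class n \<kappa>" unfolding lift_class_def using g'(1) by blast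
  moreover have "h * x = (-1) ^ size \<kappa> * g' * h" using minus_one_power_cases[of "size \<kappa>"] g'(2) p(4) by auto
  ultimately show ?thesis by blast
qed

definition lift_pairs :: "nat \<Rightarrow> partition \<Rightarrow> partition \<Rightarrow> clifford \<Rightarrow> (clifford \<times> clifford) set" where
  "lift_pairs n \<kappa> \<mu> g = {(x, y). x \<in> lift_class n \<kappa> \<and> y \<in> lift_class n \<mu> \<and> x * y = g}"

lemma finite_lift_pairs: "finite (lift_pairs n \<kappa> \<mu> g)"
proof -
  have "lift_pairs n \<kappa> \<mu> g \<subseteq> lift_class n \<kappa> \<times> lift_class n \<mu>" by (auto simp: lift_pairs_def)
  then show ?thesis by (rule finite_subset) (simp add: finite_lift_class)
qed

lemma card_lift_pairs_conj_le:
  assumes h: "lifts h \<sigma> e" and \<sigma>: "\<sigma> permutes {1..n}" and eq: "h * g = g' * h"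
  shows "card (lift_pairs n \<kappa> \<mu> g) \<le> card (lift_pairs n \<kappa> \<mu> g')"
proof -
  obtain k where k: "h * k = 1" "k * h = 1" using h by (auto simp: lifts_def)
  let ?f = "\<lambda>(x, y). (h * x * k, h * y * k)"
  have inj: "inj_on ?f (lift_pairs n \<kappa> \<mu> g)"
  proof (rule inj_on_inverseI[where g = "\<lambda>(x, y). (k * x * h, k * y * h)"])
    have "k * (h * x * k) * h = x" for x using k by (metis mult.assoc mult_1_left mult_1_right)
    then show "(\<lambda>(x, y). (k * x * h, k * y * h)) (?f p) = p" for p by (cases p) simp
  qed
  have cl: "h * x * k \<in> lift_class n \<kappa>" if "x \<in> lift_class n \<kappa>" for x \<kappa>
  proof -
    from lift_class_conj[OF that h \<sigma>] obtain y where "y \<in> lift_class n \<kappa>" "h * x = y * h" by blast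
    then show ?thesis using k by (simp add: mult.assoc)
  qed
  have "?f ` lift_pairs n \<kappa> \<mu> g \<subseteq> lift_pairs n \<kappa> \<mu> g'"
  proof (rule image_subsetI)
    fix p assume "p \<in> lift_pairs n \<kappa> \<mu> g"
    then obtain x y where p: "p = (x, y)" "x \<in> lift_class n \<kappa>" "y \<in> lift_class n \<mu>" "x * y = g"
      by (auto simp: lift_pairs_def)
    have "(h * x * k) * (h * y * k) = h * (x * y) * k" using k by (metis mult.assoc mult_1_left)
    also have "\<dots> = g'" using eq k p(4) by (simp add: mult.assoc)
    finally show "?f p \<in> lift_pairs n \<kappa> \<mu> g'" using p cl by (simp add: lift_pairs_def)
  qed
  then show ?thesis using inj finite_lift_pairs by (metis card_inj_on_le)
qed

lemma lifts_inverse: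
  assumes "lifts h \<sigma> e" "h * k = 1" "k * h = 1" shows "lifts k (inv' \<sigma>) e"
proof -
  have b: "bij \<sigma>" and e: "e = 1 \<or> e = -1" using assms(1) by (auto simp: lifts_def)
  have "k * E i = e *\<^sub>R (E (inv' \<sigma> i) * k)" for i
  proof -
    have "h * E (inv' \<sigma> i) = e *\<^sub>R (E i * h)" using assms(1) b by (simp add: lifts_def bij_is_surj surj_f_inv_f)
    then have "k * (h * E (inv' \<sigma> i)) * k = e *\<^sub>R (k * (E i * h) * k)" by simp
    moreover have "k * (h * E (inv' \<sigma> i)) * k = (k * h) * E (inv' \<sigma> i) * k" "k * (E i * h) * k = k * E i * (h * k)"
      by (simp_all only: mult.assoc)
    ultimately have "E (inv' \<sigma> i) * k = e *\<^sub>R (k * E i)" using assms(2,3) by simp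
    then show ?thesis using e by auto
  qed
  then show ?thesis using assms b e unfolding lifts_def by (auto simp: bij_imp_bij_inv)
qed

lemma card_lift_pairs_conj:
  assumes h: "lifts h \<sigma> e" and \<sigma>: "\<sigma> permutes {1..n}" and eq: "h * g = g' * h"
  shows "card (lift_pairs n \<kappa> \<mu> g) = card (lift_pairs n \<kappa> \<mu> g')"
proof (rule antisym)
  show "card (lift_pairs n \<kappa> \<mu> g) \<le> card (lift_pairs n \<kappa> \<mu> g')" by (rule card_lift_pairs_conj_le[OF assms])
  obtain k where k: "h * k = 1" "k * h = 1" using h by (auto simp: lifts_def)
  have "k * g' = g * k" using eq k by (metis mult.assoc mult_1_left mult_1_right)
  then show "card (lift_pairs n \<kappa> \<mu> g') \<le> card (lift_pairs n \<kappa> \<mu> g)"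
    using card_lift_pairs_conj_le[OF lifts_inverse[OF h k] permutes_inv[OF \<sigma>]] by blast
qed

lemma lift_pairs_odd_sign:
  assumes "lifts g p (-1)" shows "lift_pairs n \<kappa> \<mu> g = {}"
proof (rule ccontr)
  assume "lift_pairs n \<kappa> \<mu> g \<noteq> {}"
  then obtain x y where xy: "x \<in> lift_class n \<kappa>" "y \<in> lift_class n \<mu>" "x * y = g" by (auto simp: lift_pairs_def)
  obtain q r where "lifts x q 1" "lifts y r 1" using lift_class_lifts[OF xy(1)] lift_class_lifts[OF xy(2)] by blast
  then have "lifts g (q \<circ> r) (1 * 1)" unfolding xy(3)[symmetric] by (rule lifts_mult)
  then have "-1 = (1 :: real) * 1" by (rule lifts_sign_unique[OF assms])
  then show False by simp
qed

text \<open>If \<open>g\<close> has parity -1, it is not a product of two elements of the classes,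
  which have parity 1. Otherwise \<open>even_cycle_anticommute\<close> conjugates \<open>g\<close>
  to \<open>- g\<close>. So the two counts cancel in \<open>spin_coeff\<close>.\<close>

lemma card_lift_pairs_not_EPar:
  assumes g: "lifts g p e" and p: "p permutes {1..n}" and "mct p \<notin> EPar"
  shows "card (lift_pairs n \<kappa> \<mu> g) = card (lift_pairs n \<kappa> \<mu> (- g))"
proof (cases "e = -1")
  case True
  then show ?thesis using g lifts_uminus[OF g] lift_pairs_odd_sign by metis
next
  case False
  then have g1: "lifts g p 1" using g by (auto simp: lifts_def)
  have pb: "p (n + 1) = n + 1" "permutation p" using p permutation_permutes by (auto simp: permutes_def)
  obtain h \<sigma> d where h: "lifts h \<sigma> d" "\<forall>x. p x = x \<longrightarrow> \<sigma> x = x" "g * h = - (h * g)"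
    using even_cycle_anticommute[OF g1 pb assms(3)] by blast
  have "bij \<sigma>" using h(1) by (simp add: lifts_def)
  then have "\<sigma> permutes {1..n}"
    using h(2) p by (simp add: permutes_def bij_iff)
  moreover have "h * g = - g * h" using h(3) by simp
  ultimately show ?thesis using card_lift_pairs_conj[OF h(1)] by blast
qed

lemma canonical_lift_exists_permutes:
  assumes "u permutes {1..n}" "mct u \<in> EPar" shows "\<exists>a. canonical_lift (n + 1) u a"
proof (rule canonical_lift_exists)
  show "permutation u" using assms(1) permutation_permutes by blast
  show "u (n + 1) = n + 1" using assms(1) by (simp add: permutes_def)
qed (rule assms(2))

text \<open>Since the canonical lifts of a minimal factorization multiply to the canonical lift of the product,
  only the sign normalizing \<^const>\<open>lift_class\<close> remains.\<close>

lemma card_lift_pairs_minimal: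
  assumes ev: "\<kappa> \<in> EPar" "\<mu> \<in> EPar" and w: "w permutes {1..n}" "nrm w = \<Sum>\<^sub># \<kappa> + \<Sum>\<^sub># \<mu>"
    and g: "canonical_lift (n + 1) w g"
  shows "card (lift_pairs n \<kappa> \<mu> ((-1) ^ (size \<kappa> + size \<mu>) * g)) = card (factorizations \<kappa> \<mu> w)"
    "lift_pairs n \<kappa> \<mu> (- ((-1) ^ (size \<kappa> + size \<mu>) * g)) = {}"
proof -
  let ?s = "(-1 :: clifford) ^ size \<kappa>" and ?t = "(-1 :: clifford) ^ size \<mu>"
  have key: "u \<circ> v = w \<and> a * b = g"
    if "u permutes {1..n}" "v permutes {1..n}" "mct u = \<kappa>" "mct v = \<mu>" "canonical_lift (n + 1) u a" "canonical_lift (n + 1) v b"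
      "(?s * a) * (?t * b) = x" "x = (-1) ^ (size \<kappa> + size \<mu>) * g \<or> x = - ((-1) ^ (size \<kappa> + size \<mu>) * g)" for u v a b x
  proof -
    have "(?s * a) * (?t * b) = (?s * ?t) * (a * b)"
      using minus_one_power_cases[of "size \<kappa>"] minus_one_power_cases[of "size \<mu>"] by auto
    then have "a * b = g \<or> a * b = - g"
      using that(7,8) minus_one_power_cases[of "size \<kappa>"] minus_one_power_cases[of "size \<mu>"] by (auto simp: power_add)
    moreover have ab: "lifts (a * b) (u \<circ> v) (1 * 1)"
      using that canonical_lift_lifts lifts_mult by blast
    moreover have gw: "lifts g w 1" "lifts (- g) w 1" using canonical_lift_lifts[OF g] lifts_uminus by blast+
    \<comment> \<open>The permutation does not see the sign, so the factors lie over
      \<open>w\<close> in either case; minimality then forces \<open>a * b = g\<close>.\<close>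
    ultimately have uv: "u \<circ> v = w" using lifts_unique by metis
    have "nrm (u \<circ> v) = nrm u + nrm v" using uv w(2) that(3,4) by (simp add: nrm_def)
    then have "canonical_lift (n + 1) w (a * b)" using canonical_lift_minimal that(5,6) uv by blast
    then show ?thesis using uv canonical_lift_unique g by blast
  qed
  show "lift_pairs n \<kappa> \<mu> (- ((-1) ^ (size \<kappa> + size \<mu>) * g)) = {}"
  proof (rule ccontr)
    assume "lift_pairs n \<kappa> \<mu> (- ((-1) ^ (size \<kappa> + size \<mu>) * g)) \<noteq> {}"
    then obtain u v a b where uv: "u permutes {1..n}" "v permutes {1..n}" "mct u = \<kappa>" "mct v = \<mu>" "canonical_lift (n + 1) u a" "canonical_lift (n + 1) v b"
      "(?s * a) * (?t * b) = - ((-1) ^ (size \<kappa> + size \<mu>) * g)"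
      unfolding lift_pairs_def lift_class_def by auto
    then have "a * b = g" using key by blast
    then have "(-1) ^ (size \<kappa> + size \<mu>) * g = - ((-1) ^ (size \<kappa> + size \<mu>) * g)"
      using uv(7) minus_one_power_cases[of "size \<kappa>"] minus_one_power_cases[of "size \<mu>"] by (auto simp: power_add)
    then have "g = - g" using minus_one_power_cases[of "size \<kappa> + size \<mu>"] by auto
    then show False using canonical_lift_lifts[OF g] lifts_neq_uminus by blast
  qed
  let ?L = "\<lambda>p. THE a. canonical_lift (n + 1) p a"
  have L: "?L p = a" if "canonical_lift (n + 1) p a" for p a
    using that canonical_lift_unique by blast
  have "bij_betw (\<lambda>(u, v). (?s * ?L u, ?t * ?L v)) (factorizations \<kappa> \<mu> w) (lift_pairs n \<kappa> \<mu> ((-1) ^ (size \<kappa> + size \<mu>) * g))"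
  proof (rule bij_betwI')
    fix p q assume pq: "p \<in> factorizations \<kappa> \<mu> w" "q \<in> factorizations \<kappa> \<mu> w"
    obtain u v u' v' where p: "p = (u, v)" "q = (u', v')" by (cases p, cases q)
    have F: "u permutes {1..n} \<and> v permutes {1..n} \<and> mct u = \<kappa> \<and> mct v = \<mu>" if "(u, v) \<in> factorizations \<kappa> \<mu> w" for u v
      using that unfolding card_factorizations_permutes[OF w, symmetric] by simp
    note ex = canonical_lift_exists_permutes
    obtain a b a' b' where ab: "canonical_lift (n + 1) u a" "canonical_lift (n + 1) v b" "canonical_lift (n + 1) u' a'" "canonical_lift (n + 1) v' b'"
      using F[OF pq(1)[unfolded p(1)]] F[OF pq(2)[unfolded p(2)]] ev
        ex[of u n] ex[of v n] ex[of u' n] ex[of v' n] by (elim conjE exE) (simp, blast)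
    show "((\<lambda>(u, v). (?s * ?L u, ?t * ?L v)) p = (\<lambda>(u, v). (?s * ?L u, ?t * ?L v)) q) = (p = q)"
    proof
      assume "(\<lambda>(u, v). (?s * ?L u, ?t * ?L v)) p = (\<lambda>(u, v). (?s * ?L u, ?t * ?L v)) q"
      then have "?s * a = ?s * a'" "?t * b = ?t * b'" using p L ab by auto
      then have "a = a'" "b = b'"
        using minus_one_power_cases[of "size \<kappa>"] minus_one_power_cases[of "size \<mu>"] by auto
      then have "canonical_lift (n + 1) u' a" "canonical_lift (n + 1) v' b" using ab by blast+
      then have "u = u'" "v = v'"
        using ab(1,2) lifts_unique[OF canonical_lift_lifts canonical_lift_lifts] by blast+
      then show "p = q" using p by simp
    qed simp
  next
    fix p assume "p \<in> factorizations \<kappa> \<mu> w"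
    then obtain u v where p: "p = (u, v)" "u permutes {1..n}" "v permutes {1..n}" "mct u = \<kappa>" "mct v = \<mu>" "u \<circ> v = w"
      using card_factorizations_permutes[OF w, symmetric] by auto
    note ex = canonical_lift_exists_permutes
    obtain a b where ab: "canonical_lift (n + 1) u a" "canonical_lift (n + 1) v b" using p ex ev by metis
    have "nrm (u \<circ> v) = nrm u + nrm v" using p w(2) by (simp add: nrm_def)
    then have "canonical_lift (n + 1) w (a * b)" using canonical_lift_minimal[OF ab] p(6) by simp
    then have "a * b = g" using canonical_lift_unique g by blast
    then have "(?s * a) * (?t * b) = (-1) ^ (size \<kappa> + size \<mu>) * g"
      using minus_one_power_cases[of "size \<kappa>"] minus_one_power_cases[of "size \<mu>"] by (auto simp: power_add)
    then show "(\<lambda>(u, v). (?s * ?L u, ?t * ?L v)) p \<in> lift_pairs n \<kappa> \<mu> ((-1) ^ (size \<kappa> + size \<mu>) * g)"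
      using p ab L unfolding lift_pairs_def lift_class_def by auto
  next
    fix q assume "q \<in> lift_pairs n \<kappa> \<mu> ((-1) ^ (size \<kappa> + size \<mu>) * g)"
    then obtain u v a b where uv: "u permutes {1..n}" "v permutes {1..n}" "mct u = \<kappa>" "mct v = \<mu>" "canonical_lift (n + 1) u a" "canonical_lift (n + 1) v b"
      "(?s * a) * (?t * b) = (-1) ^ (size \<kappa> + size \<mu>) * g" "q = (?s * a, ?t * b)"
      unfolding lift_pairs_def lift_class_def by auto
    then have "u \<circ> v = w" using key by blast
    then have "(u, v) \<in> factorizations \<kappa> \<mu> w" using uv permutation_permutes by (auto simp: factorizations_def)
    moreover have "q = (\<lambda>(u, v). (?s * ?L u, ?t * ?L v)) (u, v)" using uv L by simp
    ultimately show "\<exists>p \<in> factorizations \<kappa> \<mu> w. q = (\<lambda>(u, v). (?s * ?L u, ?t * ?L v)) p" by blast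
  qed
  then show "card (lift_pairs n \<kappa> \<mu> ((-1) ^ (size \<kappa> + size \<mu>) * g)) = card (factorizations \<kappa> \<mu> w)"
    using bij_betw_same_card by metis
qed

lemma spin_D_subset: "spin_D n \<kappa> \<subseteq> carrier (spin_group n)"
  unfolding spin_D_def by blast

lemma finite_spin_D: "\<kappa> \<in> EPar \<Longrightarrow> finite (spin_D n \<kappa>)"
proof -
  assume "\<kappa> \<in> EPar"
  then have "finite (spin_op ` spin_D n \<kappa>)" by (simp add: spin_op_D_image finite_lift_class)
  moreover have "inj_on spin_op (spin_D n \<kappa>)"
    using spin_op_inj[of _ n] spin_D_subset by (intro inj_onI) blast
  ultimately show ?thesis by (rule finite_imageD)
qed

lemma spin_D_iff_lift_class:
  assumes "\<kappa> \<in> EPar" "A \<in> carrier (spin_group n)"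
  shows "A \<in> spin_D n \<kappa> \<longleftrightarrow> spin_op A \<in> lift_class n \<kappa>"
proof
  assume "spin_op A \<in> lift_class n \<kappa>"
  then obtain B where "B \<in> spin_D n \<kappa>" "spin_op A = spin_op B" unfolding spin_op_D_image[OF assms(1), symmetric] by auto
  then show "A \<in> spin_D n \<kappa>" using spin_op_inj[OF assms(2), of B] spin_D_subset by blast
qed (use spin_op_D_image[OF assms(1)] in blast)

lemma lookup_spin_sum:
  "\<kappa> \<in> EPar \<Longrightarrow> lookup (\<Sum>A \<in> spin_D n \<kappa>. frag_of A) B = (if B \<in> spin_D n \<kappa> then 1 else 0)"
  using finite_spin_D by (simp add: lookup_sum)

lemma keys_spin_sum: "\<kappa> \<in> EPar \<Longrightarrow> keys (\<Sum>A \<in> spin_D n \<kappa>. frag_of A) \<subseteq> spin_D n \<kappa>"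
  by (auto simp: in_keys_iff lookup_spin_sum split: if_splits)

lemma lookup_spin_sum_mult:
  assumes ev: "\<kappa> \<in> EPar" "\<mu> \<in> EPar" and A: "A \<in> carrier (spin_group n)"
  shows "lookup ((\<Sum>A \<in> spin_D n \<kappa>. frag_of A) \<otimes>\<^bsub>group_ring (spin_group n)\<^esub> (\<Sum>A \<in> spin_D n \<mu>. frag_of A)) A =
    int (card (lift_pairs n \<kappa> \<mu> (spin_op A)))"
proof -
  let ?S = "\<lambda>\<kappa>. \<Sum>A \<in> spin_D n \<kappa>. frag_of A"
  let ?P = "\<lambda>p. fst p \<otimes>\<^bsub>spin_group n\<^esub> snd p = A"
  have fin: "finite (spin_D n \<kappa> \<times> spin_D n \<mu>)" using finite_spin_D ev by blast
  have "?S \<kappa> \<otimes>\<^bsub>group_ring (spin_group n)\<^esub> ?S \<mu> =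
      (\<Sum>x \<in> spin_D n \<kappa>. \<Sum>y \<in> spin_D n \<mu>. single (x \<otimes>\<^bsub>spin_group n\<^esub> y) (lookup (?S \<kappa>) x * lookup (?S \<mu>) y))"
    by (rule group_ring_mult_superset) (use finite_spin_D keys_spin_sum ev in auto)
  also have "\<dots> = (\<Sum>x \<in> spin_D n \<kappa>. \<Sum>y \<in> spin_D n \<mu>. single (x \<otimes>\<^bsub>spin_group n\<^esub> y) 1)"
    by (intro sum.cong HOL.refl) (simp add: lookup_spin_sum[OF ev(1)] lookup_spin_sum[OF ev(2)])
  finally have "lookup (?S \<kappa> \<otimes>\<^bsub>group_ring (spin_group n)\<^esub> ?S \<mu>) A =
      (\<Sum>x \<in> spin_D n \<kappa>. \<Sum>y \<in> spin_D n \<mu>. if x \<otimes>\<^bsub>spin_group n\<^esub> y = A then 1 else 0)"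
    by (simp add: lookup_sum lookup_single when_def eq_commute[of A])
  also have "\<dots> = (\<Sum>p \<in> spin_D n \<kappa> \<times> spin_D n \<mu>. if ?P p then 1 else 0)"
    by (simp add: sum.cartesian_product split_def)
  also have "\<dots> = int (card {p \<in> spin_D n \<kappa> \<times> spin_D n \<mu>. ?P p})" using fin by (rule sum_of_bool_card)
  also have "card {p \<in> spin_D n \<kappa> \<times> spin_D n \<mu>. ?P p} = card (lift_pairs n \<kappa> \<mu> (spin_op A))"
  proof (rule bij_betw_same_card[where f = "map_prod spin_op spin_op"], rule bij_betw_imageI)
    show "inj_on (map_prod spin_op spin_op) {p \<in> spin_D n \<kappa> \<times> spin_D n \<mu>. ?P p}"
    proof (rule inj_onI)
      fix p q assume pq: "p \<in> {p \<in> spin_D n \<kappa> \<times> spin_D n \<mu>. ?P p}" "q \<in> {p \<in> spin_D n \<kappa> \<times> spin_D n \<mu>. ?P p}"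
        "map_prod spin_op spin_op p = map_prod spin_op spin_op q"
      then have "fst p \<in> carrier (spin_group n)" "snd p \<in> carrier (spin_group n)"
        "fst q \<in> carrier (spin_group n)" "snd q \<in> carrier (spin_group n)"
        "spin_op (fst p) = spin_op (fst q)" "spin_op (snd p) = spin_op (snd q)"
        using spin_D_subset[THEN subsetD] by (auto simp del: spin_group_sel simp: prod_eq_iff)
      then show "p = q" using spin_op_inj by (metis prod_eq_iff)
    qed
    show "map_prod spin_op spin_op ` {p \<in> spin_D n \<kappa> \<times> spin_D n \<mu>. ?P p} = lift_pairs n \<kappa> \<mu> (spin_op A)"
    proof (intro equalityI subsetI)
      fix q assume "q \<in> map_prod spin_op spin_op ` {p \<in> spin_D n \<kappa> \<times> spin_D n \<mu>. ?P p}"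
      then obtain B C where B: "B \<in> spin_D n \<kappa>" "C \<in> spin_D n \<mu>" "B \<otimes>\<^bsub>spin_group n\<^esub> C = A" "q = (spin_op B, spin_op C)"
        by auto
      then have "spin_op B * spin_op C = spin_op A"
        using spin_op_mult[OF spin_D_subset[THEN subsetD] spin_D_subset[THEN subsetD]] by metis
      then show "q \<in> lift_pairs n \<kappa> \<mu> (spin_op A)"
        unfolding lift_pairs_def using B spin_op_D_image[OF ev(1), of n] spin_op_D_image[OF ev(2), of n] by blast
    next
      fix q assume "q \<in> lift_pairs n \<kappa> \<mu> (spin_op A)"
      then obtain B C where B: "B \<in> spin_D n \<kappa>" "C \<in> spin_D n \<mu>" "q = (spin_op B, spin_op C)" "spin_op B * spin_op C = spin_op A"
        unfolding lift_pairs_def spin_op_D_image[OF ev(1), symmetric] spin_op_D_image[OF ev(2), symmetric] by blast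
      have c: "B \<in> carrier (spin_group n)" "C \<in> carrier (spin_group n)" using B spin_D_subset by blast+
      have "B \<otimes>\<^bsub>spin_group n\<^esub> C = A"
        using spin_op_mult[OF c] spin_op_inj[OF spin_mult_closed[OF c] A] B(4) by simp
      then have "(B, C) \<in> {p \<in> spin_D n \<kappa> \<times> spin_D n \<mu>. ?P p}" using B by simp
      moreover have "q = map_prod spin_op spin_op (B, C)" using B(3) by simp
      ultimately show "q \<in> map_prod spin_op spin_op ` {p \<in> spin_D n \<kappa> \<times> spin_D n \<mu>. ?P p}" by blast
    qed
  qed
  finally show ?thesis .
qed

text \<open>The quotient of the two elements lies over the identity, where
  \<open>spin_kernel\<close> leaves only 1 and z.\<close>

lemma spin_op_same_perm:
  assumes "A \<in> carrier (spin_group n)" "B \<in> carrier (spin_group n)" "lifts (spin_op A) p e" "lifts (spin_op B) p d"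
  shows "spin_op A = spin_op B \<or> spin_op A = - spin_op B"
proof -
  obtain u v where u: "u \<in> spin_words n" "A = spin_class n u" and v: "v \<in> spin_words n" "B = spin_class n v"
    using assms(1,2) by auto
  obtain v' where v': "v' \<in> spin_words n" "spin_eq n (v @ v') []" "spin_eq n (v' @ v) []" using spin_inverse[OF v(1)] by blast
  have perm: "word_perm u = p" "word_perm v = p"
    using assms(3,4) u v word_lifts lifts_unique by (metis spin_op_class)+
  have inv: "word_op v * word_op v' = 1" "word_op v' * word_op v = 1"
    using spin_eq_word_op[OF v'(2)] spin_eq_word_op[OF v'(3)] by simp_all
  have "word_perm (v @ v') = id"
    using spin_eq_word_op[OF v'(2)] word_lifts lifts_one lifts_unique by (metis word_op_simps(1))
  then have "word_perm (u @ v') = id" using perm by simp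
  then have "spin_eq n (u @ v') [] \<or> spin_eq n (u @ v') [SpinZ]" using spin_kernel[of "u @ v'" n] u v' by simp
  then have "word_op u * word_op v' = 1 \<or> word_op u * word_op v' = -1"
    using spin_eq_word_op by fastforce
  then have "word_op u * word_op v' * word_op v = word_op v \<or> word_op u * word_op v' * word_op v = - word_op v" by auto
  then have "word_op u = word_op v \<or> word_op u = - word_op v" using inv(2) by (simp add: mult.assoc)
  then show ?thesis using u v by simp
qed

text \<open>The functional at the representative \<open>t \<nu>\<close> counts pairs with product
  \<open>spin_op (t \<nu>)\<close> minus pairs with the negative product, and one of the two sets is
  empty. Products of the classes are canonical lifts with the sign of exponent
  \<open>size \<kappa> + size \<mu>\<close>, the representative carries the exponent
  \<open>size \<nu>\<close>; comparing the two gives the sign.\<close>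

lemma spin_FH_coeff_eq:
  assumes ev: "\<kappa> \<in> EPar" "\<mu> \<in> EPar" "\<nu> \<in> EPar" and deg: "\<Sum>\<^sub># \<nu> = \<Sum>\<^sub># \<kappa> + \<Sum>\<^sub># \<mu>"
  shows "spin_FH_coeff \<kappa> \<mu> \<nu> = (-1) ^ (size \<kappa> + size \<mu> + size \<nu>) * int (factor_count \<kappa> \<mu> \<nu>)"
proof -
  have main: "lookup (coords (spin_ring n) (EPar \<inter> fits n) (spin_class_sum n)
         (spin_class_sum n \<kappa> \<otimes>\<^bsub>spin_ring n\<^esub> spin_class_sum n \<mu>)) \<nu> =
         (-1) ^ (size \<kappa> + size \<mu> + size \<nu>) * int (factor_count \<kappa> \<mu> \<nu>)"
    if n: "n \<ge> \<Sum>\<^sub># \<nu> + size \<nu>" for n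
  proof -
    let ?G = "spin_group n"
    let ?S = "\<lambda>\<kappa>. \<Sum>A \<in> spin_D n \<kappa>. frag_of A"
    let ?x = "spin_class_sum n \<kappa> \<otimes>\<^bsub>spin_ring n\<^esub> spin_class_sum n \<mu>"
    let ?M = "\<lambda>g. int (card (lift_pairs n \<kappa> \<mu> g))"
    have "\<forall>\<rho> \<in> EPar \<inter> fits n. \<exists>A. A \<in> spin_D n \<rho>"
    proof
      fix \<rho> assume \<rho>: "\<rho> \<in> EPar \<inter> fits n"
      then obtain p where p: "p permutes {1..n}" "mct p = \<rho>"
        using exists_permutes_of_type[of \<rho> n] by (auto simp: EPar_def fits_def)
      then obtain g where "canonical_lift (n + 1) p g" using canonical_lift_exists_permutes \<rho> by blast
      then have "lift_class n \<rho> \<noteq> {}" unfolding lift_class_def using p by blast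
      then show "\<exists>A. A \<in> spin_D n \<rho>" using spin_op_D_image[of \<rho> n] \<rho> by auto
    qed
    then obtain t where t: "\<And>\<rho>. \<rho> \<in> EPar \<inter> fits n \<Longrightarrow> t \<rho> \<in> spin_D n \<rho>" by metis
    have tc: "t \<rho> \<in> carrier ?G" if "\<rho> \<in> EPar \<inter> fits n" for \<rho> using t[OF that] spin_D_subset by blast
    have kS: "keys (?S \<rho>) \<subseteq> carrier ?G" if "\<rho> \<in> EPar" for \<rho>
      using keys_spin_sum[OF that] spin_D_subset by blast
    have notboth: "spin_neg n A \<notin> spin_D n \<rho>" if "A \<in> spin_D n \<rho>'" "\<rho> \<in> EPar" "\<rho>' \<in> EPar" for A \<rho> \<rho>'
    proof
      assume z: "spin_neg n A \<in> spin_D n \<rho>"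
      have Ac: "A \<in> carrier ?G" using that(1) spin_D_subset by blast
      have A: "spin_op A \<in> lift_class n \<rho>'" using that spin_D_iff_lift_class[OF that(3) Ac] by blast
      have zA: "- spin_op A \<in> lift_class n \<rho>"
        using z spin_D_iff_lift_class[OF that(2) spin_z_mult(1)[OF Ac]] spin_z_mult(2)[OF Ac] by simp
      obtain p where "lifts (spin_op A) p 1" using lift_class_lifts[OF A] by blast
      then show False using lift_class_unique(2)[OF A zA] lifts_uminus lifts_neq_uminus by blast
    qed
    have disj: "\<rho> = \<rho>'" if "A \<in> spin_D n \<rho>'" "A \<in> spin_D n \<rho>" "\<rho> \<in> EPar" "\<rho>' \<in> EPar" for A \<rho> \<rho>'
    proof -
      have "spin_op A \<in> lift_class n \<rho>'" "spin_op A \<in> lift_class n \<rho>"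
        using that spin_op_D_image[OF that(3), of n] spin_op_D_image[OF that(4), of n] by blast+
      then show ?thesis using lift_class_unique(1) lift_class_lifts by metis
    qed
    have cS: "spin_coeff n A (spin_class_sum n \<rho>) =
        (if A \<in> spin_D n \<rho> then 1 else 0) - (if spin_neg n A \<in> spin_D n \<rho> then 1 else 0)"
      if "A \<in> carrier ?G" "\<rho> \<in> EPar" for A \<rho>
      unfolding spin_class_sum_def using spin_coeff_coset[OF kS[OF that(2)] that(1)] lookup_spin_sum[OF that(2)] by simp
    have xeq: "?x = spin_coset n (?S \<kappa> \<otimes>\<^bsub>group_ring ?G\<^esub> ?S \<mu>)"
      unfolding spin_class_sum_def using spin_ring_ops(2)[OF kS[OF ev(1)] kS[OF ev(2)]] .
    have kx: "keys (?S \<kappa> \<otimes>\<^bsub>group_ring ?G\<^esub> ?S \<mu>) \<subseteq> carrier ?G"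
      by (rule group_ring_mult_closed[OF spin_group_group kS[OF ev(1)] kS[OF ev(2)]])
    have cx: "spin_coeff n A ?x = ?M (spin_op A) - ?M (- spin_op A)" if "A \<in> carrier ?G" for A
      unfolding xeq spin_coeff_coset[OF kx that]
      using lookup_spin_sum_mult[OF ev(1,2) that] lookup_spin_sum_mult[OF ev(1,2) spin_z_mult(1)[OF that]]
        spin_z_mult(2)[OF that] by simp
    have cz: "spin_coeff n (spin_neg n A) ?x = - spin_coeff n A ?x" if "A \<in> carrier ?G" for A
      using cx[OF that] cx[OF spin_z_mult(1)[OF that]] spin_z_mult(2)[OF that] by simp
    \<comment> \<open>A lift of a conjugating permutation carries \<open>A\<close> to the
      representative, and the pairs counted for \<open>A\<close> to those counted for it.\<close>
    have clss: "spin_coeff n A ?x = spin_coeff n (t \<rho>) ?x" if "A \<in> spin_D n \<rho>" "\<rho> \<in> EPar \<inter> fits n" for A \<rho>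
    proof -
      note AD = that(1) and R = that(2)
      have Ac: "A \<in> carrier ?G" using AD spin_D_subset by blast
      obtain p g where p: "p permutes {1..n}" "mct p = \<rho>" "canonical_lift (n + 1) p g" "spin_op A = (-1) ^ size \<rho> * g"
        using AD R spin_D_canonical[of \<rho> A n] by blast
      obtain q h where q: "q permutes {1..n}" "mct q = \<rho>" "canonical_lift (n + 1) q h" "spin_op (t \<rho>) = (-1) ^ size \<rho> * h"
        using t[OF R] R spin_D_canonical[of \<rho> "t \<rho>" n] by blast
      obtain \<pi> where \<pi>: "\<pi> permutes {1..n}" "q = \<pi> \<circ> p \<circ> inv' \<pi>"
        using conjugate_if_same_type[OF p(1) q(1)] p(2) q(2) by auto
      have "permutation \<pi>" using \<pi>(1) permutation_permutes by blast
      then obtain k e where k: "lifts k \<pi> e" using lifts_exists by blast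
      have "\<pi> (n + 1) = n + 1" using \<pi>(1) by (simp add: permutes_def)
      then obtain h' where h': "canonical_lift (n + 1) q h'" "k * g = h' * k"
        using canonical_lift_conj[OF p(3) k] \<pi>(2) by blast
      then have "k * g = h * k" using canonical_lift_unique q(3) by blast
      then have "k * spin_op A = spin_op (t \<rho>) * k" "k * (- spin_op A) = (- spin_op (t \<rho>)) * k"
        using p(4) q(4) minus_one_power_cases[of "size \<rho>"] by auto
      then have "?M (spin_op A) = ?M (spin_op (t \<rho>))" "?M (- spin_op A) = ?M (- spin_op (t \<rho>))"
        using card_lift_pairs_conj[OF k \<pi>(1)] by metis+
      then show ?thesis using cx[OF Ac] cx[OF tc[OF that(2)]] by simp
    qed
    have \<nu>: "\<nu> \<in> EPar \<inter> fits n" using ev n by (simp add: fits_def)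
    have fin: "finite (EPar \<inter> fits n)"
      using finite_fits by (rule finite_subset[rotated]) (auto simp: EPar_def)
    have "lookup (coords (spin_ring n) (EPar \<inter> fits n) (spin_class_sum n) ?x) \<nu> = spin_coeff n (t \<nu>) ?x"
    proof (rule lookup_coords[where e = "spin_coeff n" and T = "carrier ?G"])
      show "abelian_group (spin_ring n)" using spin_ring_ring ring.is_abelian_group by blast
      show "additive_on (spin_ring n) (spin_coeff n A)" if A: "A \<in> carrier ?G" for A
        unfolding additive_on_def spin_ring_carrier
      proof (intro ballI)
        fix X Y assume "X \<in> spin_coset n ` {f. keys f \<subseteq> carrier ?G}" "Y \<in> spin_coset n ` {f. keys f \<subseteq> carrier ?G}"
        then obtain f g where f: "keys f \<subseteq> carrier ?G" "X = spin_coset n f" and g: "keys g \<subseteq> carrier ?G" "Y = spin_coset n g" by blast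
        have fg: "keys (f + g) \<subseteq> carrier ?G" using Poly_Mapping.keys_add[of f g] f(1) g(1) by blast
        show "spin_coeff n A (X \<oplus>\<^bsub>spin_ring n\<^esub> Y) = spin_coeff n A X + spin_coeff n A Y"
          unfolding f(2) g(2) spin_ring_ops(1)[OF f(1) g(1)] spin_coeff_coset[OF fg A] spin_coeff_coset[OF f(1) A]
            spin_coeff_coset[OF g(1) A] by (simp add: lookup_add)
      qed
      show "X = Y" if "X \<in> carrier (spin_ring n)" "Y \<in> carrier (spin_ring n)"
        "\<And>A. A \<in> carrier ?G \<Longrightarrow> spin_coeff n A X = spin_coeff n A Y" for X Y
      proof -
        note XY = that(1,2)
        obtain f g where f: "keys f \<subseteq> carrier ?G" "X = spin_coset n f" and g: "keys g \<subseteq> carrier ?G" "Y = spin_coset n g"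
          using XY unfolding spin_ring_carrier by blast
        show ?thesis unfolding f(2) g(2)
        proof (rule spin_coset_eqI[OF f(1) g(1)])
          fix A assume A: "A \<in> carrier ?G"
          show "lookup f A - lookup f (spin_neg n A) = lookup g A - lookup g (spin_neg n A)"
            using that(3)[OF A] spin_coeff_coset[OF f(1) A] spin_coeff_coset[OF g(1) A] f(2) g(2) by simp
        qed
      qed
      show "finite (EPar \<inter> fits n)" by (rule fin)
      show "spin_class_sum n \<rho> \<in> carrier (spin_ring n)" if "\<rho> \<in> EPar \<inter> fits n" for \<rho>
        unfolding spin_class_sum_def spin_ring_carrier using kS that by blast
      show "t \<rho> \<in> carrier ?G" if "\<rho> \<in> EPar \<inter> fits n" for \<rho> using tc[OF that] .
      show "spin_coeff n (t \<rho>) (spin_class_sum n \<rho>') = (if \<rho> = \<rho>' then 1 else 0)"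
        if "\<rho> \<in> EPar \<inter> fits n" "\<rho>' \<in> EPar \<inter> fits n" for \<rho> \<rho>'
      proof -
        have "t \<rho> \<in> spin_D n \<rho>' \<longleftrightarrow> \<rho> = \<rho>'" using t[OF that(1)] disj[of "t \<rho>" \<rho> \<rho>'] that by auto
        moreover have "spin_neg n (t \<rho>) \<notin> spin_D n \<rho>'" using notboth[OF t[OF that(1)]] that by blast
        ultimately show ?thesis using cS[OF tc[OF that(1)], of \<rho>'] that(2) by auto
      qed
      show "?x \<in> carrier (spin_ring n)" unfolding xeq spin_ring_carrier using kx by blast
      show "\<nu> \<in> EPar \<inter> fits n" by (rule \<nu>)
      \<comment> \<open>The expansion is tested by every functional. For an even type only the
        summand \<open>mct p\<close> survives, with a sign that depends on whether \<open>A\<close>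
        or \<open>?zA\<close> lies in the class; for every other type both sides vanish.\<close>
      show "spin_coeff n A ?x = (\<Sum>\<rho> \<in> EPar \<inter> fits n. spin_coeff n (t \<rho>) ?x * spin_coeff n A (spin_class_sum n \<rho>))"
        if A: "A \<in> carrier ?G" for A
      proof -
        let ?zA = "spin_neg n A"
        obtain p e where p: "p permutes {1..n}" "lifts (spin_op A) p e" using spin_op_lifts[OF A] by blast
        have in_D: "mct p = \<rho>" if "A \<in> spin_D n \<rho> \<or> ?zA \<in> spin_D n \<rho>" "\<rho> \<in> EPar" for \<rho>
        proof -
          have "spin_op A \<in> lift_class n \<rho> \<or> - spin_op A \<in> lift_class n \<rho>"
            using that spin_D_iff_lift_class[OF that(2) A] spin_D_iff_lift_class[OF that(2) spin_z_mult(1)[OF A]]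
              spin_z_mult(2)[OF A] by auto
          then show ?thesis using lift_class_lifts lifts_unique p(2) lifts_uminus[OF p(2)] by metis
        qed
        have sum1: "(\<Sum>\<rho> \<in> EPar \<inter> fits n. spin_coeff n (t \<rho>) ?x * spin_coeff n A (spin_class_sum n \<rho>)) =
            (\<Sum>\<rho> \<in> EPar \<inter> fits n. if \<rho> = mct p then spin_coeff n (t \<rho>) ?x * spin_coeff n A (spin_class_sum n \<rho>) else 0)"
          using in_D cS[OF A] by (intro sum.cong) auto
        show ?thesis
        proof (cases "mct p \<in> EPar")
          case True
          then have m: "mct p \<in> EPar \<inter> fits n" using mct_fits[OF p(1)] by (simp add: fits_def)
          have "t (mct p) \<in> spin_D n (mct p)" using t[OF m] .
          then obtain q where "mct q = mct p" "q permutes {1..n}" "lifts (spin_op (t (mct p))) q 1"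
            using lift_class_lifts spin_op_D_image[OF True, of n] by (metis imageI)
          obtain g where g: "canonical_lift (n + 1) p g" using canonical_lift_exists_permutes p(1) True by blast
          then have "(-1) ^ size (mct p) * g \<in> lift_class n (mct p)" unfolding lift_class_def using p(1) by blast
          then obtain B where B: "B \<in> spin_D n (mct p)" "spin_op B = (-1) ^ size (mct p) * g"
            using spin_op_D_image[OF True, of n] by (metis imageE)
          have Bc: "B \<in> carrier ?G" using B(1) spin_D_subset by blast
          have "lifts (spin_op B) p 1"
            unfolding B(2) using canonical_lift_lifts[OF g] minus_one_power_cases[of "size (mct p)"] lifts_uminus by (metis mult_1 mult_minus1)
          then have "spin_op A = spin_op B \<or> spin_op A = - spin_op B" using spin_op_same_perm[OF A Bc p(2)] by blast
          then have "A = B \<or> ?zA = B"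
            using spin_op_inj[OF A Bc] spin_op_inj[OF spin_z_mult(1)[OF A] Bc] spin_z_mult(2)[OF A] by auto
          then have "spin_coeff n A ?x = spin_coeff n (t (mct p)) ?x * spin_coeff n A (spin_class_sum n (mct p))"
          proof
            assume "A = B"
            then have "A \<in> spin_D n (mct p)" "?zA \<notin> spin_D n (mct p)" using B(1) notboth True by blast+
            then show ?thesis using clss[OF _ m] cS[OF A True] by simp
          next
            assume zB: "?zA = B"
            then have zD: "?zA \<in> spin_D n (mct p)" using B(1) by simp
            then have "A \<notin> spin_D n (mct p)" using notboth True by blast
            then have "spin_coeff n A (spin_class_sum n (mct p)) = -1" using cS[OF A True] zD by simp
            moreover have "spin_coeff n A ?x = - spin_coeff n (t (mct p)) ?x" using clss[OF zD m] cz[OF A] by simp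
            ultimately show ?thesis by simp
          qed
          then show ?thesis unfolding sum1 using fin m by simp
        next
          case False
          have "?M (spin_op A) = ?M (- spin_op A)" using card_lift_pairs_not_EPar[OF p(2,1) False] by simp
          moreover have "(\<Sum>\<rho> \<in> EPar \<inter> fits n. if \<rho> = mct p then spin_coeff n (t \<rho>) ?x * spin_coeff n A (spin_class_sum n \<rho>) else 0) = 0"
            using False by (intro sum.neutral) auto
          ultimately show ?thesis unfolding sum1 using cx[OF A] by simp
        qed
      qed
    qed
    also have "\<dots> = (-1) ^ (size \<kappa> + size \<mu> + size \<nu>) * int (factor_count \<kappa> \<mu> \<nu>)"
    proof -
      obtain w g where w: "w permutes {1..n}" "mct w = \<nu>" "canonical_lift (n + 1) w g" "spin_op (t \<nu>) = (-1) ^ size \<nu> * g"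
        using t[OF \<nu>] ev(3) spin_D_canonical[of \<nu> "t \<nu>" n] by blast
      have nw: "nrm w = \<Sum>\<^sub># \<kappa> + \<Sum>\<^sub># \<mu>" using w(2) deg by (simp add: nrm_def)
      have "permutation w" using w(1) permutation_permutes by blast
      then have fc: "card (factorizations \<kappa> \<mu> w) = factor_count \<kappa> \<mu> \<nu>" using card_factorizations w(2) deg by blast
      let ?s = "(-1) ^ (size \<kappa> + size \<mu>) * g"
      have 1: "?M ?s = int (factor_count \<kappa> \<mu> \<nu>)" "?M (- ?s) = 0"
        using card_lift_pairs_minimal[OF ev(1,2) w(1) nw w(3)] fc by simp_all
      show ?thesis
      proof (cases "even (size \<kappa> + size \<mu> + size \<nu>)")
        case True
        then have "even (size \<kappa> + size \<mu>) \<longleftrightarrow> even (size \<nu>)" by presburger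
        then have "spin_op (t \<nu>) = ?s" unfolding w(4) by (cases "even (size \<nu>)") (auto simp del: even_add)
        then show ?thesis using cx[OF tc[OF \<nu>]] 1 True by simp
      next
        case False
        then have "even (size \<kappa> + size \<mu>) \<longleftrightarrow> odd (size \<nu>)" by presburger
        then have "spin_op (t \<nu>) = - ?s" unfolding w(4) by (cases "even (size \<nu>)") (auto simp del: even_add)
        then show ?thesis using cx[OF tc[OF \<nu>]] 1 False by simp
      qed
    qed
    finally show ?thesis .
  qed
  show ?thesis unfolding spin_FH_coeff_def by (rule the_equality) (use main in blast)+
qed

section \<open>Generating functions for minimal products whose first factor is a single
  cycle\<close>

unbundle fps_syntax

section \<open>Minimal factorizations with a single cycle as first factor\<close>

text \<open>Cuts of a cyclic word \<open>C\<close> into \<open>m\<close> nonempty blocks. The prefix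
  \<open>P\<close> is the end of the last block, which runs over the end of the word.\<close>

definition segmentations :: "'a list \<Rightarrow> nat \<Rightarrow> ('a list \<times> 'a list list) set" where
  "segmentations C m = {(P, Ls). length Ls = m \<and> [] \<notin> set Ls \<and> P @ concat Ls = C}"

lemma segment_heads:
  assumes "[] \<notin> set Ms"
  shows "set (map hd Ms) \<subseteq> set (concat Ms)" "distinct (concat Ms) \<Longrightarrow> distinct (map hd Ms)"
  using assms
proof (induction Ms)
  case (Cons M Ms)
  { case 1 then show ?case using Cons by (cases M) auto
  next case 2 then show ?case using Cons by (cases M) auto }
qed simp_all

definition compositions :: "nat \<Rightarrow> nat \<Rightarrow> (nat \<times> nat list) set" where
  "compositions N m = {(p, ls). length ls = m \<and> 0 \<notin> set ls \<and> p + sum_list ls = N}"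

text \<open>The prefix counts towards the last block, whose length is therefore
  \<open>last ls + p\<close>; a block of length l has weight \<open>f (l - 1)\<close>, matching the
  modified cycle type.\<close>

definition comp_weight :: "(nat \<Rightarrow> 'a::comm_ring_1) \<Rightarrow> nat \<times> nat list \<Rightarrow> 'a" where
  "comp_weight f = (\<lambda>(p, ls). f (last ls + p - 1) * (\<Prod>l\<leftarrow>butlast ls. f (l - 1)))"

definition shift_fps :: "(nat \<Rightarrow> 'a::comm_ring_1) \<Rightarrow> 'a fps" where
  "shift_fps f = fps_X * Abs_fps f"

lemma shift_fps_nth: "shift_fps f $ k = (if k = 0 then 0 else f (k - 1))"
  by (simp add: shift_fps_def)

lemma finite_compositions: "finite (compositions N m)"
proof -
  have "compositions N m \<subseteq> {..N} \<times> {ls. set ls \<subseteq> {..N} \<and> length ls = m}"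
    using member_le_sum_list by (fastforce simp: compositions_def)
  then show ?thesis by (rule finite_subset) (simp add: finite_lists_length_eq)
qed

text \<open>A single block wraps around completely, and its cut can be placed in \<open>N\<close>
  ways: \<open>N * f (N - 1)\<close> is the coefficient of X \<tau>' with \<tau> =
  \<open>shift_fps f\<close>. Every further block contributes one factor \<tau>.\<close>

lemma sum_comp_weight:
  "(\<Sum>x \<in> compositions N (Suc r). comp_weight f x) = (fps_X * fps_deriv (shift_fps f) * shift_fps f ^ r) $ N"
proof (induction r arbitrary: N)
  case 0
  have "compositions N (Suc 0) = (\<lambda>l. (N - l, [l])) ` {1..N}"
    by (auto simp: compositions_def length_Suc_conv image_iff)
  then have "(\<Sum>x \<in> compositions N (Suc 0). comp_weight f x) = (\<Sum>x \<in> (\<lambda>l. (N - l, [l])) ` {1..N}. comp_weight f x)" by simp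
  also have "\<dots> = (\<Sum>l \<in> {1..N}. f (N - 1))"
    by (subst sum.reindex) (auto simp: inj_on_def comp_weight_def intro!: sum.cong)
  also have "\<dots> = (fps_X * fps_deriv (shift_fps f)) $ N" by (cases N) (simp_all add: shift_fps_nth)
  finally show ?case by simp
next
  case (Suc r)
  have "bij_betw (\<lambda>(l, (p, ls)). (p, l # ls)) (SIGMA l : {1..N}. compositions (N - l) (Suc r)) (compositions N (Suc (Suc r)))"
    by (rule bij_betw_byWitness[where f' = "\<lambda>(p, ls). (hd ls, (p, tl ls))"])
       (auto simp: compositions_def length_Suc_conv)
  then have "(\<Sum>x \<in> compositions N (Suc (Suc r)). comp_weight f x) =
      (\<Sum>x \<in> (SIGMA l : {1..N}. compositions (N - l) (Suc r)). comp_weight f ((\<lambda>(l, (p, ls)). (p, l # ls)) x))"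
    by (rule sum.reindex_bij_betw[symmetric])
  also have "\<dots> = (\<Sum>(l, y) \<in> (SIGMA l : {1..N}. compositions (N - l) (Suc r)). f (l - 1) * comp_weight f y)"
    by (intro sum.cong) (auto simp: comp_weight_def compositions_def algebra_simps)
  also have "\<dots> = (\<Sum>l = 1..N. \<Sum>y \<in> compositions (N - l) (Suc r). f (l - 1) * comp_weight f y)"
    by (subst sum.Sigma) (auto simp: finite_compositions)
  also have "\<dots> = (\<Sum>l = 1..N. f (l - 1) * (fps_X * fps_deriv (shift_fps f) * shift_fps f ^ r) $ (N - l))"
    by (simp add: sum_distrib_left[symmetric] Suc.IH)
  also have "\<dots> = (\<Sum>l = 0..N. shift_fps f $ l * (fps_X * fps_deriv (shift_fps f) * shift_fps f ^ r) $ (N - l))"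
    by (rule sum.mono_neutral_cong_left) (auto simp: shift_fps_nth)
  also have "\<dots> = (shift_fps f * (fps_X * fps_deriv (shift_fps f) * shift_fps f ^ r)) $ N"
    by (simp add: fps_mult_nth)
  finally show ?case by (simp add: algebra_simps)
qed

lemma exists_segmentation: "sum_list ls = length C \<Longrightarrow> \<exists>Ls. map length Ls = ls \<and> concat Ls = C"
proof (induction ls arbitrary: C)
  case (Cons l ls)
  then have "sum_list ls = length (drop l C)" by (simp add: algebra_simps)
  then obtain Ls where "map length Ls = ls" "concat Ls = drop l C" using Cons.IH[of "drop l C"] by auto
  then show ?case using Cons.prems by (intro exI[of _ "take l C # Ls"]) simp
qed simp

lemma bij_segmentations:
  "bij_betw (\<lambda>(P, Ls). (length P, map length Ls)) (segmentations C m) (compositions (length C) m)"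
proof (rule bij_betw_imageI)
  show "inj_on (\<lambda>(P, Ls). (length P, map length Ls)) (segmentations C m)"
  proof (rule inj_onI)
    fix x y assume xy: "x \<in> segmentations C m" "y \<in> segmentations C m"
      "(\<lambda>(P, Ls). (length P, map length Ls)) x = (\<lambda>(P, Ls). (length P, map length Ls)) y"
    obtain P Ls P' Ls' where x: "x = (P, Ls)" "y = (P', Ls')" by (cases x, cases y)
    have PP: "P @ concat Ls = P' @ concat Ls'" "length P = length P'" "map length Ls = map length Ls'"
      using xy x by (auto simp: segmentations_def)
    then have "P = P'" "map id (concat Ls) = concat Ls'" by auto
    moreover from this have "map (map id) Ls = Ls'" using map_map_concat_eq PP(3) by blast
    ultimately show "x = y" using x by simp
  qed
  show "(\<lambda>(P, Ls). (length P, map length Ls)) ` segmentations C m = compositions (length C) m"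
  proof (intro equalityI subsetI)
    fix x assume "x \<in> (\<lambda>(P, Ls). (length P, map length Ls)) ` segmentations C m"
    then show "x \<in> compositions (length C) m"
      by (auto simp: segmentations_def compositions_def length_concat)
  next
    fix x assume "x \<in> compositions (length C) m"
    then obtain p ls where x: "x = (p, ls)" "length ls = m" "0 \<notin> set ls" "p + sum_list ls = length C"
      by (auto simp: compositions_def)
    then have "sum_list ls = length (drop p C)" unfolding length_drop by linarith
    then obtain Ls where Ls: "map length Ls = ls" "concat Ls = drop p C" using exists_segmentation by blast
    have "[] \<notin> set Ls" using x(3) Ls(1) by force
    moreover have "length Ls = m" using Ls(1) x(2) by (metis length_map)
    ultimately have "(take p C, Ls) \<in> segmentations C m" using Ls by (simp add: segmentations_def)
    moreover have "length (take p C) = p" using x(4) by simp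
    ultimately show "x \<in> (\<lambda>(P, Ls). (length P, map length Ls)) ` segmentations C m"
      using x(1) Ls(1) by (intro image_eqI[of _ _ "(take p C, Ls)"]) auto
  qed
qed

lemma sum_segmentations:
  "(\<Sum>(P, Ls) \<in> segmentations C (Suc r). comp_weight f (length P, map length Ls)) =
    (fps_X * fps_deriv (shift_fps f) * shift_fps f ^ r) $ length C"
  using sum.reindex_bij_betw[OF bij_segmentations[of C "Suc r"], of "comp_weight f"]
  by (simp add: split_def sum_comp_weight)

text \<open>The entries are distinct, so the set of heads already shows where blocks begin:
  \<open>P\<close> is the part of the word before the first member of this set.\<close>

lemma segmentation_heads_unique:
  assumes "P @ concat Ls = P' @ concat Ls'" "distinct (P @ concat Ls)" "[] \<notin> set Ls" "[] \<notin> set Ls'"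
    "set (map hd Ls) = set (map hd Ls')"
  shows "P = P' \<and> Ls = Ls'"
  using assms
proof (induction Ls arbitrary: P P' Ls')
  case Nil
  then show ?case by simp
next
  case (Cons L Ls)
  obtain h A where L: "L = h # A" using Cons.prems by (cases L) auto
  obtain L' Ls2 where Ls': "Ls' = L' # Ls2" using Cons.prems by (cases Ls') auto
  obtain h' A' where L': "L' = h' # A'" using Cons.prems Ls' by (cases L') auto
  let ?H = "set (map hd (L # Ls))"
  note heads = segment_heads(1)
  have eq: "P @ h # A @ concat Ls = P' @ h' # A' @ concat Ls2" using Cons.prems(1) L Ls' L' by simp
  have d: "distinct (P @ h # A @ concat Ls)" "distinct (P' @ h' # A' @ concat Ls2)"
    using Cons.prems(2) L eq by auto
  have H: "?H = insert h (set (map hd Ls))" "?H = insert h' (set (map hd Ls2))"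
    using Cons.prems(5) L Ls' L' by simp_all
  have hs: "set (map hd Ls) \<subseteq> set (concat Ls)" "set (map hd Ls2) \<subseteq> set (concat Ls2)"
    using heads Cons.prems(3,4) Ls' by auto
  have "takeWhile (\<lambda>x. x \<notin> ?H) (P @ h # A @ concat Ls) = P"
  proof -
    have "x \<notin> ?H" if "x \<in> set P" for x
      using that d(1) hs(1) unfolding H(1) distinct_append set_append distinct.simps list.set by blast
    moreover have "h \<in> ?H" using H(1) by blast
    ultimately show ?thesis by (subst takeWhile_append2) (auto simp del: list.map)
  qed
  moreover have "takeWhile (\<lambda>x. x \<notin> ?H) (P' @ h' # A' @ concat Ls2) = P'"
  proof -
    have "x \<notin> ?H" if "x \<in> set P'" for x
      using that d(2) hs(2) unfolding H(2) distinct_append set_append distinct.simps list.set by blast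
    moreover have "h' \<in> ?H" using H(2) by blast
    ultimately show ?thesis by (subst takeWhile_append2) (auto simp del: list.map)
  qed
  ultimately have PP: "P = P'" using eq by metis
  then have hh: "h = h'" "A @ concat Ls = A' @ concat Ls2" using eq by auto
  have "h \<notin> set (map hd Ls)" "h \<notin> set (map hd Ls2)"
    using d hs hh unfolding distinct_append set_append distinct.simps list.set by blast+
  then have "set (map hd Ls) = set (map hd Ls2)" using H hh(1) by (metis insert_ident)
  then have "A = A' \<and> Ls = Ls2"
    using Cons.IH[of A A' Ls2] hh(2) d(1) Cons.prems(3,4) Ls' by auto
  then show ?case using PP hh L Ls' L' by simp
qed

lemma cycle_of_list_rotate: "distinct xs \<Longrightarrow> cycle_of_list (rotate k xs) = cycle_of_list xs"
proof (cases "xs = []")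
  case False
  assume d: "distinct xs"
  have "disjoint_cycles (cycle_of_list xs \<circ> id) [xs]" "disjoint_cycles (cycle_of_list (rotate k xs) \<circ> id) [rotate k xs]"
    using d False by (intro disjoint_cycles_ConsI; simp add: disjoint_cycles_Nil_iff)+
  then have "disjoint_cycles (cycle_of_list xs \<circ> id) [rotate k xs]" "disjoint_cycles (cycle_of_list (rotate k xs) \<circ> id) [rotate k xs]"
    using disjoint_cycles_rotate[of _ xs "[]" k] by blast+
  then have "cycle_of_list xs \<circ> id = cycle_of_list (rotate k xs) \<circ> id" by (rule disjoint_cycles_unique)
  then show ?thesis by simp
qed simp

definition list_weight :: "(nat \<Rightarrow> 'a::comm_ring_1) \<Rightarrow> nat list list \<Rightarrow> 'a" where
  "list_weight f cs = (\<Prod>c\<leftarrow>cs. f (length c - 1))"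

lemma prod_mset_mct:
  assumes "disjoint_cycles p cs" "f 0 = (1 :: 'a::comm_ring_1)"
  shows "(\<Prod>j \<in># mct p. f j) = list_weight f cs"
proof -
  have "(\<Prod>j \<in># filter_mset (\<lambda>k. k \<noteq> 0) M. f j) = (\<Prod>j \<in># M. f j)" for M
    using assms(2) by (induction M) auto
  then have "(\<Prod>j \<in># mct p. f j) = (\<Prod>j \<in># mset (map (\<lambda>c. length c - 1) cs). f j)"
    unfolding modified_cycle_type_eq[OF assms(1)] .
  also have "\<dots> = list_weight f cs" by (induction cs) (simp_all add: list_weight_def)
  finally show ?thesis .
qed

lemma mct_cycle:
  assumes "distinct xs" "length xs = Suc r" "r \<ge> 1"
  shows "mct (cycle_of_list xs) = {#r#}" "{x. cycle_of_list xs x \<noteq> x} = set xs"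
proof -
  have dc: "disjoint_cycles (cycle_of_list xs) [xs]"
    using disjoint_cycles_ConsI[of id "[]" xs] assms by (cases xs) (simp_all add: disjoint_cycles_Nil_iff)
  show "mct (cycle_of_list xs) = {#r#}" using modified_cycle_type_eq[OF dc] assms by simp
  have "cycle_of_list xs x \<noteq> x" if "x \<in> set xs" for x
    using disjoint_cycles_fixed[OF dc, of xs x] that assms by auto
  then show "{x. cycle_of_list xs x \<noteq> x} = set xs" using id_outside_supp[of _ xs] by blast
qed

definition cycle_factorizations :: "nat \<Rightarrow> (nat \<Rightarrow> nat) \<Rightarrow> ((nat \<Rightarrow> nat) \<times> (nat \<Rightarrow> nat)) set" where
  "cycle_factorizations r w = {(u, v). permutation u \<and> permutation v \<and> mct u = {#r#} \<and> u \<circ> v = w \<and> nrm w = r + nrm v}"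

text \<open>The converse of a merge: the blocks, with \<open>P\<close> appended to the last one,
  become the cycles of \<open>v\<close>, and the cycle of their heads glues them back to a rotation
  of \<open>c\<close>.\<close>

lemma segmentation_factorization:
  assumes dc: "disjoint_cycles w (c # cs)" and seg: "(P, Ls) \<in> segmentations c (Suc r)" and r: "r \<ge> 1"
  shows "\<exists>v. (cycle_of_list (map hd Ls), v) \<in> cycle_factorizations r w \<and>
    disjoint_cycles v (butlast Ls @ [last Ls @ P] @ cs)"
proof -
  have Ls: "length Ls = Suc r" "[] \<notin> set Ls" "P @ concat Ls = c" using seg by (auto simp: segmentations_def)
  then have split: "Ls = butlast Ls @ [last Ls]" by (metis append_butlast_last_id list.size(3) nat.distinct(1))
  let ?Ms = "butlast Ls @ [last Ls @ P]"
  let ?xs = "map hd Ls" and ?As = "map tl ?Ms"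
  have ne: "[] \<notin> set (butlast Ls)" "last Ls \<noteq> []"
    using Ls(2) by (meson in_set_butlastD) (metis Ls(1,2) last_in_set list.size(3) nat.distinct(1))
  have hds: "?xs = map hd ?Ms" using ne(2) by (subst split) simp
  have "map2 (#) (map hd Ms) (map tl Ms) = Ms" if "[] \<notin> set Ms" for Ms :: "nat list list"
    using that by (induction Ms) auto
  from this[of ?Ms] have Ms: "map2 (#) ?xs ?As = ?Ms" unfolding hds using ne by auto
  have cM: "concat ?Ms = rotate (length P) c"
  proof -
    have "concat ?Ms = concat Ls @ P" by (subst (3) split) simp
    then show ?thesis unfolding Ls(3)[symmetric] by (simp add: rotate_append)
  qed
  have dist: "distinct (concat (c # cs))" "[] \<notin> set cs" using dc by (auto simp: disjoint_cycles_def)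
  have "concat (?Ms @ cs) = rotate (length P) c @ concat cs" using cM by simp
  then have "distinct (concat (?Ms @ cs))" "length (concat (?Ms @ cs)) = length (concat (c # cs))"
    using dist(1) by (simp_all only: distinct_append concat.simps set_rotate distinct_rotate length_append length_rotate)
  then obtain v where v: "disjoint_cycles v (?Ms @ cs)"
    using disjoint_cycles_exists[of "?Ms @ cs"] ne dist(2) by auto
  have lenx: "length ?As = length ?xs" using Ls(1) by simp
  have "disjoint_cycles (cycle_of_list ?xs \<circ> v) (concat (map2 (#) ?xs ?As) # cs)"
    by (rule disjoint_cycles_merge) (use v Ms lenx Ls(1) in \<open>auto simp: Ms\<close>)
  then have "disjoint_cycles (cycle_of_list ?xs \<circ> v) (rotate (length P) c # cs)" unfolding Ms cM .
  moreover have "disjoint_cycles w (rotate (length P) c # cs)" by (rule disjoint_cycles_rotate[OF dc])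
  ultimately have w: "cycle_of_list ?xs \<circ> v = w" by (rule disjoint_cycles_unique)
  have dx: "distinct ?xs" using segment_heads(2)[of Ls] dist(1) Ls(2,3) by auto
  have "nrm w + length (c # cs) = length (concat (c # cs))" by (rule nrm_add_length[OF dc])
  moreover have "nrm v + length (?Ms @ cs) = length (concat (?Ms @ cs))" by (rule nrm_add_length[OF v])
  ultimately have "nrm w = r + nrm v"
    using Ls(1) \<open>length (concat (?Ms @ cs)) = length (concat (c # cs))\<close> by (simp only: length_append) simp
  then show ?thesis
    using v w mct_cycle(1)[OF dx, of r] Ls(1) r permutation_of_cycle disjoint_cycles_permutation[OF v]
    by (auto simp: cycle_factorizations_def)
qed

text \<open>A block that straddles the beginning of \<open>c\<close> is divided there: its rear part
  becomes the prefix and its front part the last block. The list of heads is only rotated.\<close>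

lemma rotate_segments:
  assumes "[] \<notin> set Ls" "Ls \<noteq> []" "rotate k c = concat Ls"
  shows "\<exists>P Ms j. (P, Ms) \<in> segmentations c (length Ls) \<and> map hd Ms = rotate j (map hd Ls)"
proof -
  have "c = rotate (length c - k mod length c) (rotate k c)"
  proof (cases "c = []")
    case False
    have "rotate (length c - k mod length c) (rotate k c) = rotate (length c - k mod length c + k) c"
      by (simp add: rotate_rotate)
    also have "(length c - k mod length c + k) mod length c = 0"
    proof -
      have "k mod length c < length c" using False by simp
      then have "length c - k mod length c + k = length c + (k div length c) * length c"
        using div_mult_mod_eq[of k "length c"] by linarith
      then show ?thesis by simp
    qed
    then have "rotate (length c - k mod length c + k) c = c" by (rule rotate_id)
    finally show ?thesis by simp
  qed simp
  then obtain m where m: "c = rotate m (concat Ls)" using assms(3) by metis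
  define i where "i = m mod length (concat Ls)"
  have c: "c = drop i (concat Ls) @ take i (concat Ls)" unfolding m i_def by (rule rotate_drop_take)
  show ?thesis
  proof (cases "i = 0")
    case True
    then have "([], Ls) \<in> segmentations c (length Ls)" using assms c by (simp add: segmentations_def)
    moreover have "map hd Ls = rotate 0 (map hd Ls)" by simp
    ultimately show ?thesis by blast
  next
    case False
    have "concat Ls \<noteq> []" using assms by (cases Ls) auto
    then have il: "i < length (concat Ls)" unfolding i_def by simp
    text \<open>Cut inside the segment that contains the last entry before position \<open>i\<close>.\<close>
    obtain y where y: "take i (concat Ls) = take (i - 1) (concat Ls) @ [y]"
      using take_Suc_conv_app_nth[of "i - 1" "concat Ls"] False il by auto
    have "concat Ls = take (i - 1) (concat Ls) @ (y # drop i (concat Ls))"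
      using append_take_drop_id[of i "concat Ls"] y by simp
    then obtain L1 S T L2 where L: "Ls = L1 @ (S @ T) # L2" "take (i - 1) (concat Ls) = concat L1 @ S" "y # drop i (concat Ls) = T @ concat L2"
      using concat_eq_appendD[of Ls "take (i - 1) (concat Ls)" "y # drop i (concat Ls)"] assms(2) by metis
    show ?thesis
    proof (cases T)
      case (Cons t T')
      then have T: "t = y" "drop i (concat Ls) = T' @ concat L2" using L(3) by auto
      have "c = T' @ concat (L2 @ L1 @ [S @ [y]])" unfolding c T(2) y L(2) by simp
      moreover have "[] \<notin> set (L2 @ L1 @ [S @ [y]])" using assms(1) L(1) by auto
      ultimately have "(T', L2 @ L1 @ [S @ [y]]) \<in> segmentations c (length Ls)"
        unfolding segmentations_def using L(1) by simp
      moreover have "map hd (L2 @ L1 @ [S @ [y]]) = rotate (Suc (length L1)) (map hd Ls)"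
      proof -
        have "hd (S @ [y]) = hd (S @ T)" using Cons T(1) by (cases S) auto
        then show ?thesis using rotate_append[of "map hd L1 @ [hd (S @ T)]" "map hd L2"] L(1) by simp
      qed
      ultimately show ?thesis by blast
    next
      case Nil
      then have L2: "concat L2 = y # drop i (concat Ls)" using L(3) by simp
      then obtain M L3 where M: "L2 = M # L3" by (cases L2) auto
      have "M \<noteq> []" using assms(1) L(1) M by auto
      then obtain M' where M': "M = y # M'" "drop i (concat Ls) = M' @ concat L3" using L2 M by (cases M) auto
      have "c = M' @ concat (L3 @ L1 @ [S, [y]])" unfolding c M'(2) y L(2) by simp
      moreover have "[] \<notin> set (L3 @ L1 @ [S, [y]])" using assms(1) L(1) M Nil by auto
      ultimately have "(M', L3 @ L1 @ [S, [y]]) \<in> segmentations c (length Ls)"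
        unfolding segmentations_def using L(1) M Nil by simp
      moreover have "map hd (L3 @ L1 @ [S, [y]]) = rotate (Suc (Suc (length L1))) (map hd Ls)"
        using rotate_append[of "map hd L1 @ [hd S, y]" "map hd L3"] L(1) M M' Nil by simp
      ultimately show ?thesis by blast
    qed
  qed
qed

text \<open>Equality of norms lets \<open>nrm_cycle_comp\<close> exhibit the cycles of
  \<open>v\<close> that are glued. The glued cycle contains a moved point of \<open>w\<close>, so up
  to rotation it is one of the given cycles.\<close>

lemma cycle_factorization_segmentation:
  assumes dc: "disjoint_cycles w cs" and uv: "(u, v) \<in> cycle_factorizations r w" and r: "r \<ge> 1"
  shows "\<exists>c \<in> set cs. \<exists>(P, Ls) \<in> segmentations c (Suc r). u = cycle_of_list (map hd Ls)"
proof -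
  have u: "permutation u" "permutation v" "mct u = {#r#}" "u \<circ> v = w" "nrm w = r + nrm v"
    using uv by (auto simp: cycle_factorizations_def)
  obtain us where us: "disjoint_cycles u us" "map length us = cycle_lengths {#r#}"
    using disjoint_cycles_sorted[OF u(1)] u(3) by auto
  have "cycle_lengths {#r#} = [Suc r]" by (simp add: cycle_lengths_def)
  then obtain xs where xs: "us = [xs]" "length xs = Suc r" using us(2) by (auto simp: map_eq_Cons_conv)
  obtain q where "disjoint_cycles q []" "u = cycle_of_list xs \<circ> q" "distinct xs" "xs \<noteq> []"
    using disjoint_cycles_ConsE[of u xs "[]"] us(1) xs(1) by metis
  then have ux: "u = cycle_of_list xs" "distinct xs" "xs \<noteq> []" by (simp_all add: disjoint_cycles_Nil_iff)
  obtain vs where vs: "disjoint_cycles v vs" using u(2) by (rule disjoint_cycles_ex')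
  have "nrm (cycle_of_list xs \<circ> v) = nrm v + (length xs - 1)" using u(4,5) ux(1) xs(2) by simp
  then obtain As rest where As: "length As = length xs" "disjoint_cycles v (map2 (#) xs As @ rest)"
    using nrm_cycle_comp[OF vs ux(2,3)] by blast
  let ?Ls = "map2 (#) xs As"
  have w: "disjoint_cycles w (concat ?Ls # rest)"
    using disjoint_cycles_merge[OF As(2,1) ux(3)] ux(1) u(4) by simp
  obtain x xs' A As' where x: "xs = x # xs'" "As = A # As'" using ux(3) As(1) by (cases xs; cases As) auto
  obtain C where C: "concat ?Ls = x # C" using x by simp
  have lenC: "length (concat ?Ls) \<ge> length xs"
    using As(1) by (induction xs As rule: list_induct2') auto
  have "w x \<noteq> x"
  proof
    assume "w x = x"
    then have "concat ?Ls = [x]" using disjoint_cycles_fixed[OF w, of "concat ?Ls" x] C by simp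
    then show False using lenC xs(2) r by simp
  qed
  then have "x \<in> set (concat cs)" using dc unfolding disjoint_cycles_def by blast
  then obtain as c bs k B where c: "cs = as @ c # bs" "rotate k c = x # B" "disjoint_cycles w ((x # B) # as @ bs)"
    using disjoint_cycles_to_front[OF dc] by metis
  have "orbit w x = set (x # B)" "orbit w x = set (x # C)"
    using disjoint_cycles_orbit[of w "x # B" x] disjoint_cycles_orbit[of w "x # C" x] c(3) w C
    unfolding disjoint_cycles_def by simp_all
  have "C = B"
  proof -
    have mapC: "map w (x # C) = C @ [x]" "distinct (x # C)" using w C by (auto simp: disjoint_cycles_def)
    have mapB: "map w (x # B) = B @ [x]" "distinct (x # B)" using c(3) by (auto simp: disjoint_cycles_def)
    have "length (x # C) = length (x # B)"
      using \<open>orbit w x = set (x # B)\<close> \<open>orbit w x = set (x # C)\<close> mapC(2) mapB(2) by (metis distinct_card)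
    then have len: "length C = length B" by simp
    have "(C @ [x]) ! i = (B @ [x]) ! i" if "i \<le> length C" for i
      using that
    proof (induction i)
      case 0
      then show ?case using mapC(1) mapB(1) by (metis list.simps(9) nth_Cons_0)
    next
      case (Suc i)
      have "(C @ [x]) ! Suc i = w ((x # C) ! Suc i)" using mapC(1) Suc.prems nth_map[of "Suc i" "x # C" w] by simp
      moreover have "(B @ [x]) ! Suc i = w ((x # B) ! Suc i)" using mapB(1) Suc.prems len nth_map[of "Suc i" "x # B" w] by simp
      moreover have "(x # C) ! Suc i = (C @ [x]) ! i" "(x # B) ! Suc i = (B @ [x]) ! i"
        using Suc.prems len by (simp_all add: nth_append)
      ultimately show ?case using Suc by simp
    qed
    then have "C @ [x] = B @ [x]" using len by (intro nth_equalityI) auto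
    then show ?thesis by simp
  qed
  then have "rotate k c = concat ?Ls" using c(2) C by simp
  moreover have "[] \<notin> set ?Ls" "?Ls \<noteq> []" using x by auto
  ultimately obtain P Ms j where Ms: "(P, Ms) \<in> segmentations c (length ?Ls)" "map hd Ms = rotate j (map hd ?Ls)"
    using rotate_segments by blast
  have "map hd ?Ls = xs" using As(1) by (induction xs As rule: list_induct2') auto
  then have "u = cycle_of_list (map hd Ms)" using Ms(2) ux cycle_of_list_rotate by metis
  moreover have "length ?Ls = Suc r" using As(1) xs(2) by simp
  ultimately show ?thesis using Ms(1) c(1) by (intro bexI[of _ c] bexI[of _ "(P, Ms)"]) auto
qed

lemma finite_segmentations: "finite (segmentations C m)"
  using bij_betw_finite[OF bij_segmentations] finite_compositions by blast

text \<open>The moved points of \<open>u\<close> are the heads; they determine the cycle of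
  \<open>w\<close> in which they lie and its cuts. As \<open>u\<close> and \<open>w\<close>
  determine \<open>v\<close>, the pairs correspond to the cuts of single cycles of
  \<open>w\<close>.\<close>

theorem sum_cycle_factorizations:
  fixes f :: "nat \<Rightarrow> 'a::comm_ring_1"
  assumes dc: "disjoint_cycles w cs" and r: "r \<ge> 1" and f0: "f 0 = 1"
  shows "(\<Sum>(u, v) \<in> cycle_factorizations r w. \<Prod>j \<in># mct v. f j) =
    (\<Sum>c \<in> set cs. (fps_X * fps_deriv (shift_fps f) * shift_fps f ^ r) $ length c *
       (\<Prod>d \<in> set cs - {c}. f (length d - 1)))"
proof -
  have dcs: "distinct cs" by (rule disjoint_cycles_distinct(1)[OF dc])
  let ?D = "SIGMA c : set cs. segmentations c (Suc r)"
  let ?u = "\<lambda>(c :: nat list, (P :: nat list, Ls)). cycle_of_list (map hd Ls)"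
  let ?\<Phi> = "\<lambda>x. (?u x, inv' (?u x) \<circ> w)"
  note front = disjoint_cycles_move_front[OF dc]
  have inv_eq: "v = inv' u \<circ> w" if "permutation u" "u \<circ> v = w" for u v :: "nat \<Rightarrow> nat"
    unfolding that(2)[symmetric] using permutation_bijective[OF that(1)] by (simp add: fun_eq_iff bij_is_inj)
  have fact: "?\<Phi> (c, (P, Ls)) \<in> cycle_factorizations r w \<and>
      (\<Prod>j \<in># mct (inv' (cycle_of_list (map hd Ls)) \<circ> w). f j) =
        comp_weight f (length P, map length Ls) * (\<Prod>d \<in> set cs - {c}. f (length d - 1))"
    if c: "c \<in> set cs" and seg: "(P, Ls) \<in> segmentations c (Suc r)" for c P Ls
  proof -
    obtain v where v: "(cycle_of_list (map hd Ls), v) \<in> cycle_factorizations r w"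
      "disjoint_cycles v (butlast Ls @ [last Ls @ P] @ remove1 c cs)"
      using segmentation_factorization[OF front[OF c] seg r] by blast
    have veq: "v = inv' (cycle_of_list (map hd Ls)) \<circ> w"
      using v(1) inv_eq by (auto simp: cycle_factorizations_def)
    have ne: "Ls \<noteq> []" using seg by (auto simp: segmentations_def)
    have "list_weight f (remove1 c cs) = (\<Prod>d \<in> set cs - {c}. f (length d - 1))"
      unfolding list_weight_def using dcs by (subst prod.distinct_set_conv_list[symmetric]) auto
    then have "(\<Prod>j \<in># mct v. f j) = comp_weight f (length P, map length Ls) * (\<Prod>d \<in> set cs - {c}. f (length d - 1))"
      unfolding prod_mset_mct[OF v(2), of f, OF f0] comp_weight_def using ne
      by (simp add: list_weight_def last_map map_butlast[symmetric] comp_def mult.assoc mult.left_commute)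
    then show ?thesis using v(1) veq by simp
  qed
  have bij: "bij_betw ?\<Phi> ?D (cycle_factorizations r w)"
  proof (rule bij_betw_imageI)
    show "inj_on ?\<Phi> ?D"
    proof (rule inj_onI)
      fix x y assume xy: "x \<in> ?D" "y \<in> ?D" "?\<Phi> x = ?\<Phi> y"
      obtain c P Ls c' P' Ls' where x: "x = (c, (P, Ls))" "y = (c', (P', Ls'))"
        by (cases x, cases y) auto
      have c: "c \<in> set cs" "c' \<in> set cs" and seg: "(P, Ls) \<in> segmentations c (Suc r)" "(P', Ls') \<in> segmentations c' (Suc r)"
        using xy x by auto
      have Ls: "length Ls = Suc r" "[] \<notin> set Ls" "P @ concat Ls = c" "length Ls' = Suc r" "[] \<notin> set Ls'" "P' @ concat Ls' = c'"
        using seg by (auto simp: segmentations_def)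
      have dist: "distinct c" "distinct c'" using dc c by (auto simp: disjoint_cycles_def distinct_concat_iff)
      have h: "set (map hd Ls) \<subseteq> set c" "distinct (map hd Ls)" "set (map hd Ls') \<subseteq> set c'" "distinct (map hd Ls')"
      proof -
        have "distinct (concat Ls)" "set (concat Ls) \<subseteq> set c" "distinct (concat Ls')" "set (concat Ls') \<subseteq> set c'"
          unfolding Ls(3,6)[symmetric] using dist Ls(3,6) by auto
        then show "set (map hd Ls) \<subseteq> set c" "distinct (map hd Ls)" "set (map hd Ls') \<subseteq> set c'" "distinct (map hd Ls')"
          using segment_heads[of Ls] segment_heads[of Ls'] Ls(2,5) by blast+
      qed
      have "cycle_of_list (map hd Ls) = cycle_of_list (map hd Ls')" using xy(3) x by simp
      then have seteq: "set (map hd Ls) = set (map hd Ls')"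
        using mct_cycle(2)[OF h(2), of r] mct_cycle(2)[OF h(4), of r] Ls r by simp
      obtain z where z: "z \<in> set (map hd Ls)" using Ls(1) by (cases Ls) auto
      then have "z \<in> set c \<inter> set c'" using h seteq by blast
      then have cc: "c = c'" using dc c unfolding disjoint_cycles_def distinct_concat_iff by blast
      then have "P = P' \<and> Ls = Ls'" using segmentation_heads_unique[of P Ls P' Ls'] Ls dist seteq by simp
      then show "x = y" using x cc by simp
    qed
    show "?\<Phi> ` ?D = cycle_factorizations r w"
    proof (intro equalityI subsetI)
      fix y assume "y \<in> ?\<Phi> ` ?D"
      then show "y \<in> cycle_factorizations r w" using fact by auto
    next
      fix y assume y: "y \<in> cycle_factorizations r w"
      obtain u v where uv: "y = (u, v)" by (cases y)
      then obtain c P Ls where c: "c \<in> set cs" "(P, Ls) \<in> segmentations c (Suc r)" "u = cycle_of_list (map hd Ls)"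
        using cycle_factorization_segmentation[OF dc _ r] y by blast
      moreover have "v = inv' u \<circ> w" using y uv inv_eq by (auto simp: cycle_factorizations_def)
      ultimately show "y \<in> ?\<Phi> ` ?D" using uv by (intro image_eqI[of _ _ "(c, (P, Ls))"]) auto
    qed
  qed
  have "(\<Sum>(u, v) \<in> cycle_factorizations r w. \<Prod>j \<in># mct v. f j) =
      (\<Sum>x \<in> ?D. (\<lambda>(u, v). \<Prod>j \<in># mct v. f j) (?\<Phi> x))"
    by (rule sum.reindex_bij_betw[OF bij, symmetric])
  also have "\<dots> = (\<Sum>(c, (P, Ls)) \<in> ?D. comp_weight f (length P, map length Ls) * (\<Prod>d \<in> set cs - {c}. f (length d - 1)))"
  proof (intro sum.cong HOL.refl)
    fix x assume "x \<in> ?D"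
    then obtain c P Ls where x: "x = (c, (P, Ls))" "c \<in> set cs" "(P, Ls) \<in> segmentations c (Suc r)" by auto
    then show "(\<lambda>(u, v). \<Prod>j \<in># mct v. f j) (?\<Phi> x) =
        (case x of (c, (P, Ls)) \<Rightarrow> comp_weight f (length P, map length Ls) * (\<Prod>d \<in> set cs - {c}. f (length d - 1)))"
      using fact[OF x(2,3)] by simp
  qed
  also have "\<dots> = (\<Sum>c \<in> set cs. \<Sum>(P, Ls) \<in> segmentations c (Suc r).
      comp_weight f (length P, map length Ls) * (\<Prod>d \<in> set cs - {c}. f (length d - 1)))"
    by (subst sum.Sigma) (auto simp: finite_segmentations split_def)
  also have "\<dots> = (\<Sum>c \<in> set cs. (fps_X * fps_deriv (shift_fps f) * shift_fps f ^ r) $ length c *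
       (\<Prod>d \<in> set cs - {c}. f (length d - 1)))"
    unfolding sum_segmentations[symmetric] by (simp add: split_def sum_distrib_right)
  finally show ?thesis .
qed

text \<open>Groups the pairs by the type of \<open>v\<close>. The value \<open>f 0 = 1\<close> makes
  one-element cycles invisible in the weights.\<close>

theorem sum_factor_count_cycle:
  fixes f :: "nat \<Rightarrow> 'a::comm_ring_1"
  assumes \<nu>: "\<nu> \<in> Par" and r: "r \<ge> 1" "r \<le> \<Sum>\<^sub># \<nu>" and f0: "f 0 = 1"
  shows "(\<Sum>\<mu> \<in> partitions_of (\<Sum>\<^sub># \<nu> - r). of_nat (factor_count {#r#} \<mu> \<nu>) * (\<Prod>j \<in># \<mu>. f j)) =
    (\<Sum>n \<in># \<nu>. (fps_X * fps_deriv (shift_fps f) * shift_fps f ^ r) $ (n + 1) * (\<Prod>j \<in># \<nu> - {#n#}. f j))"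
proof -
  obtain w where w: "permutation w" "mct w = \<nu>" using exists_permutation_of_type[OF \<nu>] by blast
  obtain cs where cs: "disjoint_cycles w cs" "map length cs = cycle_lengths \<nu>"
    using disjoint_cycles_sorted[OF w(1)] w(2) by blast
  have nw: "nrm w = \<Sum>\<^sub># \<nu>" using w(2) by (simp add: nrm_def)
  let ?N = "\<Sum>\<^sub># \<nu> - r"
  have fin: "finite (factorizations {#r#} \<mu> w)" if "\<mu> \<in> partitions_of ?N" for \<mu>
    using finite_factorizations(1)[OF w(1), of "{#r#}" \<mu>] that nw r(2) by (simp add: partitions_of_def)
  have union: "cycle_factorizations r w = (\<Union>\<mu> \<in> partitions_of ?N. factorizations {#r#} \<mu> w)"
    using nw r(2) by (auto simp: cycle_factorizations_def factorizations_def partitions_of_def nrm_def modified_cycle_type_Par)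
  have "(\<Sum>(u, v) \<in> cycle_factorizations r w. \<Prod>j \<in># mct v. f j) =
      (\<Sum>\<mu> \<in> partitions_of ?N. \<Sum>(u, v) \<in> factorizations {#r#} \<mu> w. \<Prod>j \<in># mct v. f j)"
    unfolding union using fin by (subst sum.UNION_disjoint) (auto simp: factorizations_def)
  also have "\<dots> = (\<Sum>\<mu> \<in> partitions_of ?N. of_nat (factor_count {#r#} \<mu> \<nu>) * (\<Prod>j \<in># \<mu>. f j))"
  proof (intro sum.cong HOL.refl)
    fix \<mu> assume "\<mu> \<in> partitions_of ?N"
    then have "card (factorizations {#r#} \<mu> w) = factor_count {#r#} \<mu> \<nu>"
      using card_factorizations[OF w] r(2) by (simp add: partitions_of_def)
    moreover have "(\<Sum>(u, v) \<in> factorizations {#r#} \<mu> w. \<Prod>j \<in># mct v. f j) = (\<Sum>(u, v) \<in> factorizations {#r#} \<mu> w. \<Prod>j \<in># \<mu>. f j)"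
      by (intro sum.cong) (auto simp: factorizations_def)
    ultimately show "(\<Sum>(u, v) \<in> factorizations {#r#} \<mu> w. \<Prod>j \<in># mct v. f j) = of_nat (factor_count {#r#} \<mu> \<nu>) * (\<Prod>j \<in># \<mu>. f j)"
      by (simp add: split_def)
  qed
  finally have L: "(\<Sum>(u, v) \<in> cycle_factorizations r w. \<Prod>j \<in># mct v. f j) =
    (\<Sum>\<mu> \<in> partitions_of ?N. of_nat (factor_count {#r#} \<mu> \<nu>) * (\<Prod>j \<in># \<mu>. f j))" .
  have dcs: "distinct cs" by (rule disjoint_cycles_distinct(1)[OF cs(1)])
  have len: "length c = length c - 1 + 1" if "c \<in> set cs" for c
  proof -
    have "c \<noteq> []" using cs(1) that unfolding disjoint_cycles_def by blast
    then show ?thesis by (cases c) auto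
  qed
  have "mset (map (\<lambda>k. k - 1) (map length cs)) = \<nu>" unfolding cs(2) cycle_lengths_def by (simp add: comp_def)
  then have \<nu>_eq: "\<nu> = image_mset (\<lambda>c. length c - 1) (mset_set (set cs))"
    using dcs by (simp add: mset_set_set comp_def)
  have minus: "\<nu> - {#length c - 1#} = image_mset (\<lambda>c. length c - 1) (mset_set (set cs - {c}))" if "c \<in> set cs" for c
  proof -
    have "mset_set (set cs) = add_mset c (mset_set (set cs - {c}))" using that by (subst mset_set.remove[of _ c]) auto
    then show ?thesis unfolding \<nu>_eq by simp
  qed
  let ?\<phi> = "\<lambda>n. (fps_X * fps_deriv (shift_fps f) * shift_fps f ^ r) $ n"
  have "(\<Sum>n \<in># \<nu>. ?\<phi> (n + 1) * (\<Prod>j \<in># \<nu> - {#n#}. f j)) =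
      (\<Sum>c \<in> set cs. ?\<phi> (length c - 1 + 1) * (\<Prod>j \<in># \<nu> - {#length c - 1#}. f j))"
  proof -
    have "(\<Sum>n \<in># \<nu>. \<Psi> n) = (\<Sum>c \<in> set cs. \<Psi> (length c - 1))" for \<Psi> :: "nat \<Rightarrow> 'a"
      unfolding \<nu>_eq by (simp add: multiset.map_comp comp_def sum_unfold_sum_mset)
    then show ?thesis .
  qed
  also have "\<dots> = (\<Sum>c \<in> set cs. ?\<phi> (length c) * (\<Prod>d \<in> set cs - {c}. f (length d - 1)))"
    by (intro sum.cong HOL.refl) (simp add: minus len[symmetric] multiset.map_comp comp_def prod_unfold_prod_mset del: One_nat_def add_Suc_right)
  finally show ?thesis using L sum_cycle_factorizations[OF cs(1) r(1), of f] f0 by simp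
qed

section \<open>Symmetric functions, their bases and the Hall inner product\<close>

section \<open>Coefficients of symmetric functions\<close>

lemmas mcoeff_simps [simp] =
  zero_symfun.rep_eq one_symfun.rep_eq plus_symfun.rep_eq uminus_symfun.rep_eq
  complete_symfun.rep_eq power_sum.rep_eq monomial_symfun.rep_eq symfun_const.rep_eq symfun_of_int.rep_eq

lemma symfun_eqI: "(\<And>m. mcoeff f m = mcoeff g m) \<Longrightarrow> f = g"
  by (simp add: mcoeff_inject[symmetric] fun_eq_iff)

lemma mcoeff_mult: "mcoeff (f * g) m = (\<Sum>(a, b) \<in> {(a, b). a + b = m}. mcoeff f a * mcoeff g b)"
  by (simp only: times_symfun.rep_eq series_mult_def)

lemma mcoeff_mult_single:
  assumes "a0 + b0 = m" "\<And>a b. a + b = m \<Longrightarrow> (a, b) \<noteq> (a0, b0) \<Longrightarrow> mcoeff f a * mcoeff g b = 0"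
  shows "mcoeff (f * g) m = mcoeff f a0 * mcoeff g b0"
proof -
  have "(\<Sum>(a, b) \<in> {(a, b). a + b = m}. mcoeff f a * mcoeff g b) = (\<Sum>(a, b) \<in> {(a0, b0)}. mcoeff f a * mcoeff g b)"
  proof (rule sum.mono_neutral_right[OF finite_multiset_splits])
    show "\<forall>p \<in> {(a, b). a + b = m} - {(a0, b0)}. (case p of (a, b) \<Rightarrow> mcoeff f a * mcoeff g b) = 0"
    proof
      fix p assume p: "p \<in> {(a, b). a + b = m} - {(a0, b0)}"
      obtain a b where ab: "p = (a, b)" by (cases p)
      then have "a + b = m" "(a, b) \<noteq> (a0, b0)" using p by blast+
      from assms(2)[OF this] show "(case p of (a, b) \<Rightarrow> mcoeff f a * mcoeff g b) = 0" using ab by simp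
    qed
  qed (use assms(1) in blast)
  then show ?thesis by (simp only: mcoeff_mult) simp
qed

lemma mcoeff_diff [simp]: "mcoeff (f - g) m = mcoeff f m - mcoeff g m"
  by (simp only: minus_symfun_def mcoeff_simps) simp

lemma mcoeff_sum: "mcoeff (\<Sum>x \<in> A. F x) m = (\<Sum>x \<in> A. mcoeff (F x) m)"
  by (induction A rule: infinite_finite_induct) simp_all

lemma mcoeff_symmetric: "bij \<pi> \<Longrightarrow> mcoeff f (image_mset \<pi> m) = mcoeff f m"
  using mcoeff[of f] by (simp add: symmetric_series_def)

lemma mcoeff_bounded: "\<exists>d. \<forall>m. mcoeff f m \<noteq> 0 \<longrightarrow> size m \<le> d"
  using mcoeff[of f] by (simp add: bounded_degree_def)

text \<open>The coefficient of the least monomial of a product is the product of the coefficients of the least monomials.\<close>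

instance symfun :: (idom) idom
proof
  fix f g :: "'a symfun"
  assume f: "f \<noteq> 0" and g: "g \<noteq> 0"
  have nz: "\<exists>m. mcoeff k m \<noteq> 0" if "k \<noteq> 0" for k :: "'a symfun"
    using that symfun_eqI[of k 0] by auto
  define m where "m = (LEAST m. mcoeff f m \<noteq> 0)"
  define n where "n = (LEAST n. mcoeff g n \<noteq> 0)"
  have m: "mcoeff f m \<noteq> 0" unfolding m_def using nz[OF f] by (rule LeastI_ex)
  have n: "mcoeff g n \<noteq> 0" unfolding n_def using nz[OF g] by (rule LeastI_ex)
  have "mcoeff f a * mcoeff g b = 0" if "a + b = m + n" "(a, b) \<noteq> (m, n)" for a b
  proof (rule ccontr)
    assume "mcoeff f a * mcoeff g b \<noteq> 0"
    then have "m \<le> a" "n \<le> b" unfolding m_def n_def by (auto intro: Least_le)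
    then have "m + n < a + b"
      using that(2) by (metis add_less_le_mono add_le_less_mono order_le_imp_less_or_eq)
    then show False using that(1) by simp
  qed
  then have "mcoeff (f * g) (m + n) = mcoeff f m * mcoeff g n" by (intro mcoeff_mult_single) blast+
  then show "f * g \<noteq> 0" using m n by auto
qed

lemma symfun_const_add: "symfun_const (a + b) = symfun_const a + symfun_const b"
  by (rule symfun_eqI) simp

lemma symfun_const_minus: "symfun_const (- a) = - symfun_const a"
  by (rule symfun_eqI) simp

lemma symfun_const_1: "symfun_const 1 = 1"
  by (rule symfun_eqI) simp

lemma symfun_const_0: "symfun_const 0 = 0"
  by (rule symfun_eqI) simp

lemma mcoeff_const_mult [simp]: "mcoeff (symfun_const c * f) m = c * mcoeff f m"
proof -
  have "mcoeff (symfun_const c * f) m = (\<Sum>(a, b) \<in> {({#}, m)}. mcoeff (symfun_const c) a * mcoeff f b)"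
    unfolding mcoeff_mult
    by (intro sum.mono_neutral_right finite_multiset_splits) (auto split: if_splits)
  then show ?thesis by simp
qed

lemma symfun_const_mult: "symfun_const (a * b) = symfun_const a * symfun_const b"
  by (rule symfun_eqI) simp

lemma of_nat_symfun: "of_nat c = symfun_const (of_nat c)"
  by (induction c) (simp_all add: symfun_const_0 symfun_const_1 symfun_const_add)

lemma of_int_symfun: "of_int c = symfun_const (of_int c)"
  by (cases c rule: int_cases2) (simp_all add: of_nat_symfun symfun_const_minus)

instance symfun :: ("{comm_ring_1, ring_char_0}") ring_char_0
proof
  show "inj (of_nat :: nat \<Rightarrow> 'a symfun)"
  proof (rule injI)
    fix a b assume "(of_nat a :: 'a symfun) = of_nat b"
    then have "mcoeff (symfun_const (of_nat a) :: 'a symfun) {#} = mcoeff (symfun_const (of_nat b)) {#}"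
      by (simp only: of_nat_symfun)
    then show "a = b" by simp
  qed
qed

lemma mcoeff_of_int_mult [simp]: "mcoeff (of_int c * f) m = of_int c * mcoeff f m"
  by (simp add: of_int_symfun)

lemma size_eq_sum_exponents: "size m = \<Sum>\<^sub># (exponents m)"
  by (simp add: exponents_def size_multiset_overloaded_eq flip: sum_unfold_sum_mset)

lemma exponents_Par: "exponents m \<in> Par"
  by (auto simp: Par_def exponents_def simp flip: not_in_iff)

lemma size_exponents: "size (exponents m) = card (set_mset m)"
  by (simp add: exponents_def)

lemma count_image_mset_inj:
  assumes "inj \<pi>"
  shows "count (image_mset \<pi> m) (\<pi> i) = count m i"
  using assms by (induction m) (auto simp: inj_eq)

lemma exponents_eq_imp_image:
  assumes "exponents m = exponents m'"
  obtains \<pi> where "bij \<pi>" "image_mset \<pi> m = m'"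
proof -
  obtain xs where xs: "set xs = set_mset m" "distinct xs" using finite_distinct_list[of "set_mset m"] by auto
  obtain ys where ys: "set ys = set_mset m'" "distinct ys" using finite_distinct_list[of "set_mset m'"] by auto
  have "image_mset (count m) (mset xs) = mset (map (count m') ys)"
    using assms xs ys by (simp add: exponents_def mset_set_set[symmetric])
  then obtain zs where zs: "mset zs = mset xs" "map (count m) zs = map (count m') ys"
    using map_eq_rearrange by blast
  have zs': "set zs = set_mset m" "distinct zs" using zs(1) xs by (metis set_mset_mset, metis mset_eq_imp_distinct_iff)
  have len: "length zs = length ys" using zs(2) by (metis length_map)
  obtain \<pi> where \<pi>: "\<pi> permutes (set zs \<union> set ys)" "map \<pi> zs = ys"
    using permutes_extend[of zs ys "set zs \<union> set ys"] zs' ys len by auto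
  have b: "bij \<pi>" using \<pi>(1) by (rule permutes_bij)
  have "count (image_mset \<pi> m) y = count m' y" for y
  proof -
    obtain x where x: "y = \<pi> x" using b by (metis bij_pointE)
    have "count m x = count m' (\<pi> x)"
    proof (cases "x \<in> set zs")
      case True
      then obtain k where "k < length zs" "x = zs ! k" by (metis in_set_conv_nth)
      then show ?thesis using zs(2) \<pi>(2) len by (metis nth_map)
    next
      case False
      have "\<pi> x \<notin> \<pi> ` set zs" using False b by (simp add: bij_is_inj inj_image_mem_iff)
      also have "\<pi> ` set zs = set ys" using \<pi>(2) by (metis set_map)
      finally have "count m' (\<pi> x) = 0" using ys(1) by (simp add: not_in_iff)
      then show ?thesis using False zs'(1) by (simp add: not_in_iff)
    qed
    then show ?thesis using x count_image_mset_inj[OF bij_is_inj[OF b]] by simp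
  qed
  then have "image_mset \<pi> m = m'" by (rule multiset_eqI)
  then show ?thesis using that b by blast
qed

lemma mcoeff_exponents: "exponents m = exponents m' \<Longrightarrow> mcoeff f m = mcoeff f m'"
  by (metis exponents_eq_imp_image mcoeff_symmetric)

definition mono_of :: "nat list \<Rightarrow> nat multiset" where
  "mono_of ks = (\<Sum>i < length ks. replicate_mset (ks ! i) i)"

lemma count_mono_of: "count (mono_of ks) i = (if i < length ks then ks ! i else 0)"
  by (simp add: mono_of_def count_sum if_distrib cong: if_cong)

lemma exponents_mono_of: "exponents (mono_of ks) = mset (filter (\<lambda>k. 0 < k) ks)"
proof -
  have set: "set_mset (mono_of ks) = {i \<in> {..<length ks}. ks ! i \<noteq> 0}"
    by (auto simp: count_mono_of simp flip: count_greater_zero_iff split: if_splits)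
  have "mset ks = image_mset ((!) ks) (mset_set {..<length ks})"
    by (metis map_nth mset_map mset_upt atLeast0LessThan)
  then have "mset (filter (\<lambda>k. 0 < k) ks) = filter_mset (\<lambda>k. 0 < k) (image_mset ((!) ks) (mset_set {..<length ks}))"
    by simp
  also have "\<dots> = image_mset ((!) ks) (filter_mset (\<lambda>i. ks ! i \<noteq> 0) (mset_set {..<length ks}))"
    by (simp add: filter_mset_image_mset)
  also have "\<dots> = exponents (mono_of ks)"
    unfolding exponents_def set by (auto simp: count_mono_of intro!: image_mset_cong)
  finally show ?thesis by simp
qed

text \<open>The coefficient of the monomial symmetric function of type \<kappa>: every monomial with
  these exponents gives the same value (\<open>mcf_exponents\<close>).\<close>

definition mcf :: "'a::zero symfun \<Rightarrow> partition \<Rightarrow> 'a" where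
  "mcf f \<kappa> = mcoeff f (mono_of (sorted_list_of_multiset \<kappa>))"

lemma exponents_mono_of_sorted:
  assumes "\<kappa> \<in> Par"
  shows "exponents (mono_of (sorted_list_of_multiset \<kappa>)) = \<kappa>"
proof -
  have "filter_mset (\<lambda>k. 0 < k) \<kappa> = \<kappa>"
    using assms by (auto simp: filter_mset_eq_conv Par_def intro: gr0I)
  then show ?thesis by (simp add: exponents_mono_of)
qed

lemma mcf_exponents: "mcf f (exponents m) = mcoeff f m"
  unfolding mcf_def by (rule mcoeff_exponents) (simp add: exponents_mono_of_sorted exponents_Par)

lemma mcf_add [simp]: "mcf (f + g) \<kappa> = mcf f \<kappa> + mcf g \<kappa>"
  and mcf_0 [simp]: "mcf 0 \<kappa> = 0"
  and mcf_minus [simp]: "mcf (- f) \<kappa> = - mcf f \<kappa>"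
  and mcf_of_int_mult [simp]: "mcf (of_int c * f) \<kappa> = of_int c * mcf f \<kappa>"
  and mcf_sum: "mcf (\<Sum>x \<in> A. F x) \<kappa> = (\<Sum>x \<in> A. mcf (F x) \<kappa>)"
  by (simp_all add: mcf_def mcoeff_sum)

lemma mcf_monomial: "\<kappa> \<in> Par \<Longrightarrow> mcf (monomial_symfun \<mu>) \<kappa> = (if \<kappa> = \<mu> then 1 else 0)"
  by (simp add: mcf_def exponents_mono_of_sorted)

lemma symfun_eq_mcfI:
  assumes "\<And>\<kappa>. \<kappa> \<in> Par \<Longrightarrow> mcf f \<kappa> = mcf g \<kappa>"
  shows "f = g"
  using assms[OF exponents_Par] by (intro symfun_eqI) (simp add: mcf_exponents)

lemma finite_mcf_support: "finite {\<kappa> \<in> Par. mcf f \<kappa> \<noteq> 0}"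
proof -
  obtain d where d: "\<And>m. mcoeff f m \<noteq> 0 \<Longrightarrow> size m \<le> d" using mcoeff_bounded[of f] by blast
  have "{\<kappa> \<in> Par. mcf f \<kappa> \<noteq> 0} \<subseteq> (\<Union>n \<le> d. partitions_of n)"
  proof
    fix \<kappa> assume \<kappa>: "\<kappa> \<in> {\<kappa> \<in> Par. mcf f \<kappa> \<noteq> 0}"
    then have "size (mono_of (sorted_list_of_multiset \<kappa>)) \<le> d" by (intro d) (simp add: mcf_def)
    then have "\<Sum>\<^sub># \<kappa> \<le> d" using \<kappa> by (simp add: size_eq_sum_exponents exponents_mono_of_sorted)
    then show "\<kappa> \<in> (\<Union>n \<le> d. partitions_of n)" using \<kappa> by (auto simp: partitions_of_def)
  qed
  then show ?thesis by (rule finite_subset) simp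
qed

lemma symfun_monomial_expansion:
  fixes f :: "int symfun"
  shows "f = (\<Sum>\<mu> \<in> {\<kappa> \<in> Par. mcf f \<kappa> \<noteq> 0}. of_int (mcf f \<mu>) * monomial_symfun \<mu>)"
proof (rule symfun_eq_mcfI)
  fix \<kappa> :: partition assume \<kappa>: "\<kappa> \<in> Par"
  let ?S = "{\<kappa> \<in> Par. mcf f \<kappa> \<noteq> 0}"
  have "mcf (\<Sum>\<mu> \<in> ?S. of_int (mcf f \<mu>) * monomial_symfun \<mu>) \<kappa> = (\<Sum>\<mu> \<in> ?S. if \<kappa> = \<mu> then mcf f \<mu> else 0)"
    using \<kappa> by (auto simp: mcf_sum mcf_monomial intro!: sum.cong)
  also have "\<dots> = mcf f \<kappa>" using \<kappa> by (simp add: finite_mcf_support)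
  finally show "mcf f \<kappa> = mcf (\<Sum>\<mu> \<in> ?S. of_int (mcf f \<mu>) * monomial_symfun \<mu>) \<kappa>" by simp
qed

section \<open>Integral combinations of a family indexed by partitions\<close>

definition lin_ext :: "(partition \<Rightarrow> 'a::comm_ring_1) \<Rightarrow> (partition \<Rightarrow>\<^sub>0 int) \<Rightarrow> 'a" where
  "lin_ext F a = (\<Sum>\<kappa> \<in> keys a. of_int (lookup a \<kappa>) * F \<kappa>)"

lemma lin_ext_superset:
  "finite S \<Longrightarrow> keys a \<subseteq> S \<Longrightarrow> lin_ext F a = (\<Sum>\<kappa> \<in> S. of_int (lookup a \<kappa>) * F \<kappa>)"
  unfolding lin_ext_def by (rule sum.mono_neutral_left) (auto simp: in_keys_iff)

lemma lin_ext_add: "lin_ext F (a + b) = lin_ext F a + lin_ext F b"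
proof -
  let ?S = "keys a \<union> keys b"
  have "keys (a + b) \<subseteq> ?S" by (rule Poly_Mapping.keys_add)
  then show ?thesis
    by (simp add: lin_ext_superset[of ?S] lookup_add distrib_right sum.distrib)
qed

lemma lin_ext_minus: "lin_ext F (- a) = - lin_ext F a"
  by (simp add: lin_ext_def sum_negf)

lemma lin_ext_single [simp]: "lin_ext F (single \<kappa> c) = of_int c * F \<kappa>"
  by (simp add: lin_ext_def)

lemma lin_ext_0 [simp]: "lin_ext F 0 = 0"
  by (simp add: lin_ext_def)

inductive_set int_span :: "(partition \<Rightarrow> 'a::comm_ring_1) \<Rightarrow> 'a set" for F where
  zero: "0 \<in> int_span F"
| gen: "\<kappa> \<in> Par \<Longrightarrow> F \<kappa> \<in> int_span F"
| add: "x \<in> int_span F \<Longrightarrow> y \<in> int_span F \<Longrightarrow> x + y \<in> int_span F"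
| minus: "x \<in> int_span F \<Longrightarrow> - x \<in> int_span F"

lemma int_span_sum: "(\<And>x. x \<in> A \<Longrightarrow> G x \<in> int_span F) \<Longrightarrow> (\<Sum>x \<in> A. G x) \<in> int_span F"
  by (induction A rule: infinite_finite_induct) (auto intro: int_span.intros)

lemma int_span_of_int_mult:
  assumes "x \<in> int_span F"
  shows "of_int c * x \<in> int_span F"
proof -
  have nat: "of_nat n * x \<in> int_span F" for n
    by (induction n) (auto simp: distrib_right intro: int_span.intros assms)
  show ?thesis by (cases c rule: int_cases2) (auto simp: nat intro: int_span.minus)
qed

lemma int_span_eq_lin_ext: "x \<in> int_span F \<longleftrightarrow> (\<exists>a. keys a \<subseteq> Par \<and> x = lin_ext F a)"
proof
  assume "x \<in> int_span F"
  then show "\<exists>a. keys a \<subseteq> Par \<and> x = lin_ext F a"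
  proof induction
    case zero
    then show ?case by (intro exI[of _ 0]) simp
  next
    case (gen \<kappa>)
    then show ?case by (intro exI[of _ "single \<kappa> 1"]) simp
  next
    case (add x y)
    then obtain a b where "keys a \<subseteq> Par" "x = lin_ext F a" "keys b \<subseteq> Par" "y = lin_ext F b"
      by blast
    then show ?case
      by (intro exI[of _ "a + b"]) (use Poly_Mapping.keys_add[of a b] in \<open>auto simp: lin_ext_add\<close>)
  next
    case (minus x)
    then obtain a where "keys a \<subseteq> Par" "x = lin_ext F a" by blast
    then show ?case by (intro exI[of _ "- a"]) (simp add: lin_ext_minus)
  qed
next
  assume "\<exists>a. keys a \<subseteq> Par \<and> x = lin_ext F a"
  then show "x \<in> int_span F"
    by (auto simp: lin_ext_def intro!: int_span_sum int_span_of_int_mult int_span.gen)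
qed

lemma int_span_mult:
  assumes F: "\<And>\<kappa> \<mu>. F (\<kappa> + \<mu>) = F \<kappa> * F \<mu>" and x: "x \<in> int_span F" and y: "y \<in> int_span F"
  shows "x * y \<in> int_span F"
  using x
proof induction
  case (gen \<kappa>)
  show ?case using y
  proof induction
    case (gen \<mu>)
    then have "\<kappa> + \<mu> \<in> Par" using \<open>\<kappa> \<in> Par\<close> by (simp add: Par_def)
    then show ?case using int_span.gen[of "\<kappa> + \<mu>" F] F by simp
  qed (auto simp: distrib_left intro: int_span.intros)
qed (auto simp: distrib_right intro: int_span.intros)

section \<open>The complete symmetric functions\<close>

definition hprod :: "partition \<Rightarrow> 'a::comm_ring_1 symfun" where
  "hprod \<kappa> = (\<Prod>r \<in># \<kappa>. complete_symfun r)"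

lemma complete_0 [simp]: "complete_symfun 0 = 1"
  by (rule symfun_eqI) simp

lemma hprod_add: "hprod (\<kappa> + \<mu>) = hprod \<kappa> * hprod \<mu>"
  by (simp add: hprod_def)

lemma hprod_simps [simp]: "hprod {#} = 1" "hprod (add_mset r \<kappa>) = complete_symfun r * hprod \<kappa>"
  by (simp_all add: hprod_def)

text \<open>The elementary symmetric function: degree and number of variables agree exactly for
  squarefree monomials.\<close>

lift_definition elem_symfun :: "nat \<Rightarrow> 'a::comm_ring_1 symfun" is
  "\<lambda>r m. if size m = r \<and> card (set_mset m) = r then 1 else 0"
proof -
  fix r :: nat
  have "card (\<pi> ` A) = card A" if "bij \<pi>" for \<pi> :: "nat \<Rightarrow> nat" and A
    using that by (metis bij_is_inj card_image inj_on_subset subset_UNIV)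
  then show "symmetric_series (\<lambda>m. if size m = r \<and> card (set_mset m) = r then 1 else 0 :: 'a) \<and>
      bounded_degree (\<lambda>m. if size m = r \<and> card (set_mset m) = r then 1 else 0 :: 'a)"
    by (auto simp: symmetric_series_def bounded_degree_def)
qed

lemma mset_set_support_subset: "mset_set (set_mset m) \<subseteq># m"
proof (rule mset_subset_eqI)
  fix i show "count (mset_set (set_mset m)) i \<le> count m i"
    by (cases "i \<in># m") (auto simp: count_mset_set' Suc_le_eq)
qed

lemma squarefree_iff: "card (set_mset m) = size m \<longleftrightarrow> m = mset_set (set_mset m)"
proof
  assume "card (set_mset m) = size m"
  then have "size (mset_set (set_mset m)) = size m" by simp
  then show "m = mset_set (set_mset m)"
    using mset_set_support_subset by (metis mset_subset_size nless_le subset_mset.nless_le)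
next
  assume "m = mset_set (set_mset m)"
  then show "card (set_mset m) = size m" by (metis size_mset_set)
qed

text \<open>At a monomial of degree \<open>n\<close> the sum runs with alternating signs over its
  squarefree divisors, that is over the sets of its variables. It equals a nonempty product of
  factors (-1) + 1.\<close>

lemma sum_alternating_elem_complete:
  assumes "n \<ge> 1"
  shows "(\<Sum>i \<le> n. (-1) ^ i * elem_symfun i * complete_symfun (n - i)) = (0 :: int symfun)"
proof (rule symfun_eqI)
  fix m :: "nat multiset"
  let ?E = "\<lambda>a :: nat multiset. card (set_mset a) = size a"
  let ?P = "{(a, b). a + b = m}"
  have coeff: "mcoeff ((-1) ^ i * elem_symfun i * complete_symfun (n - i)) m =
      (\<Sum>(a, b) \<in> ?P. if size a = i \<and> size b = n - i \<and> ?E a then (-1) ^ i else 0 :: int)" for i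
  proof -
    have "(-1) ^ i * elem_symfun i * complete_symfun (n - i) = of_int ((-1) ^ i) * (elem_symfun i * complete_symfun (n - i) :: int symfun)"
      by (simp add: mult.assoc)
    then have "mcoeff ((-1) ^ i * elem_symfun i * complete_symfun (n - i)) m =
        (-1) ^ i * (\<Sum>(a, b) \<in> ?P. mcoeff (elem_symfun i :: int symfun) a * mcoeff (complete_symfun (n - i)) b)"
      by (simp only: mcoeff_of_int_mult mcoeff_mult[of "elem_symfun i :: int symfun" "complete_symfun (n - i)"] of_int_eq_id id_apply)
    also have "\<dots> = (\<Sum>(a, b) \<in> ?P. if size a = i \<and> size b = n - i \<and> ?E a then (-1) ^ i else 0)"
      unfolding sum_distrib_left by (intro sum.cong) (auto simp: elem_symfun.rep_eq)
    finally show ?thesis .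
  qed
  have "mcoeff (\<Sum>i \<le> n. (-1) ^ i * elem_symfun i * complete_symfun (n - i)) m =
     (\<Sum>(a, b) \<in> ?P. \<Sum>i \<le> n. if size a = i \<and> size b = n - i \<and> ?E a then (-1) ^ i else 0 :: int)"
    unfolding mcoeff_sum coeff by (subst sum.swap) (simp add: split_def)
  also have "\<dots> = (\<Sum>(a, b) \<in> ?P. if size m = n \<and> ?E a then (-1) ^ size a else 0)"
  proof (intro sum.cong HOL.refl, clarify)
    fix a b assume "m = a + b"
    have "(\<Sum>i \<le> n. if size a = i \<and> size b = n - i \<and> ?E a then (-1) ^ i else 0 :: int) =
      (\<Sum>i \<le> n. if i = size a then (if size b = n - size a \<and> ?E a then (-1) ^ size a else 0) else 0)"
      by (intro sum.cong) auto
    also have "\<dots> = (if size (a + b) = n \<and> ?E a then (-1) ^ size a else 0)" by auto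
    finally show "(\<Sum>i \<le> n. if size a = i \<and> size b = n - i \<and> ?E a then (-1) ^ i else 0 :: int) =
      (if size (a + b) = n \<and> ?E a then (-1) ^ size a else 0)" .
  qed
  also have "\<dots> = 0"
  proof (cases "size m = n")
    case True
    have "(\<Sum>(a, b) \<in> ?P. if size m = n \<and> ?E a then (-1) ^ size a else 0 :: int) =
        (\<Sum>(a, b) \<in> {(a, b) \<in> ?P. ?E a}. (-1) ^ size a)"
      using True by (intro sum.mono_neutral_cong_right) (auto simp: finite_multiset_splits split: if_splits)
    also have "\<dots> = (\<Sum>A \<in> Pow (set_mset m). (-1) ^ card A)"
    proof (rule sum.reindex_bij_witness[of _ "\<lambda>A. (mset_set A, m - mset_set A)" "\<lambda>(a, b). set_mset a"])
      fix x assume x: "x \<in> {(a, b) \<in> ?P. ?E a}"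
      then obtain a b where ab: "x = (a, b)" "a + b = m" "a = mset_set (set_mset a)"
        unfolding squarefree_iff by blast
      then have sz: "size a = card (set_mset a)" by (metis size_mset_set)
      show "(\<lambda>A. (mset_set A, m - mset_set A)) ((\<lambda>(a, b). set_mset a) x) = x" using ab by auto
      show "(\<lambda>(a, b). set_mset a) x \<in> Pow (set_mset m)" using ab by auto
      show "(-1) ^ card ((\<lambda>(a, b). set_mset a) x) = (\<lambda>(a, b). (-1) ^ size a :: int) x" using ab(1) sz by simp
    next
      fix A assume A: "A \<in> Pow (set_mset m)"
      then have fA: "finite A" by (auto intro: finite_subset)
      show "(\<lambda>(a, b). set_mset a) (mset_set A, m - mset_set A) = A" using fA by simp
      have "mset_set A \<subseteq># m" using A fA
        by (metis PowD finite_set_mset msubset_mset_set_iff mset_set_support_subset subset_mset.trans)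
      then show "(mset_set A, m - mset_set A) \<in> {(a, b) \<in> ?P. ?E a}" using fA by auto
    qed
    also have "\<dots> = (\<Prod>x \<in> set_mset m. (-1) + 1)"
      using prod_add[of "set_mset m" "\<lambda>_. -1 :: int" "\<lambda>_. 1"] by simp
    also have "\<dots> = 0"
    proof -
      have "set_mset m \<noteq> {}" using True assms by auto
      then show ?thesis by (simp add: card_gt_0_iff)
    qed
    finally show ?thesis .
  qed simp
  finally show "mcoeff (\<Sum>i \<le> n. (-1) ^ i * elem_symfun i * complete_symfun (n - i)) m = mcoeff (0 :: int symfun) m"
    by simp
qed

lemma complete_in_span: "(complete_symfun n :: int symfun) \<in> int_span hprod"
proof (cases n)
  case 0
  then show ?thesis using int_span.gen[of "{#}" "hprod :: _ \<Rightarrow> int symfun"] by (simp add: Par_def)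
next
  case (Suc k)
  then show ?thesis using int_span.gen[of "{#n#}" "hprod :: _ \<Rightarrow> int symfun"] by (simp add: Par_def)
qed

text \<open>As h_0 = 1, the alternating relation expresses e_n by products of earlier e_i with
  complete functions.\<close>

lemma elem_in_span: "(elem_symfun n :: int symfun) \<in> int_span hprod"
proof (induction n rule: less_induct)
  case (less n)
  have mult: "x * y \<in> int_span hprod" if "x \<in> int_span hprod" "y \<in> int_span hprod" for x y :: "int symfun"
    using int_span_mult[of hprod] that hprod_add by blast
  show ?case
  proof (cases "n = 0")
    case True
    then have "elem_symfun n = (complete_symfun n :: int symfun)"
      using True by (intro symfun_eqI) (auto simp: elem_symfun.rep_eq)
    then show ?thesis using complete_in_span by metis
  next
    case False
    then have "0 = (\<Sum>i \<le> n. (-1) ^ i * elem_symfun i * complete_symfun (n - i) :: int symfun)"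
      using sum_alternating_elem_complete[of n] by simp
    also have "\<dots> = (-1) ^ n * elem_symfun n + (\<Sum>i < n. (-1) ^ i * elem_symfun i * complete_symfun (n - i))"
      by (simp flip: lessThan_Suc_atMost)
    finally have "(-1) ^ n * elem_symfun n = - (\<Sum>i < n. of_int ((-1) ^ i) * (elem_symfun i * complete_symfun (n - i)) :: int symfun)"
      by (simp add: eq_neg_iff_add_eq_0 mult.assoc)
    then have "(-1) ^ n * ((-1) ^ n * elem_symfun n) = of_int ((-1) ^ n) * (- (\<Sum>i < n. of_int ((-1) ^ i) * (elem_symfun i * complete_symfun (n - i)) :: int symfun))"
      by simp
    moreover have "(-1) ^ n * ((-1) ^ n * elem_symfun n) = (elem_symfun n :: int symfun)"
      by (cases "even n") simp_all
    moreover have "of_int ((-1) ^ n) * (- (\<Sum>i < n. of_int ((-1) ^ i) * (elem_symfun i * complete_symfun (n - i)) :: int symfun)) \<in> int_span hprod"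
      by (intro int_span_of_int_mult int_span.minus int_span_sum mult less complete_in_span) simp
    ultimately show ?thesis by simp
  qed
qed

text \<open>Multiplying by \<open>e\<^sub>\<ell>\<close> with \<open>\<ell> = \<ell>(\<mu>)\<close> adds the first column back to the diagram of \<open>\<mu>\<close>,
  up to monomials with more variables.\<close>

definition drop_column :: "partition \<Rightarrow> partition" where
  "drop_column \<mu> = filter_mset (\<lambda>k. 0 < k) (image_mset (\<lambda>k. k - 1) \<mu>)"

lemma drop_column_inj:
  assumes "\<mu> \<in> Par" "\<nu> \<in> Par" "size \<mu> = size \<nu>" "drop_column \<mu> = drop_column \<nu>"
  shows "\<mu> = \<nu>"
proof -
  have *: "\<mu> = image_mset Suc (drop_column \<mu> + replicate_mset (size \<mu> - size (drop_column \<mu>)) 0)" if "\<mu> \<in> Par" for \<mu>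
  proof -
    let ?M = "image_mset (\<lambda>k. k - 1) \<mu>"
    have "?M = drop_column \<mu> + filter_mset (\<lambda>k. k = 0) ?M"
      unfolding drop_column_def using multiset_partition[of ?M "\<lambda>k. k \<noteq> 0"] by simp
    moreover have "filter_mset (\<lambda>k. k = 0) ?M = replicate_mset (size (filter_mset (\<lambda>k. k = 0) ?M)) 0"
      by (metis filter_eq_replicate_mset size_replicate_mset)
    ultimately have "?M = drop_column \<mu> + replicate_mset (size \<mu> - size (drop_column \<mu>)) 0"
      by (metis add_diff_cancel_left' size_image_mset size_union)
    moreover have "image_mset Suc ?M = \<mu>"
    proof -
      have "image_mset (\<lambda>k. Suc (k - 1)) \<mu> = image_mset id \<mu>"
      proof (rule image_mset_cong)
        fix k assume "k \<in># \<mu>"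
        then have "k \<noteq> 0" using that unfolding Par_def by (metis mem_Collect_eq)
        then show "Suc (k - 1) = id k" by simp
      qed
      then show ?thesis by (simp add: multiset.map_comp comp_def)
    qed
    ultimately show ?thesis by metis
  qed
  show ?thesis using *[OF assms(1)] *[OF assms(2)] assms(3,4) by metis
qed

lemma exponents_drop_support: "exponents (m - mset_set (set_mset m)) = drop_column (exponents m)"
proof -
  have cnt: "count (m - mset_set (set_mset m)) i = count m i - 1" for i
    by (cases "i \<in># m") (auto simp: not_in_iff)
  have set: "set_mset (m - mset_set (set_mset m)) = {i \<in> set_mset m. 0 < count m i - 1}"
    using cnt by (auto simp flip: count_greater_zero_iff)
  show ?thesis
    unfolding drop_column_def exponents_def set cnt by (simp add: multiset.map_comp comp_def filter_mset_image_mset)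
qed

text \<open>With at most \<open>size \<mu>\<close> variables available, the squarefree factor must
  use each of them exactly once; what remains has lost the first column of \<kappa>.\<close>

lemma elem_mult_monomial:
  assumes \<mu>: "\<mu> \<in> Par" and \<kappa>: "\<kappa> \<in> Par" "size \<kappa> \<le> size \<mu>"
  shows "mcf (elem_symfun (size \<mu>) * monomial_symfun (drop_column \<mu>) :: int symfun) \<kappa> = (if \<kappa> = \<mu> then 1 else 0)"
proof -
  define m where "m = mono_of (sorted_list_of_multiset \<kappa>)"
  have m: "exponents m = \<kappa>" "card (set_mset m) = size \<kappa>"
    using \<kappa>(1) by (simp_all add: m_def exponents_mono_of_sorted flip: size_exponents)
  let ?s = "mset_set (set_mset m)"
  note sub = mset_set_support_subset[of m]
  have zero: "mcoeff (elem_symfun (size \<mu>) :: int symfun) a * mcoeff (monomial_symfun (drop_column \<mu>)) b = 0"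
    if ab: "a + b = m" "(a, b) \<noteq> (?s, m - ?s)" for a b
  proof (rule ccontr)
    assume "\<not> ?thesis"
    then have a: "size a = size \<mu>" "a = mset_set (set_mset a)"
      by (auto simp: elem_symfun.rep_eq squarefree_iff[symmetric] split: if_splits)
    have sz: "card (set_mset a) = size \<mu>" using a by (metis size_mset_set)
    have "set_mset a \<subseteq> set_mset m" using ab by auto
    then have "set_mset a = set_mset m" using sz m(2) \<kappa>(2) by (metis card_seteq finite_set_mset)
    then have "a = ?s" using a(2) by simp
    then show False using ab by (metis add_diff_cancel_left')
  qed
  have "mcf (elem_symfun (size \<mu>) * monomial_symfun (drop_column \<mu>) :: int symfun) \<kappa> =
    mcoeff (elem_symfun (size \<mu>)) ?s * mcoeff (monomial_symfun (drop_column \<mu>)) (m - ?s)"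
    unfolding mcf_def m_def[symmetric] using zero sub by (intro mcoeff_mult_single) simp_all
  also have "\<dots> = (if size \<kappa> = size \<mu> \<and> drop_column \<kappa> = drop_column \<mu> then 1 else 0)"
    by (simp add: elem_symfun.rep_eq exponents_drop_support m)
  finally show ?thesis using drop_column_inj[OF \<kappa>(1) \<mu>] by auto
qed

lemma size_le_sum_Par: "\<kappa> \<in> Par \<Longrightarrow> size \<kappa> \<le> \<Sum>\<^sub># \<kappa>"
  unfolding Par_def by (induction \<kappa>) auto

lemma mcf_mult_degree:
  assumes "\<And>a. size a \<noteq> p \<Longrightarrow> mcoeff f a = 0" "\<And>b. size b \<noteq> q \<Longrightarrow> mcoeff g b = 0" "\<kappa> \<in> Par" "\<Sum>\<^sub># \<kappa> \<noteq> p + q"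
  shows "mcf (f * g) \<kappa> = 0"
proof -
  have "size (mono_of (sorted_list_of_multiset \<kappa>)) \<noteq> p + q"
    using assms(3,4) by (simp add: size_eq_sum_exponents exponents_mono_of_sorted)
  then have "mcoeff f a * mcoeff g b = 0" if "a + b = mono_of (sorted_list_of_multiset \<kappa>)" for a b
    using assms(1)[of a] assms(2)[of b] that by (metis mult_zero_left mult_zero_right size_union)
  then show ?thesis unfolding mcf_def mcoeff_mult by (intro sum.neutral) auto
qed

lemma sum_drop_column: "\<mu> \<in> Par \<Longrightarrow> \<Sum>\<^sub># (drop_column \<mu>) + size \<mu> = \<Sum>\<^sub># \<mu>"
  unfolding Par_def drop_column_def by (induction \<mu>) auto

lemma drop_column_Par: "drop_column \<mu> \<in> Par"
  by (simp add: drop_column_def Par_def)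

lemma monomial_in_span:
  assumes "\<mu> \<in> Par"
  shows "(monomial_symfun \<mu> :: int symfun) \<in> int_span hprod"
proof -
  have "wf (less_than <*lex*> less_than)" by blast
  \<comment> \<open>The difference \<open>\<Sum>\<^sub># \<mu> - size \<mu>\<close> turns a growing
    number of parts in a fixed degree into a descent; the number of parts is bounded by the
    degree.\<close>
  then have "wf (inv_image (less_than <*lex*> less_than) (\<lambda>\<mu> :: partition. (\<Sum>\<^sub># \<mu>, \<Sum>\<^sub># \<mu> - size \<mu>)))" by (rule wf_inv_image)
  then show ?thesis using assms
  proof (induction \<mu> rule: wf_induct_rule)
    case (less \<mu>)
    show ?case
    proof (cases "\<mu> = {#}")
      case True
      have "monomial_symfun \<mu> = (1 :: int symfun)"
        using True by (intro symfun_eqI) (simp add: exponents_def mset_set_empty_iff)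
      then show ?thesis using int_span.gen[of "{#}" "hprod :: _ \<Rightarrow> int symfun"] by (simp add: Par_def)
    next
      case False
      let ?f = "elem_symfun (size \<mu>) * monomial_symfun (drop_column \<mu>) :: int symfun"
      have deg: "\<Sum>\<^sub># (drop_column \<mu>) + size \<mu> = \<Sum>\<^sub># \<mu>" using sum_drop_column less.prems .
      have "size \<mu> > 0" using False by (simp add: nonempty_has_size)
      then have "monomial_symfun (drop_column \<mu>) \<in> int_span (hprod :: _ \<Rightarrow> int symfun)"
        using deg by (intro less.IH drop_column_Par) simp
      then have f: "?f \<in> int_span hprod"
        by (intro int_span_mult elem_in_span) (simp_all add: hprod_add)
      let ?S = "{\<kappa> \<in> Par. mcf ?f \<kappa> \<noteq> 0}"
      have \<mu>: "mcf ?f \<mu> = 1" using elem_mult_monomial[OF less.prems less.prems] by simp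
      have mem: "\<kappa> \<in> Par" "\<Sum>\<^sub># \<kappa> = \<Sum>\<^sub># \<mu>" "\<kappa> \<noteq> \<mu> \<Longrightarrow> size \<mu> < size \<kappa>" if "\<kappa> \<in> ?S" for \<kappa>
      proof -
        show \<kappa>: "\<kappa> \<in> Par" using that by blast
        have "mcf ?f \<kappa> \<noteq> 0" using that by blast
        then show "\<kappa> \<noteq> \<mu> \<Longrightarrow> size \<mu> < size \<kappa>" using elem_mult_monomial[OF less.prems \<kappa>] by fastforce
        show "\<Sum>\<^sub># \<kappa> = \<Sum>\<^sub># \<mu>"
        proof (rule ccontr)
          assume "\<Sum>\<^sub># \<kappa> \<noteq> \<Sum>\<^sub># \<mu>"
          then have "\<Sum>\<^sub># \<kappa> \<noteq> size \<mu> + \<Sum>\<^sub># (drop_column \<mu>)" using deg by linarith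
          moreover have "mcoeff (elem_symfun (size \<mu>)) a = (0 :: int)" if "size a \<noteq> size \<mu>" for a
            using that by (simp add: elem_symfun.rep_eq)
          moreover have "mcoeff (monomial_symfun (drop_column \<mu>)) b = (0 :: int)" if "size b \<noteq> \<Sum>\<^sub># (drop_column \<mu>)" for b
            using that by (auto simp: size_eq_sum_exponents)
          ultimately show False using mcf_mult_degree \<kappa> \<open>mcf ?f \<kappa> \<noteq> 0\<close> by blast
        qed
      qed
      have "?f = (\<Sum>\<kappa> \<in> ?S. of_int (mcf ?f \<kappa>) * monomial_symfun \<kappa>)" by (rule symfun_monomial_expansion)
      also have "\<dots> = monomial_symfun \<mu> + (\<Sum>\<kappa> \<in> ?S - {\<mu>}. of_int (mcf ?f \<kappa>) * monomial_symfun \<kappa>)"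
        using \<mu> less.prems by (subst sum.remove[of _ \<mu>]) (simp_all add: finite_mcf_support)
      finally have "monomial_symfun \<mu> = ?f + - (\<Sum>\<kappa> \<in> ?S - {\<mu>}. of_int (mcf ?f \<kappa>) * monomial_symfun \<kappa>)"
        by (simp add: algebra_simps)
      moreover have "(\<Sum>\<kappa> \<in> ?S - {\<mu>}. of_int (mcf ?f \<kappa>) * monomial_symfun \<kappa> :: int symfun) \<in> int_span hprod"
      proof (intro int_span_sum int_span_of_int_mult less.IH)
        fix \<kappa> assume "\<kappa> \<in> ?S - {\<mu>}"
        then have \<kappa>: "\<kappa> \<in> ?S" "\<kappa> \<noteq> \<mu>" by blast+
        then show "\<kappa> \<in> Par" by blast
        show "(\<kappa>, \<mu>) \<in> inv_image (less_than <*lex*> less_than) (\<lambda>\<mu>. (\<Sum>\<^sub># \<mu>, \<Sum>\<^sub># \<mu> - size \<mu>))"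
          using mem[OF \<kappa>(1)] \<kappa>(2) size_le_sum_Par[of \<kappa>] by (simp add: in_inv_image)
      qed
      ultimately show ?thesis using f by (simp only:) (intro int_span.add int_span.minus)
    qed
  qed
qed

lemma int_span_hprod: "(f :: int symfun) \<in> int_span hprod"
  by (subst symfun_monomial_expansion) (auto intro!: int_span_sum int_span_of_int_mult monomial_in_span)

lemma symfun_induct [case_names zero hprod add minus]:
  fixes f :: "int symfun"
  assumes "P 0" "\<And>\<kappa>. \<kappa> \<in> Par \<Longrightarrow> P (hprod \<kappa>)" "\<And>x y. P x \<Longrightarrow> P y \<Longrightarrow> P (x + y)" "\<And>x. P x \<Longrightarrow> P (- x)"
  shows "P f"
  using int_span_hprod[of f] by induction (auto intro: assms)

section \<open>Symmetry of the Hall inner product\<close>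

text \<open>Matrices of nonnegative integers, each row stored as a multiset of column indices: the
  row sums are \<open>ls\<close>, the column sums are the multiplicities in
  \<open>m\<close>.\<close>

definition distributions :: "nat list \<Rightarrow> 'a multiset \<Rightarrow> 'a multiset list set" where
  "distributions ls m = {Ms. map size Ms = ls \<and> sum_list Ms = m}"

lemma finite_distributions: "finite (distributions ls m)"
proof -
  have "a \<subseteq># sum_list Ms" if "a \<in> set Ms" for a :: "'a multiset" and Ms
    using that by (induction Ms) (auto intro: subset_mset.order_trans)
  then have "distributions ls m \<subseteq> {Ms. set Ms \<subseteq> {a. a \<subseteq># m} \<and> length Ms = length ls}"
    by (auto simp: distributions_def)
  then show ?thesis by (rule finite_subset) (simp add: finite_lists_length_eq finite_submultisets)
qed

lemma mcoeff_prod_complete: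
  "mcoeff (\<Prod>l\<leftarrow>ls. complete_symfun l :: int symfun) m = int (card (distributions ls m))"
proof (induction ls arbitrary: m)
  case Nil
  have "distributions [] m = (if m = {#} then {[]} else {})" by (auto simp: distributions_def)
  then show ?case by simp
next
  case (Cons l ls)
  let ?P = "{(a, b). a + b = m}" and ?Q = "{(a, b). a + b = m \<and> size a = l}"
  have Q: "?Q \<subseteq> ?P" by auto
  then have fQ: "finite ?Q" using finite_subset finite_multiset_splits by blast
  have "distributions (l # ls) m = (\<Union>(a, b) \<in> ?Q. (#) a ` distributions ls b)"
  proof (intro equalityI subsetI)
    fix Ms assume "Ms \<in> distributions (l # ls) m"
    then obtain a Ns where "Ms = a # Ns" "size a = l" "map size Ns = ls" "a + sum_list Ns = m"
      by (auto simp: distributions_def map_eq_Cons_conv)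
    then show "Ms \<in> (\<Union>(a, b) \<in> ?Q. (#) a ` distributions ls b)"
      by (intro UN_I[of "(a, sum_list Ns)"]) (auto simp: distributions_def)
  qed (auto simp: distributions_def)
  then have "card (distributions (l # ls) m) = (\<Sum>(a, b) \<in> ?Q. card ((#) a ` distributions ls b))"
    using fQ by (simp only:) (subst card_UN_disjoint, auto simp: finite_distributions split_def)
  also have "\<dots> = (\<Sum>(a, b) \<in> ?Q. card (distributions ls b))"
    by (simp add: card_image split_def)
  finally have "int (card (distributions (l # ls) m)) = (\<Sum>(a, b) \<in> ?Q. int (card (distributions ls b)))"
    by (simp add: split_def)
  also have "\<dots> = (\<Sum>(a, b) \<in> ?P. mcoeff (complete_symfun l) a * mcoeff (\<Prod>l\<leftarrow>ls. complete_symfun l :: int symfun) b)"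
    by (rule sum.mono_neutral_cong_left[OF finite_multiset_splits Q]) (auto simp: Cons.IH split: if_splits)
  finally show ?case by (simp only: list.map prod_list.Cons mcoeff_mult)
qed

lemma count_sum_list_mset: "count (sum_list Ms) i = (\<Sum>M\<leftarrow>Ms. count M i)"
  by (induction Ms) simp_all

lemma size_mono_of: "size (mono_of ks) = sum_list ks"
proof -
  have "size (\<Sum>i \<in> I. M i) = (\<Sum>i \<in> I. size (M i))" for M :: "nat \<Rightarrow> nat multiset" and I
    by (induction I rule: infinite_finite_induct) simp_all
  then show ?thesis by (simp add: mono_of_def sum_list_sum_nth atLeast0LessThan)
qed

definition transpose_distribution :: "nat \<Rightarrow> nat multiset list \<Rightarrow> nat multiset list" where
  "transpose_distribution k Ms = map (\<lambda>i. mono_of (map (\<lambda>M. count M i) Ms)) [0..<k]"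

lemma transpose_distribution:
  assumes "Ms \<in> distributions ls (mono_of ks)"
  shows "transpose_distribution (length ks) Ms \<in> distributions ks (mono_of ls)"
    and "transpose_distribution (length ls) (transpose_distribution (length ks) Ms) = Ms"
proof -
  let ?Ns = "transpose_distribution (length ks) Ms"
  have Ms: "map size Ms = ls" "sum_list Ms = mono_of ks" using assms by (auto simp: distributions_def)
  have len: "length Ms = length ls" using Ms(1) by auto
  have cnt: "count (?Ns ! i) j = (if j < length ls then count (Ms ! j) i else 0)" if "i < length ks" for i j
    using that len by (simp add: transpose_distribution_def count_mono_of)
  have supp: "count (Ms ! j) i = 0" if "j < length ls" "i \<ge> length ks" for i j
  proof -
    have "count (Ms ! j) i \<le> (\<Sum>M\<leftarrow>Ms. count M i)"
      by (rule member_le_sum_list) (use that len in auto)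
    also have "\<dots> = 0" using that by (simp add: Ms(2) count_mono_of flip: count_sum_list_mset)
    finally show ?thesis by simp
  qed
  have "map size ?Ns = ks"
  proof (rule nth_equalityI)
    fix i assume "i < length (map size ?Ns)"
    then have i: "i < length ks" by (simp add: transpose_distribution_def)
    then show "map size ?Ns ! i = ks ! i"
      by (simp add: transpose_distribution_def size_mono_of count_mono_of Ms(2) flip: count_sum_list_mset)
  qed (simp add: transpose_distribution_def)
  moreover have "sum_list ?Ns = mono_of ls"
  proof (rule multiset_eqI)
    fix j
    have "count (sum_list ?Ns) j = (\<Sum>i < length ks. if j < length ls then count (Ms ! j) i else 0)"
      unfolding count_sum_list_mset using len
      by (auto simp: transpose_distribution_def sum_list_sum_nth count_mono_of atLeast0LessThan intro!: sum.cong)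
    also have "\<dots> = count (mono_of ls) j"
    proof (cases "j < length ls")
      case True
      have "set_mset (Ms ! j) \<subseteq> {..<length ks}" using supp[OF True] by (metis lessThan_iff linorder_not_less not_in_iff subsetI)
      then have "(\<Sum>i < length ks. count (Ms ! j) i) = size (Ms ! j)"
        unfolding size_multiset_overloaded_eq by (intro sum.mono_neutral_right) (auto simp: not_in_iff)
      then show ?thesis using True len Ms(1) by (simp add: count_mono_of) (metis nth_map)
    qed (simp add: count_mono_of)
    finally show "count (sum_list ?Ns) j = count (mono_of ls) j" .
  qed
  ultimately show "?Ns \<in> distributions ks (mono_of ls)" by (simp add: distributions_def)
  have lN: "length ?Ns = length ks" by (simp add: transpose_distribution_def)
  show "transpose_distribution (length ls) ?Ns = Ms"
  proof (rule nth_equalityI)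
    fix j assume "j < length (transpose_distribution (length ls) ?Ns)"
    then have j: "j < length ls" by (simp add: transpose_distribution_def)
    have "count (mono_of (map (\<lambda>N. count N j) ?Ns)) i = count (Ms ! j) i" for i
      using j cnt supp lN by (simp add: count_mono_of)
    then show "transpose_distribution (length ls) ?Ns ! j = Ms ! j"
      using j by (simp add: transpose_distribution_def[of "length ls"] multiset_eq_iff)
  qed (simp add: transpose_distribution_def len)
qed

lemma hprod_mset: "hprod (mset ls) = (\<Prod>l\<leftarrow>ls. complete_symfun l)"
  by (induction ls) simp_all

text \<open>Both sides count matrices of nonnegative integers with given row and column sums;
  transposition exchanges the two counts.\<close>

lemma mcf_hprod_commute: "mcf (hprod \<kappa> :: int symfun) \<mu> = mcf (hprod \<mu>) \<kappa>"
proof -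
  have "bij_betw (transpose_distribution (length ks)) (distributions ls (mono_of ks)) (distributions ks (mono_of ls))" for ks ls
    using transpose_distribution
    by (intro bij_betw_byWitness[where f' = "transpose_distribution (length ls)"]) blast+
  then have "mcoeff (hprod (mset ls) :: int symfun) (mono_of ks) = mcoeff (hprod (mset ks)) (mono_of ls)" for ks ls
    unfolding hprod_mset mcoeff_prod_complete by (metis bij_betw_same_card)
  from this[of "sorted_list_of_multiset \<kappa>" "sorted_list_of_multiset \<mu>"] show ?thesis by (simp add: mcf_def)
qed

lemma lin_ext_mcf_add: "lin_ext (mcf (f + g)) a = lin_ext (mcf f) a + lin_ext (mcf g) a"
  by (simp add: lin_ext_def distrib_left sum.distrib)

text \<open>A relation between the h_\<kappa> gives, by the symmetry of their monomial coefficients,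
  a functional that kills every h_\<mu> and hence everything, since they span. Its value at
  m_\<kappa> is the coefficient of h_\<kappa> in the relation.\<close>

lemma lin_ext_hprod_inj:
  assumes "keys a \<subseteq> Par" "keys b \<subseteq> Par" "lin_ext hprod a = (lin_ext hprod b :: int symfun)"
  shows "a = b"
proof -
  define c where "c = a + - b"
  have c: "keys c \<subseteq> Par"
    using assms(1,2) Poly_Mapping.keys_add[of a "- b"] unfolding c_def by auto
  have 0: "lin_ext hprod c = (0 :: int symfun)"
    using assms(3) by (simp only: c_def lin_ext_add lin_ext_minus) simp
  have all: "lin_ext (mcf g) c = 0" for g :: "int symfun"
  proof (induction g rule: symfun_induct)
    case zero
    show ?case by (simp add: lin_ext_def)
  next
    case (hprod \<kappa>)
    have "lin_ext (mcf (HP \<kappa>)) c = mcf (lin_ext HP c) \<kappa>" if "\<And>\<kappa> \<mu>. mcf (HP \<kappa>) \<mu> = mcf (HP \<mu>) \<kappa>" for HP :: "partition \<Rightarrow> int symfun"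
      unfolding lin_ext_def by (simp add: mcf_sum that[of \<kappa>])
    from this[OF mcf_hprod_commute] show ?case using 0 by simp
  next
    case (add x y)
    then show ?case by (simp only: lin_ext_mcf_add)
  next
    case (minus x)
    then show ?case by (simp add: lin_ext_def sum_negf)
  qed
  have "lookup c \<kappa> = 0" for \<kappa>
  proof (cases "\<kappa> \<in> keys c")
    case True
    have "lin_ext (mcf (monomial_symfun \<kappa>)) c = (\<Sum>\<mu> \<in> keys c. if \<mu> = \<kappa> then lookup c \<mu> else 0)"
      unfolding lin_ext_def using c by (intro sum.cong) (auto simp: mcf_monomial)
    then show ?thesis using all[of "monomial_symfun \<kappa>"] True by simp
  qed (simp add: in_keys_iff)
  then have "c = 0" by (simp add: poly_mapping_eq_iff fun_eq_iff)
  then show ?thesis by (simp add: c_def)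
qed

lemma hprod_coordinates:
  obtains a where "keys a \<subseteq> Par" "(f :: int symfun) = lin_ext hprod a"
  using int_span_hprod[of f] by (auto simp: int_span_eq_lin_ext)

lemma mcf_lin_ext_monomial:
  assumes "\<kappa> \<in> Par"
  shows "mcf (lin_ext monomial_symfun b :: int symfun) \<kappa> = lookup b \<kappa>"
proof -
  have "mcf (lin_ext monomial_symfun b :: int symfun) \<kappa> = (\<Sum>\<mu> \<in> keys b. lookup b \<mu> * mcf (monomial_symfun \<mu> :: int symfun) \<kappa>)"
    by (simp add: lin_ext_def mcf_sum)
  also have "\<dots> = (\<Sum>\<mu> \<in> keys b. if \<mu> = \<kappa> then lookup b \<mu> else 0)"
    using assms by (intro sum.cong) (auto simp: mcf_monomial)
  also have "\<dots> = lookup b \<kappa>" by (simp add: in_keys_iff)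
  finally show ?thesis .
qed

lemma monomial_coordinates:
  fixes g :: "int symfun"
  obtains b where "keys b \<subseteq> Par" "g = lin_ext monomial_symfun b"
proof -
  have "g \<in> int_span monomial_symfun"
    by (subst symfun_monomial_expansion) (auto intro!: int_span_sum int_span_of_int_mult int_span.gen)
  then show ?thesis using that by (auto simp: int_span_eq_lin_ext)
qed

text \<open>Uniqueness of coordinates in both bases makes the definite description in
  \<open>hall_inner\<close> take this value.\<close>

lemma hall_lin_ext:
  assumes a: "keys a \<subseteq> Par"
  shows "hall_inner (lin_ext hprod a) g = lin_ext (mcf g) a"
proof -
  obtain b where b: "keys b \<subseteq> Par" "g = lin_ext monomial_symfun b" using monomial_coordinates .
  have val: "(\<Sum>\<kappa> \<in> keys a'. lookup a' \<kappa> * lookup b' \<kappa>) = lin_ext (mcf g) a"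
    if "keys a' \<subseteq> Par" "keys b' \<subseteq> Par" "lin_ext hprod a = (lin_ext hprod a' :: int symfun)" "g = lin_ext monomial_symfun b'" for a' b'
  proof -
    have "a' = a" using lin_ext_hprod_inj[OF a that(1,3)] by simp
    moreover have "mcf g \<kappa> = lookup b' \<kappa>" if "\<kappa> \<in> keys a" for \<kappa>
      using \<open>g = lin_ext monomial_symfun b'\<close> that a mcf_lin_ext_monomial by blast
    ultimately show ?thesis by (simp add: lin_ext_def)
  qed
  show ?thesis
    unfolding hall_inner_def hprod_def[symmetric] lin_ext_def[symmetric, where 'a = "int symfun"]
  proof (rule the_equality)
    show "\<exists>a' b'. keys a' \<subseteq> Par \<and> keys b' \<subseteq> Par \<and> lin_ext hprod a = (lin_ext hprod a' :: int symfun) \<and>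
       g = lin_ext monomial_symfun b' \<and> lin_ext (mcf g) a = (\<Sum>\<kappa> \<in> keys a'. lookup a' \<kappa> * lookup b' \<kappa>)"
      using a b val[OF a b(1) HOL.refl b(2)] by (rule_tac exI[of _ a], rule_tac exI[of _ b]) metis
  next
    fix k
    assume "\<exists>a' b'. keys a' \<subseteq> Par \<and> keys b' \<subseteq> Par \<and> lin_ext hprod a = (lin_ext hprod a' :: int symfun) \<and>
       g = lin_ext monomial_symfun b' \<and> k = (\<Sum>\<kappa> \<in> keys a'. lookup a' \<kappa> * lookup b' \<kappa>)"
    then show "k = lin_ext (mcf g) a" using val by blast
  qed
qed

lemma hall_hprod: "\<kappa> \<in> Par \<Longrightarrow> hall_inner (hprod \<kappa>) g = mcf g \<kappa>"
  using hall_lin_ext[of "single \<kappa> 1" g] by simp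

lemma hall_add_left [simp]: "hall_inner (f + f') g = hall_inner f g + hall_inner f' g"
proof -
  obtain a where a: "keys a \<subseteq> Par" "f = lin_ext hprod a" using hprod_coordinates .
  obtain b where b: "keys b \<subseteq> Par" "f' = lin_ext hprod b" using hprod_coordinates .
  have "keys (a + b) \<subseteq> Par" using a b Poly_Mapping.keys_add[of a b] by auto
  then show ?thesis using hall_lin_ext[of "a + b"] a b by (simp add: lin_ext_add hall_lin_ext)
qed

lemma hall_minus_left [simp]: "hall_inner (- f) g = - hall_inner f g"
proof -
  obtain a where a: "keys a \<subseteq> Par" "f = lin_ext hprod a" using hprod_coordinates .
  then show ?thesis using hall_lin_ext[of "- a"] by (simp add: lin_ext_minus hall_lin_ext)
qed

lemma hall_zero_left [simp]: "hall_inner 0 g = 0"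
  using hall_lin_ext[of 0 g] by simp

lemma hall_add_right [simp]: "hall_inner f (g + g') = hall_inner f g + hall_inner f g'"
  by (induction f rule: symfun_induct) (simp_all add: hall_hprod)

lemma hall_minus_right [simp]: "hall_inner f (- g) = - hall_inner f g"
  by (induction f rule: symfun_induct) (simp_all add: hall_hprod)

lemma hall_zero_right [simp]: "hall_inner f 0 = 0"
  by (induction f rule: symfun_induct) (simp_all add: hall_hprod)

lemma hall_commute: "hall_inner f g = hall_inner g f"
proof (induction f rule: symfun_induct)
  case (hprod \<kappa>)
  show ?case
  proof (induction g rule: symfun_induct)
    case (hprod \<mu>)
    then show ?case using \<open>\<kappa> \<in> Par\<close> mcf_hprod_commute by (simp add: hall_hprod)
  qed simp_all
qed simp_all

lemma hall_nondegenerate: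
  assumes "\<And>g. hall_inner f g = 0"
  shows "f = 0"
proof (rule symfun_eq_mcfI)
  fix \<kappa> :: partition assume "\<kappa> \<in> Par"
  then show "mcf f \<kappa> = mcf 0 \<kappa>" using assms[of "hprod \<kappa>"] by (simp add: hall_commute[of f] hall_hprod)
qed

lemma hall_of_int_mult_left [simp]: "hall_inner (of_int c * f) g = c * hall_inner f g"
proof -
  have "hall_inner (of_nat n * f) g = int n * hall_inner f g" for n
    by (induction n) (simp_all add: distrib_right)
  then show ?thesis by (cases c rule: int_cases2) simp_all
qed

lemma hall_of_int_mult_right [simp]: "hall_inner f (of_int c * g) = c * hall_inner f g"
  by (simp add: hall_commute[of f])

lemma hall_sum_left: "hall_inner (\<Sum>x \<in> A. F x) g = (\<Sum>x \<in> A. hall_inner (F x) g)"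
  by (induction A rule: infinite_finite_induct) simp_all

lemma hall_sum_right: "hall_inner f (\<Sum>x \<in> A. F x) = (\<Sum>x \<in> A. hall_inner f (F x))"
  by (induction A rule: infinite_finite_induct) simp_all

text \<open>The common source of the endomorphism \<open>star\<close> and of the derivations
  \<open>p_adj\<close>; the coordinates in the basis h_\<kappa> are unique by
  \<open>lin_ext_hprod_inj\<close>.\<close>

definition hmap :: "(partition \<Rightarrow> int symfun) \<Rightarrow> int symfun \<Rightarrow> int symfun" where
  "hmap F f = lin_ext F (THE a. keys a \<subseteq> Par \<and> f = lin_ext hprod a)"

lemma hmap_lin_ext:
  assumes "keys a \<subseteq> Par"
  shows "hmap F (lin_ext hprod a) = lin_ext F a"
proof -
  have "(THE b. keys b \<subseteq> Par \<and> (lin_ext hprod a :: int symfun) = lin_ext hprod b) = a"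
    using assms lin_ext_hprod_inj by (intro the_equality) metis+
  then show ?thesis by (simp add: hmap_def)
qed

lemma hmap_hprod: "\<kappa> \<in> Par \<Longrightarrow> hmap F (hprod \<kappa>) = F \<kappa>"
  using hmap_lin_ext[of "single \<kappa> 1"] by simp

lemma hmap_add [simp]: "hmap F (f + g) = hmap F f + hmap F g"
proof -
  obtain a where a: "keys a \<subseteq> Par" "f = lin_ext hprod a" using hprod_coordinates .
  obtain b where b: "keys b \<subseteq> Par" "g = lin_ext hprod b" using hprod_coordinates .
  have "keys (a + b) \<subseteq> Par" using a b Poly_Mapping.keys_add[of a b] by auto
  then show ?thesis using hmap_lin_ext[of "a + b"] a b by (simp add: lin_ext_add hmap_lin_ext)
qed

lemma hmap_minus [simp]: "hmap F (- f) = - hmap F f"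
proof -
  obtain a where a: "keys a \<subseteq> Par" "f = lin_ext hprod a" using hprod_coordinates .
  then show ?thesis using hmap_lin_ext[of "- a"] by (simp add: lin_ext_minus hmap_lin_ext)
qed

lemma hmap_zero [simp]: "hmap F 0 = 0"
  using hmap_lin_ext[of 0 F] by simp

lemma hmap_sum: "hmap F (\<Sum>x \<in> A. G x) = (\<Sum>x \<in> A. hmap F (G x))"
  by (induction A rule: infinite_finite_induct) simp_all

lemma hmap_of_int_mult: "hmap F (of_int c * f) = of_int c * hmap F f"
proof -
  have "hmap F (of_nat n * f) = of_nat n * hmap F f" for n
    by (induction n) (simp_all add: distrib_right)
  then show ?thesis by (cases c rule: int_cases2) simp_all
qed


section \<open>Inverse series, Macdonald's basis and its multiplication\<close>

section \<open>Compositional inverses\<close>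

lemma shifted_series_eq: "shifted_series a = shift_fps a"
  by (simp add: shifted_series_def shift_fps_def)

fun comp_inverse :: "(nat \<Rightarrow> 'a::comm_ring_1) \<Rightarrow> nat \<Rightarrow> 'a" where
  "comp_inverse f k = fps_X $ Suc k - (\<Sum>i < k. comp_inverse f i * (shift_fps f ^ Suc i) $ Suc k)"

declare comp_inverse.simps [simp del]

lemma shift_compose_eq_X_iff:
  fixes f a :: "nat \<Rightarrow> 'a::comm_ring_1"
  assumes "f 0 = 1"
  shows "shift_fps a oo shift_fps f = fps_X \<longleftrightarrow> a = comp_inverse f"
proof -
  have nth: "(shift_fps a oo shift_fps f) $ Suc k = a k + (\<Sum>i < k. a i * (shift_fps f ^ Suc i) $ Suc k)" for k
  proof -
    have diag: "(shift_fps f ^ Suc k) $ Suc k = 1"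
      by (subst startsby_zero_power_nth_same) (simp_all add: shift_fps_nth assms)
    have "(shift_fps a oo shift_fps f) $ Suc k = (\<Sum>i < Suc (Suc k). shift_fps a $ i * (shift_fps f ^ i) $ Suc k)"
      unfolding fps_compose_nth by (intro sum.cong) auto
    also have "\<dots> = (\<Sum>i < Suc k. shift_fps a $ Suc i * (shift_fps f ^ Suc i) $ Suc k)"
      by (subst sum.lessThan_Suc_shift) (simp add: shift_fps_nth)
    also have "\<dots> = a k + (\<Sum>i < k. a i * (shift_fps f ^ Suc i) $ Suc k)"
      unfolding sum.lessThan_Suc diag by (simp add: shift_fps_nth del: power_Suc)
    finally show ?thesis .
  qed
  have "shift_fps a oo shift_fps f = fps_X \<longleftrightarrow> (\<forall>k. (shift_fps a oo shift_fps f) $ Suc k = fps_X $ Suc k)"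
  proof
    assume *: "\<forall>k. (shift_fps a oo shift_fps f) $ Suc k = fps_X $ Suc k"
    show "shift_fps a oo shift_fps f = fps_X"
    proof (rule fps_ext)
      fix n show "(shift_fps a oo shift_fps f) $ n = fps_X $ n"
        using * by (cases n) (simp_all add: shift_fps_nth)
    qed
  qed simp
  also have "\<dots> \<longleftrightarrow> (\<forall>k. a k = fps_X $ Suc k - (\<Sum>i < k. a i * (shift_fps f ^ Suc i) $ Suc k))"
    unfolding nth by (simp only: eq_diff_eq)
  also have "\<dots> \<longleftrightarrow> a = comp_inverse f"
  proof
    assume *: "\<forall>k. a k = fps_X $ Suc k - (\<Sum>i < k. a i * (shift_fps f ^ Suc i) $ Suc k)"
    have "a k = comp_inverse f k" for k
    proof (induction k rule: less_induct)
      case (less k)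
      then show ?case using spec[OF *, of k] by (subst comp_inverse.simps) simp
    qed
    then show "a = comp_inverse f" by blast
  next
    assume a: "a = comp_inverse f"
    show "\<forall>k. a k = fps_X $ Suc k - (\<Sum>i < k. a i * (shift_fps f ^ Suc i) $ Suc k)"
      unfolding a by (rule allI) (rule comp_inverse.simps)
  qed
  finally show ?thesis .
qed

lemma comp_inverse_0: "comp_inverse f 0 = 1"
  by (subst comp_inverse.simps) simp

text \<open>By associativity of composition, a left inverse of the left inverse is the original
  series.\<close>

lemma comp_inverse_involution:
  fixes f :: "nat \<Rightarrow> 'a::idom"
  assumes "f 0 = 1"
  shows "comp_inverse (comp_inverse f) = f"
proof -
  let ?\<sigma> = "shift_fps f" and ?\<tau> = "shift_fps (comp_inverse f)" and ?\<rho> = "shift_fps (comp_inverse (comp_inverse f))"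
  have 1: "?\<tau> oo ?\<sigma> = fps_X" using shift_compose_eq_X_iff[of f] assms by blast
  have 2: "?\<rho> oo ?\<tau> = fps_X" using shift_compose_eq_X_iff[of "comp_inverse f"] comp_inverse_0 by blast
  have z: "shift_fps g $ 0 = 0" for g :: "nat \<Rightarrow> 'a" by (simp add: shift_fps_nth)
  have "?\<rho> = ?\<rho> oo (?\<tau> oo ?\<sigma>)" using 1 by simp
  also have "\<dots> = (?\<rho> oo ?\<tau>) oo ?\<sigma>" using fps_compose_assoc z by blast
  also have "\<dots> = ?\<sigma>" using 2 z by simp
  finally have "?\<rho> $ Suc n = ?\<sigma> $ Suc n" for n by simp
  then show ?thesis by (auto simp: shift_fps_nth)
qed

lemma hstar_eq: "hstar = comp_inverse complete_symfun"
proof -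
  have "(THE a. a 0 = 1 \<and> shift_fps a oo shift_fps complete_symfun = fps_X) = (comp_inverse complete_symfun :: nat \<Rightarrow> int symfun)"
    using shift_compose_eq_X_iff[of "complete_symfun :: nat \<Rightarrow> int symfun"]
    by (intro the_equality) (simp_all add: comp_inverse_0)
  then show ?thesis unfolding hstar_def shifted_series_eq .
qed

lemma hstar_0: "hstar 0 = 1"
  by (simp add: hstar_eq comp_inverse_0)

lemma comp_inverse_hstar: "comp_inverse hstar = complete_symfun"
  by (simp add: hstar_eq comp_inverse_involution)

definition hsprod :: "partition \<Rightarrow> int symfun" where
  "hsprod \<kappa> = (\<Prod>r \<in># \<kappa>. hstar r)"

lemma hsprod_simps [simp]: "hsprod {#} = 1" "hsprod (add_mset r \<kappa>) = hstar r * hsprod \<kappa>"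
  by (simp_all add: hsprod_def)

lemma hsprod_add: "hsprod (\<kappa> + \<mu>) = hsprod \<kappa> * hsprod \<mu>"
  by (simp add: hsprod_def)

lemma hmap_mult:
  assumes "\<And>\<kappa> \<mu>. F (\<kappa> + \<mu>) = F \<kappa> * F \<mu>"
  shows "hmap F (f * g) = hmap F f * hmap F g"
proof (induction f rule: symfun_induct)
  case (hprod \<kappa>)
  show ?case
  proof (induction g rule: symfun_induct)
    case (hprod \<mu>)
    then have "\<kappa> + \<mu> \<in> Par" using \<open>\<kappa> \<in> Par\<close> by (simp add: Par_def)
    then show ?case using hprod \<open>\<kappa> \<in> Par\<close> by (simp add: hmap_hprod assms flip: hprod_add)
  qed (simp_all add: distrib_left)
qed (simp_all add: distrib_right)

text \<open>Since compositional inversion is an involution, this ring endomorphism exchanges \<open>h\<^sub>r\<close> and \<open>h\<^sub>r\<^sup>*\<close>;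
  hence the \<open>h\<^sub>\<mu>\<^sup>*\<close> are a basis because the \<open>h\<^sub>\<mu>\<close> are.\<close>

abbreviation star :: "int symfun \<Rightarrow> int symfun" where
  "star \<equiv> hmap hsprod"

lemma star_mult: "star (f * g) = star f * star g"
  by (rule hmap_mult) (rule hsprod_add)

lemma star_one: "star 1 = 1"
  using hmap_hprod[of "{#}" hsprod] by (simp add: Par_def)

lemma star_complete: "star (complete_symfun n) = hstar n"
proof (cases "n = 0")
  case True
  then show ?thesis by (simp add: star_one hstar_0)
next
  case False
  then show ?thesis using hmap_hprod[of "{#n#}" hsprod] by (simp add: Par_def)
qed

definition fps_image :: "('a \<Rightarrow> 'b) \<Rightarrow> 'a fps \<Rightarrow> 'b::zero fps" where
  "fps_image \<phi> F = Abs_fps (\<lambda>n. \<phi> (F $ n))"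

lemma fps_image_nth [simp]: "fps_image \<phi> F $ n = \<phi> (F $ n)"
  by (simp add: fps_image_def)

lemma star_power: "fps_image star (F ^ i) = fps_image star F ^ i"
proof (induction i)
  case 0
  show ?case by (rule fps_ext) (simp add: star_one)
next
  case (Suc i)
  show ?case
    by (rule fps_ext) (simp add: fps_mult_nth hmap_sum star_mult Suc.IH[symmetric])
qed

lemma star_compose: "fps_image star (F oo G) = fps_image star F oo fps_image star G"
  by (rule fps_ext) (simp add: fps_compose_nth hmap_sum star_mult flip: star_power)

text \<open>Applying \<open>star\<close> to the coefficients of the inversion equation turns h into
  h* and shows that the image of h* is the compositional inverse of h*, which is h.\<close>

lemma star_hstar: "star (hstar n) = complete_symfun n"
proof -
  have im: "fps_image star (shift_fps f) = shift_fps (\<lambda>n. star (f n))" for f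
    by (rule fps_ext) (simp add: shift_fps_nth)
  have "shift_fps hstar oo shift_fps complete_symfun = fps_X"
    using shift_compose_eq_X_iff[of complete_symfun] complete_0 hstar_eq by blast
  then have "fps_image star (shift_fps hstar oo shift_fps complete_symfun) = fps_image star fps_X" by simp
  also have "fps_image star fps_X = fps_X" by (rule fps_ext) (simp add: fps_X_def star_one)
  finally have "shift_fps (\<lambda>n. star (hstar n)) oo shift_fps hstar = fps_X"
    by (simp add: star_compose im star_complete)
  then have "(\<lambda>n. star (hstar n)) = comp_inverse hstar"
    using shift_compose_eq_X_iff[of hstar] hstar_0 by blast
  then show ?thesis by (metis comp_inverse_hstar)
qed

lemma star_hsprod: "star (hsprod \<kappa>) = hprod \<kappa>"
  by (induction \<kappa>) (simp_all add: star_one star_mult star_hstar)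

lemma star_star: "star (star f) = f"
  by (induction f rule: symfun_induct) (simp_all add: hmap_hprod star_hsprod)

lemma hsprod_induct [case_names zero hsprod add minus]:
  assumes "P 0" "\<And>\<kappa>. \<kappa> \<in> Par \<Longrightarrow> P (hsprod \<kappa>)" "\<And>x y. P x \<Longrightarrow> P y \<Longrightarrow> P (x + y)" "\<And>x. P x \<Longrightarrow> P (- x)"
  shows "P f"
proof -
  have "P (star g)" for g
    by (induction g rule: symfun_induct) (auto simp: hmap_hprod intro: assms)
  then show ?thesis by (metis star_star)
qed

section \<open>Homogeneity\<close>

definition homogeneous :: "nat \<Rightarrow> 'a::comm_ring_1 symfun \<Rightarrow> bool" where
  "homogeneous d f \<longleftrightarrow> (\<forall>m. mcoeff f m \<noteq> 0 \<longrightarrow> size m = d)"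

lemma homogeneous_simps [simp]:
  "homogeneous d 0" "homogeneous d 1 \<longleftrightarrow> d = 0" "homogeneous n (complete_symfun n)"
  by (auto simp: homogeneous_def)

lemma homogeneous_sum: "(\<And>x. x \<in> A \<Longrightarrow> homogeneous d (F x)) \<Longrightarrow> homogeneous d (\<Sum>x \<in> A. F x)"
  unfolding homogeneous_def mcoeff_sum by (meson sum.neutral)

lemma homogeneous_diff: "homogeneous d f \<Longrightarrow> homogeneous d g \<Longrightarrow> homogeneous d (f - g)"
  unfolding homogeneous_def mcoeff_diff by (metis diff_0_right)

lemma homogeneous_mult:
  assumes "homogeneous d f" "homogeneous e g"
  shows "homogeneous (d + e) (f * g)"
  unfolding homogeneous_def
proof (intro allI impI)
  fix m assume m: "mcoeff (f * g) m \<noteq> 0"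
  obtain a b where "a + b = m" "mcoeff f a * mcoeff g b \<noteq> 0"
    using m unfolding mcoeff_mult by (auto elim!: sum.not_neutral_contains_not_neutral)
  then show "size m = d + e"
    using assms unfolding homogeneous_def by (metis mult_zero_left mult_zero_right size_union)
qed

lemma homogeneous_fps_power:
  assumes "\<And>n. homogeneous n (F $ n)"
  shows "homogeneous n ((F ^ i) $ n)"
proof (induction i arbitrary: n)
  case (Suc i)
  have "homogeneous n (F $ j * (F ^ i) $ (n - j))" if "j \<le> n" for j
    using homogeneous_mult[OF assms[of j] Suc.IH[of "n - j"]] that by simp
  then show ?case by (auto simp: fps_mult_nth intro: homogeneous_sum)
qed simp

lemma homogeneous_hstar: "homogeneous n (hstar n)"
proof (induction n rule: less_induct)
  case (less n)
  have pow: "homogeneous (n - i) ((shift_fps complete_symfun ^ Suc i) $ Suc n :: int symfun)" if "i < n" for i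
  proof -
    \<comment> \<open>Pulling out the power of X shows that the coefficient at n + 1 has degree n -
      i.\<close>
    have "shift_fps complete_symfun ^ Suc i = fps_X ^ Suc i * Abs_fps (complete_symfun :: nat \<Rightarrow> int symfun) ^ Suc i"
      by (simp add: shift_fps_def power_mult_distrib)
    then have "(shift_fps complete_symfun ^ Suc i) $ Suc n = (Abs_fps (complete_symfun :: nat \<Rightarrow> int symfun) ^ Suc i) $ (n - i)"
      using that by (simp only: fps_X_power_mult_nth) simp
    then show ?thesis by (simp only:) (rule homogeneous_fps_power, simp)
  qed
  have "homogeneous n (hstar i * (shift_fps complete_symfun ^ Suc i) $ Suc n)" if "i < n" for i
    using homogeneous_mult[OF less[OF that] pow[OF that]] that by simp
  moreover have "homogeneous n (fps_X $ Suc n :: int symfun)" by (simp add: fps_X_def)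
  ultimately have "homogeneous n (fps_X $ Suc n - (\<Sum>i < n. hstar i * (shift_fps complete_symfun ^ Suc i) $ Suc n))"
    by (intro homogeneous_diff homogeneous_sum) blast+
  then show ?case unfolding hstar_eq by (subst comp_inverse.simps)
qed

lemma homogeneous_hsprod: "homogeneous (\<Sum>\<^sub># \<kappa>) (hsprod \<kappa>)"
  by (induction \<kappa>) (auto intro: homogeneous_mult homogeneous_hstar)

lemma homogeneous_mcf:
  assumes "homogeneous d f" "\<kappa> \<in> Par" "\<Sum>\<^sub># \<kappa> \<noteq> d"
  shows "mcf f \<kappa> = 0"
proof (rule ccontr)
  assume "mcf f \<kappa> \<noteq> 0"
  then have "size (mono_of (sorted_list_of_multiset \<kappa>)) = d" using assms(1) by (simp add: mcf_def homogeneous_def)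
  then show False using assms(2,3) by (simp add: size_eq_sum_exponents exponents_mono_of_sorted)
qed

lemma homogeneous_expansion:
  fixes f :: "int symfun"
  assumes "homogeneous d f"
  shows "f = (\<Sum>\<mu> \<in> partitions_of d. of_int (mcf f \<mu>) * monomial_symfun \<mu>)"
proof -
  have "f = (\<Sum>\<mu> \<in> {\<kappa> \<in> Par. mcf f \<kappa> \<noteq> 0}. of_int (mcf f \<mu>) * monomial_symfun \<mu>)" by (rule symfun_monomial_expansion)
  also have "\<dots> = (\<Sum>\<mu> \<in> partitions_of d. of_int (mcf f \<mu>) * monomial_symfun \<mu>)"
    using homogeneous_mcf[OF assms] by (intro sum.mono_neutral_left) (simp, auto simp: partitions_of_def)
  finally show ?thesis .
qed

section \<open>Macdonald's basis\<close>

lemma hsprod_pairing_inj: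
  assumes "\<And>\<mu>. \<mu> \<in> Par \<Longrightarrow> hall_inner g (hsprod \<mu>) = hall_inner g' (hsprod \<mu>)"
  shows "g = g'"
proof -
  have "hall_inner (g + - g') f = 0" for f
  proof (induction f rule: hsprod_induct)
    case (hsprod \<kappa>)
    then show ?case using assms by (simp del: add_uminus_conv_diff)
  qed (simp_all del: add_uminus_conv_diff)
  then have "g + - g' = 0" by (rule hall_nondegenerate)
  then show ?thesis by simp
qed

lemma hall_monomial_hprod:
  assumes "\<kappa> \<in> Par" "\<mu> \<in> Par"
  shows "hall_inner (monomial_symfun \<kappa>) (hprod \<mu>) = (if \<kappa> = \<mu> then 1 else 0)"
  using assms by (auto simp: hall_commute[of "monomial_symfun \<kappa>"] hall_hprod mcf_monomial)

text \<open>In degree |\<kappa>| the candidate \<open>g\<close> represents the functional that pairs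
  m_\<kappa> with \<open>star f\<close>. As \<open>star\<close> turns h*_\<nu> into h_\<nu>, duality
  of m and h gives the claim; homogeneity of h*_\<nu> settles the other degrees and keeps the sum
  finite.\<close>

lemma hall_macdonald_g:
  assumes "\<kappa> \<in> Par" "\<mu> \<in> Par"
  shows "hall_inner (macdonald_g \<kappa>) (hsprod \<mu>) = (if \<kappa> = \<mu> then 1 else 0)"
proof -
  let ?d = "\<Sum>\<^sub># \<kappa>"
  define g :: "int symfun" where "g = (\<Sum>\<mu> \<in> partitions_of ?d. of_int (hall_inner (monomial_symfun \<kappa>) (star (monomial_symfun \<mu>))) * hprod \<mu>)"
  have g: "hall_inner g f = (\<Sum>\<mu> \<in> partitions_of ?d. hall_inner (monomial_symfun \<kappa>) (star (monomial_symfun \<mu>)) * mcf f \<mu>)" for f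
    unfolding g_def by (auto simp: hall_sum_left hall_hprod partitions_of_def intro!: sum.cong)
  have dual: "hall_inner g (hsprod \<nu>) = (if \<kappa> = \<nu> then 1 else 0)" if \<nu>: "\<nu> \<in> Par" for \<nu>
  proof (cases "\<Sum>\<^sub># \<nu> = ?d")
    case True
    have "hsprod \<nu> = (\<Sum>\<mu> \<in> partitions_of ?d. of_int (mcf (hsprod \<nu>) \<mu>) * monomial_symfun \<mu>)"
      using homogeneous_expansion[OF homogeneous_hsprod[of \<nu>]] True by simp
    then have "hall_inner (monomial_symfun \<kappa>) (star (hsprod \<nu>)) =
      hall_inner (monomial_symfun \<kappa>) (star (\<Sum>\<mu> \<in> partitions_of ?d. of_int (mcf (hsprod \<nu>) \<mu>) * monomial_symfun \<mu>))"
      by metis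
    also have "\<dots> = hall_inner g (hsprod \<nu>)"
      by (auto simp: g hmap_sum hmap_of_int_mult hall_sum_right intro!: sum.cong)
    finally show ?thesis using assms(1) \<nu> by (simp add: star_hsprod hall_monomial_hprod)
  next
    case False
    then have "mcf (hsprod \<nu>) \<mu> = 0" if "\<mu> \<in> partitions_of ?d" for \<mu>
      using homogeneous_mcf[OF homogeneous_hsprod] that by (simp add: partitions_of_def)
    then show ?thesis using False by (auto simp: g)
  qed
  have "macdonald_g \<kappa> = g"
    unfolding macdonald_g_def hsprod_def[symmetric]
  proof (rule the_equality)
    fix g' assume "\<forall>\<mu> \<in> Par. hall_inner g' (hsprod \<mu>) = (if \<kappa> = \<mu> then 1 else 0)"
    then show "g' = g" using dual by (intro hsprod_pairing_inj) simp
  qed (use dual in blast)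
  then show ?thesis using dual assms(2) by simp
qed

lemma hall_one: "hall_inner 1 f = mcoeff f {#}"
  using hall_hprod[of "{#}" f] by (simp add: Par_def mcf_def mono_of_def)

lemma macdonald_g_empty: "macdonald_g {#} = 1"
proof (rule hsprod_pairing_inj)
  fix \<mu> :: partition assume \<mu>: "\<mu> \<in> Par"
  have "mcoeff (hsprod \<mu>) {#} = 0" if "\<mu> \<noteq> {#}"
  proof (rule ccontr)
    assume "mcoeff (hsprod \<mu>) {#} \<noteq> 0"
    then have "size ({#} :: nat multiset) = \<Sum>\<^sub># \<mu>" using homogeneous_hsprod[of \<mu>] unfolding homogeneous_def by blast
    then have "\<forall>x \<in># \<mu>. x = 0" by simp
    then show False using \<mu> that unfolding Par_def by (metis mem_Collect_eq multiset_nonemptyE)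
  qed
  then have "hall_inner 1 (hsprod \<mu>) = (if \<mu> = {#} then 1 else 0)" by (simp add: hall_one)
  then show "hall_inner (macdonald_g {#}) (hsprod \<mu>) = hall_inner 1 (hsprod \<mu>)"
    using hall_macdonald_g[of "{#}" \<mu>] \<mu> by (auto simp: Par_def)
qed

section \<open>The adjoints of multiplication by power sums\<close>

definition h_lower :: "nat \<Rightarrow> nat \<Rightarrow> int symfun" where
  "h_lower r j = (if r \<le> j then complete_symfun (j - r) else 0)"

text \<open>The Leibniz rule on products of the generators for the derivation with h_j \<mapsto>
  h_{j-r}.\<close>

definition hprod_lower :: "nat \<Rightarrow> partition \<Rightarrow> int symfun" where
  "hprod_lower r \<kappa> = (\<Sum>j \<in># \<kappa>. h_lower r j * hprod (\<kappa> - {#j#}))"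

abbreviation p_adj :: "nat \<Rightarrow> int symfun \<Rightarrow> int symfun" where
  "p_adj r \<equiv> hmap (hprod_lower r)"

lemma hprod_lower_add: "hprod_lower r (\<kappa> + \<mu>) = hprod_lower r \<kappa> * hprod \<mu> + hprod \<kappa> * hprod_lower r \<mu>"
proof -
  have 1: "(\<Sum>j \<in># \<kappa>. h_lower r j * hprod (\<kappa> + \<mu> - {#j#})) = (\<Sum>j \<in># \<kappa>. h_lower r j * hprod (\<kappa> - {#j#})) * hprod \<mu>"
    for \<kappa> \<mu> :: partition
  proof -
    have "image_mset (\<lambda>j. h_lower r j * hprod (\<kappa> + \<mu> - {#j#})) \<kappa> =
      image_mset (\<lambda>j. h_lower r j * hprod (\<kappa> - {#j#}) * hprod \<mu>) \<kappa>"
    proof (rule image_mset_cong)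
      fix j assume "j \<in># \<kappa>"
      then have "\<kappa> + \<mu> - {#j#} = \<kappa> - {#j#} + \<mu>" by simp
      then show "h_lower r j * hprod (\<kappa> + \<mu> - {#j#}) = h_lower r j * hprod (\<kappa> - {#j#}) * hprod \<mu>"
        by (simp only: hprod_add mult.assoc)
    qed
    then show ?thesis by (simp add: sum_mset_distrib_right)
  qed
  show ?thesis
    using 1[of \<kappa> \<mu>] 1[of \<mu> \<kappa>] by (simp add: hprod_lower_def add.commute[of \<mu>] mult.commute)
qed

lemma p_adj_mult: "p_adj r (f * g) = p_adj r f * g + f * p_adj r g"
proof (induction f rule: symfun_induct)
  case (hprod \<kappa>)
  show ?case
  proof (induction g rule: symfun_induct)
    case (hprod \<mu>)
    then have "\<kappa> + \<mu> \<in> Par" using \<open>\<kappa> \<in> Par\<close> by (simp add: Par_def)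
    then show ?case using hprod \<open>\<kappa> \<in> Par\<close> by (simp add: hmap_hprod hprod_lower_add flip: hprod_add)
  qed (simp_all add: algebra_simps)
qed (simp_all add: algebra_simps)

lemma p_adj_one: "p_adj r 1 = 0"
  using hmap_hprod[of "{#}" "hprod_lower r"] by (simp add: Par_def hprod_lower_def)

lemma p_adj_complete:
  assumes "r \<ge> 1"
  shows "p_adj r (complete_symfun n) = h_lower r n"
proof (cases "n = 0")
  case True
  then show ?thesis using assms by (simp add: p_adj_one h_lower_def)
next
  case False
  then show ?thesis using hmap_hprod[of "{#n#}" "hprod_lower r"] by (simp add: Par_def hprod_lower_def)
qed

lemma p_adj_prod_mset: "p_adj r (\<Prod>j \<in># \<nu>. f j) = (\<Sum>n \<in># \<nu>. p_adj r (f n) * (\<Prod>j \<in># \<nu> - {#n#}. f j))"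
proof (induction \<nu>)
  case empty
  then show ?case by (simp add: p_adj_one)
next
  case (add x \<nu>)
  have "image_mset (\<lambda>n. p_adj r (f n) * (\<Prod>j \<in># add_mset x \<nu> - {#n#}. f j)) \<nu> =
     image_mset (\<lambda>n. f x * (p_adj r (f n) * (\<Prod>j \<in># \<nu> - {#n#}. f j))) \<nu>"
  proof (rule image_mset_cong)
    fix n assume "n \<in># \<nu>"
    then have "add_mset x \<nu> - {#n#} = add_mset x (\<nu> - {#n#})" by simp
    then show "p_adj r (f n) * (\<Prod>j \<in># add_mset x \<nu> - {#n#}. f j) = f x * (p_adj r (f n) * (\<Prod>j \<in># \<nu> - {#n#}. f j))"
      by (simp add: mult_ac)
  qed
  then show ?case using add by (simp add: p_adj_mult sum_mset_distrib_left)
qed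

lemma hprod_filter_pos: "hprod (filter_mset (\<lambda>k. 0 < k) \<kappa>) = hprod \<kappa>"
  by (induction \<kappa>) auto

lemma hall_hprod_mset: "hall_inner (hprod (mset ks)) g = mcoeff g (mono_of ks)"
proof -
  let ?\<kappa> = "filter_mset (\<lambda>k. 0 < k) (mset ks)"
  have "hall_inner (hprod (mset ks)) g = hall_inner (hprod ?\<kappa>) g" by (simp only: hprod_filter_pos)
  also have "\<dots> = mcf g ?\<kappa>" by (rule hall_hprod) (simp add: Par_def)
  also have "\<dots> = mcoeff g (mono_of ks)"
    using mcf_exponents[of g "mono_of ks"] by (simp add: exponents_mono_of)
  finally show ?thesis .
qed

lemma mcoeff_power_sum_mult:
  assumes r: "r \<ge> 1"
  shows "mcoeff (power_sum r * g :: int symfun) (mono_of ks) =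
    (\<Sum>i < length ks. if r \<le> ks ! i then mcoeff g (mono_of (ks[i := ks ! i - r])) else 0)"
proof -
  let ?m = "mono_of ks" and ?I = "{i. i < length ks \<and> r \<le> ks ! i}"
  let ?j = "\<lambda>i. (replicate_mset r i, ?m - replicate_mset r i)"
  have sub: "replicate_mset r i \<subseteq># ?m \<longleftrightarrow> i \<in> ?I" for i
    using r by (auto simp: count_mono_of simp flip: count_le_replicate_mset_subset_eq)
  have rest: "?m - replicate_mset r i = mono_of (ks[i := ks ! i - r])" if "i \<in> ?I" for i
    using that by (auto simp: multiset_eq_iff count_mono_of nth_list_update)
  have "mcoeff (power_sum r * g) ?m = (\<Sum>(a, b) \<in> ?j ` ?I. mcoeff (power_sum r) a * mcoeff g b)"
    unfolding mcoeff_mult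
  proof (rule sum.mono_neutral_right[OF finite_multiset_splits])
    show "?j ` ?I \<subseteq> {(a, b). a + b = ?m}"
    proof (rule image_subsetI)
      fix i assume "i \<in> ?I"
      then have "replicate_mset r i + (?m - replicate_mset r i) = ?m" using sub by (intro subset_mset.add_diff_inverse) blast
      then show "?j i \<in> {(a, b). a + b = ?m}" by blast
    qed
    show "\<forall>p \<in> {(a, b). a + b = ?m} - ?j ` ?I. (case p of (a, b) \<Rightarrow> mcoeff (power_sum r) a * mcoeff g b) = 0"
    proof
      fix p assume p: "p \<in> {(a, b). a + b = ?m} - ?j ` ?I"
      obtain a b where ab: "p = (a, b)" by (cases p)
      have "a \<noteq> replicate_mset r i" for i
      proof
        assume a: "a = replicate_mset r i"
        have ab': "a + b = ?m" using p ab by blast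
        then have "i \<in> ?I" using sub[of i] a by (metis mset_subset_eq_add_left)
        moreover have "b = ?m - replicate_mset r i" using ab' a by (metis add_diff_cancel_left')
        ultimately have "p \<in> ?j ` ?I" using ab a by blast
        then show False using p by blast
      qed
      then show "(case p of (a, b) \<Rightarrow> mcoeff (power_sum r) a * mcoeff g b) = 0" using ab by simp
    qed
  qed
  also have "\<dots> = (\<Sum>i \<in> ?I. mcoeff g (mono_of (ks[i := ks ! i - r])))"
  proof (subst sum.reindex)
    show "inj_on ?j ?I"
    proof (rule inj_onI)
      fix i i' assume "?j i = ?j i'"
      then have "set_mset (replicate_mset r i) = set_mset (replicate_mset r i')" by simp
      then show "i = i'" using r by (simp add: set_mset_replicate_mset_subset split: if_splits)
    qed
    show "sum ((\<lambda>(a, b). mcoeff (power_sum r) a * mcoeff g b) \<circ> ?j) ?I = (\<Sum>i \<in> ?I. mcoeff g (mono_of (ks[i := ks ! i - r])))"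
      using rest by (intro sum.cong) auto
  qed
  also have "\<dots> = (\<Sum>i < length ks. if r \<le> ks ! i then mcoeff g (mono_of (ks[i := ks ! i - r])) else 0)"
    by (subst sum.inter_filter[symmetric]) (auto intro!: sum.cong)
  finally show ?thesis .
qed

lemma sum_mset_mset_nth: "(\<Sum>j \<in># mset ks. F j) = (\<Sum>i < length ks. F (ks ! i))"
  unfolding mset_map[symmetric] sum_mset_sum_list by (simp add: sum_list_sum_nth atLeast0LessThan)

text \<open>Pairing with h_\<kappa> reads off a monomial coefficient. A factor p_r takes
  \<open>r\<close> from one exponent, while the derivation takes \<open>r\<close> from one index,
  and the two sums agree term by term.\<close>

lemma hall_p_adj:
  assumes r: "r \<ge> 1"
  shows "hall_inner (p_adj r f) g = hall_inner f (power_sum r * g)"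
proof (induction f rule: symfun_induct)
  case (hprod \<kappa>)
  define ks where "ks = sorted_list_of_multiset \<kappa>"
  have \<kappa>: "\<kappa> = mset ks" by (simp add: ks_def)
  have "hall_inner (hprod_lower r \<kappa>) g = (\<Sum>i < length ks. hall_inner (h_lower r (ks ! i) * hprod (mset ks - {#ks ! i#})) g)"
    unfolding hprod_lower_def \<kappa> sum_mset_mset_nth hall_sum_left ..
  also have "\<dots> = (\<Sum>i < length ks. if r \<le> ks ! i then mcoeff g (mono_of (ks[i := ks ! i - r])) else 0)"
  proof (intro sum.cong HOL.refl)
    fix i assume "i \<in> {..<length ks}"
    then have "mset (ks[i := ks ! i - r]) = add_mset (ks ! i - r) (mset ks - {#ks ! i#})" by (simp add: mset_update)
    then show "hall_inner (h_lower r (ks ! i) * hprod (mset ks - {#ks ! i#})) g =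
        (if r \<le> ks ! i then mcoeff g (mono_of (ks[i := ks ! i - r])) else 0)"
      using hall_hprod_mset[of "ks[i := ks ! i - r]" g] by (simp add: h_lower_def)
  qed
  also have "\<dots> = mcf (power_sum r * g) \<kappa>"
    unfolding mcf_def ks_def[symmetric] mcoeff_power_sum_mult[OF r] ..
  finally show ?case using hprod by (simp add: hmap_hprod hall_hprod)
qed simp_all

section \<open>The action on the generators \<open>h\<^sub>r\<^sup>*\<close>\<close>

lemma p_adj_fps_mult: "fps_image (p_adj r) (F * G) = fps_image (p_adj r) F * G + F * fps_image (p_adj r) G"
  by (rule fps_ext) (simp add: fps_mult_nth hmap_sum p_adj_mult sum.distrib)

lemma p_adj_fps_power:
  "fps_image (p_adj r) (G ^ i) = of_nat i * G ^ (i - 1) * fps_image (p_adj r) G"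
proof (induction i)
  case 0
  show ?case by (rule fps_ext) (simp add: p_adj_one)
next
  case (Suc i)
  have "G * (of_nat i * G ^ (i - 1) * H) = of_nat i * G ^ i * H" for H
    by (cases i) (simp_all add: mult_ac)
  then show ?case by (simp add: p_adj_fps_mult Suc.IH) (simp add: algebra_simps)
qed

lemma fps_mult_vanish:
  fixes F G :: "'a::comm_ring_1 fps"
  assumes "\<And>k. k < p \<Longrightarrow> F $ k = 0" "G $ 0 = 0" "n \<le> p"
  shows "(F * G) $ n = 0"
  unfolding fps_mult_nth
proof (rule sum.neutral, rule ballI)
  fix i assume "i \<in> {0..n}"
  then have "i < p \<or> n - i = 0" using assms(3) by auto
  then show "F $ i * G $ (n - i) = 0" using assms(1,2) by auto
qed

text \<open>The chain rule for a derivation that acts on coefficients: one term from the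
  coefficients of \<open>F\<close>, one from those of the powers of \<open>G\<close>.\<close>

lemma p_adj_compose:
  assumes "G $ 0 = 0"
  shows "fps_image (p_adj r) (F oo G) = (fps_image (p_adj r) F oo G) + (fps_deriv F oo G) * fps_image (p_adj r) G"
proof (rule fps_ext)
  fix n
  let ?D = "fps_image (p_adj r)"
  have low: "(G ^ i) $ k = 0" if "k < i" for i k using startsby_zero_power_prefix[OF assms] that by blast
  have D0: "?D G $ 0 = 0" using assms by simp
  have "((fps_deriv F oo G) * ?D G) $ n = (\<Sum>k = 0..n. \<Sum>i = 0..n. fps_deriv F $ i * (G ^ i) $ k * ?D G $ (n - k))"
  proof -
    \<comment> \<open>Powers \<open>G ^ i\<close> with \<open>i > k\<close> start above degree k, so
      the bound can be raised to \<open>n\<close>, independently of k, and the two sums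
      interchanged.\<close>
    have "(fps_deriv F oo G) $ k = (\<Sum>i = 0..n. fps_deriv F $ i * (G ^ i) $ k)" if "k \<le> n" for k
      unfolding fps_compose_nth using that low by (intro sum.mono_neutral_left) auto
    then show ?thesis by (simp add: fps_mult_nth sum_distrib_right)
  qed
  also have "\<dots> = (\<Sum>i = 0..n. fps_deriv F $ i * (G ^ i * ?D G) $ n)"
    by (subst sum.swap) (simp add: fps_mult_nth sum_distrib_left mult.assoc)
  \<comment> \<open>The summand with \<open>i = n\<close> vanishes: \<open>G ^ n\<close> starts in
    degree n and the derived series has no constant term. This makes room for the shift to
    \<open>Suc i\<close>.\<close>
  also have "\<dots> = (\<Sum>i = 0..<n. fps_deriv F $ i * (G ^ i * ?D G) $ n)"
    using fps_mult_vanish[of n "G ^ n" "?D G" n] low D0 by (simp add: atLeastLessThanSuc_atLeastAtMost[symmetric])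
  also have "\<dots> = (\<Sum>i = 0..<n. F $ Suc i * ?D (G ^ Suc i) $ n)"
  proof (intro sum.cong HOL.refl)
    fix i
    have "?D (G ^ Suc i) = of_nat (Suc i) * (G ^ i * ?D G)" unfolding p_adj_fps_power by (simp add: mult.assoc)
    then have "?D (G ^ Suc i) $ n = of_nat (Suc i) * (G ^ i * ?D G) $ n"
      by (simp only: fps_of_nat[symmetric] fps_mult_left_const_nth)
    then show "fps_deriv F $ i * (G ^ i * ?D G) $ n = F $ Suc i * ?D (G ^ Suc i) $ n" by (simp add: mult_ac)
  qed
  also have "\<dots> = (\<Sum>i = 0..n. F $ i * ?D (G ^ i) $ n)"
  proof -
    have "?D (G ^ 0) $ n = 0" by (simp add: p_adj_one)
    then show ?thesis
      unfolding atLeast0AtMost atLeast0LessThan lessThan_Suc_atMost[symmetric] sum.lessThan_Suc_shift by simp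
  qed
  finally have "((fps_deriv F oo G) * ?D G) $ n = (\<Sum>i = 0..n. F $ i * ?D (G ^ i) $ n)" .
  then show "?D (F oo G) $ n = ((?D F oo G) + (fps_deriv F oo G) * ?D G) $ n"
    by (simp add: fps_compose_nth hmap_sum p_adj_mult sum.distrib)
qed

text \<open>With \<sigma> and \<tau> for the series of h and h*, the derivation D sends \<sigma> to
  X^r \<sigma>. Applied to \<tau>(\<sigma>) = X it gives (D \<tau>)(\<sigma>) = - \<tau>'(\<sigma>)
  X^r \<sigma>, and substituting \<tau> for X turns \<sigma> into X and X^r into \<tau>^r.\<close>

lemma p_adj_shift_hstar:
  assumes r: "r \<ge> 1"
  shows "fps_image (p_adj r) (shift_fps hstar) = - (fps_X * fps_deriv (shift_fps hstar) * shift_fps hstar ^ r)"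
proof -
  let ?D = "fps_image (p_adj r)" and ?\<sigma> = "shift_fps complete_symfun :: int symfun fps" and ?\<tau> = "shift_fps hstar"
  have z: "?\<sigma> $ 0 = 0" "?\<tau> $ 0 = 0" by (simp_all add: shift_fps_nth)
  have ts: "?\<tau> oo ?\<sigma> = fps_X" using shift_compose_eq_X_iff[of complete_symfun] complete_0 hstar_eq by blast
  have st: "?\<sigma> oo ?\<tau> = fps_X" using shift_compose_eq_X_iff[of hstar] hstar_0 comp_inverse_hstar by metis
  have "?D fps_X = 0" by (rule fps_ext) (simp add: fps_X_def p_adj_one)
  then have "(?D ?\<tau> oo ?\<sigma>) + (fps_deriv ?\<tau> oo ?\<sigma>) * ?D ?\<sigma> = 0"
    using p_adj_compose[OF z(1), of r ?\<tau>] ts by simp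
  moreover have "?D ?\<sigma> = fps_X ^ r * ?\<sigma>"
    by (rule fps_ext) (use r in \<open>auto simp: fps_X_power_mult_nth shift_fps_nth p_adj_complete h_lower_def\<close>)
  ultimately have "?D ?\<tau> oo ?\<sigma> = - ((fps_deriv ?\<tau> oo ?\<sigma>) * (fps_X ^ r * ?\<sigma>))" by (simp add: eq_neg_iff_add_eq_0)
  then have "(?D ?\<tau> oo ?\<sigma>) oo ?\<tau> = - (((fps_deriv ?\<tau> oo ?\<sigma>) oo ?\<tau>) * ((fps_X ^ r oo ?\<tau>) * (?\<sigma> oo ?\<tau>)))"
    by (simp add: fps_compose_uminus fps_compose_mult_distrib z)
  moreover have "(F oo ?\<sigma>) oo ?\<tau> = F" for F
    using fps_compose_assoc[of ?\<tau> ?\<sigma> F] z st by simp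
  moreover have "fps_X ^ r oo ?\<tau> = ?\<tau> ^ r" using fps_compose_power[of ?\<tau> fps_X r] z by simp
  ultimately show ?thesis using st by (simp add: mult_ac)
qed

lemma p_adj_hsprod:
  assumes \<nu>: "\<nu> \<in> Par" and r: "r \<ge> 1"
  shows "- p_adj r (hsprod \<nu>) = (if r \<le> \<Sum>\<^sub># \<nu>
    then \<Sum>\<mu> \<in> partitions_of (\<Sum>\<^sub># \<nu> - r). of_nat (factor_count {#r#} \<mu> \<nu>) * hsprod \<mu> else 0)"
proof -
  let ?\<phi> = "fps_X * fps_deriv (shift_fps hstar) * shift_fps hstar ^ r"
  have coeff: "p_adj r (hstar n) = - ?\<phi> $ (n + 1)" for n
  proof -
    have "p_adj r (hstar n) = fps_image (p_adj r) (shift_fps hstar) $ (n + 1)" by (simp add: shift_fps_nth)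
    also have "\<dots> = - ?\<phi> $ (n + 1)" by (simp only: p_adj_shift_hstar[OF r] fps_neg_nth)
    finally show ?thesis .
  qed
  have *: "- p_adj r (hsprod \<nu>) = (\<Sum>n \<in># \<nu>. ?\<phi> $ (n + 1) * (\<Prod>j \<in># \<nu> - {#n#}. hstar j))"
  proof -
    have "(\<Sum>n \<in># M. - F n) = - (\<Sum>n \<in># M. F n)" for F :: "nat \<Rightarrow> int symfun" and M
      by (induction M) simp_all
    then show ?thesis unfolding hsprod_def p_adj_prod_mset coeff by (simp only: fps_neg_nth mult_minus_left minus_minus)
  qed
  show ?thesis
  proof (cases "r \<le> \<Sum>\<^sub># \<nu>")
    case True
    then show ?thesis using sum_factor_count_cycle[OF \<nu> r True, where f = hstar] hstar_0 * by (simp add: hsprod_def)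
  next
    case False
    \<comment> \<open>Every part is smaller than \<open>r\<close>, whereas X \<tau>' \<tau>^r starts
      in degree r + 1.\<close>
    have "?\<phi> $ (n + 1) = 0" if "n \<in># \<nu>" for n
    proof -
      have "n < r" using False sum_mset.remove[OF that] by simp
      then have "(shift_fps hstar ^ r) $ k = 0" if "k < r" for k
        using startsby_zero_power_prefix[of "shift_fps hstar" r] that by (simp add: shift_fps_nth)
      then have "(shift_fps hstar ^ r * (fps_X * fps_deriv (shift_fps hstar))) $ (n + 1) = 0"
        using \<open>n < r\<close> fps_mult_vanish[of r "shift_fps hstar ^ r" "fps_X * fps_deriv (shift_fps hstar)" "n + 1"] by simp
      then show ?thesis by (simp add: mult.commute)
    qed
    then have "(\<Sum>n \<in># \<nu>. ?\<phi> $ (n + 1) * (\<Prod>j \<in># \<nu> - {#n#}. hstar j)) = (\<Sum>n \<in># \<nu>. 0)"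
      by (intro arg_cong[where f = sum_mset] image_mset_cong) simp
    then show ?thesis using False * by simp
  qed
qed

text \<open>Pairing with h*_\<rho> moves the multiplication over to the derivation, whose value on
  h*_\<rho> is known; orthogonality then selects one coefficient.\<close>

theorem power_sum_mult_macdonald_g:
  assumes \<mu>: "\<mu> \<in> Par" and r: "r \<ge> 1"
  shows "- power_sum r * macdonald_g \<mu> =
    (\<Sum>\<nu> \<in> partitions_of (r + \<Sum>\<^sub># \<mu>). of_nat (factor_count {#r#} \<mu> \<nu>) * macdonald_g \<nu>)"
proof (rule hsprod_pairing_inj)
  fix \<rho> :: partition assume \<rho>: "\<rho> \<in> Par"
  let ?k = "\<lambda>\<mu> \<nu>. factor_count {#r#} \<mu> \<nu>"
  have of_nat: "of_nat c = (of_int (int c) :: int symfun)" for c by simp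
  have val: "(\<Sum>\<nu> \<in> partitions_of d. of_nat (c \<nu>) * F \<nu>) = (\<Sum>\<nu> \<in> partitions_of d. of_int (int (c \<nu>)) * (F \<nu> :: int symfun))" for c d F
    by simp
  have "hall_inner (- power_sum r * macdonald_g \<mu>) (hsprod \<rho>) = hall_inner (- p_adj r (hsprod \<rho>)) (macdonald_g \<mu>)"
    using hall_p_adj[OF r, of "hsprod \<rho>" "macdonald_g \<mu>"]
    by (simp add: hall_commute[of "power_sum r * macdonald_g \<mu>"])
  also have "\<dots> = (if r + \<Sum>\<^sub># \<mu> = \<Sum>\<^sub># \<rho> then int (?k \<mu> \<rho>) else 0)"
  proof (cases "r \<le> \<Sum>\<^sub># \<rho>")
    case True
    have "hall_inner (- p_adj r (hsprod \<rho>)) (macdonald_g \<mu>) =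
      (\<Sum>\<mu>' \<in> partitions_of (\<Sum>\<^sub># \<rho> - r). int (?k \<mu>' \<rho>) * hall_inner (hsprod \<mu>') (macdonald_g \<mu>))"
      unfolding p_adj_hsprod[OF \<rho> r] if_P[OF True] val hall_sum_left hall_of_int_mult_left ..
    also have "\<dots> = (\<Sum>\<mu>' \<in> partitions_of (\<Sum>\<^sub># \<rho> - r). if \<mu>' = \<mu> then int (?k \<mu>' \<rho>) else 0)"
      using \<mu> by (intro sum.cong) (auto simp: hall_commute[of "hsprod _"] hall_macdonald_g partitions_of_def)
    also have "\<dots> = (if r + \<Sum>\<^sub># \<mu> = \<Sum>\<^sub># \<rho> then int (?k \<mu> \<rho>) else 0)"
      using True \<mu> by (simp, auto simp: partitions_of_def)
    finally show ?thesis .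
  next
    case False
    then show ?thesis by (simp add: p_adj_hsprod[OF \<rho> r])
  qed
  also have "\<dots> = (\<Sum>\<nu> \<in> partitions_of (r + \<Sum>\<^sub># \<mu>). if \<nu> = \<rho> then int (?k \<mu> \<nu>) else 0)"
    using \<rho> by (simp, auto simp: partitions_of_def)
  also have "\<dots> = (\<Sum>\<nu> \<in> partitions_of (r + \<Sum>\<^sub># \<mu>). int (?k \<mu> \<nu>) * hall_inner (macdonald_g \<nu>) (hsprod \<rho>))"
    using \<rho> by (intro sum.cong) (auto simp: hall_macdonald_g partitions_of_def)
  also have "\<dots> = hall_inner (\<Sum>\<nu> \<in> partitions_of (r + \<Sum>\<^sub># \<mu>). of_nat (?k \<mu> \<nu>) * macdonald_g \<nu>) (hsprod \<rho>)"
    unfolding val hall_sum_left hall_of_int_mult_left ..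
  finally show "hall_inner (- power_sum r * macdonald_g \<mu>) (hsprod \<rho>) =
      hall_inner (\<Sum>\<nu> \<in> partitions_of (r + \<Sum>\<^sub># \<mu>). of_nat (?k \<mu> \<nu>) * macdonald_g \<nu>) (hsprod \<rho>)" .
qed

section \<open>Multiplicativity of Macdonald's basis\<close>

lemma factor_count_empty_left:
  assumes "\<mu> \<in> Par" "\<nu> \<in> partitions_of (\<Sum>\<^sub># \<mu>)"
  shows "factor_count {#} \<mu> \<nu> = (if \<mu> = \<nu> then 1 else 0)"
proof -
  have \<nu>: "\<nu> \<in> Par" "\<Sum>\<^sub># \<nu> = \<Sum>\<^sub># {#} + \<Sum>\<^sub># \<mu>" using assms(2) by (simp_all add: partitions_of_def)
  obtain w where w: "permutation w" "mct w = \<nu>" using exists_permutation_of_type[OF \<nu>(1)] by blast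
  have "factorizations {#} \<mu> w = (if \<mu> = \<nu> then {(id, w)} else {})"
    using w by (auto simp: factorizations_def mct_empty_iff)
  then show ?thesis using card_factorizations[OF w \<nu>(2)] by (auto split: if_splits)
qed

lemma factor_count_empty_right:
  assumes "\<kappa> \<in> Par" "\<nu> \<in> partitions_of (\<Sum>\<^sub># \<kappa>)"
  shows "factor_count \<kappa> {#} \<nu> = (if \<kappa> = \<nu> then 1 else 0)"
proof -
  have \<nu>: "\<nu> \<in> Par" "\<Sum>\<^sub># \<nu> = \<Sum>\<^sub># \<kappa> + \<Sum>\<^sub># {#}" using assms(2) by (simp_all add: partitions_of_def)
  obtain w where w: "permutation w" "mct w = \<nu>" using exists_permutation_of_type[OF \<nu>(1)] by blast
  have "(u, v) \<in> factorizations \<kappa> {#} w \<longleftrightarrow> \<kappa> = \<nu> \<and> (u, v) = (w, id)" for u v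
  proof
    assume uv: "(u, v) \<in> factorizations \<kappa> {#} w"
    then have "v = id" using mct_empty_iff[of v] by (simp add: factorizations_def)
    then show "\<kappa> = \<nu> \<and> (u, v) = (w, id)" using uv w(2) by (auto simp: factorizations_def)
  next
    assume "\<kappa> = \<nu> \<and> (u, v) = (w, id)"
    then show "(u, v) \<in> factorizations \<kappa> {#} w" using w mct_empty_iff[of id] by (simp add: factorizations_def)
  qed
  then have "factorizations \<kappa> {#} w = (if \<kappa> = \<nu> then {(w, id)} else {})" by (intro subset_antisym subrelI) (auto split: if_splits)
  then show ?thesis using card_factorizations[OF w \<nu>(2)] by (auto split: if_splits)
qed

lemma mct_append:
  assumes "disjoint_cycles p (cs @ ds)"
  shows "mct p = filter_mset (\<lambda>k. k \<noteq> 0) (mset (map (\<lambda>c. length c - 1) cs)) +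
    filter_mset (\<lambda>k. k \<noteq> 0) (mset (map (\<lambda>c. length c - 1) ds))"
  unfolding modified_cycle_type_eq[OF assms] by simp

text \<open>A minimal product with a cycle either merges nontrivial cycles or is a disjoint product.\<close>

lemma factor_count_cycle_size:
  assumes \<rho>: "\<rho> \<in> Par" "\<Sum>\<^sub># \<rho> = r + \<Sum>\<^sub># \<kappa>" and r: "r \<ge> 1" and ne: "factor_count {#r#} \<kappa> \<rho> \<noteq> 0"
  shows "\<rho> = add_mset r \<kappa> \<or> size \<rho> \<le> size \<kappa>"
proof -
  obtain w where w: "permutation w" "mct w = \<rho>" using exists_permutation_of_type[OF \<rho>(1)] by blast
  have "card (factorizations {#r#} \<kappa> w) = factor_count {#r#} \<kappa> \<rho>"
    using card_factorizations[OF w, of "{#r#}" \<kappa>] \<rho>(2) by simp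
  then have "factorizations {#r#} \<kappa> w \<noteq> {}" using ne by auto
  then obtain u v where uv: "permutation u" "permutation v" "mct u = {#r#}" "mct v = \<kappa>" "u \<circ> v = w"
    by (auto simp: factorizations_def)
  then have cf: "(u, v) \<in> cycle_factorizations r w"
    using w \<rho>(2) by (simp add: cycle_factorizations_def nrm_def)
  obtain cs where cs: "disjoint_cycles w cs" using disjoint_cycles_sorted[OF w(1)] by blast
  obtain c P Ls where c: "c \<in> set cs" "(P, Ls) \<in> segmentations c (Suc r)" "u = cycle_of_list (map hd Ls)"
    using cycle_factorization_segmentation[OF cs cf r] by blast
  let ?cs = "remove1 c cs" and ?Ms = "butlast Ls @ [last Ls @ P]"
  have wc: "disjoint_cycles w ([c] @ ?cs)" using disjoint_cycles_move_front[OF cs c(1)] by simp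
  then obtain v' where v': "(u, v') \<in> cycle_factorizations r w" "disjoint_cycles v' (?Ms @ ?cs)"
    using segmentation_factorization[of w c ?cs P Ls r] c r by auto
  have "u \<circ> v' = u \<circ> v" using v'(1) uv(5) by (simp add: cycle_factorizations_def)
  then have "v' = v" using permutation_bijective[OF uv(1)] by (metis bij_is_inj fun.inj_map injD)
  let ?A = "filter_mset (\<lambda>k. k \<noteq> 0) (mset (map (\<lambda>c. length c - 1) ?Ms))"
  let ?B = "filter_mset (\<lambda>k. k \<noteq> 0) (mset (map (\<lambda>c. length c - 1) ?cs))"
  have \<kappa>: "\<kappa> = ?A + ?B" using mct_append[OF v'(2)] \<open>v' = v\<close> uv(4) by simp
  have \<rho>': "\<rho> = filter_mset (\<lambda>k. k \<noteq> 0) {#length c - 1#} + ?B" using mct_append[OF wc] w(2) by simp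
  show ?thesis
  proof (cases "?A = {#}")
    case True
    then have "\<kappa> = ?B" using \<kappa> by simp
    then have eq: "\<rho> = filter_mset (\<lambda>k. k \<noteq> 0) {#length c - 1#} + \<kappa>" using \<rho>' by simp
    then have "\<Sum>\<^sub># (filter_mset (\<lambda>k. k \<noteq> 0) {#length c - 1#}) = r" using \<rho>(2) by (metis add_right_cancel sum_mset.union)
    then have "length c - 1 = r" using r by (simp split: if_splits)
    then show ?thesis using eq r by simp
  next
    case False
    then have "1 \<le> size ?A" by (simp add: Suc_le_eq nonempty_has_size)
    moreover have "size (filter_mset (\<lambda>k. k \<noteq> 0) {#length c - 1#}) \<le> 1" by simp
    moreover have "size \<rho> = size (filter_mset (\<lambda>k. k \<noteq> 0) {#length c - 1#}) + size ?B"
      using arg_cong[OF \<rho>', of size] by (simp only: size_union)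
    moreover have "size \<kappa> = size ?A + size ?B" using arg_cong[OF \<kappa>, of size] by (simp only: size_union)
    ultimately show ?thesis by linarith
  qed
qed

text \<open>Cutting a cycle with \<open>r + 1\<close> entries of \<open>w\<close> into single
  entries makes \<open>u\<close> this cycle and \<open>v\<close> the rest of
  \<open>w\<close>.\<close>

lemma factor_count_disjoint_cycle:
  assumes \<kappa>: "\<kappa> \<in> Par" and r: "r \<ge> 1"
  shows "factor_count {#r#} \<kappa> (add_mset r \<kappa>) > 0"
proof -
  have "add_mset r \<kappa> \<in> Par" using \<kappa> r by (simp add: Par_def)
  then obtain w where w: "permutation w" "mct w = add_mset r \<kappa>" using exists_permutation_of_type by blast
  obtain cs where cs: "disjoint_cycles w cs" using disjoint_cycles_sorted[OF w(1)] by blast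
  have "r \<in># mct w" using w(2) by simp
  then obtain c where c: "c \<in> set cs" "length c - 1 = r" unfolding modified_cycle_type_eq[OF cs] by auto
  let ?cs = "remove1 c cs" and ?Ls = "map (\<lambda>x. [x]) c"
  have wc: "disjoint_cycles w ([c] @ ?cs)" using disjoint_cycles_move_front[OF cs c(1)] by simp
  have len: "length c = Suc r" using c(2) r by simp
  have "([], ?Ls) \<in> segmentations c (Suc r)" using len by (auto simp: segmentations_def)
  then obtain u v where v: "(u, v) \<in> cycle_factorizations r w" "disjoint_cycles v (butlast ?Ls @ [last ?Ls] @ ?cs)"
    using segmentation_factorization[of w c ?cs "[]" ?Ls r] wc r by auto
  have "?Ls \<noteq> []" using len by auto
  then have "butlast ?Ls @ [last ?Ls] = ?Ls" by (rule append_butlast_last_id)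
  then have dv: "disjoint_cycles v (?Ls @ ?cs)" using v(2) by (metis append.assoc)
  let ?B = "filter_mset (\<lambda>k. k \<noteq> 0) (mset (map (\<lambda>c. length c - 1) ?cs))"
  have "mct v = ?B" using mct_append[OF dv] by (simp add: comp_def filter_mset_eq_conv)
  moreover have "add_mset r \<kappa> = add_mset r ?B" using mct_append[OF wc] w(2) c(2) r by simp
  ultimately have "mct v = \<kappa>" by simp
  then have "(u, v) \<in> factorizations {#r#} \<kappa> w"
    using v(1) by (auto simp: cycle_factorizations_def factorizations_def)
  moreover have "finite (factorizations {#r#} \<kappa> w)"
    using finite_factorizations(1)[OF w(1), of "{#r#}" \<kappa>] w(2) by (simp add: nrm_def)
  ultimately have "card (factorizations {#r#} \<kappa> w) > 0" by (auto simp: card_gt_0_iff)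
  then show ?thesis using card_factorizations[OF w, of "{#r#}" \<kappa>] by simp
qed

definition g_product :: "partition \<Rightarrow> partition \<Rightarrow> int symfun" where
  "g_product \<kappa> \<mu> = (\<Sum>\<nu> \<in> partitions_of (\<Sum>\<^sub># \<kappa> + \<Sum>\<^sub># \<mu>). of_nat (factor_count \<kappa> \<mu> \<nu>) * macdonald_g \<nu>)"

lemma g_product_cycle:
  "\<mu> \<in> Par \<Longrightarrow> r \<ge> 1 \<Longrightarrow> g_product {#r#} \<mu> = - power_sum r * macdonald_g \<mu>"
  using power_sum_mult_macdonald_g[of \<mu> r] by (simp add: g_product_def)

text \<open>This associativity comes from counting triples, before \<open>g_product\<close> is known
  to be the product of symmetric functions.\<close>

lemma g_product_assoc:
  "(\<Sum>\<rho> \<in> partitions_of (\<Sum>\<^sub># \<kappa> + \<Sum>\<^sub># \<alpha>). of_nat (factor_count \<kappa> \<alpha> \<rho>) * g_product \<rho> \<mu>) =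
   (\<Sum>\<sigma> \<in> partitions_of (\<Sum>\<^sub># \<alpha> + \<Sum>\<^sub># \<mu>). of_nat (factor_count \<alpha> \<mu> \<sigma>) * g_product \<kappa> \<sigma>)"
  (is "?L = ?R")
proof -
  let ?N = "partitions_of (\<Sum>\<^sub># \<kappa> + \<Sum>\<^sub># \<alpha> + \<Sum>\<^sub># \<mu>)"
  have "?L = (\<Sum>\<rho> \<in> partitions_of (\<Sum>\<^sub># \<kappa> + \<Sum>\<^sub># \<alpha>). \<Sum>\<nu> \<in> ?N.
      of_nat (factor_count \<kappa> \<alpha> \<rho> * factor_count \<rho> \<mu> \<nu>) * macdonald_g \<nu>)"
    by (intro sum.cong) (auto simp: g_product_def partitions_of_def sum_distrib_left mult.assoc)
  also have "\<dots> = (\<Sum>\<nu> \<in> ?N. of_nat (\<Sum>\<rho> \<in> partitions_of (\<Sum>\<^sub># \<kappa> + \<Sum>\<^sub># \<alpha>). factor_count \<kappa> \<alpha> \<rho> * factor_count \<rho> \<mu> \<nu>) * macdonald_g \<nu>)"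
    by (subst sum.swap) (simp only: of_nat_sum sum_distrib_right)
  also have "\<dots> = (\<Sum>\<nu> \<in> ?N. of_nat (\<Sum>\<sigma> \<in> partitions_of (\<Sum>\<^sub># \<alpha> + \<Sum>\<^sub># \<mu>). factor_count \<alpha> \<mu> \<sigma> * factor_count \<kappa> \<sigma> \<nu>) * macdonald_g \<nu>)"
    by (intro sum.cong HOL.refl) (subst factor_count_assoc, simp_all add: partitions_of_def)
  also have "\<dots> = (\<Sum>\<sigma> \<in> partitions_of (\<Sum>\<^sub># \<alpha> + \<Sum>\<^sub># \<mu>). \<Sum>\<nu> \<in> ?N.
      of_nat (factor_count \<alpha> \<mu> \<sigma> * factor_count \<kappa> \<sigma> \<nu>) * macdonald_g \<nu>)"
    by (subst sum.swap) (simp only: of_nat_sum sum_distrib_right)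
  also have "\<dots> = ?R"
    by (intro sum.cong) (auto simp: g_product_def partitions_of_def sum_distrib_left mult.assoc add.assoc)
  finally show ?thesis .
qed

lemma remove_part:
  assumes "\<kappa> \<in> Par" "\<kappa> \<noteq> {#}"
  obtains r \<alpha> where "\<kappa> = add_mset r \<alpha>" "r \<ge> 1" "\<alpha> \<in> Par"
proof -
  obtain r \<alpha> where "\<kappa> = add_mset r \<alpha>" using assms(2) multiset_cases by blast
  moreover from this have "r \<ge> 1" "\<alpha> \<in> Par" using assms(1) by (auto simp: Par_def Suc_le_eq)
  ultimately show ?thesis using that by blast
qed

text \<open>For \<kappa> = {r} \<union> \<alpha>, the triple product of (r), \<alpha> and \<mu> is
  bracketed in two ways. The rule for p_r and the hypothesis for \<alpha> evaluate one bracketing;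
  in the other every term except that of \<kappa> has fewer parts and agrees by induction.\<close>

theorem macdonald_g_mult:
  assumes "\<kappa> \<in> Par" "\<mu> \<in> Par"
  shows "macdonald_g \<kappa> * macdonald_g \<mu> = g_product \<kappa> \<mu>"
  using assms(1)
proof (induction "size \<kappa>" arbitrary: \<kappa> rule: less_induct)
  case less
  show ?case
  proof (cases "\<kappa> = {#}")
    case True
    have "g_product {#} \<mu> = (\<Sum>\<nu> \<in> partitions_of (\<Sum>\<^sub># \<mu>). if \<nu> = \<mu> then macdonald_g \<nu> else 0)"
      unfolding g_product_def using assms(2) by (intro sum.cong) (auto simp: factor_count_empty_left)
    also have "\<dots> = macdonald_g \<mu>" using assms(2) by (simp, simp add: partitions_of_def)
    finally show ?thesis using True by (simp add: macdonald_g_empty)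
  next
    case False
    then obtain r \<alpha> where \<kappa>: "\<kappa> = add_mset r \<alpha>" "r \<ge> 1" "\<alpha> \<in> Par" using remove_part less.prems by blast
    let ?P = "partitions_of (\<Sum>\<^sub># {#r#} + \<Sum>\<^sub># \<alpha>)" and ?k = "factor_count {#r#} \<alpha>"
    have mem: "\<kappa> \<in> ?P" using \<kappa> less.prems by (simp add: partitions_of_def)
    have rest: "of_nat (?k \<rho>) * g_product \<rho> \<mu> = of_nat (?k \<rho>) * (macdonald_g \<rho> * macdonald_g \<mu>)"
      if "\<rho> \<in> ?P - {\<kappa>}" for \<rho>
    proof (cases "?k \<rho> = 0")
      case False
      have "size \<rho> \<le> size \<alpha>" using factor_count_cycle_size[of \<rho> r \<alpha>] that False \<kappa> by (auto simp: partitions_of_def)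
      then show ?thesis using less.hyps[of \<rho>] that \<kappa>(1) by (simp add: partitions_of_def)
    qed simp
    have "(\<Sum>\<rho> \<in> ?P. of_nat (?k \<rho>) * g_product \<rho> \<mu>) =
        (\<Sum>\<sigma> \<in> partitions_of (\<Sum>\<^sub># \<alpha> + \<Sum>\<^sub># \<mu>). of_nat (factor_count \<alpha> \<mu> \<sigma>) * g_product {#r#} \<sigma>)"
      by (rule g_product_assoc)
    also have "\<dots> = (\<Sum>\<sigma> \<in> partitions_of (\<Sum>\<^sub># \<alpha> + \<Sum>\<^sub># \<mu>). - power_sum r * (of_nat (factor_count \<alpha> \<mu> \<sigma>) * macdonald_g \<sigma>))"
      using \<kappa>(2) by (intro sum.cong) (auto simp: g_product_cycle partitions_of_def)
    also have "\<dots> = - power_sum r * g_product \<alpha> \<mu>" by (simp only: g_product_def sum_distrib_left)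
    also have "g_product \<alpha> \<mu> = macdonald_g \<alpha> * macdonald_g \<mu>" using less.hyps[of \<alpha>] \<kappa> by simp
    also have "- power_sum r * (macdonald_g \<alpha> * macdonald_g \<mu>) = g_product {#r#} \<alpha> * macdonald_g \<mu>"
      using g_product_cycle \<kappa> by simp
    also have "\<dots> = (\<Sum>\<rho> \<in> ?P. of_nat (?k \<rho>) * (macdonald_g \<rho> * macdonald_g \<mu>))"
      by (simp only: g_product_def sum_distrib_right mult.assoc)
    finally have "of_nat (?k \<kappa>) * g_product \<kappa> \<mu> + (\<Sum>\<rho> \<in> ?P - {\<kappa>}. of_nat (?k \<rho>) * g_product \<rho> \<mu>) =
      of_nat (?k \<kappa>) * (macdonald_g \<kappa> * macdonald_g \<mu>) + (\<Sum>\<rho> \<in> ?P - {\<kappa>}. of_nat (?k \<rho>) * (macdonald_g \<rho> * macdonald_g \<mu>))"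
      using mem by (simp only: sum.remove[OF finite_partitions_of mem])
    \<comment> \<open>The coefficient of the leading term need not be 1; it is cancelled because the
      ring is a domain of characteristic 0.\<close>
    then have "of_nat (?k \<kappa>) * g_product \<kappa> \<mu> = of_nat (?k \<kappa>) * (macdonald_g \<kappa> * macdonald_g \<mu>)"
      using rest by simp
    moreover have "?k \<kappa> \<noteq> 0" using factor_count_disjoint_cycle \<kappa> by simp
    ultimately show ?thesis by simp
  qed
qed

section \<open>The two maps of the theorem\<close>

section \<open>The embedding into the Farahat--Higman ring\<close>

lemma graded_algebra_sel [simp]:
  "carrier (graded_algebra B k) = {f. keys f \<subseteq> B}"
  "\<one>\<^bsub>graded_algebra B k\<^esub> = single {#} 1"
  "x \<oplus>\<^bsub>graded_algebra B k\<^esub> y = x + y"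
  by (simp_all add: graded_algebra_def)

lemma graded_algebra_mult:
  "x \<otimes>\<^bsub>graded_algebra B k\<^esub> y = (\<Sum>\<kappa> \<in> keys x. \<Sum>\<mu> \<in> keys y. \<Sum>\<nu> \<in> {\<nu> \<in> B. \<Sum>\<^sub># \<nu> = \<Sum>\<^sub># \<kappa> + \<Sum>\<^sub># \<mu>}.
     single \<nu> (lookup x \<kappa> * lookup y \<mu> * of_int (k \<kappa> \<mu> \<nu>)))"
  by (simp add: graded_algebra_def)

lemma EPar_degree: "{\<nu> \<in> EPar. \<Sum>\<^sub># \<nu> = n} = partitions_of n \<inter> EPar" "{\<nu> \<in> Par. \<Sum>\<^sub># \<nu> = n} = partitions_of n"
  by (auto simp: partitions_of_def EPar_def)

definition sign_twist :: "(partition \<Rightarrow>\<^sub>0 'r::comm_ring_1) \<Rightarrow> (partition \<Rightarrow>\<^sub>0 'r)" where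
  "sign_twist x = Poly_Mapping.mapp (\<lambda>\<kappa> c. (-1) ^ size \<kappa> * c) x"

lemma lookup_sign_twist [simp]: "lookup (sign_twist x) \<kappa> = (-1) ^ size \<kappa> * lookup x \<kappa>"
  by (simp add: sign_twist_def lookup_mapp when_def in_keys_iff)

lemma keys_sign_twist [simp]: "keys (sign_twist x) = keys x"
proof -
  have "(-1) ^ n * c = 0 \<longleftrightarrow> c = 0" for n and c :: 'a by (cases "even n") simp_all
  then show ?thesis by (auto simp: in_keys_iff)
qed

lemma sign_twist_add: "sign_twist (x + y) = sign_twist x + sign_twist y"
  by (rule poly_mapping_eqI) (simp add: lookup_add distrib_left)

lemma sign_twist_single: "sign_twist (single \<kappa> c) = single \<kappa> ((-1) ^ size \<kappa> * c)"
  by (rule poly_mapping_eqI) (simp add: lookup_single when_def)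

lemma sign_twist_sum: "sign_twist (\<Sum>x \<in> A. F x) = (\<Sum>x \<in> A. sign_twist (F x))"
proof -
  have "sign_twist 0 = 0" by (rule poly_mapping_eqI) simp
  then show ?thesis by (induction A rule: infinite_finite_induct) (simp_all add: sign_twist_add)
qed

lemma sign_twist_mult:
  fixes x y :: "partition \<Rightarrow>\<^sub>0 int"
  assumes "keys x \<subseteq> EPar" "keys y \<subseteq> EPar"
  shows "sign_twist (x \<otimes>\<^bsub>spin_FH\<^esub> y) = sign_twist x \<otimes>\<^bsub>FH\<^esub> sign_twist y"
  unfolding spin_FH_def FH_def graded_algebra_mult sign_twist_sum keys_sign_twist
proof (rule sum.cong[OF HOL.refl], rule sum.cong[OF HOL.refl])
  fix \<kappa> \<mu> assume "\<kappa> \<in> keys x" "\<mu> \<in> keys y"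
  then have ev: "\<kappa> \<in> EPar" "\<mu> \<in> EPar" using assms by blast+
  let ?n = "\<Sum>\<^sub># \<kappa> + \<Sum>\<^sub># \<mu>"
  let ?c = "\<lambda>\<nu>. lookup (sign_twist x) \<kappa> * lookup (sign_twist y) \<mu> * of_int (FH_coeff \<kappa> \<mu> \<nu>)"
  have "(\<Sum>\<nu> \<in> {\<nu> \<in> EPar. \<Sum>\<^sub># \<nu> = ?n}. sign_twist (single \<nu> (lookup x \<kappa> * lookup y \<mu> * of_int (spin_FH_coeff \<kappa> \<mu> \<nu>)))) =
      (\<Sum>\<nu> \<in> partitions_of ?n \<inter> EPar. single \<nu> (?c \<nu>))"
    unfolding EPar_degree
  proof (intro sum.cong HOL.refl)
    fix \<nu> assume "\<nu> \<in> partitions_of ?n \<inter> EPar"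
    then have \<nu>: "\<nu> \<in> EPar" "\<nu> \<in> Par" "\<Sum>\<^sub># \<nu> = ?n" by (auto simp: partitions_of_def)
    let ?s = "\<lambda>\<rho> :: partition. (-1 :: int) ^ size \<rho>" and ?k = "int (factor_count \<kappa> \<mu> \<nu>)"
    have sq: "?s \<nu> * ?s \<nu> = 1" by (simp flip: power_add)
    have "?s \<nu> * (lookup x \<kappa> * lookup y \<mu> * (?s \<kappa> * ?s \<mu> * ?s \<nu> * ?k)) =
        (?s \<nu> * ?s \<nu>) * (?s \<kappa> * lookup x \<kappa> * (?s \<mu> * lookup y \<mu>) * ?k)"
      by (simp only: mult_ac)
    then have "?s \<nu> * (lookup x \<kappa> * lookup y \<mu> * of_int (spin_FH_coeff \<kappa> \<mu> \<nu>)) = ?c \<nu>"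
      unfolding spin_FH_coeff_eq[OF ev \<nu>(1,3)] FH_coeff_eq[OF \<nu>(2,3)] lookup_sign_twist power_add sq by simp
    then show "sign_twist (single \<nu> (lookup x \<kappa> * lookup y \<mu> * of_int (spin_FH_coeff \<kappa> \<mu> \<nu>))) = single \<nu> (?c \<nu>)"
      by (simp only: sign_twist_single)
  qed
  also have "\<dots> = (\<Sum>\<nu> \<in> partitions_of ?n. single \<nu> (?c \<nu>))"
  proof (rule sum.mono_neutral_left)
    \<comment> \<open>Even factors produce only even types, so the sum over even partitions may be
      extended to all partitions of the degree.\<close>
    show "\<forall>\<nu> \<in> partitions_of ?n - partitions_of ?n \<inter> EPar. single \<nu> (?c \<nu>) = 0"
    proof
      fix \<nu> assume "\<nu> \<in> partitions_of ?n - partitions_of ?n \<inter> EPar"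
      then have \<nu>: "\<nu> \<in> Par" "\<Sum>\<^sub># \<nu> = ?n" "\<nu> \<notin> EPar" by (auto simp: partitions_of_def)
      then have "FH_coeff \<kappa> \<mu> \<nu> = 0" using FH_coeff_eq[OF \<nu>(1,2)] factor_count_EPar[OF ev \<nu>(1,2)] by auto
      then show "single \<nu> (?c \<nu>) = 0" by simp
    qed
  qed auto
  finally show "(\<Sum>\<nu> \<in> {\<nu> \<in> EPar. \<Sum>\<^sub># \<nu> = ?n}. sign_twist (single \<nu> (lookup x \<kappa> * lookup y \<mu> * of_int (spin_FH_coeff \<kappa> \<mu> \<nu>)))) =
      (\<Sum>\<nu> \<in> {\<nu> \<in> Par. \<Sum>\<^sub># \<nu> = ?n}. single \<nu> (?c \<nu>))"
    unfolding EPar_degree .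
qed

lemma EPar_subset_Par: "EPar \<subseteq> Par"
  by (auto simp: EPar_def)

lemma sign_twist_hom: "sign_twist \<in> ring_hom (spin_FH :: (partition \<Rightarrow>\<^sub>0 int) ring) FH"
proof (rule ring_hom_memI)
  fix x y :: "partition \<Rightarrow>\<^sub>0 int"
  assume x: "x \<in> carrier spin_FH" and y: "y \<in> carrier spin_FH"
  show "sign_twist x \<in> carrier FH" using x EPar_subset_Par by (auto simp: spin_FH_def FH_def)
  show "sign_twist (x \<otimes>\<^bsub>spin_FH\<^esub> y) = sign_twist x \<otimes>\<^bsub>FH\<^esub> sign_twist y"
    using x y by (intro sign_twist_mult) (simp_all add: spin_FH_def)
  show "sign_twist (x \<oplus>\<^bsub>spin_FH\<^esub> y) = sign_twist x \<oplus>\<^bsub>FH\<^esub> sign_twist y"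
    by (simp add: spin_FH_def FH_def sign_twist_add)
next
  show "sign_twist \<one>\<^bsub>spin_FH\<^esub> = \<one>\<^bsub>FH\<^esub>" unfolding spin_FH_def FH_def graded_algebra_sel sign_twist_single by simp
qed

lemma inj_sign_twist: "inj sign_twist"
proof (rule injI)
  fix x y :: "partition \<Rightarrow>\<^sub>0 'a" assume "sign_twist x = sign_twist y"
  then have "(-1) ^ size \<kappa> * lookup x \<kappa> = (-1) ^ size \<kappa> * lookup y \<kappa>" for \<kappa> by (metis lookup_sign_twist)
  then have "lookup x \<kappa> = lookup y \<kappa>" for \<kappa> by (cases "even (size \<kappa>)") (metis mult_minus1 neg_equal_iff_equal mult_1 minus_one_power_iff)+
  then show "x = y" by (rule poly_mapping_eqI)
qed

section \<open>The isomorphism with the ring generated by the even power sums\<close>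

lemma symfun_of_int_simps [simp]:
  "symfun_of_int 0 = 0" "symfun_of_int 1 = 1" "symfun_of_int (power_sum r) = power_sum r"
  by (rule symfun_eqI; simp)+

lemma symfun_of_int_add: "symfun_of_int (f + g) = symfun_of_int f + symfun_of_int g"
  by (rule symfun_eqI) simp

lemma symfun_of_int_minus: "symfun_of_int (- f) = - symfun_of_int f"
  by (rule symfun_eqI) simp

lemma symfun_of_int_mult: "symfun_of_int (f * g) = symfun_of_int f * symfun_of_int g"
  by (rule symfun_eqI) (simp add: mcoeff_mult split_def)

lemma symfun_of_int_of_nat: "symfun_of_int (of_nat n) = of_nat n"
  by (induction n) (simp_all add: symfun_of_int_add)

lemma symfun_of_int_sum: "symfun_of_int (\<Sum>x \<in> A. F x) = (\<Sum>x \<in> A. symfun_of_int (F x))"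
  by (induction A rule: infinite_finite_induct) (simp_all add: symfun_of_int_add)

definition even_g :: "partition \<Rightarrow> rat symfun" where
  "even_g \<kappa> = (-1) ^ size \<kappa> * symfun_of_int (macdonald_g \<kappa>)"

lemma even_g_mult:
  assumes ev: "\<kappa> \<in> EPar" "\<mu> \<in> EPar"
  shows "even_g \<kappa> * even_g \<mu> =
    (\<Sum>\<nu> \<in> {\<nu> \<in> EPar. \<Sum>\<^sub># \<nu> = \<Sum>\<^sub># \<kappa> + \<Sum>\<^sub># \<mu>}. symfun_const (of_int (spin_FH_coeff \<kappa> \<mu> \<nu>)) * even_g \<nu>)"
proof -
  let ?n = "\<Sum>\<^sub># \<kappa> + \<Sum>\<^sub># \<mu>" and ?k = "factor_count \<kappa> \<mu>"
  let ?s = "(-1) ^ (size \<kappa> + size \<mu>) :: rat symfun"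
  have "macdonald_g \<kappa> * macdonald_g \<mu> = (\<Sum>\<nu> \<in> partitions_of ?n. of_nat (?k \<nu>) * macdonald_g \<nu>)"
    using macdonald_g_mult[of \<kappa> \<mu>] ev EPar_subset_Par by (auto simp: g_product_def)
  then have "symfun_of_int (macdonald_g \<kappa>) * symfun_of_int (macdonald_g \<mu>) =
      (\<Sum>\<nu> \<in> partitions_of ?n. of_nat (?k \<nu>) * symfun_of_int (macdonald_g \<nu>) :: rat symfun)"
    by (simp add: symfun_of_int_sum symfun_of_int_mult symfun_of_int_of_nat flip: symfun_of_int_mult[of "macdonald_g \<kappa>"])
  then have "even_g \<kappa> * even_g \<mu> = ?s * (\<Sum>\<nu> \<in> partitions_of ?n. of_nat (?k \<nu>) * symfun_of_int (macdonald_g \<nu>))"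
    by (simp add: even_g_def power_add mult_ac)
  also have "\<dots> = (\<Sum>\<nu> \<in> partitions_of ?n. ?s * (of_nat (?k \<nu>) * symfun_of_int (macdonald_g \<nu>)))"
    by (rule sum_distrib_left)
  also have "\<dots> = (\<Sum>\<nu> \<in> partitions_of ?n \<inter> EPar. symfun_const (of_int (spin_FH_coeff \<kappa> \<mu> \<nu>)) * even_g \<nu>)"
  proof (rule sum.mono_neutral_cong_right)
    show "\<forall>\<nu> \<in> partitions_of ?n - partitions_of ?n \<inter> EPar. ?s * (of_nat (?k \<nu>) * symfun_of_int (macdonald_g \<nu>)) = 0"
      using factor_count_EPar[OF ev] by (auto simp: partitions_of_def)
  next
    fix \<nu> assume "\<nu> \<in> partitions_of ?n \<inter> EPar"
    then have \<nu>: "\<nu> \<in> EPar" "\<Sum>\<^sub># \<nu> = ?n" by (auto simp: partitions_of_def)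
    have "symfun_const (of_int (spin_FH_coeff \<kappa> \<mu> \<nu>)) = ?s * (-1) ^ size \<nu> * of_nat (?k \<nu>)"
      unfolding spin_FH_coeff_eq[OF ev \<nu>] of_int_symfun[symmetric] by (simp add: power_add)
    then have "symfun_const (of_int (spin_FH_coeff \<kappa> \<mu> \<nu>)) * even_g \<nu> =
        ((-1) ^ size \<nu> * (-1) ^ size \<nu>) * (?s * (of_nat (?k \<nu>) * symfun_of_int (macdonald_g \<nu>)))"
      by (simp only: even_g_def mult_ac)
    also have "(-1) ^ size \<nu> * (-1) ^ size \<nu> = (1 :: rat symfun)" by (simp flip: power_add)
    finally show "?s * (of_nat (?k \<nu>) * symfun_of_int (macdonald_g \<nu>)) = symfun_const (of_int (spin_FH_coeff \<kappa> \<mu> \<nu>)) * even_g \<nu>"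
      by simp
  qed auto
  finally show ?thesis unfolding EPar_degree .
qed

definition even_iso :: "(partition \<Rightarrow>\<^sub>0 rat) \<Rightarrow> rat symfun" where
  "even_iso x = (\<Sum>\<kappa> \<in> keys x. symfun_const (lookup x \<kappa>) * even_g \<kappa>)"

lemma even_iso_superset:
  "finite S \<Longrightarrow> keys x \<subseteq> S \<Longrightarrow> even_iso x = (\<Sum>\<kappa> \<in> S. symfun_const (lookup x \<kappa>) * even_g \<kappa>)"
  unfolding even_iso_def by (rule sum.mono_neutral_left) (auto simp: in_keys_iff symfun_const_0)

lemma even_iso_add: "even_iso (x + y) = even_iso x + even_iso y"
proof -
  let ?S = "keys x \<union> keys y"
  have "keys (x + y) \<subseteq> ?S" by (rule Poly_Mapping.keys_add)
  then show ?thesis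
    by (simp add: even_iso_superset[of ?S] lookup_add symfun_const_add distrib_right sum.distrib)
qed

lemma even_iso_single: "even_iso (single \<kappa> c) = symfun_const c * even_g \<kappa>"
  by (simp add: even_iso_def symfun_const_0)

lemma even_iso_sum: "even_iso (\<Sum>x \<in> A. F x) = (\<Sum>x \<in> A. even_iso (F x))"
proof -
  have "even_iso 0 = 0" by (simp add: even_iso_def)
  then show ?thesis by (induction A rule: infinite_finite_induct) (simp_all add: even_iso_add)
qed

lemma even_iso_scale: "even_iso (Poly_Mapping.map ((*) q) x) = symfun_const q * even_iso x"
proof -
  have "keys (Poly_Mapping.map ((*) q) x) \<subseteq> keys x" by (auto simp: in_keys_iff map.rep_eq when_def)
  moreover have "lookup (Poly_Mapping.map ((*) q) x) \<kappa> = q * lookup x \<kappa>" for \<kappa> by (simp add: map.rep_eq when_def)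
  ultimately have "even_iso (Poly_Mapping.map ((*) q) x) = (\<Sum>\<kappa> \<in> keys x. symfun_const (q * lookup x \<kappa>) * even_g \<kappa>)"
    by (simp add: even_iso_superset[of "keys x"])
  then show ?thesis by (simp add: even_iso_def symfun_const_mult sum_distrib_left mult.assoc)
qed

lemma even_iso_mult:
  assumes "keys x \<subseteq> EPar" "keys y \<subseteq> EPar"
  shows "even_iso (x \<otimes>\<^bsub>spin_FH\<^esub> y) = even_iso x * even_iso y"
proof -
  have "even_iso (x \<otimes>\<^bsub>spin_FH\<^esub> y) = (\<Sum>\<kappa> \<in> keys x. \<Sum>\<mu> \<in> keys y.
      symfun_const (lookup x \<kappa>) * symfun_const (lookup y \<mu>) * (even_g \<kappa> * even_g \<mu>))"
    unfolding spin_FH_def graded_algebra_mult even_iso_sum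
  proof (intro sum.cong HOL.refl)
    fix \<kappa> \<mu> assume "\<kappa> \<in> keys x" "\<mu> \<in> keys y"
    then have ev: "\<kappa> \<in> EPar" "\<mu> \<in> EPar" using assms by blast+
    show "(\<Sum>\<nu> \<in> {\<nu> \<in> EPar. \<Sum>\<^sub># \<nu> = \<Sum>\<^sub># \<kappa> + \<Sum>\<^sub># \<mu>}.
        even_iso (single \<nu> (lookup x \<kappa> * lookup y \<mu> * of_int (spin_FH_coeff \<kappa> \<mu> \<nu>)))) =
      symfun_const (lookup x \<kappa>) * symfun_const (lookup y \<mu>) * (even_g \<kappa> * even_g \<mu>)"
      unfolding even_g_mult[OF ev] even_iso_single symfun_const_mult by (simp only: sum_distrib_left mult.assoc)
  qed
  also have "\<dots> = even_iso x * even_iso y"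
    unfolding even_iso_def sum_product by (intro sum.cong HOL.refl) (simp only: mult_ac)
  finally show ?thesis .
qed

text \<open>The rational extension of the functional \<open>\<langle>\<cdot>, h\<^sub>\<mu>\<^sup>*\<rangle>\<close> reads off the coefficient of \<open>g\<^sub>\<mu>\<close>.\<close>

lemma rational_pairing:
  "\<exists>\<phi> :: rat symfun \<Rightarrow> rat. (\<forall>f g. \<phi> (f + g) = \<phi> f + \<phi> g) \<and> (\<forall>c f. \<phi> (symfun_const c * f) = c * \<phi> f) \<and>
    (\<forall>g. \<phi> (symfun_of_int g) = of_int (hall_inner g (hsprod \<mu>)))"
proof -
  obtain a where a: "keys a \<subseteq> Par" "hsprod \<mu> = lin_ext hprod a" using hprod_coordinates .
  define \<phi> :: "rat symfun \<Rightarrow> rat" where "\<phi> f = (\<Sum>\<kappa> \<in> keys a. of_int (lookup a \<kappa>) * mcf f \<kappa>)" for f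
  have 1: "\<phi> (f + g) = \<phi> f + \<phi> g" for f g by (simp add: \<phi>_def distrib_left sum.distrib)
  have 2: "\<phi> (symfun_const c * f) = c * \<phi> f" for c f
    by (auto simp: \<phi>_def mcf_def sum_distrib_left intro!: sum.cong)
  have 3: "\<phi> (symfun_of_int g) = of_int (hall_inner g (hsprod \<mu>))" for g
    unfolding hall_commute[of g] a(2) hall_lin_ext[OF a(1)] by (simp add: \<phi>_def lin_ext_def mcf_def)
  show ?thesis using 1 2 3 by (intro exI[of _ \<phi>]) blast
qed

lemma even_iso_inj:
  assumes x: "keys x \<subseteq> EPar" and 0: "even_iso x = 0"
  shows "x = 0"
proof (rule poly_mapping_eqI)
  fix \<mu>
  show "lookup x \<mu> = lookup 0 \<mu>"
  proof (cases "\<mu> \<in> keys x")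
    case True
    then have \<mu>: "\<mu> \<in> Par" using x EPar_subset_Par by blast
    obtain \<phi> :: "rat symfun \<Rightarrow> rat" where \<phi>: "\<And>f g. \<phi> (f + g) = \<phi> f + \<phi> g" "\<And>c f. \<phi> (symfun_const c * f) = c * \<phi> f"
      "\<And>g. \<phi> (symfun_of_int g) = of_int (hall_inner g (hsprod \<mu>))" using rational_pairing[of \<mu>] by blast
    have \<phi>0: "\<phi> 0 = 0" using \<phi>(1)[of 0 0] by simp
    have sum: "\<phi> (\<Sum>x \<in> A. F x) = (\<Sum>x \<in> A. \<phi> (F x))" for F :: "partition \<Rightarrow> rat symfun" and A
      by (induction A rule: infinite_finite_induct) (simp_all add: \<phi> \<phi>0)
    have even_g: "\<phi> (even_g \<kappa>) = (if \<kappa> = \<mu> then (-1) ^ size \<mu> else 0)" if "\<kappa> \<in> keys x" for \<kappa>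
    proof -
      have "\<kappa> \<in> Par" using that x EPar_subset_Par by blast
      moreover have "even_g \<kappa> = symfun_const (of_int ((-1) ^ size \<kappa>)) * symfun_of_int (macdonald_g \<kappa>)"
        unfolding of_int_symfun[symmetric] by (simp add: even_g_def)
      ultimately show ?thesis using \<mu> by (simp add: \<phi> hall_macdonald_g)
    qed
    have "\<phi> (even_iso x) = (\<Sum>\<kappa> \<in> keys x. if \<kappa> = \<mu> then lookup x \<kappa> * (-1) ^ size \<mu> else 0)"
      unfolding even_iso_def sum by (intro sum.cong) (auto simp: \<phi>(2) even_g)
    also have "\<dots> = lookup x \<mu> * (-1) ^ size \<mu>" using True by simp
    finally show ?thesis using 0 \<phi>0 by simp
  qed (simp add: in_keys_iff)
qed

lemma power_sum_eq_macdonald_g: "r \<ge> 1 \<Longrightarrow> macdonald_g {#r#} = - power_sum r"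
proof -
  assume r: "r \<ge> 1"
  then have P: "{#r#} \<in> Par" by (simp add: Par_def)
  have "- power_sum r = (\<Sum>\<nu> \<in> partitions_of r. of_nat (factor_count {#r#} {#} \<nu>) * macdonald_g \<nu>)"
    using power_sum_mult_macdonald_g[of "{#}" r] r by (simp add: Par_def macdonald_g_empty)
  also have "\<dots> = (\<Sum>\<nu> \<in> partitions_of r. if \<nu> = {#r#} then macdonald_g \<nu> else 0)"
    using factor_count_empty_right[OF P] by (intro sum.cong) auto
  also have "\<dots> = macdonald_g {#r#}" using P by (simp, simp add: partitions_of_def)
  finally show ?thesis by simp
qed

lemma even_symfuns_sum: "(\<And>x. x \<in> A \<Longrightarrow> F x \<in> even_symfuns) \<Longrightarrow> (\<Sum>x \<in> A. F x) \<in> even_symfuns"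
proof (induction A rule: infinite_finite_induct)
  case (insert x A)
  then show ?case by (simp add: even_symfuns.add)
qed (use even_symfuns.const[of 0] in \<open>simp_all add: symfun_const_0\<close>)

lemma even_symfuns_minus: "f \<in> even_symfuns \<Longrightarrow> - f \<in> even_symfuns"
  using even_symfuns.mult[OF even_symfuns.const[of "-1"]] by (simp add: symfun_const_minus symfun_const_1)

text \<open>The rule for p_r with even \<open>r\<close> expresses a multiple of g_\<kappa> by
  g_\<alpha> and even partitions with fewer parts than \<kappa>. The multiple is the multiplicity of
  \<open>r\<close> in \<kappa>, and dividing by it requires rational scalars.\<close>

lemma macdonald_g_even:
  assumes "\<kappa> \<in> EPar"
  shows "symfun_of_int (macdonald_g \<kappa>) \<in> even_symfuns"
  using assms
proof (induction "size \<kappa>" arbitrary: \<kappa> rule: less_induct)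
  case less
  show ?case
  proof (cases "\<kappa> = {#}")
    case True
    then show ?thesis using even_symfuns.const[of 1] by (simp add: macdonald_g_empty symfun_const_1)
  next
    case False
    have "\<kappa> \<in> Par" using less.prems EPar_subset_Par by blast
    then obtain r \<alpha> where \<kappa>: "\<kappa> = add_mset r \<alpha>" "r \<ge> 1" "\<alpha> \<in> Par" using remove_part False by blast
    then have ev: "{#r#} \<in> EPar" "\<alpha> \<in> EPar" "even r" using less.prems by (auto simp: EPar_def Par_def)
    let ?P = "partitions_of (r + \<Sum>\<^sub># \<alpha>)" and ?k = "factor_count {#r#} \<alpha>"
    let ?g = "\<lambda>\<rho>. symfun_of_int (macdonald_g \<rho>) :: rat symfun"
    have mem: "\<kappa> \<in> ?P" using \<kappa> \<open>\<kappa> \<in> Par\<close> by (simp add: partitions_of_def)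
    have nat: "of_nat n \<in> even_symfuns" for n
      using even_symfuns.const[of "of_nat n"] by (simp add: of_nat_symfun)
    have "of_nat (?k \<rho>) * ?g \<rho> \<in> even_symfuns" if "\<rho> \<in> ?P - {\<kappa>}" for \<rho>
    proof (cases "?k \<rho> = 0")
      case True
      then show ?thesis using even_symfuns.const[of 0] by (simp add: symfun_const_0)
    next
      case False
      then have "size \<rho> < size \<kappa>" "\<rho> \<in> EPar"
        using factor_count_cycle_size[of \<rho> r \<alpha>] factor_count_EPar[OF ev(1,2), of \<rho>] that \<kappa> by (auto simp: partitions_of_def)
      then show ?thesis using less.hyps nat by (blast intro: even_symfuns.mult)
    qed
    then have rest: "(\<Sum>\<rho> \<in> ?P - {\<kappa>}. of_nat (?k \<rho>) * ?g \<rho>) \<in> even_symfuns" by (rule even_symfuns_sum)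
    have "- power_sum r * ?g \<alpha> = (\<Sum>\<rho> \<in> ?P. of_nat (?k \<rho>) * ?g \<rho>)"
      using arg_cong[OF power_sum_mult_macdonald_g[OF \<kappa>(3,2)], of "symfun_of_int :: _ \<Rightarrow> rat symfun"]
      by (simp add: symfun_of_int_sum symfun_of_int_mult symfun_of_int_minus symfun_of_int_of_nat)
    also have "\<dots> = of_nat (?k \<kappa>) * ?g \<kappa> + (\<Sum>\<rho> \<in> ?P - {\<kappa>}. of_nat (?k \<rho>) * ?g \<rho>)"
      by (rule sum.remove[OF finite_partitions_of mem])
    finally have eq: "of_nat (?k \<kappa>) * ?g \<kappa> = - power_sum r * ?g \<alpha> + - (\<Sum>\<rho> \<in> ?P - {\<kappa>}. of_nat (?k \<rho>) * ?g \<rho>)"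
      by (simp add: algebra_simps)
    have p: "power_sum r \<in> even_symfuns"
    proof -
      obtain k where "r = 2 * k" using ev(3) by blast
      then show ?thesis using even_symfuns.power_sum[of k] \<kappa>(2) by simp
    qed
    have g: "?g \<alpha> \<in> even_symfuns" using less.hyps ev(2) \<kappa>(1) by simp
    have "of_nat (?k \<kappa>) * ?g \<kappa> \<in> even_symfuns"
      unfolding eq using even_symfuns_minus[OF p] g even_symfuns_minus[OF rest] by (blast intro: even_symfuns.add even_symfuns.mult)
    then have "symfun_const (1 / of_nat (?k \<kappa>)) * (of_nat (?k \<kappa>) * ?g \<kappa>) \<in> even_symfuns"
      by (rule even_symfuns.mult[OF even_symfuns.const])
    moreover have "?k \<kappa> \<noteq> 0" using factor_count_disjoint_cycle \<kappa> by simp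
    then have "symfun_const (1 / of_nat (?k \<kappa>)) * of_nat (?k \<kappa>) = (1 :: rat symfun)"
      by (simp add: of_nat_symfun symfun_const_1 flip: symfun_const_mult)
    ultimately show ?thesis by (metis mult.assoc mult_1)
  qed
qed

lemma even_iso_hom: "even_iso \<in> ring_hom spin_FH even_symfun_ring"
proof (rule ring_hom_memI)
  fix x y :: "partition \<Rightarrow>\<^sub>0 rat"
  assume x: "x \<in> carrier spin_FH" and y: "y \<in> carrier spin_FH"
  have "even_g \<kappa> \<in> even_symfuns" if "\<kappa> \<in> EPar" for \<kappa>
  proof -
    have "even_g \<kappa> = symfun_const (of_int ((-1) ^ size \<kappa>)) * symfun_of_int (macdonald_g \<kappa>)"
      unfolding of_int_symfun[symmetric] by (simp add: even_g_def)
    then show ?thesis using even_symfuns.mult[OF even_symfuns.const macdonald_g_even[OF that]] by simp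
  qed
  then show "even_iso x \<in> carrier even_symfun_ring"
    using x by (auto simp: even_symfun_ring_def spin_FH_def even_iso_def intro!: even_symfuns_sum even_symfuns.mult even_symfuns.const)
  show "even_iso (x \<otimes>\<^bsub>spin_FH\<^esub> y) = even_iso x \<otimes>\<^bsub>even_symfun_ring\<^esub> even_iso y"
  proof -
    have "keys x \<subseteq> EPar" "keys y \<subseteq> EPar" using x y by (simp_all add: spin_FH_def)
    then show ?thesis by (simp add: even_symfun_ring_def even_iso_mult)
  qed
  show "even_iso (x \<oplus>\<^bsub>spin_FH\<^esub> y) = even_iso x \<oplus>\<^bsub>even_symfun_ring\<^esub> even_iso y"
    by (simp add: even_symfun_ring_def spin_FH_def even_iso_add)
next
  show "even_iso \<one>\<^bsub>spin_FH\<^esub> = \<one>\<^bsub>even_symfun_ring\<^esub>"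
    unfolding spin_FH_def even_symfun_ring_def graded_algebra_sel even_iso_single
    by (simp add: even_g_def macdonald_g_empty symfun_const_1)
qed

lemma keys_sum_subset: "(\<And>i. i \<in> A \<Longrightarrow> keys (F i) \<subseteq> B) \<Longrightarrow> keys (\<Sum>i \<in> A. F i) \<subseteq> B"
  using keys_sum[of F A] by blast

lemma even_iso_surj: "f \<in> even_symfuns \<Longrightarrow> f \<in> even_iso ` {x. keys x \<subseteq> EPar}"
proof (induction rule: even_symfuns.induct)
  case (const q)
  have "even_iso (single {#} q) = symfun_const q" by (simp add: even_iso_single even_g_def macdonald_g_empty)
  moreover have "keys (single {#} q) \<subseteq> EPar" by (auto simp: EPar_def Par_def)
  ultimately show ?case by (metis (mono_tags) imageI mem_Collect_eq)
next
  case (power_sum k)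
  \<comment> \<open>The sign attached to a single part cancels the one in g_(r) = - p_r.\<close>
  have "even_iso (single {#2 * k#} 1) = power_sum (2 * k)"
    using power_sum by (simp add: even_iso_single even_g_def power_sum_eq_macdonald_g symfun_const_1 symfun_of_int_minus)
  moreover have "keys (single {#2 * k#} (1 :: rat)) \<subseteq> EPar" using power_sum by (auto simp: EPar_def Par_def)
  ultimately show ?case by (metis (mono_tags) imageI mem_Collect_eq)
next
  case (add f g)
  then obtain x y where "keys x \<subseteq> EPar" "f = even_iso x" "keys y \<subseteq> EPar" "g = even_iso y" by auto
  moreover from this have "keys (x + y) \<subseteq> EPar" using Poly_Mapping.keys_add[of x y] by blast
  ultimately show ?case by (metis (mono_tags) even_iso_add imageI mem_Collect_eq)
next
  case (mult f g)
  then obtain x y where xy: "keys x \<subseteq> EPar" "f = even_iso x" "keys y \<subseteq> EPar" "g = even_iso y" by auto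
  have "keys (x \<otimes>\<^bsub>spin_FH\<^esub> y) \<subseteq> EPar"
    unfolding spin_FH_def graded_algebra_mult by (intro keys_sum_subset) (auto split: if_splits)
  then show ?case using even_iso_mult[OF xy(1,3)] xy(2,4) by (metis (mono_tags) imageI mem_Collect_eq)
qed

lemma even_iso_iso: "even_iso \<in> ring_iso spin_FH even_symfun_ring"
proof -
  have car: "carrier (spin_FH :: (partition \<Rightarrow>\<^sub>0 rat) ring) = {x. keys x \<subseteq> EPar}" by (simp add: spin_FH_def)
  have "inj_on even_iso {x. keys x \<subseteq> EPar}"
  proof (rule inj_onI)
    fix x y assume xy: "x \<in> {x. keys x \<subseteq> EPar}" "y \<in> {x. keys x \<subseteq> EPar}" "even_iso x = even_iso y"
    have "even_iso (x - y) + even_iso y = even_iso x" by (simp flip: even_iso_add)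
    then have "even_iso (x - y) = 0" using xy(3) by simp
    moreover have "keys (x - y) \<subseteq> EPar" using xy(1,2) keys_diff[of x y] by blast
    ultimately have "x - y = 0" using even_iso_inj by blast
    then show "x = y" by simp
  qed
  moreover have "even_iso ` {x. keys x \<subseteq> EPar} = even_symfuns"
    using even_iso_surj ring_hom_closed[OF even_iso_hom] car by (auto simp: even_symfun_ring_def)
  ultimately have "bij_betw even_iso (carrier spin_FH) (carrier even_symfun_ring)"
    by (simp add: bij_betw_def car even_symfun_ring_def)
  then show ?thesis using even_iso_hom by (simp add: ring_iso_def)
qed

theorem proposition6p1:
  shows "(\<exists>\<iota> \<in> ring_hom (spin_FH :: (partition \<Rightarrow>\<^sub>0 int) ring) FH.
            inj_on \<iota> (carrier spin_FH) \<and>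
            (\<forall>\<kappa> \<in> EPar. \<iota> (Poly_Mapping.single \<kappa> 1) = Poly_Mapping.single \<kappa> ((-1) ^ size \<kappa>))) \<and>
         (\<exists>\<psi> \<in> ring_iso (spin_FH :: (partition \<Rightarrow>\<^sub>0 rat) ring) even_symfun_ring.
            (\<forall>q. \<forall>x \<in> carrier spin_FH. \<psi> (Poly_Mapping.map ((*) q) x) = symfun_const q * \<psi> x) \<and>
            (\<forall>\<kappa> \<in> EPar. \<psi> (Poly_Mapping.single \<kappa> 1) =
               (-1) ^ size \<kappa> * symfun_of_int (macdonald_g \<kappa>)))"
proof
  show "\<exists>\<iota> \<in> ring_hom (spin_FH :: (partition \<Rightarrow>\<^sub>0 int) ring) FH.
            inj_on \<iota> (carrier spin_FH) \<and>
            (\<forall>\<kappa> \<in> EPar. \<iota> (single \<kappa> 1) = single \<kappa> ((-1) ^ size \<kappa>))"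
    using inj_sign_twist by (intro bexI[OF _ sign_twist_hom]) (auto simp: sign_twist_single intro: inj_on_subset)
  show "\<exists>\<psi> \<in> ring_iso (spin_FH :: (partition \<Rightarrow>\<^sub>0 rat) ring) even_symfun_ring.
            (\<forall>q. \<forall>x \<in> carrier spin_FH. \<psi> (Poly_Mapping.map ((*) q) x) = symfun_const q * \<psi> x) \<and>
            (\<forall>\<kappa> \<in> EPar. \<psi> (single \<kappa> 1) = (-1) ^ size \<kappa> * symfun_of_int (macdonald_g \<kappa>))"
    by (intro bexI[OF _ even_iso_iso]) (auto simp: even_iso_scale even_iso_single symfun_const_1 even_g_def)
qed

end
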